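(* Let $\mathcal{L}$ be a complex vector space with $\mathbb{P}\mathcal{L}\cong\mathbb{P}^3$, and let $X\subset\mathbb{P}\mathcal{L}$ be the dual variety of an irreducible curve $X^\vee\subset\mathbb{P}\mathcal{L}^\ast$ that is not a plane curve. Suppose that there are two smooth points $[\alpha],[\beta]\in X^\vee$ such that the secant line (pencil) they span meets $X^\vee$ in $\deg(X^\vee)-1$ many points. Let $F=\alpha\cdot\beta$. Then $\mathrm{MLD}_F(X)=1$. Moreover, $X$ is ruled by a family of curves $C$ such that $\mathrm{MLD}_F(C)=1$.
   Context: For a homogeneous polynomial $F$ of positive degree on $\mathcal{L}$ and a closed irreducible variety $X\subset\mathbb{P}\mathcal{L}$ not contained in $V(F)$: $C_X\subset\mathcal{L}$ is the affine cone over $X$ and $C_X^\circ=(C_X)_{\mathrm{reg}}\setminus V(F)$. For $u\in\mathcal{L}^\ast$, $\ell_{F,u}(p)=\log F(p)-u(p)$, with differential $p\mapsto\frac{d_pF}{F(p)}-u$. Let $\xi_F=\{(x,u): x\text{ is a critical point of }\ell_{F,u}|_{C_X^\circ}\}\subset\mathcal{L}\times\mathcal{L}^\ast$. $\mathrm{MLD}_F(X)$ is the degree of the projection $\xi_F\to\mathcal{L}^\ast$ if it is dominant and $0$ otherwise (the number of critical points of $\ell_{F,u}|_{C_X^\circ}$ for general $u$). $\mathcal{L}^\ast$ is the space of linear forms on $\mathcal{L}$; $[\alpha]\in\mathbb{P}\mathcal{L}^\ast$ is the class of $\alpha\in\mathcal{L}^\ast$. The dual variety of a projective variety is the closure of the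 set of hyperplanes tangent to it at some smooth point; by biduality $(X^\vee)^\vee=X$. *)

theory Defs
  imports "HOL-Analysis.Analysis"
begin

section \<open>Polynomial functions and Zariski topologies\<close>

text \<open>
  A complex vector space of dimension \<open>n\<close> is rendered as \<open>complex ^ 'n\<close>, and its dual is
  identified with \<open>complex ^ 'n\<close> by the bilinear (not Hermitian) pairing below.
\<close>

definition pairing :: "complex ^ 'n \<Rightarrow> complex ^ 'n \<Rightarrow> complex" where
  "pairing u p = (\<Sum>i\<in>UNIV. u $ i * p $ i)"

inductive_set generated_algebra :: "('a \<Rightarrow> complex) set \<Rightarrow> ('a \<Rightarrow> complex) set"
  for G :: "('a \<Rightarrow> complex) set" where
  gen: "g \<in> G \<Longrightarrow> g \<in> generated_algebra G"
| const: "(\<lambda>x. c) \<in> generated_algebra G"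
| add: "f \<in> generated_algebra G \<Longrightarrow> g \<in> generated_algebra G \<Longrightarrow> (\<lambda>x. f x + g x) \<in> generated_algebra G"
| mult: "f \<in> generated_algebra G \<Longrightarrow> g \<in> generated_algebra G \<Longrightarrow> (\<lambda>x. f x * g x) \<in> generated_algebra G"

definition poly_funs :: "(complex ^ 'n \<Rightarrow> complex) set" where
  "poly_funs = generated_algebra (range (\<lambda>i x. x $ i))"

definition hom_poly_funs :: "(complex ^ 'n \<Rightarrow> complex) set" where
  "hom_poly_funs = {f \<in> poly_funs. \<exists>d. \<forall>c x. f (c *s x) = c ^ d * f x}"

definition bihom_poly_funs :: "((complex ^ 'm) \<times> (complex ^ 'n) \<Rightarrow> complex) set" where
  "bihom_poly_funs =
     {f \<in> generated_algebra (range (\<lambda>i z. fst z $ i) \<union> range (\<lambda>j z. snd z $ j)).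
        \<exists>k l. \<forall>a c b x. f (a *s b, c *s x) = a ^ k * c ^ l * f (b, x)}"

definition zariski :: "(complex ^ 'n) topology" where
  "zariski = topology (\<lambda>U. \<exists>S \<subseteq> poly_funs. U = {x. \<exists>f\<in>S. f x \<noteq> 0})"

text \<open>Points of projective space are the lines through the origin, \<open>[x] = vec.span {x}\<close>.\<close>

definition projectivize :: "(complex ^ 'n) set \<Rightarrow> (complex ^ 'n) set set" where
  "projectivize A = {vec.span {x} | x. x \<in> A \<and> x \<noteq> 0}"

lemma projectivizeI: "x \<in> A \<Longrightarrow> x \<noteq> 0 \<Longrightarrow> vec.span {x} \<in> projectivize A"
  unfolding projectivize_def by blast

lemma projectivizeE:
  assumes "l \<in> projectivize A"
  obtains x where "l = vec.span {x}" "x \<noteq> 0" "x \<in> A"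
  using assms unfolding projectivize_def by blast

lemma projectivize_mono: "A \<subseteq> B \<Longrightarrow> projectivize A \<subseteq> projectivize B"
  unfolding projectivize_def by blast

definition proj_zariski :: "((complex ^ 'n) set) topology" where
  "proj_zariski = topology (\<lambda>U. \<exists>S \<subseteq> hom_poly_funs. U = projectivize {x. \<exists>f\<in>S. f x \<noteq> 0})"

lemma poly_funs_mult: "f \<in> poly_funs \<Longrightarrow> g \<in> poly_funs \<Longrightarrow> (\<lambda>x. f x * g x) \<in> poly_funs"
  unfolding poly_funs_def by (rule generated_algebra.mult)

lemma hom_poly_funs_mult:
  assumes "f \<in> hom_poly_funs" "g \<in> hom_poly_funs"
  shows "(\<lambda>x. f x * g x) \<in> hom_poly_funs"
proof -
  obtain d e where "\<forall>c x. f (c *s x) = c ^ d * f x" "\<forall>c x. g (c *s x) = c ^ e * g x"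
    using assms unfolding hom_poly_funs_def by blast
  then have "\<forall>c x. f (c *s x) * g (c *s x) = c ^ (d + e) * (f x * g x)"
    by (simp add: power_add algebra_simps)
  then show ?thesis
    using assms poly_funs_mult unfolding hom_poly_funs_def by blast
qed

lemma hom_poly_funs_span_eq:
  assumes f: "f \<in> hom_poly_funs" and xy: "vec.span {x} = vec.span {y}" and "f x \<noteq> 0" "x \<noteq> 0"
  shows "f y \<noteq> 0"
proof -
  obtain d where d: "\<And>c x. f (c *s x) = c ^ d * f x"
    using f unfolding hom_poly_funs_def by blast
  have "x \<in> vec.span {y}" using xy vec.span_base by blast
  then obtain c where "x = c *s y" by (auto simp: vec.span_singleton)
  then show ?thesis using d[of c y] \<open>f x \<noteq> 0\<close> by auto
qed

lemma istopology_zariski: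
  "istopology (\<lambda>U. \<exists>S \<subseteq> (poly_funs :: (complex ^ 'n \<Rightarrow> complex) set). U = {x. \<exists>f\<in>S. f x \<noteq> 0})"
  unfolding istopology_def
proof (intro conjI allI impI)
  fix U V :: "(complex ^ 'n) set"
  assume "\<exists>S\<subseteq>poly_funs. U = {x. \<exists>f\<in>S. f x \<noteq> 0}" "\<exists>S\<subseteq>poly_funs. V = {x. \<exists>f\<in>S. f x \<noteq> 0}"
  then obtain S T where ST: "S \<subseteq> poly_funs" "U = {x. \<exists>f\<in>S. f x \<noteq> 0}"
    "T \<subseteq> poly_funs" "V = {x. \<exists>f\<in>T. f x \<noteq> 0}" by blast
  let ?R = "{\<lambda>x. f x * g x | f g. f \<in> S \<and> g \<in> T}"
  have "?R \<subseteq> poly_funs" using ST poly_funs_mult by blast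
  moreover have "U \<inter> V = {x. \<exists>f\<in>?R. f x \<noteq> 0}" unfolding ST by fastforce
  ultimately show "\<exists>S\<subseteq>poly_funs. U \<inter> V = {x. \<exists>f\<in>S. f x \<noteq> 0}" by blast
next
  fix K :: "(complex ^ 'n) set set"
  assume "\<forall>U\<in>K. \<exists>S\<subseteq>poly_funs. U = {x. \<exists>f\<in>S. f x \<noteq> 0}"
  from bchoice[OF this] obtain S
    where S: "\<And>U. U \<in> K \<Longrightarrow> S U \<subseteq> poly_funs \<and> U = {x. \<exists>f\<in>S U. f x \<noteq> 0}"
    by (elim exE) (rule that, erule (1) bspec)
  have "\<Union>(S ` K) \<subseteq> poly_funs" using S by blast
  moreover have "(\<Union>U\<in>K. U) = (\<Union>U\<in>K. {x. \<exists>f\<in>S U. f x \<noteq> 0})"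
    by (rule SUP_cong[OF refl]) (rule conjunct2[OF S])
  then have "\<Union>K = {x. \<exists>f\<in>\<Union>(S ` K). f x \<noteq> 0}" by auto
  ultimately show "\<exists>S\<subseteq>poly_funs. \<Union>K = {x. \<exists>f\<in>S. f x \<noteq> 0}" by blast
qed

lemma openin_zariski: "openin zariski U \<longleftrightarrow> (\<exists>S \<subseteq> poly_funs. U = {x. \<exists>f\<in>S. f x \<noteq> 0})"
  unfolding zariski_def by (subst topology_inverse'[OF istopology_zariski]) (rule refl)

lemma istopology_proj_zariski:
  "istopology (\<lambda>U. \<exists>S \<subseteq> (hom_poly_funs :: (complex ^ 'n \<Rightarrow> complex) set).
     U = projectivize {x. \<exists>f\<in>S. f x \<noteq> 0})"
  unfolding istopology_def
proof (intro conjI allI impI)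
  fix U V :: "(complex ^ 'n) set set"
  assume "\<exists>S\<subseteq>hom_poly_funs. U = projectivize {x. \<exists>f\<in>S. f x \<noteq> 0}"
    "\<exists>S\<subseteq>hom_poly_funs. V = projectivize {x. \<exists>f\<in>S. f x \<noteq> 0}"
  then obtain S T where ST: "S \<subseteq> hom_poly_funs" "U = projectivize {x. \<exists>f\<in>S. f x \<noteq> 0}"
    "T \<subseteq> hom_poly_funs" "V = projectivize {x. \<exists>f\<in>T. f x \<noteq> 0}"
    by (elim exE conjE) (rule that)
  let ?R = "{\<lambda>x. f x * g x | f g. f \<in> S \<and> g \<in> T}"
  have "?R \<subseteq> hom_poly_funs" using ST(1,3) hom_poly_funs_mult by blast
  moreover have "U \<inter> V = projectivize {x. \<exists>f\<in>?R. f x \<noteq> 0}"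
  proof (intro equalityI subsetI)
    fix l assume l: "l \<in> U \<inter> V"
    obtain x f where x: "l = vec.span {x}" "x \<noteq> 0" "f \<in> S" "f x \<noteq> 0"
      using IntD1[OF l] unfolding ST(2) by (elim projectivizeE CollectE bexE)
    obtain y g where y: "l = vec.span {y}" "y \<noteq> 0" "g \<in> T" "g y \<noteq> 0"
      using IntD2[OF l] unfolding ST(4) by (elim projectivizeE CollectE bexE)
    have "g \<in> hom_poly_funs" using ST(3) y(3) by (rule subsetD)
    moreover have "vec.span {y} = vec.span {x}" by (rule trans[OF y(1)[symmetric] x(1)])
    ultimately have "g x \<noteq> 0" using y(4,2) by (rule hom_poly_funs_span_eq)
    then have "f x * g x \<noteq> 0" using x(4) by simp
    moreover have "(\<lambda>x. f x * g x) \<in> ?R" using x(3) y(3) by blast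
    ultimately have "\<exists>h\<in>?R. h x \<noteq> 0" by (rule bexI[where P = "\<lambda>h. h x \<noteq> 0"])
    then show "l \<in> projectivize {x. \<exists>f\<in>?R. f x \<noteq> 0}"
      unfolding x(1) by (intro projectivizeI CollectI x(2))
  next
    fix l assume "l \<in> projectivize {x. \<exists>f\<in>?R. f x \<noteq> 0}"
    then obtain x where x: "l = vec.span {x}" "x \<noteq> 0" and "x \<in> {x. \<exists>f\<in>?R. f x \<noteq> 0}"
      by (rule projectivizeE)
    from this(3) obtain h where "h \<in> ?R" "h x \<noteq> 0" unfolding mem_Collect_eq[of x] by (rule bexE)
    note x = x this
    from x(3) obtain f g where fg: "h = (\<lambda>x. f x * g x)" "f \<in> S" "g \<in> T" by blast
    have "f x \<noteq> 0 \<and> g x \<noteq> 0" using x(4) unfolding fg(1) by simp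
    then have "(\<exists>f\<in>S. f x \<noteq> 0) \<and> (\<exists>g\<in>T. g x \<noteq> 0)" using fg(2,3) by blast
    then show "l \<in> U \<inter> V"
      unfolding ST(2,4) x(1) by (intro IntI projectivizeI CollectI x(2)) simp_all
  qed
  ultimately show "\<exists>S\<subseteq>hom_poly_funs. U \<inter> V = projectivize {x. \<exists>f\<in>S. f x \<noteq> 0}"
    by (intro exI[of _ ?R] conjI)
next
  fix K :: "(complex ^ 'n) set set set"
  assume "\<forall>U\<in>K. \<exists>S\<subseteq>hom_poly_funs. U = projectivize {x. \<exists>f\<in>S. f x \<noteq> 0}"
  from bchoice[OF this] obtain S
    where S: "\<And>U. U \<in> K \<Longrightarrow> S U \<subseteq> hom_poly_funs \<and> U = projectivize {x. \<exists>f\<in>S U. f x \<noteq> 0}"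
    by (elim exE) (rule that, erule (1) bspec)
  have "\<Union>(S ` K) \<subseteq> hom_poly_funs" using S by blast
  moreover have "(\<Union>U\<in>K. U) = (\<Union>U\<in>K. projectivize {x. \<exists>f\<in>S U. f x \<noteq> 0})"
    by (rule SUP_cong[OF refl]) (rule conjunct2[OF S])
  moreover have "(\<Union>U\<in>K. projectivize {x. \<exists>f\<in>S U. f x \<noteq> 0}) =
      projectivize {x. \<exists>f\<in>\<Union>(S ` K). f x \<noteq> 0}"
    unfolding projectivize_def by blast
  ultimately have "\<Union>(S ` K) \<subseteq> hom_poly_funs" "\<Union>K = projectivize {x. \<exists>f\<in>\<Union>(S ` K). f x \<noteq> 0}"
    by simp_all
  then show "\<exists>S\<subseteq>hom_poly_funs. \<Union>K = projectivize {x. \<exists>f\<in>S. f x \<noteq> 0}"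
    by (intro exI[of _ "\<Union>(S ` K)"] conjI)
qed

lemma openin_proj_zariski:
  "openin proj_zariski U \<longleftrightarrow> (\<exists>S \<subseteq> hom_poly_funs. U = projectivize {x. \<exists>f\<in>S. f x \<noteq> 0})"
  unfolding proj_zariski_def by (subst topology_inverse'[OF istopology_proj_zariski]) (rule refl)

lemma topspace_zariski [simp]: "topspace zariski = (UNIV :: (complex ^ 'n) set)"
proof -
  have "(\<lambda>x. 1) \<in> (poly_funs :: (complex ^ 'n \<Rightarrow> complex) set)"
    unfolding poly_funs_def by (rule generated_algebra.const)
  then have "openin zariski (UNIV :: (complex ^ 'n) set)"
    unfolding openin_zariski by (intro exI[of _ "{\<lambda>x. 1}"]) auto
  then show ?thesis by (simp add: openin_subset subset_antisym)
qed

lemma topspace_proj_zariski: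
  "topspace proj_zariski = projectivize (UNIV :: (complex ^ 'n) set)"
proof (rule subset_antisym)
  have "openin proj_zariski (topspace (proj_zariski :: (complex ^ 'n) set topology))"
    by (rule openin_topspace)
  then obtain S :: "(complex ^ 'n \<Rightarrow> complex) set" where
    "topspace proj_zariski = projectivize {x :: complex ^ 'n. \<exists>f\<in>S. f x \<noteq> 0}"
    unfolding openin_proj_zariski by (elim exE conjE) (rule that)
  then show "topspace proj_zariski \<subseteq> projectivize (UNIV :: (complex ^ 'n) set)"
    by (simp add: projectivize_mono)
next
  have "(\<lambda>x. 1) \<in> (hom_poly_funs :: (complex ^ 'n \<Rightarrow> complex) set)"
    unfolding hom_poly_funs_def poly_funs_def
    by (intro CollectI conjI generated_algebra.const exI[of _ 0]) simp
  then have "openin proj_zariski (projectivize (UNIV :: (complex ^ 'n) set))"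
    unfolding openin_proj_zariski by (intro exI[of _ "{\<lambda>x. 1}"]) auto
  then show "projectivize (UNIV :: (complex ^ 'n) set) \<subseteq> topspace proj_zariski"
    by (rule openin_subset)
qed

lemma closedin_zariski:
  "closedin zariski (A :: (complex ^ 'n) set) \<longleftrightarrow> (\<exists>S \<subseteq> poly_funs. A = {x. \<forall>f\<in>S. f x = 0})"
proof -
  have "closedin zariski A \<longleftrightarrow> openin zariski (- A)"
    by (simp add: closedin_def Compl_eq_Diff_UNIV)
  also have "\<dots> \<longleftrightarrow> (\<exists>S \<subseteq> poly_funs. A = {x. \<forall>f\<in>S. f x = 0})"
  proof -
    have "(- A = {x. \<exists>f\<in>S. f x \<noteq> 0}) = (A = {x. \<forall>f\<in>S. f x = 0})"
      for S :: "(complex ^ 'n \<Rightarrow> complex) set"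
      by (auto simp: set_eq_iff)
    then show ?thesis unfolding openin_zariski by simp
  qed
  finally show ?thesis .
qed

lemma closedin_proj_zariski:
  "closedin proj_zariski (X :: (complex ^ 'n) set set) \<longleftrightarrow>
     (\<exists>S \<subseteq> hom_poly_funs. X = projectivize {x. \<forall>f\<in>S. f x = 0})"
proof -
  have compl: "projectivize UNIV - projectivize {x :: complex ^ 'n. \<exists>f\<in>S. f x \<noteq> 0} =
      projectivize {x. \<forall>f\<in>S. f x = 0}" (is "?L = ?R")
    if S: "S \<subseteq> hom_poly_funs" for S
  proof (intro equalityI subsetI)
    fix l assume l: "l \<in> ?L"
    then obtain x where x: "l = vec.span {x}" "x \<noteq> 0" by (elim DiffE projectivizeE)
    have "\<not> (\<exists>f\<in>S. f x \<noteq> 0)"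
    proof
      assume "\<exists>f\<in>S. f x \<noteq> 0"
      then have "l \<in> projectivize {x. \<exists>f\<in>S. f x \<noteq> 0}"
        unfolding x(1) by (intro projectivizeI CollectI x(2))
      then show False using l by simp
    qed
    then show "l \<in> ?R" unfolding x(1) by (intro projectivizeI CollectI x(2)) simp
  next
    fix l assume "l \<in> ?R"
    then obtain x where x: "l = vec.span {x}" "x \<noteq> 0" "\<forall>f\<in>S. f x = 0"
      by (elim projectivizeE CollectE)
    have "l \<notin> projectivize {x. \<exists>f\<in>S. f x \<noteq> 0}"
    proof
      assume "l \<in> projectivize {x. \<exists>f\<in>S. f x \<noteq> 0}"
      then obtain y f where y: "l = vec.span {y}" "y \<noteq> 0" "f \<in> S" "f y \<noteq> 0"
        by (elim projectivizeE CollectE bexE)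
      have "f \<in> hom_poly_funs" using S y(3) by (rule subsetD)
      moreover have "vec.span {y} = vec.span {x}" by (rule trans[OF y(1)[symmetric] x(1)])
      ultimately have "f x \<noteq> 0" using y(4,2) by (rule hom_poly_funs_span_eq)
      then show False using x(3) y(3) by simp
    qed
    moreover have "l \<in> projectivize UNIV" unfolding x(1) by (intro projectivizeI x(2)) simp
    ultimately show "l \<in> ?L" by (rule DiffI[rotated])
  qed
  show ?thesis
  proof
    assume "closedin proj_zariski X"
    then have sub: "X \<subseteq> projectivize UNIV" and "openin proj_zariski (projectivize UNIV - X)"
      unfolding closedin_def topspace_proj_zariski by auto
    then obtain S where S: "S \<subseteq> hom_poly_funs"
      "projectivize UNIV - X = projectivize {x. \<exists>f\<in>S. f x \<noteq> 0}"
      unfolding openin_proj_zariski by (elim exE conjE) (rule that)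
    have "X = projectivize UNIV - (projectivize UNIV - X)" using sub by (simp add: double_diff)
    then have "X = projectivize {x. \<forall>f\<in>S. f x = 0}" unfolding S(2) compl[OF S(1)] .
    then show "\<exists>S \<subseteq> hom_poly_funs. X = projectivize {x. \<forall>f\<in>S. f x = 0}"
      using S(1) by (intro exI[of _ S] conjI)
  next
    assume "\<exists>S \<subseteq> hom_poly_funs. X = projectivize {x. \<forall>f\<in>S. f x = 0}"
    then obtain S where S: "S \<subseteq> hom_poly_funs" "X = projectivize {x. \<forall>f\<in>S. f x = 0}"
      by (elim exE conjE) (rule that)
    have sub: "projectivize {x. \<exists>f\<in>S. f x \<noteq> 0} \<subseteq> projectivize UNIV"
      by (rule projectivize_mono) simp
    have "projectivize UNIV - X = projectivize {x. \<exists>f\<in>S. f x \<noteq> 0}"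
      unfolding S(2) compl[OF S(1), symmetric] using sub by (rule double_diff) simp
    moreover have "X \<subseteq> projectivize UNIV" unfolding S(2) by (rule projectivize_mono) simp
    ultimately show "closedin proj_zariski X"
      unfolding closedin_def topspace_proj_zariski openin_proj_zariski
      using S(1) by (intro conjI exI[of _ S])
  qed
qed

definition proj_prod_closed :: "((complex ^ 'm) set \<times> (complex ^ 'n) set) set \<Rightarrow> bool" where
  "proj_prod_closed Z \<longleftrightarrow> (\<exists>S \<subseteq> bihom_poly_funs.
     Z = {(vec.span {b}, vec.span {x}) | b x. b \<noteq> 0 \<and> x \<noteq> 0 \<and> (\<forall>f\<in>S. f (b, x) = 0)})"

definition irreducible_in :: "'a topology \<Rightarrow> 'a set \<Rightarrow> bool" where
  "irreducible_in T A \<longleftrightarrow> A \<subseteq> topspace T \<and> A \<noteq> {} \<and>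
     (\<forall>B C. closedin T B \<and> closedin T C \<and> A \<subseteq> B \<union> C \<longrightarrow> A \<subseteq> B \<or> A \<subseteq> C)"

text \<open>Krull dimension of a nonempty closed set: the supremum of the lengths \<open>n\<close> of strict chains
  \<open>Z 0 \<subset> \<dots> \<subset> Z n\<close> of irreducible closed subsets.\<close>

definition krull_dim :: "'a topology \<Rightarrow> 'a set \<Rightarrow> enat" where
  "krull_dim T A = (SUP n \<in> {n. \<exists>Z. (\<forall>i\<le>n. closedin T (Z i) \<and> irreducible_in T (Z i) \<and> Z i \<subseteq> A) \<and>
                                (\<forall>i<n. Z i \<subset> Z (Suc i))}. enat n)"

definition irreducible_curve :: "(complex ^ 'n) set set \<Rightarrow> bool" where
  "irreducible_curve C \<longleftrightarrow>
     closedin proj_zariski C \<and> irreducible_in proj_zariski C \<and> krull_dim proj_zariski C = 1"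

definition hyperplane :: "complex ^ 'n \<Rightarrow> (complex ^ 'n) set set" where
  "hyperplane h = projectivize {x. pairing h x = 0}"

text \<open>A property of vectors holds generically if it holds on a nonempty Zariski-open set. Two such
  sets always meet, so \<open>generic_card\<close> is the unique generic number of elements if there is one.\<close>

definition generically :: "(complex ^ 'n \<Rightarrow> bool) \<Rightarrow> bool" where
  "generically P \<longleftrightarrow> (\<exists>U. openin zariski U \<and> U \<noteq> {} \<and> (\<forall>u\<in>U. P u))"

definition generic_card :: "(complex ^ 'n \<Rightarrow> 'a set) \<Rightarrow> nat" where
  "generic_card A = (THE k. generically (\<lambda>u. finite (A u) \<and> card (A u) = k))"

definition curve_degree :: "(complex ^ 'n) set set \<Rightarrow> nat" where
  "curve_degree C = generic_card (\<lambda>h. C \<inter> hyperplane h)"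

section \<open>Cones, tangent spaces and dual varieties\<close>

definition cone :: "(complex ^ 'n) set set \<Rightarrow> (complex ^ 'n) set" where
  "cone X = insert 0 (\<Union>X)"

definition differential :: "(complex ^ 'n \<Rightarrow> complex) \<Rightarrow> complex ^ 'n \<Rightarrow> complex ^ 'n \<Rightarrow> complex" where
  "differential f p v = deriv (\<lambda>t. f (p + t *s v)) 0"

definition tangent_space :: "(complex ^ 'n) set \<Rightarrow> complex ^ 'n \<Rightarrow> (complex ^ 'n) set" where
  "tangent_space A p = {v. \<forall>f\<in>poly_funs. (\<forall>x\<in>A. f x = 0) \<longrightarrow> differential f p v = 0}"

text \<open>The regular locus of the affine cone over an irreducible variety, which has dimension one more
  than the variety.\<close>

definition cone_reg :: "(complex ^ 'n) set set \<Rightarrow> (complex ^ 'n) set" where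
  "cone_reg X = {p \<in> cone X. enat (vec.dim (tangent_space (cone X) p)) = krull_dim proj_zariski X + 1}"

definition smooth_points :: "(complex ^ 'n) set set \<Rightarrow> (complex ^ 'n) set set" where
  "smooth_points X = projectivize (cone_reg X)"

definition dual_variety :: "(complex ^ 'n) set set \<Rightarrow> (complex ^ 'n) set set" where
  "dual_variety X = proj_zariski closure_of projectivize
     {h. \<exists>x \<in> cone_reg X - {0}. \<forall>v \<in> tangent_space (cone X) x. pairing h v = 0}"

section \<open>Maximum likelihood degree\<close>

text \<open>The pairs \<open>(x, u)\<close> such that \<open>x\<close> is a critical point of \<open>log F - u\<close> on the regular locus of
  the cone minus \<open>V(F)\<close>.\<close>

definition critical_pairs ::
    "(complex ^ 'n \<Rightarrow> complex) \<Rightarrow> (complex ^ 'n) set set \<Rightarrow> ((complex ^ 'n) \<times> (complex ^ 'n)) set" where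
  "critical_pairs F X = {(x, u). x \<in> cone_reg X \<and> F x \<noteq> 0 \<and>
     (\<forall>v \<in> tangent_space (cone X) x. differential F x v / F x - pairing u v = 0)}"

text \<open>The projection of \<open>critical_pairs F X\<close> to the dual space is a morphism of irreducible
  varieties of the same dimension. If it is dominant, its degree is the number of points of a
  general fibre, as the ground field has characteristic 0.\<close>

definition MLD :: "(complex ^ 'n \<Rightarrow> complex) \<Rightarrow> (complex ^ 'n) set set \<Rightarrow> nat" where
  "MLD F X = (if zariski closure_of (snd ` critical_pairs F X) = UNIV
              then generic_card (\<lambda>u. {x. (x, u) \<in> critical_pairs F X}) else 0)"

section \<open>Surfaces ruled by curves\<close>

text \<open>
  \<open>X\<close> is ruled by the curves \<open>Z `` {b}\<close> for \<open>b \<in> B\<close>: they form an algebraic family over the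
  irreducible projective curve \<open>B\<close> and cover \<open>X\<close>. Finitely many of these curves may be
  reducible. The dimension condition excludes that a single fibre covers all of a surface.
\<close>

definition ruled_by_curves :: "(complex ^ 'n) set set \<Rightarrow> (complex ^ 'm) set set \<Rightarrow>
    ((complex ^ 'm) set \<times> (complex ^ 'n) set) set \<Rightarrow> bool" where
  "ruled_by_curves X B Z \<longleftrightarrow>
     irreducible_curve B \<and> proj_prod_closed Z \<and> Z \<subseteq> B \<times> X \<and> Z `` B = X \<and>
     (\<forall>b\<in>B. krull_dim proj_zariski (Z `` {b}) = 1) \<and>
     finite {b \<in> B. \<not> irreducible_curve (Z `` {b})}"

end

theory Submission
  imports Defs
    "HOL-Computational_Algebra.Fundamental_Theorem_Algebra"
    "HOL-Computational_Algebra.Polynomial_Factorial"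
    "HOL-Computational_Algebra.Field_as_Ring"
begin

text \<open>
  The planes through the secant line \<open>\<alpha>\<beta>\<close> meet the dual curve in at most one further point, so projection from the
  secant is birational onto a line. In a frame \<open>b\<close> with \<open>b 3 = \<alpha>\<close> and \<open>b 4 = \<beta>\<close> the curve is therefore parametrised
  by binary forms \<open>v s t\<close> whose first two coordinates are \<open>g s\<close> and \<open>g t\<close> for a common form \<open>g\<close>. Its tangent lines
  are given by \<open>v \<and> v' = G \<psi>\<close>, and their annihilators, the kernels of the skew forms \<open>\<psi>\<close>, are the rulings of
  the dual surface. At a regular point \<open>p\<close> of the cone over the surface, on the ruling of \<open>(s, t)\<close>, the tangent space
  is the kernel of \<open>v s t\<close>. Hence \<open>p\<close> is critical for \<open>u\<close> iff \<open>u = \<alpha> / \<alpha>(p) + \<beta> / \<beta>(p) + k v s t\<close> for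
  some \<open>k\<close>: the first two coordinates of \<open>u\<close> give \<open>(s, t)\<close> and \<open>k\<close>, the last two give \<open>\<alpha>(p)\<close> and \<open>\<beta>(p)\<close>,
  and these determine \<open>p\<close> on its ruling. On a single ruling \<open>\<alpha>\<close> and \<open>\<beta>\<close> are coordinates, so its degree is 1 too.

  Points of plane sections are counted without multiplicity. The number of distinct roots of a polynomial is lower
  semicontinuous in its coefficients, so a finite plane section never has more points than the generic one.
\<close>

section \<open>Algebras of functions\<close>

text \<open>Three elementary devices carry the argument. Elimination is done by relations u f + v g
  = 0 with bounded degrees of u and v: their absence is linear independence of shifted coefficient
  vectors, hence open in the coefficients. With different bounds it expresses that f and g have no
  common root, which makes projections closed, or that p has at least r distinct roots, via p and
  its derivative. Dimension is bounded below by explicit chains of irreducible closed sets and above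
  by the number of linearly independent forms of each degree. Exceptional parameters, such as points
  at infinity or cusps of the curve, are treated by polynomial identities that hold off a finite
  set. The difficulty in the degree hypothesis is that \<open>curve_degree\<close> is a generic
  count, while the planes through the secant line are special. The comparison writes the product of
  a plane form over the points of a fibre as a polynomial in both the plane and the fibre parameter,
  by interpolating between n + 1 plane projections of the curve.\<close>

lemmas ga_gen = generated_algebra.gen
lemmas ga_const = generated_algebra.const
lemmas ga_add = generated_algebra.add
lemmas ga_mult = generated_algebra.mult

lemma ga_minus: "f \<in> generated_algebra G \<Longrightarrow> (\<lambda>x. - f x) \<in> generated_algebra G"
  using ga_mult[OF ga_const[of "-1"]] by fastforce

lemma ga_diff: "f \<in> generated_algebra G \<Longrightarrow> g \<in> generated_algebra G \<Longrightarrow> (\<lambda>x. f x - g x) \<in> generated_algebra G"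
  using ga_add[OF _ ga_minus] by fastforce

lemma ga_sum: "(\<And>i. i \<in> I \<Longrightarrow> f i \<in> generated_algebra G) \<Longrightarrow> (\<lambda>x. \<Sum>i\<in>I. f i x) \<in> generated_algebra G"
proof (induction I rule: infinite_finite_induct)
  case (insert i I)
  then show ?case using ga_add[of "f i" G "\<lambda>x. \<Sum>i\<in>I. f i x"] by (simp add: insert.hyps)
qed (simp_all add: ga_const)

lemma ga_prod: "(\<And>i. i \<in> I \<Longrightarrow> f i \<in> generated_algebra G) \<Longrightarrow> (\<lambda>x. \<Prod>i\<in>I. f i x) \<in> generated_algebra G"
proof (induction I rule: infinite_finite_induct)
  case (insert i I)
  then show ?case using ga_mult[of "f i" G "\<lambda>x. \<Prod>i\<in>I. f i x"] by (simp add: insert.hyps)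
qed (simp_all add: ga_const)

lemma ga_power: "f \<in> generated_algebra G \<Longrightarrow> (\<lambda>x. f x ^ n) \<in> generated_algebra G"
  by (induction n) (simp_all add: ga_const ga_mult)

lemma ga_comp:
  assumes "f \<in> generated_algebra G" "\<And>g. g \<in> G \<Longrightarrow> (\<lambda>x. g (V x)) \<in> generated_algebra H"
  shows "(\<lambda>x. f (V x)) \<in> generated_algebra H"
  using assms(1) by induction (simp_all add: assms(2) ga_const ga_add ga_mult)

lemma poly_funs_comp:
  assumes "f \<in> poly_funs" "\<And>i. (\<lambda>x. V x $ i) \<in> generated_algebra H"
  shows "(\<lambda>x. f (V x)) \<in> generated_algebra H"
  using assms unfolding poly_funs_def by (elim ga_comp) auto

lemma pf_coord: "(\<lambda>x. x $ i) \<in> poly_funs"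
  unfolding poly_funs_def by (rule ga_gen) auto

lemmas pf_const = ga_const[where G = "range (\<lambda>i x. x $ i)", folded poly_funs_def]
lemmas pf_add = ga_add[where G = "range (\<lambda>i x. x $ i)", folded poly_funs_def]
lemmas pf_diff = ga_diff[where G = "range (\<lambda>i x. x $ i)", folded poly_funs_def]
lemmas pf_mult = ga_mult[where G = "range (\<lambda>i x. x $ i)", folded poly_funs_def]
lemmas pf_sum = ga_sum[where G = "range (\<lambda>i x. x $ i)", folded poly_funs_def]
lemma pf_pairing: "pairing u \<in> poly_funs"
  unfolding pairing_def[abs_def] by (intro pf_sum pf_mult pf_const pf_coord)

section \<open>The bilinear pairing\<close>

lemma pairing_add: "pairing u (x + y) = pairing u x + pairing u y"
  by (simp add: pairing_def distrib_left sum.distrib)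

lemma pairing_scale: "pairing u (c *s x) = c * pairing u x"
  by (simp add: pairing_def sum_distrib_left algebra_simps)

lemma pairing_commute: "pairing u x = pairing x u"
  by (simp add: pairing_def mult.commute)

lemma pairing_diff: "pairing u (x - y) = pairing u x - pairing u y"
  by (simp add: pairing_def right_diff_distrib sum_subtractf)

lemma pairing_zero [simp]: "pairing u 0 = 0" "pairing 0 u = 0"
  by (simp_all add: pairing_def)

lemma pairing_sum: "pairing u (\<Sum>i\<in>I. x i) = (\<Sum>i\<in>I. pairing u (x i))"
  by (induction I rule: infinite_finite_induct) (simp_all add: pairing_add)

lemma pairing_add_left: "pairing (u + v) x = pairing u x + pairing v x"
  by (metis pairing_commute pairing_add)

lemma pairing_scale_left: "pairing (c *s u) x = c * pairing u x"
  by (metis pairing_commute pairing_scale)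

lemma pairing_diff_left: "pairing (u - v) x = pairing u x - pairing v x"
  by (metis pairing_commute pairing_diff)

lemma pairing_axis: "pairing u (axis i 1) = u $ i"
  by (simp add: pairing_def axis_def if_distrib[of "\<lambda>x. u $ _ * x"] cong: if_cong)

lemma pairing_nondegenerate: "(\<And>x. pairing u x = 0) \<Longrightarrow> u = 0"
  by (metis pairing_axis vec_eq_iff zero_index)

text \<open>Lets polynomiality of a one-parameter family be shown by the closure rules of the
  algebra and then be exploited through roots and degrees.\<close>

lemma ga_univariate: "f \<in> generated_algebra {\<lambda>x. x} \<longleftrightarrow> (\<exists>p. f = poly p)"
proof
  assume "f \<in> generated_algebra {\<lambda>x. x}"
  then show "\<exists>p. f = poly p"
  proof induction
    case (gen g)
    then show ?case by (intro exI[of _ "[:0, 1:]"]) auto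
  next
    case (const c)
    then show ?case by (intro exI[of _ "[:c:]"]) auto
  next
    case (add f g)
    then show ?case by (auto simp flip: poly_add)
  next
    case (mult f g)
    then show ?case by (auto simp flip: poly_mult)
  qed
next
  assume "\<exists>p. f = poly p"
  then obtain p where "f = poly p" by blast
  moreover have "poly p \<in> generated_algebra {\<lambda>x. x}"
  proof (induction p)
    case (pCons a p)
    have "(\<lambda>x. a + x * poly p x) \<in> generated_algebra {\<lambda>x. x}"
      by (intro ga_add ga_mult ga_const pCons.IH ga_gen) simp
    then show ?case by simp
  qed (simp add: ga_const)
  ultimately show "f \<in> generated_algebra {\<lambda>x. x}" by simp
qed

lemma ga_poly_comp:
  assumes "f \<in> generated_algebra G" shows "(\<lambda>x. poly p (f x)) \<in> generated_algebra G"
  by (induction p) (simp_all add: ga_const ga_add ga_mult assms)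

lemma poly_fun_on_curve:
  assumes "f \<in> poly_funs" "\<And>i. \<exists>p. \<forall>\<tau>. V \<tau> $ i = poly p \<tau>"
  shows "\<exists>p. \<forall>\<tau>. f (V \<tau>) = poly p \<tau>"
proof -
  have "(\<lambda>\<tau>. V \<tau> $ i) \<in> generated_algebra {\<lambda>x. x}" for i
    using assms(2)[of i] unfolding ga_univariate by (auto simp: fun_eq_iff)
  then have "(\<lambda>\<tau>. f (V \<tau>)) \<in> generated_algebra {\<lambda>x. x}"
    by (rule poly_funs_comp[OF assms(1)])
  then show ?thesis unfolding ga_univariate by (auto simp: fun_eq_iff)
qed

lemma poly_fun_on_line:
  assumes "f \<in> poly_funs"
  shows "\<exists>p. \<forall>\<tau>. f (a + \<tau> *s b) = poly p \<tau>"
proof -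
  have "\<exists>p. \<forall>\<tau>. (a + \<tau> *s b) $ i = poly p \<tau>" for i
    by (intro exI[of _ "[:a $ i, b $ i:]"]) simp
  then show ?thesis by (rule poly_fun_on_curve[OF assms])
qed

section \<open>Genericity over an infinite field\<close>

lemma complex_avoid_finite: "finite (A :: complex set) \<Longrightarrow> \<exists>x. x \<notin> A"
  using ex_new_if_finite infinite_UNIV_char_0 by blast

lemma poly_nonzero_cofinite:
  fixes p :: "complex poly"
  assumes "\<not> finite A" "\<And>x. x \<in> A \<Longrightarrow> poly p x = 0"
  shows "p = 0"
  using assms poly_roots_finite[of p] by (metis (mono_tags, lifting) finite_subset mem_Collect_eq subsetI)

lemma poly_eq_cofinite:
  fixes p q :: "complex poly"
  assumes "finite A" "\<And>x. x \<notin> A \<Longrightarrow> poly p x = poly q x"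
  shows "p = q"
proof -
  have "infinite (- A)" using assms(1) by (metis Compl_eq_Diff_UNIV finite_Diff2 infinite_UNIV_char_0)
  then have "p - q = 0" using assms(2) by (intro poly_nonzero_cofinite[of "- A"]) auto
  then show ?thesis by simp
qed

text \<open>Affine space is irreducible: on the line joining x and y both functions restrict to
  nonzero univariate polynomials, and so does their product.\<close>

lemma poly_funs_common_nonzero:
  assumes "f \<in> poly_funs" "g \<in> poly_funs" "f x \<noteq> 0" "g y \<noteq> 0"
  shows "\<exists>z. f z \<noteq> 0 \<and> g z \<noteq> 0"
proof -
  obtain p where p: "\<And>\<tau>. f (x + \<tau> *s (y - x)) = poly p \<tau>" using poly_fun_on_line[OF assms(1)] by blast
  obtain q where q: "\<And>\<tau>. g (x + \<tau> *s (y - x)) = poly q \<tau>" using poly_fun_on_line[OF assms(2)] by blast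
  have "poly p 0 \<noteq> 0" "poly q 1 \<noteq> 0" using p[of 0] q[of 1] assms(3,4) by auto
  then have "p * q \<noteq> 0" by auto
  then obtain \<tau> where "poly (p * q) \<tau> \<noteq> 0" using poly_all_0_iff_0 by blast
  then show ?thesis using p q by (metis mult_eq_0_iff poly_mult)
qed

text \<open>A nonempty open set contains the nonvanishing locus of one of its defining functions, so
  genericity is certified by a single nonzero polynomial.\<close>

lemma generically_iff: "generically P \<longleftrightarrow> (\<exists>f\<in>poly_funs. (\<exists>x. f x \<noteq> 0) \<and> (\<forall>x. f x \<noteq> 0 \<longrightarrow> P x))"
proof
  assume "generically P"
  then obtain U where U: "openin zariski U" "U \<noteq> {}" "\<forall>u\<in>U. P u"
    unfolding generically_def by (elim exE conjE)
  obtain S where S: "S \<subseteq> poly_funs" "U = {x. \<exists>f\<in>S. f x \<noteq> 0}"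
    using U(1) unfolding openin_zariski by (elim exE conjE)
  obtain x f where "f \<in> S" "f x \<noteq> 0" using U(2) unfolding S(2) by auto
  moreover have "P z" if "f z \<noteq> 0" for z using U(3) that \<open>f \<in> S\<close> unfolding S(2) by auto
  ultimately show "\<exists>f\<in>poly_funs. (\<exists>x. f x \<noteq> 0) \<and> (\<forall>x. f x \<noteq> 0 \<longrightarrow> P x)"
    using S(1) by (intro bexI[of _ f]) auto
next
  assume "\<exists>f\<in>poly_funs. (\<exists>x. f x \<noteq> 0) \<and> (\<forall>x. f x \<noteq> 0 \<longrightarrow> P x)"
  then obtain f where "f \<in> poly_funs" "\<exists>x. f x \<noteq> 0" "\<forall>x. f x \<noteq> 0 \<longrightarrow> P x" by blast
  then show "generically P"
    unfolding generically_def openin_zariski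
    by (intro exI[of _ "{x. f x \<noteq> 0}"] conjI exI[of _ "{f}"]) auto
qed

lemma generically_conj:
  assumes "generically P" "generically Q" shows "generically (\<lambda>x. P x \<and> Q x)"
proof -
  obtain f x where f: "f \<in> poly_funs" "f x \<noteq> 0" "\<forall>x. f x \<noteq> 0 \<longrightarrow> P x"
    using assms(1) unfolding generically_iff by blast
  obtain g y where g: "g \<in> poly_funs" "g y \<noteq> 0" "\<forall>x. g x \<noteq> 0 \<longrightarrow> Q x"
    using assms(2) unfolding generically_iff by blast
  show ?thesis
    unfolding generically_iff
  proof (intro bexI conjI allI impI)
    show "\<exists>x. f x * g x \<noteq> 0" using poly_funs_common_nonzero[OF f(1) g(1) f(2) g(2)] by simp
  qed (use f g pf_mult[OF f(1) g(1)] in auto)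
qed

lemma generically_mono: "generically P \<Longrightarrow> (\<And>x. P x \<Longrightarrow> Q x) \<Longrightarrow> generically Q"
  unfolding generically_def by blast

lemma generically_nonzero: "f \<in> poly_funs \<Longrightarrow> f x \<noteq> 0 \<Longrightarrow> generically (\<lambda>x. f x \<noteq> 0)"
  unfolding generically_iff by blast

lemma generically_ex: "generically P \<Longrightarrow> \<exists>x. P x"
  unfolding generically_iff by blast

lemma generic_card_eq:
  assumes "generically (\<lambda>u. finite (A u) \<and> card (A u) = k)"
  shows "generic_card A = k"
  unfolding generic_card_def
proof (rule the_equality)
  show "generically (\<lambda>u. finite (A u) \<and> card (A u) = k)" by (rule assms)
  fix j assume "generically (\<lambda>u. finite (A u) \<and> card (A u) = j)"
  then show "j = k" using generically_ex[OF generically_conj[OF assms]] by blast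
qed

text \<open>Supplies the dominance required in \<open>MLD\<close>: a set containing a nonempty open
  set meets every nonempty open set.\<close>

lemma zariski_dense_if_generically:
  assumes "generically (\<lambda>u. u \<in> A)"
  shows "zariski closure_of A = UNIV"
proof -
  obtain f where f: "f \<in> poly_funs" "\<exists>x. f x \<noteq> 0" "\<And>x. f x \<noteq> 0 \<Longrightarrow> x \<in> A"
    using assms unfolding generically_iff by blast
  have "x \<in> zariski closure_of A" for x
    unfolding in_closure_of
  proof (intro conjI allI impI)
    fix T assume "x \<in> T \<and> openin zariski T"
    then obtain S where S: "S \<subseteq> poly_funs" "T = {x. \<exists>f\<in>S. f x \<noteq> 0}" "x \<in> T"
      unfolding openin_zariski by (elim exE conjE)
    then obtain g where "g \<in> S" "g x \<noteq> 0" by auto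
    then have g: "g \<in> poly_funs" "g x \<noteq> 0" "{x. g x \<noteq> 0} \<subseteq> T" using S by auto
    then show "\<exists>y. y \<in> A \<and> y \<in> T"
      using poly_funs_common_nonzero[OF f(1) g(1)] f(2,3) by blast
  qed simp
  then show ?thesis by blast
qed

section \<open>Homogeneous functions\<close>

definition hom_deg :: "nat \<Rightarrow> (complex ^ 'n \<Rightarrow> complex) \<Rightarrow> bool" where
  "hom_deg d f \<longleftrightarrow> f \<in> poly_funs \<and> (\<forall>c x. f (c *s x) = c ^ d * f x)"

lemma hom_poly_funs_iff: "f \<in> hom_poly_funs \<longleftrightarrow> (\<exists>d. hom_deg d f)"
  unfolding hom_poly_funs_def hom_deg_def by auto

lemma hom_deg_pf: "hom_deg d f \<Longrightarrow> f \<in> poly_funs"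
  by (simp add: hom_deg_def)

lemma hom_deg_scale: "hom_deg d f \<Longrightarrow> f (c *s x) = c ^ d * f x"
  by (simp add: hom_deg_def)

lemma hom_deg_mult: "hom_deg d f \<Longrightarrow> hom_deg e g \<Longrightarrow> hom_deg (d + e) (\<lambda>x. f x * g x)"
  by (auto simp: hom_deg_def power_add pf_mult)

lemma hom_deg_mult': "hom_deg d f \<Longrightarrow> hom_deg e g \<Longrightarrow> n = d + e \<Longrightarrow> hom_deg n (\<lambda>x. f x * g x)"
  using hom_deg_mult by blast

lemma hom_deg_add: "hom_deg d f \<Longrightarrow> hom_deg d g \<Longrightarrow> hom_deg d (\<lambda>x. f x + g x)"
  by (auto simp: hom_deg_def algebra_simps pf_add)

lemma hom_deg_zero: "hom_deg d (\<lambda>x. 0)"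
  by (simp add: hom_deg_def pf_const)

lemma hom_deg_const: "hom_deg 0 (\<lambda>x. c)"
  by (simp add: hom_deg_def pf_const)

lemma hom_deg_cmult: "hom_deg d f \<Longrightarrow> hom_deg d (\<lambda>x. c * f x)"
  using hom_deg_mult[OF hom_deg_const] by fastforce

lemma hom_deg_sum: "(\<And>i. i \<in> I \<Longrightarrow> hom_deg d (f i)) \<Longrightarrow> hom_deg d (\<lambda>x. \<Sum>i\<in>I. f i x)"
  by (auto simp: hom_deg_def sum_distrib_left pf_sum intro!: sum.cong)

lemma hom_deg_power: "hom_deg d f \<Longrightarrow> hom_deg (n * d) (\<lambda>x. f x ^ n)"
  by (induction n) (auto simp: hom_deg_const intro: hom_deg_mult')

lemma hom_deg_pairing: "hom_deg 1 (pairing u)"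
  by (simp add: hom_deg_def pf_pairing pairing_scale)

lemma hom_deg_coord: "hom_deg 1 (\<lambda>x. x $ i)"
  by (simp add: hom_deg_def pf_coord)

lemma homogeneous_components:
  assumes "f \<in> poly_funs"
  shows "\<exists>N g. (\<forall>i. hom_deg i (g i)) \<and> (\<forall>x. f x = (\<Sum>i\<le>N. g i x))"
  using assms unfolding poly_funs_def
proof induction
  case (gen f)
  then obtain j where j: "f = (\<lambda>x. x $ j)" by blast
  show ?case
    by (intro exI[of _ 1] exI[of _ "\<lambda>i. if i = 1 then f else (\<lambda>x. 0)"])
      (use hom_deg_coord[of j] in \<open>auto simp: j hom_deg_zero\<close>)
next
  case (const c)
  show ?case
    by (intro exI[of _ 0] exI[of _ "\<lambda>i. if i = 0 then (\<lambda>x. c) else (\<lambda>x. 0)"])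
      (auto simp: hom_deg_zero hom_deg_const)
next
  case (add f g)
  obtain N a where a: "\<And>i. hom_deg i (a i)" "\<And>x. f x = (\<Sum>i\<le>N. a i x)" using add.IH(1) by blast
  obtain M b where b: "\<And>i. hom_deg i (b i)" "\<And>x. g x = (\<Sum>i\<le>M. b i x)" using add.IH(2) by blast
  define a' where "a' = (\<lambda>i. if i \<le> N then a i else (\<lambda>x. 0))"
  define b' where "b' = (\<lambda>i. if i \<le> M then b i else (\<lambda>x. 0))"
  have "f x = (\<Sum>i\<le>max N M. a' i x)" for x
    unfolding a(2) a'_def by (intro sum.mono_neutral_cong_left) auto
  moreover have "g x = (\<Sum>i\<le>max N M. b' i x)" for x
    unfolding b(2) b'_def by (intro sum.mono_neutral_cong_left) auto
  moreover have "hom_deg i (\<lambda>x. a' i x + b' i x)" for i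
    by (intro hom_deg_add) (auto simp: a'_def b'_def a(1) b(1) hom_deg_zero)
  ultimately show ?case
    by (intro exI[of _ "max N M"] exI[of _ "\<lambda>i x. a' i x + b' i x"]) (simp add: sum.distrib)
next
  case (mult f g)
  obtain N a where a: "\<And>i. hom_deg i (a i)" "\<And>x. f x = (\<Sum>i\<le>N. a i x)" using mult.IH(1) by blast
  obtain M b where b: "\<And>i. hom_deg i (b i)" "\<And>x. g x = (\<Sum>i\<le>M. b i x)" using mult.IH(2) by blast
  define h where "h k x = (\<Sum>p\<in>{p \<in> {..N} \<times> {..M}. fst p + snd p = k}. a (fst p) x * b (snd p) x)" for k x
  have "hom_deg k (h k)" for k
    unfolding h_def[abs_def] by (intro hom_deg_sum hom_deg_mult') (auto simp: a(1) b(1))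
  moreover have "f x * g x = (\<Sum>k\<le>N + M. h k x)" for x
  proof -
    have "f x * g x = (\<Sum>p\<in>{..N} \<times> {..M}. a (fst p) x * b (snd p) x)"
      unfolding a(2) b(2) sum_product by (simp add: sum.cartesian_product case_prod_unfold)
    also have "\<dots> = (\<Sum>k\<le>N + M. h k x)"
      unfolding h_def by (intro sum.group[symmetric]) auto
    finally show ?thesis .
  qed
  ultimately show ?case by (intro exI[of _ "N + M"] exI[of _ h]) auto
qed

text \<open>For x in A the polynomial c \<mapsto> f (c x) vanishes identically, and its coefficients
  are the values of the homogeneous components of f at x.\<close>

lemma homogeneous_component_vanishes:
  fixes A :: "(complex ^ 'n) set"
  assumes f: "f \<in> poly_funs" "\<And>x. x \<in> A \<Longrightarrow> f x = 0"
    and A: "\<And>c x. x \<in> A \<Longrightarrow> c *s x \<in> A" and y: "f y \<noteq> 0"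
  shows "\<exists>d g. hom_deg d g \<and> (\<forall>x\<in>A. g x = 0) \<and> g y \<noteq> 0"
proof -
  obtain N g where g: "\<And>i. hom_deg i (g i)" "\<And>x. f x = (\<Sum>i\<le>N. g i x)"
    using homogeneous_components[OF f(1)] by blast
  have van: "g i x = 0" if "x \<in> A" "i \<le> N" for i x
  proof -
    let ?p = "\<Sum>i\<le>N. monom (g i x) i"
    have "poly ?p c = f (c *s x)" for c
      unfolding g(2) by (simp add: poly_sum poly_monom hom_deg_scale[OF g(1)] mult.commute)
    then have "poly ?p c = 0" for c using f(2)[OF A[OF that(1)]] by simp
    then have "?p = 0" using poly_all_0_iff_0 by blast
    then have "coeff ?p i = 0" by simp
    then show ?thesis using that(2) by (simp add: coeff_sum)
  qed
  obtain i where "i \<le> N" "g i y \<noteq> 0" using y unfolding g(2) by (metis atMost_iff sum.neutral)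
  then show ?thesis using g(1) van by blast
qed

section \<open>Families of univariate polynomials\<close>

text \<open>Coefficients depend on the parameter through the algebra, but the degree may vary with
  x; uniform degree bounds are therefore carried as separate hypotheses.\<close>

definition polyfam :: "('a \<Rightarrow> complex) set \<Rightarrow> ('a \<Rightarrow> complex poly) \<Rightarrow> bool" where
  "polyfam G F \<longleftrightarrow> (\<forall>k. (\<lambda>x. coeff (F x) k) \<in> generated_algebra G)"

lemma polyfam_const: "polyfam G (\<lambda>x. p)"
  by (simp add: polyfam_def ga_const)

lemma polyfam_add: "polyfam G F \<Longrightarrow> polyfam G H \<Longrightarrow> polyfam G (\<lambda>x. F x + H x)"
  by (simp add: polyfam_def ga_add)

lemma polyfam_mult: "polyfam G F \<Longrightarrow> polyfam G H \<Longrightarrow> polyfam G (\<lambda>x. F x * H x)"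
  by (simp add: polyfam_def coeff_mult ga_sum ga_mult)

lemma polyfam_sum: "(\<And>i. i \<in> I \<Longrightarrow> polyfam G (F i)) \<Longrightarrow> polyfam G (\<lambda>x. \<Sum>i\<in>I. F i x)"
  by (simp add: polyfam_def coeff_sum ga_sum)

lemma polyfam_power: "polyfam G F \<Longrightarrow> polyfam G (\<lambda>x. F x ^ n)"
  by (induction n) (simp_all add: polyfam_const polyfam_mult)

lemma polyfam_pCons:
  assumes "f \<in> generated_algebra G" "polyfam G F" shows "polyfam G (\<lambda>x. pCons (f x) (F x))"
proof -
  have "(\<lambda>x. coeff (pCons (f x) (F x)) k) \<in> generated_algebra G" for k
    using assms by (cases k) (auto simp: polyfam_def)
  then show ?thesis by (simp add: polyfam_def)
qed

lemma polyfam_smult: "f \<in> generated_algebra G \<Longrightarrow> polyfam G F \<Longrightarrow> polyfam G (\<lambda>x. smult (f x) (F x))"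
  by (simp add: polyfam_def ga_mult)

lemma polyfam_pderiv: "polyfam G F \<Longrightarrow> polyfam G (\<lambda>x. pderiv (F x))"
  by (auto simp: polyfam_def coeff_pderiv intro!: ga_mult ga_add ga_const)

lemma polyfam_pcompose:
  assumes "polyfam G F" shows "polyfam G (\<lambda>x. pcompose p (F x))"
  by (induction p) (simp_all add: pcompose_pCons polyfam_const polyfam_add polyfam_mult assms)

text \<open>Restriction of f to a family of parametrized curves. The bound N, uniform in the
  parameter, is what \<open>no_relation_no_common_root\<close> asks for.\<close>

lemma poly_fun_polyfam:
  assumes "f \<in> poly_funs" "\<And>i. polyfam G (V i)" "\<And>i x. degree (V i x) \<le> D"
  shows "\<exists>F N. polyfam G F \<and> (\<forall>x. degree (F x) \<le> N) \<and>
    (\<forall>x w v. (\<forall>i. v $ i = poly (V i x) w) \<longrightarrow> f v = poly (F x) w)"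
  using assms(1) unfolding poly_funs_def
proof induction
  case (gen g)
  then obtain i where "g = (\<lambda>x. x $ i)" by blast
  then show ?case using assms(2,3) by (intro exI[of _ "V i"] exI[of _ D]) simp
next
  case (const c)
  show ?case by (intro exI[of _ "\<lambda>x. [:c:]"] exI[of _ 0]) (auto intro: polyfam_const)
next
  case (add f g)
  then obtain F1 N1 F2 N2 where F: "polyfam G F1" "polyfam G F2"
    "\<And>x. degree (F1 x) \<le> N1" "\<And>x. degree (F2 x) \<le> N2"
    "\<And>x w v. (\<forall>i. v $ i = poly (V i x) w) \<Longrightarrow> f v = poly (F1 x) w"
    "\<And>x w v. (\<forall>i. v $ i = poly (V i x) w) \<Longrightarrow> g v = poly (F2 x) w" by metis
  have "degree (F1 x + F2 x) \<le> max N1 N2" for x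
    using F(3,4) by (intro degree_add_le) (auto simp: le_max_iff_disj)
  then show ?case
    by (intro exI[of _ "\<lambda>x. F1 x + F2 x"] exI[of _ "max N1 N2"] conjI polyfam_add F(1,2)) (simp, metis F(5,6) poly_add)
next
  case (mult f g)
  then obtain F1 N1 F2 N2 where F: "polyfam G F1" "polyfam G F2"
    "\<And>x. degree (F1 x) \<le> N1" "\<And>x. degree (F2 x) \<le> N2"
    "\<And>x w v. (\<forall>i. v $ i = poly (V i x) w) \<Longrightarrow> f v = poly (F1 x) w"
    "\<And>x w v. (\<forall>i. v $ i = poly (V i x) w) \<Longrightarrow> g v = poly (F2 x) w" by metis
  have "degree (F1 x * F2 x) \<le> N1 + N2" for x
    using F(3,4) by (intro order_trans[OF degree_mult_le] add_mono)
  then show ?case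
    by (intro exI[of _ "\<lambda>x. F1 x * F2 x"] exI[of _ "N1 + N2"] conjI polyfam_mult F(1,2)) (simp, metis F(5,6) poly_mult)
qed

text \<open>Division-free Gaussian elimination: linear independence is an open condition in the topology
  whose basic open sets are the nonvanishing loci of functions of the algebra.\<close>

lemma independent_open:
  fixes v :: "nat \<Rightarrow> nat \<Rightarrow> 'a \<Rightarrow> complex"
  assumes "\<And>i k. i < N \<Longrightarrow> v i k \<in> generated_algebra G"
    and "\<And>c. (\<And>k. (\<Sum>i<N. c i * v i k x0) = 0) \<Longrightarrow> \<forall>i<N. c i = 0"
  shows "\<exists>g\<in>generated_algebra G. g x0 \<noteq> 0 \<and>
    (\<forall>x. g x \<noteq> 0 \<longrightarrow> (\<forall>c. (\<forall>k. (\<Sum>i<N. c i * v i k x) = 0) \<longrightarrow> (\<forall>i<N. c i = 0)))"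
  using assms
proof (induction N arbitrary: v)
  case 0
  show ?case by (intro bexI[of _ "\<lambda>x. 1"] ga_const) simp
next
  case (Suc N)
  have "\<exists>j. v N j x0 \<noteq> 0"
  proof (rule ccontr)
    assume "\<not> ?thesis"
    then have "(\<Sum>i<Suc N. (if i = N then 1 else 0) * v i k x0) = 0" for k
      by (intro sum.neutral) auto
    then show False using Suc.prems(2)[of "\<lambda>i. if i = N then 1 else 0"] by auto
  qed
  then obtain j where j: "v N j x0 \<noteq> 0" by blast
  \<comment> \<open>The pivot is the entry j of the last vector; w clears column j from the other
    vectors.\<close>
  define w where "w i k x = v N j x * v i k x - v i j x * v N k x" for i k x
  have w: "w i k \<in> generated_algebra G" if "i < N" for i k
    unfolding w_def[abs_def] using that by (intro ga_diff ga_mult Suc.prems(1)) auto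
  have expand: "(\<Sum>i<N. c i * w i k x) = v N j x * (\<Sum>i<N. c i * v i k x) - v N k x * (\<Sum>i<N. c i * v i j x)"
    for c k x
    unfolding w_def sum_distrib_left sum_subtractf[symmetric]
    by (intro sum.cong) (auto simp: algebra_simps)
  have "\<forall>i<N. c i = 0" if c: "\<And>k. (\<Sum>i<N. c i * w i k x0) = 0" for c
  proof -
    \<comment> \<open>A relation among the cleared vectors lifts to the original ones: scale it by
      the pivot and choose the last coefficient so that column j cancels.\<close>
    define c' where "c' i = (if i < N then v N j x0 * c i else - (\<Sum>i<N. c i * v i j x0))" for i
    have "(\<Sum>i<Suc N. c' i * v i k x0) = 0" for k
      using c[of k] unfolding expand
      by (simp add: c'_def sum_distrib_left mult_ac)
    from Suc.prems(2)[OF this] j show ?thesis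
      unfolding c'_def by (metis less_SucI mult_eq_0_iff)
  qed
  from Suc.IH[of w, OF w this] obtain g where g: "g \<in> generated_algebra G" "g x0 \<noteq> 0"
    "\<And>x c. g x \<noteq> 0 \<Longrightarrow> (\<And>k. (\<Sum>i<N. c i * w i k x) = 0) \<Longrightarrow> \<forall>i<N. c i = 0" by blast
  show ?case
  proof (intro bexI[of _ "\<lambda>x. g x * v N j x"] conjI allI impI)
    show "(\<lambda>x. g x * v N j x) \<in> generated_algebra G" by (intro ga_mult g Suc.prems(1)) simp
    show "g x0 * v N j x0 \<noteq> 0" using g(2) j by simp
    fix x c i assume gx: "g x * v N j x \<noteq> 0" and c: "\<forall>k. (\<Sum>i<Suc N. c i * v i k x) = 0" and i: "i < Suc N"
    have s: "(\<Sum>i<N. c i * v i k x) = - (c N * v N k x)" for k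
      using c by (simp add: eq_neg_iff_add_eq_0)
    have "(\<Sum>i<N. c i * w i k x) = 0" for k unfolding expand s by simp
    then have cz: "\<forall>i<N. c i = 0" using g(3)[of x c] gx by auto
    then have "c N * v N j x = 0" using s[of j] by simp
    then show "c i = 0" using cz gx i by (cases "i = N") auto
  qed
qed

text \<open>Injectivity of a Sylvester matrix with a shifts of f and b shifts of g. For a the degree
  of g and b the degree of f it says that the resultant is nonzero; smaller bounds give the
  subresultant conditions that count common roots.\<close>

definition no_relation :: "nat \<Rightarrow> nat \<Rightarrow> complex poly \<Rightarrow> complex poly \<Rightarrow> bool" where
  "no_relation a b f g \<longleftrightarrow> (\<forall>u v. (\<forall>i\<ge>a. coeff u i = 0) \<longrightarrow> (\<forall>i\<ge>b. coeff v i = 0) \<longrightarrow>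
     u * f + v * g = 0 \<longrightarrow> u = 0 \<and> v = 0)"

lemma sum_lessThan_split: "(\<Sum>i<a + b. f i) = (\<Sum>i<a. f i) + (\<Sum>j<b. f (a + j))"
  for f :: "nat \<Rightarrow> 'a::comm_monoid_add"
  by (induction b) (simp_all add: add.assoc)

text \<open>The condition is linear independence of the a shifts of \<open>F x\<close> together with
  the b shifts of \<open>H x\<close>, so \<open>independent_open\<close> applies.\<close>

lemma no_relation_open:
  assumes "polyfam G F" "polyfam G H" "no_relation a b (F x0) (H x0)"
  shows "\<exists>g\<in>generated_algebra G. g x0 \<noteq> 0 \<and> (\<forall>x. g x \<noteq> 0 \<longrightarrow> no_relation a b (F x) (H x))"
proof -
  define v where "v i k x = (if i < a then coeff (monom 1 i * F x) k else coeff (monom 1 (i - a) * H x) k)" for i k x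
  have v: "v i k \<in> generated_algebra G" for i k
    using polyfam_mult[OF polyfam_const[of G "monom 1 i"] assms(1)]
      polyfam_mult[OF polyfam_const[of G "monom 1 (i - a)"] assms(2)]
    unfolding v_def[abs_def] polyfam_def by (cases "i < a") auto
  have rel: "(\<Sum>i<a + b. c i * v i k x) =
      coeff ((\<Sum>i<a. monom (c i) i) * F x + (\<Sum>j<b. monom (c (a + j)) j) * H x) k" for c k x
  proof -
    have 1: "c * coeff (monom 1 i * p) k = coeff (monom c i * p) k" for c i and p :: "complex poly"
      by (metis coeff_smult mult.right_neutral mult_smult_left smult_monom)
    show ?thesis
      unfolding sum_lessThan_split by (simp add: v_def 1 coeff_sum sum_distrib_right)
  qed
  have c0: "coeff (\<Sum>i<a. monom (f i) i) i = (if i < a then f i else 0)" for a i and f :: "nat \<Rightarrow> complex"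
    by (simp add: coeff_sum)
  have indep: "\<forall>i<a + b. c i = 0"
    if n: "no_relation a b (F x) (H x)" and c: "\<And>k. (\<Sum>i<a + b. c i * v i k x) = 0" for c x
  proof -
    have "(\<Sum>i<a. monom (c i) i) * F x + (\<Sum>j<b. monom (c (a + j)) j) * H x = 0"
      using c unfolding rel by (intro poly_eqI) simp
    then have "(\<Sum>i<a. monom (c i) i) = 0 \<and> (\<Sum>j<b. monom (c (a + j)) j) = 0"
      using n[unfolded no_relation_def, rule_format, of "\<Sum>i<a. monom (c i) i" "\<Sum>j<b. monom (c (a + j)) j"]
      by (simp add: c0)
    then have "\<And>i. (if i < a then c i else 0) = 0" "\<And>j. (if j < b then c (a + j) else 0) = 0"
      using c0 by (metis coeff_0)+
    then have cz: "i < a \<Longrightarrow> c i = 0" "j < b \<Longrightarrow> c (a + j) = 0" for i j by meson+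
    show ?thesis
    proof (intro allI impI)
      fix i assume "i < a + b"
      then show "c i = 0" using cz(1)[of i] cz(2)[of "i - a"] by (cases "i < a") auto
    qed
  qed
  obtain g where g: "g \<in> generated_algebra G" "g x0 \<noteq> 0"
    "\<And>x c. g x \<noteq> 0 \<Longrightarrow> (\<And>k. (\<Sum>i<a + b. c i * v i k x) = 0) \<Longrightarrow> \<forall>i<a + b. c i = 0"
    using independent_open[of "a + b" v G x0] v indep[OF assms(3)] by blast
  have "no_relation a b (F x) (H x)" if "g x \<noteq> 0" for x
    unfolding no_relation_def
  proof (intro allI impI)
    fix p q assume p: "\<forall>i\<ge>a. coeff p i = 0" and q: "\<forall>i\<ge>b. coeff q i = 0" and pq: "p * F x + q * H x = 0"
    define c where "c i = (if i < a then coeff p i else coeff q (i - a))" for i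
    have sums: "(\<Sum>i<a. monom (c i) i) = p" "(\<Sum>j<b. monom (c (a + j)) j) = q"
      using p q by (auto intro!: poly_eqI simp: c0 c_def not_less)
    have "(\<Sum>i<a + b. c i * v i k x) = 0" for k
      unfolding rel sums pq by simp
    then have "\<forall>i<a + b. c i = 0" by (rule g(3)[OF that])
    then have "coeff p i = 0" if "i < a" for i using that unfolding c_def by (metis trans_less_add1)
    moreover have "coeff q i = 0" if "i < b" for i
      using \<open>\<forall>i<a + b. c i = 0\<close>[rule_format, of "a + i"] that unfolding c_def by simp
    ultimately show "p = 0 \<and> q = 0" using p q by (metis coeff_0 linorder_not_less poly_eqI)
  qed
  then show ?thesis using g by blast
qed

text \<open>From u f = - v g and coprimality, f divides v, whose degree is less than that of
  f.\<close>

lemma no_relation_coprime: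
  assumes "f \<noteq> 0" "\<And>w. poly f w = 0 \<Longrightarrow> poly g w \<noteq> 0"
  shows "no_relation a (degree f) f g"
  unfolding no_relation_def
proof (intro allI impI)
  fix u v assume v: "\<forall>i\<ge>degree f. coeff v i = 0" and uv: "u * f + v * g = 0"
  have "coprime f g"
  proof (rule coprimeI)
    fix d assume d: "d dvd f" "d dvd g"
    show "is_unit d"
    proof (rule ccontr)
      assume "\<not> is_unit d"
      moreover have "d \<noteq> 0" using d(1) assms(1) by auto
      ultimately have "\<not> constant (poly d)"
        by (metis constant_degree is_unit_iff_degree)
      then obtain w where "poly d w = 0" using fundamental_theorem_of_algebra by blast
      then show False using assms(2)[of w] d by (metis dvd_trans poly_eq_0_iff_dvd)
    qed
  qed
  moreover have "f dvd v * g" using uv by (metis add_eq_0_iff2 dvd_minus_iff dvd_triv_right)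
  ultimately have "f dvd v" by (simp add: coprime_dvd_mult_left_iff)
  have "v = 0"
  proof (rule ccontr)
    assume "v \<noteq> 0"
    then have "degree f \<le> degree v" using \<open>f dvd v\<close> by (rule dvd_imp_degree_le[rotated])
    then show False using v \<open>v \<noteq> 0\<close> leading_coeff_0_iff by blast
  qed
  then show "u = 0 \<and> v = 0" using uv assms(1) by simp
qed

text \<open>Dividing f and g by a common linear factor leaves cofactors f1 and g1 with g1 f - f1 g =
  0, and their degrees are small enough for this relation to be excluded.\<close>

lemma no_relation_no_common_root:
  assumes "no_relation a b f g" "degree g \<le> a" "degree f \<le> b" "1 \<le> a"
  shows "poly f w \<noteq> 0 \<or> poly g w \<noteq> 0"
proof (rule ccontr)
  assume "\<not> ?thesis"
  then obtain f1 g1 where fg: "f = [:-w, 1:] * f1" "g = [:-w, 1:] * g1" by (auto simp: poly_eq_0_iff_dvd elim!: dvdE)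
  have deg: "\<forall>i\<ge>n. coeff p i = 0" if "degree ([:-w, 1:] * p) \<le> n" for n and p :: "complex poly"
  proof (cases "p = 0")
    case False
    then have "degree ([:-w, 1:] * p) = Suc (degree p)" by (subst degree_mult_eq) auto
    then show ?thesis using that by (auto intro: coeff_eq_0)
  qed simp
  show False
  proof (cases "f = 0")
    case True
    \<comment> \<open>For f = 0 the cofactor relation may be trivial, and u = 1, v = 0 replaces it;
      this is where \<open>1 \<le> a\<close> enters.\<close>
    have "\<forall>i\<ge>a. coeff (1 :: complex poly) i = 0" using assms(4) by (auto simp: coeff_1)
    then show False
      using assms(1)[unfolded no_relation_def, rule_format, of 1 0] True by auto
  next
    case False
    have "g1 * f + (- f1) * g = 0" unfolding fg by (simp add: algebra_simps)
    then have "f1 = 0"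
      using assms(1)[unfolded no_relation_def, rule_format, of g1 "- f1"] deg[of g1 a] deg[of f1 b] assms(2,3) fg
      by auto
    then show False using False fg by simp
  qed
qed

lemma rsquarefree_card_roots:
  fixes p :: "complex poly"
  assumes "rsquarefree p"
  shows "card {z. poly p z = 0} = degree p"
proof -
  have "p \<noteq> 0" using assms by (simp add: rsquarefree_def)
  have "degree p = degree (smult (lead_coeff p) (\<Prod>z|poly p z = 0. [:-z, 1:]))"
    using complex_poly_decompose_rsquarefree[OF assms] by simp
  also have "\<dots> = (\<Sum>z|poly p z = 0. degree [:-z, 1:])"
    using \<open>p \<noteq> 0\<close> by (simp add: degree_prod_eq_sum_degree)
  finally show ?thesis by simp
qed

text \<open>With d the gcd of p and its derivative p', the smallest relation between p and p' has
  the cofactors p' / d and p / d. The latter has one simple root for each distinct root of p, so its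
  degree is the number of distinct roots, and admissible relations exist exactly when r exceeds
  it.\<close>

lemma no_relation_iff_card_roots:
  assumes "p \<noteq> 0" "1 \<le> r"
  shows "no_relation (r - 1) r p (pderiv p) \<longleftrightarrow> r \<le> card {z. poly p z = 0}"
proof
  assume nr: "no_relation (r - 1) r p (pderiv p)"
  show "r \<le> card {z. poly p z = 0}"
  proof (rule ccontr)
    assume less: "\<not> ?thesis"
    show False
    proof (cases "pderiv p = 0")
      case True
      have "\<forall>i\<ge>r. coeff (1 :: complex poly) i = 0" using assms(2) by (auto simp: coeff_1)
      then show False using nr[unfolded no_relation_def, rule_format, of 0 1] True by auto
    next
      case False
      \<comment> \<open>With p = q d and p' = e d, the pair u = - e, v = q is a relation within the
        bounds as soon as p has fewer than r distinct roots.\<close>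
      define d where "d = gcd p (pderiv p)"
      obtain a b where ab: "a * p + b * pderiv p = d"
        unfolding d_def using bezout_coefficients by (metis surj_pair)
      obtain q e where qe: "p = q * d" "pderiv p = e * d"
        unfolding d_def by (metis dvdE gcd_dvd1 gcd_dvd2 mult.commute)
      have sq: "rsquarefree q" "\<And>a. poly q a = 0 \<longleftrightarrow> poly p a = 0"
        using poly_squarefree_decomp[OF False qe ab[symmetric]] by auto
      then have deg: "degree q < r" using less rsquarefree_card_roots[OF sq(1)] by simp
      have nz: "q \<noteq> 0" "e \<noteq> 0" "d \<noteq> 0" using qe assms(1) False by auto
      have "degree (pderiv p) < degree p"
        using False pderiv_eq_0_iff[of p] by (cases "degree p") (simp_all add: degree_pderiv)
      moreover have "degree (pderiv p) = degree e + degree d" unfolding qe(2) using nz by (simp add: degree_mult_eq)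
      moreover have "degree p = degree q + degree d" using arg_cong[OF qe(1), of degree] nz by (simp add: degree_mult_eq)
      ultimately have "degree e < degree q" by simp
      then have "q = 0"
        using nr[unfolded no_relation_def, rule_format, of "- e" q] deg qe
        by (auto simp: coeff_eq_0 algebra_simps)
      then show False using nz by simp
    qed
  qed
next
  assume r: "r \<le> card {z. poly p z = 0}"
  show "no_relation (r - 1) r p (pderiv p)"
    unfolding no_relation_def
  proof (intro allI impI)
    fix u v assume v: "\<forall>i\<ge>r. coeff v i = 0" and uv: "u * p + v * pderiv p = 0"
    have p': "pderiv p \<noteq> 0"
    proof
      assume "pderiv p = 0"
      then obtain c where "p = [:c:]" using pderiv_iszero by blast
      then show False using assms r by auto
    qed
    have "v = 0"
    proof (rule ccontr)
      assume nz: "v \<noteq> 0"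
      \<comment> \<open>At a root of p the order of p' is one less than that of p, so v p' = - u p
        forces v to vanish there.\<close>
      have "poly v z = 0" if z: "poly p z = 0" for z
      proof (rule ccontr)
        assume "poly v z \<noteq> 0"
        then have "order z v = 0" by (simp add: order_0I)
        moreover have eq: "v * pderiv p = - (u * p)" using uv by (simp add: eq_neg_iff_add_eq_0 add.commute)
        ultimately have "order z (u * p) = order z (pderiv p)"
          using nz p' by (metis add_0 mult_eq_0_iff order_mult order_uminus)
        moreover have "u * p \<noteq> 0" using eq nz p' by (metis mult_eq_0_iff neg_equal_0_iff_equal)
        ultimately show False using order_pderiv[OF assms(1) z] by (simp add: order_mult)
      qed
      then have "card {z. poly p z = 0} \<le> card {z. poly v z = 0}"
        by (intro card_mono poly_roots_finite nz) auto
      also have "\<dots> \<le> degree v" by (rule card_poly_roots_bound[OF nz])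
      also have "degree v < r" using v nz by (metis leading_coeff_0_iff linorder_not_less)
      finally show False using r by simp
    qed
    then show "u = 0 \<and> v = 0" using uv assms(1) by simp
  qed
qed

text \<open>\<open>F x \<noteq> 0\<close> is secured separately, by the coefficient that leads at
  \<open>x0\<close>, because \<open>no_relation_iff_card_roots\<close> is about nonzero
  polynomials.\<close>

lemma card_roots_open:
  assumes F: "polyfam G F" and "F x0 \<noteq> 0" "r \<le> card {z. poly (F x0) z = 0}"
  shows "\<exists>g\<in>generated_algebra G. g x0 \<noteq> 0 \<and>
    (\<forall>x. g x \<noteq> 0 \<longrightarrow> F x \<noteq> 0 \<and> r \<le> card {z. poly (F x) z = 0})"
proof -
  have open_nz: "\<exists>g\<in>generated_algebra G. g x0 \<noteq> 0 \<and> (\<forall>x. g x \<noteq> 0 \<longrightarrow> F x \<noteq> 0)"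
    using F assms(2) unfolding polyfam_def
    by (intro bexI[of _ "\<lambda>x. coeff (F x) (degree (F x0))"]) auto
  then obtain g1 where g1: "g1 \<in> generated_algebra G" "g1 x0 \<noteq> 0" "\<And>x. g1 x \<noteq> 0 \<Longrightarrow> F x \<noteq> 0" by blast
  show ?thesis
  proof (cases "r = 0")
    case True
    then show ?thesis using open_nz by auto
  next
    case False
    then have "no_relation (r - 1) r (F x0) (pderiv (F x0))"
      using no_relation_iff_card_roots[OF assms(2)] assms(3) by simp
    then obtain g where g: "g \<in> generated_algebra G" "g x0 \<noteq> 0"
      "\<And>x. g x \<noteq> 0 \<Longrightarrow> no_relation (r - 1) r (F x) (pderiv (F x))"
      using no_relation_open[OF F polyfam_pderiv[OF F]] by blast
    have "r \<le> card {z. poly (F x) z = 0}" if "g1 x * g x \<noteq> 0" for x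
      using no_relation_iff_card_roots[of "F x" r] that g(3)[of x] g1(3)[of x] False by simp
    then show ?thesis
      using g g1 by (intro bexI[of _ "\<lambda>x. g1 x * g x"]) (auto intro: ga_mult)
  qed
qed

section \<open>The Hilbert basis theorem\<close>

text \<open>The ascending chain condition in terms of sequences: some member lies in the ideal
  generated by its predecessors. In this form neither ideals nor carrier sets have to be
  formalized.\<close>

definition noetherian_type :: "'a::comm_ring_1 itself \<Rightarrow> bool" where
  "noetherian_type _ \<longleftrightarrow> (\<forall>a :: nat \<Rightarrow> 'a. \<exists>n c. a n = (\<Sum>i<n. c i * a i))"

lemma noetherian_field: "noetherian_type TYPE('a::field)"
  unfolding noetherian_type_def
proof (intro allI)
  fix a :: "nat \<Rightarrow> 'a"
  show "\<exists>n c. a n = (\<Sum>i<n. c i * a i)"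
  proof (cases "a 0 = 0")
    case True
    then show ?thesis by (intro exI[of _ 0]) simp
  next
    case False
    then show ?thesis by (intro exI[of _ 1] exI[of _ "\<lambda>i. a 1 / a 0"]) simp
  qed
qed

inductive_set ideal_hull :: "'a::comm_ring_1 set \<Rightarrow> 'a set" for S where
  zero: "0 \<in> ideal_hull S"
| step: "x \<in> ideal_hull S \<Longrightarrow> s \<in> S \<Longrightarrow> x + c * s \<in> ideal_hull S"

lemma ideal_hull_add: "y \<in> ideal_hull S \<Longrightarrow> x \<in> ideal_hull S \<Longrightarrow> x + y \<in> ideal_hull S"
proof (induction rule: ideal_hull.induct)
  case (step y s c)
  then have "(x + y) + c * s \<in> ideal_hull S" by (intro ideal_hull.step) auto
  then show ?case by (simp add: add.assoc)
qed simp

lemma ideal_hull_mult: "x \<in> ideal_hull S \<Longrightarrow> d * x \<in> ideal_hull S"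
proof (induction rule: ideal_hull.induct)
  case (step y s c)
  then have "d * y + (d * c) * s \<in> ideal_hull S" by (intro ideal_hull.step) auto
  then show ?case by (simp add: algebra_simps)
qed (simp add: ideal_hull.zero)

lemma ideal_hull_base: "s \<in> S \<Longrightarrow> s \<in> ideal_hull S"
  using ideal_hull.step[OF ideal_hull.zero, of s S 1] by simp

lemma ideal_hull_sum: "(\<And>i. i \<in> I \<Longrightarrow> f i \<in> ideal_hull S) \<Longrightarrow> (\<Sum>i\<in>I. f i) \<in> ideal_hull S"
  by (induction I rule: infinite_finite_induct) (auto intro: ideal_hull.zero ideal_hull_add)

lemma ideal_hull_hull: "T \<subseteq> ideal_hull S \<Longrightarrow> ideal_hull T \<subseteq> ideal_hull S"
proof
  fix x assume T: "T \<subseteq> ideal_hull S" and "x \<in> ideal_hull T"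
  from this(2) show "x \<in> ideal_hull S"
    using T by induction (auto intro: ideal_hull.zero intro!: ideal_hull_add ideal_hull_mult)
qed

lemma ideal_hull_mono: "T \<subseteq> S \<Longrightarrow> ideal_hull T \<subseteq> ideal_hull S"
  by (rule ideal_hull_hull) (auto intro: ideal_hull_base)

lemma ideal_hull_seq:
  fixes a :: "nat \<Rightarrow> 'a::comm_ring_1"
  shows "x \<in> ideal_hull (a ` {..<n}) \<longleftrightarrow> (\<exists>c. x = (\<Sum>i<n. c i * a i))"
proof
  assume "x \<in> ideal_hull (a ` {..<n})"
  then show "\<exists>c. x = (\<Sum>i<n. c i * a i)"
  proof induction
    case zero
    show ?case by (intro exI[of _ "\<lambda>_. 0"]) simp
  next
    case (step x s d)
    then obtain c j where c: "x = (\<Sum>i<n. c i * a i)" "s = a j" "j < n" by auto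
    have "(\<Sum>i<n. (if i = j then d else 0) * a i) = d * a j"
      using c(3) by (subst sum.remove[of _ j]) auto
    then have "x + d * s = (\<Sum>i<n. (c i + (if i = j then d else 0)) * a i)"
      using c by (simp add: distrib_right sum.distrib)
    then show ?case by (intro exI[of _ "\<lambda>i. c i + (if i = j then d else 0)"])
  qed
next
  assume "\<exists>c. x = (\<Sum>i<n. c i * a i)"
  then show "x \<in> ideal_hull (a ` {..<n})"
    by (auto intro!: ideal_hull_sum ideal_hull_mult intro: ideal_hull_base)
qed

text \<open>Choose g n of least degree in the ideal I outside the ideal of its predecessors. A
  relation between the leading coefficients of g 0, ..., g n yields an element h of the ideal of the
  predecessors with the same leading term as g n, and g n - h contradicts minimality.\<close>

lemma noetherian_poly:
  assumes "noetherian_type TYPE('a::idom)"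
  shows "noetherian_type TYPE('a poly)"
  unfolding noetherian_type_def
proof (intro allI, rule ccontr)
  fix f :: "nat \<Rightarrow> 'a poly"
  assume "\<nexists>n c. f n = (\<Sum>i<n. c i * f i)"
  then have bad: "f n \<notin> ideal_hull (f ` {..<n})" for n by (auto simp: ideal_hull_seq)
  define I where "I = ideal_hull (range f)"
  \<comment> \<open>A finite subset of I lies in the ideal of finitely many f i, and the next f n is
    outside that ideal by assumption.\<close>
  have proper: "\<exists>x. x \<in> I \<and> x \<notin> ideal_hull S" if "finite S" "S \<subseteq> I" for S
  proof -
    have "\<exists>n. S \<subseteq> ideal_hull (f ` {..<n})" using that
    proof (induction S)
      case (insert s S)
      have "\<exists>m. s \<in> ideal_hull (f ` {..<m})" if "s \<in> ideal_hull (range f)" using that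
      proof induction
        case (step x s c)
        then obtain m j where "x \<in> ideal_hull (f ` {..<m})" "s = f j" by auto
        then have "x + c * s \<in> ideal_hull (f ` {..<max m (Suc j)})"
          using ideal_hull_mono[OF image_mono[of "{..<m}" "{..<max m (Suc j)}" f]]
          by (intro ideal_hull.step) auto
        then show ?case by blast
      qed (auto intro: ideal_hull.zero)
      then obtain n m where "S \<subseteq> ideal_hull (f ` {..<n})" "s \<in> ideal_hull (f ` {..<m})"
        using insert I_def by auto
      then have "insert s S \<subseteq> ideal_hull (f ` {..<max m n})"
        using ideal_hull_mono[OF image_mono[of "{..<m}" "{..<max m n}" f]]
          ideal_hull_mono[OF image_mono[of "{..<n}" "{..<max m n}" f]]
        by auto
      then show ?case by blast
    qed auto
    then obtain n where "S \<subseteq> ideal_hull (f ` {..<n})" by blast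
    from ideal_hull_hull[OF this] have "f n \<notin> ideal_hull S" using bad[of n] by auto
    moreover have "f n \<in> I" unfolding I_def by (rule ideal_hull_base) simp
    ultimately show ?thesis by blast
  qed
  define next' where "next' S = (ARG_MIN degree x. x \<in> I \<and> x \<notin> ideal_hull S)" for S
  have next': "next' S \<in> I" "next' S \<notin> ideal_hull S"
    "\<And>x. x \<in> I \<Longrightarrow> x \<notin> ideal_hull S \<Longrightarrow> degree (next' S) \<le> degree x" if "finite S" "S \<subseteq> I" for S
    using arg_min_nat_lemma[of "\<lambda>x. x \<in> I \<and> x \<notin> ideal_hull S" _ degree] proper[OF that]
    unfolding next'_def by blast+
  define T where "T = rec_nat {} (\<lambda>_ S. insert (next' S) S)"
  define g where "g n = next' (T n)" for n
  have T: "finite (T n) \<and> T n \<subseteq> I" for n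
    by (induction n) (auto simp: T_def next'(1))
  have Tg: "T n = g ` {..<n}" for n
    by (induction n) (auto simp: T_def g_def lessThan_Suc)
  have mono: "degree (g i) \<le> degree (g j)" if "i \<le> j" for i j
  proof -
    have "ideal_hull (T i) \<subseteq> ideal_hull (T j)" unfolding Tg using that by (intro ideal_hull_mono) auto
    then show ?thesis
      unfolding g_def using next'[of "T i"] next'[of "T j"] T by (metis subsetD)
  qed
  obtain n c where nc: "lead_coeff (g n) = (\<Sum>i<n. c i * lead_coeff (g i))"
    using assms unfolding noetherian_type_def by (elim allE[of _ "\<lambda>n. lead_coeff (g n)"]) auto
  \<comment> \<open>The powers of the variable lift every g i to the degree of g n, which is
    possible because the chosen degrees are monotone.\<close>
  define h where "h = (\<Sum>i<n. monom (c i) (degree (g n) - degree (g i)) * g i)"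
  have h: "h \<in> ideal_hull (T n)"
    unfolding h_def Tg by (intro ideal_hull_sum ideal_hull_mult ideal_hull_base) auto
  have hdeg: "degree h \<le> degree (g n)"
    unfolding h_def
  proof (intro degree_sum_le)
    fix i assume "i \<in> {..<n}"
    have "degree (monom (c i) (degree (g n) - degree (g i)) * g i) \<le> (degree (g n) - degree (g i)) + degree (g i)"
      by (rule order_trans[OF degree_mult_le]) (simp add: degree_monom_le)
    then show "degree (monom (c i) (degree (g n) - degree (g i)) * g i) \<le> degree (g n)"
      using mono[of i n] \<open>i \<in> {..<n}\<close> by simp
  qed simp
  have hlead: "coeff h (degree (g n)) = lead_coeff (g n)"
  proof -
    have "coeff (monom (c i) (degree (g n) - degree (g i)) * g i) (degree (g n)) = c i * lead_coeff (g i)"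
      if "i < n" for i
      using mono[of i n] that by (simp add: coeff_monom_mult)
    then show ?thesis unfolding h_def coeff_sum nc by simp
  qed
  note nT = T[of n, THEN conjunct1] T[of n, THEN conjunct2]
  have gn: "g n \<notin> ideal_hull (T n)" "g n \<in> I" unfolding g_def by (rule next'(2)[OF nT], rule next'(1)[OF nT])
  have hI: "h \<in> I" using h ideal_hull_hull[of "T n" "range f"] T unfolding I_def by blast
  have "g n - h \<notin> ideal_hull (T n)" using gn(1) h ideal_hull_add[of h "T n" "g n - h"] by auto
  moreover have "g n - h \<in> I"
    using gn(2) hI ideal_hull_mult[of h "range f" "-1"] ideal_hull_add[of "- h" "range f" "g n"] unfolding I_def by simp
  ultimately have le: "degree (g n) \<le> degree (g n - h)" unfolding g_def by (rule next'(3)[OF nT, rotated])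
  have "g n - h \<noteq> 0" using \<open>g n - h \<notin> ideal_hull (T n)\<close> ideal_hull.zero[of "T n"] by auto
  moreover have "coeff (g n - h) (degree (g n - h)) = 0"
  proof (cases "degree (g n - h) = degree (g n)")
    case True
    then show ?thesis using hlead by simp
  next
    case False
    then have "degree (g n) < degree (g n - h)" using le by simp
    then show ?thesis using hdeg by (simp add: coeff_eq_0)
  qed
  ultimately show False using leading_coeff_0_iff by blast
qed

text \<open>Presents polynomial functions as images of iterated univariate polynomials, to which
  \<open>noetherian_poly\<close> applies four times. The variables are evaluated from the innermost
  role to the outermost one, with nested constants as arguments.\<close>

lemma poly_funs_4_represent:
  assumes "f \<in> (poly_funs :: (complex ^ 4 \<Rightarrow> complex) set)"
  shows "\<exists>p :: complex poly poly poly poly.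
    \<forall>x. f x = poly (poly (poly (poly p [:[:[:x $ 1:]:]:]) [:[:x $ 2:]:]) [:x $ 3:]) (x $ 4)"
  using assms unfolding poly_funs_def
proof induction
  case (gen g)
  then obtain i where i: "g = (\<lambda>x. x $ i)" by blast
  have "i = 1 \<or> i = 2 \<or> i = 3 \<or> i = 4" by (rule exhaust_4)
  then show ?case
  proof (elim disjE)
    assume "i = 1"
    then show ?thesis unfolding i by (intro exI[of _ "[:0, 1:]"]) simp
  next
    assume "i = 2"
    then show ?thesis unfolding i by (intro exI[of _ "[:[:0, 1:]:]"]) simp
  next
    assume "i = 3"
    then show ?thesis unfolding i by (intro exI[of _ "[:[:[:0, 1:]:]:]"]) simp
  next
    assume "i = 4"
    then show ?thesis unfolding i by (intro exI[of _ "[:[:[:[:0, 1:]:]:]:]"]) simp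
  qed
next
  case (const c)
  show ?case by (intro exI[of _ "[:[:[:[:c:]:]:]:]"]) simp
next
  case (add f g)
  then obtain p q where "\<forall>x. f x = poly (poly (poly (poly p [:[:[:x $ 1:]:]:]) [:[:x $ 2:]:]) [:x $ 3:]) (x $ 4)"
    "\<forall>x. g x = poly (poly (poly (poly q [:[:[:x $ 1:]:]:]) [:[:x $ 2:]:]) [:x $ 3:]) (x $ 4)" by blast
  then show ?case by (intro exI[of _ "p + q"]) simp
next
  case (mult f g)
  then obtain p q where "\<forall>x. f x = poly (poly (poly (poly p [:[:[:x $ 1:]:]:]) [:[:x $ 2:]:]) [:x $ 3:]) (x $ 4)"
    "\<forall>x. g x = poly (poly (poly (poly q [:[:[:x $ 1:]:]:]) [:[:x $ 2:]:]) [:x $ 3:]) (x $ 4)" by blast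
  then show ?case by (intro exI[of _ "p * q"]) simp
qed

text \<open>A member of the ideal generated by its predecessors vanishes wherever they do. This
  consequence for zero sets is the form used in \<open>exists_minimal_closed\<close>.\<close>

lemma poly_funs_noetherian:
  fixes f :: "nat \<Rightarrow> complex ^ 4 \<Rightarrow> complex"
  assumes "\<And>n. f n \<in> (poly_funs :: (complex ^ 4 \<Rightarrow> complex) set)"
  shows "\<exists>n. \<forall>x. (\<forall>i<n. f i x = 0) \<longrightarrow> f n x = 0"
proof -
  obtain p :: "nat \<Rightarrow> complex poly poly poly poly" where p:
    "\<And>n x. f n x = poly (poly (poly (poly (p n) [:[:[:x $ 1:]:]:]) [:[:x $ 2:]:]) [:x $ 3:]) (x $ 4)"
    using poly_funs_4_represent[OF assms] by metis
  have "noetherian_type TYPE(complex poly poly poly poly)"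
    by (intro noetherian_poly noetherian_field)
  then obtain n c where "p n = (\<Sum>i<n. c i * p i)"
    unfolding noetherian_type_def by blast
  then have "\<forall>x. (\<forall>i<n. f i x = 0) \<longrightarrow> f n x = 0"
    unfolding p by (simp add: poly_sum)
  then show ?thesis by blast
qed

section \<open>Projective sets and cones\<close>

lemma span_eq_iff:
  fixes x y :: "complex ^ 'n"
  assumes "x \<noteq> 0" "y \<noteq> 0"
  shows "vec.span {x} = vec.span {y} \<longleftrightarrow> (\<exists>c. c \<noteq> 0 \<and> x = c *s y)"
proof
  assume "vec.span {x} = vec.span {y}"
  then have "x \<in> vec.span {y}" using vec.span_base by blast
  then obtain c where "x = c *s y" by (auto simp: vec.span_singleton)
  then show "\<exists>c. c \<noteq> 0 \<and> x = c *s y" using assms by auto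
next
  assume "\<exists>c. c \<noteq> 0 \<and> x = c *s y"
  then obtain c where c: "c \<noteq> 0" "x = c *s y" by blast
  have "x \<in> vec.span {y}" using c by (auto simp: vec.span_singleton)
  moreover have "y = (1 / c) *s x" using c by simp
  then have "y \<in> vec.span {x}" unfolding vec.span_singleton by blast
  ultimately show "vec.span {x} = vec.span {y}"
    by (intro subset_antisym vec.span_minimal) (auto simp: vec.subspace_span)
qed

definition cone_closed :: "(complex ^ 'n) set \<Rightarrow> bool" where
  "cone_closed A \<longleftrightarrow> 0 \<in> A \<and> (\<forall>c. \<forall>x\<in>A. c *s x \<in> A)"

lemma cone_closedD: "cone_closed A \<Longrightarrow> x \<in> A \<Longrightarrow> c *s x \<in> A"
  by (simp add: cone_closed_def)

lemma cone_closed_zero: "cone_closed A \<Longrightarrow> 0 \<in> A"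
  by (simp add: cone_closed_def)

lemma projectivize_cone_iff:
  assumes "cone_closed A" "x \<noteq> 0"
  shows "vec.span {x} \<in> projectivize A \<longleftrightarrow> x \<in> A"
proof
  assume "vec.span {x} \<in> projectivize A"
  then obtain y where "vec.span {x} = vec.span {y}" "y \<noteq> 0" "y \<in> A" by (elim projectivizeE)
  then show "x \<in> A" using span_eq_iff[OF assms(2)] cone_closedD[OF assms(1)] by metis
qed (simp add: projectivizeI assms)

lemma projectivize_subset_iff:
  assumes "cone_closed A" "cone_closed B"
  shows "projectivize A \<subseteq> projectivize B \<longleftrightarrow> A \<subseteq> B"
proof
  assume sub: "projectivize A \<subseteq> projectivize B"
  show "A \<subseteq> B"
  proof
    fix x assume "x \<in> A"
    show "x \<in> B"
    proof (cases "x = 0")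
      case True
      then show ?thesis using cone_closed_zero[OF assms(2)] by simp
    next
      case False
      then show ?thesis using sub projectivizeI[OF \<open>x \<in> A\<close> False] projectivize_cone_iff[OF assms(2)] by blast
    qed
  qed
qed (rule projectivize_mono)

lemma cone_projectivize:
  assumes "cone_closed A" shows "cone (projectivize A) = A"
proof
  show "cone (projectivize A) \<subseteq> A"
    unfolding cone_def projectivize_def
    using assms by (auto simp: cone_closed_def vec.span_singleton)
  show "A \<subseteq> cone (projectivize A)"
  proof
    fix x assume "x \<in> A"
    show "x \<in> cone (projectivize A)"
    proof (cases "x = 0")
      case False
      then have "x \<in> vec.span {x}" "vec.span {x} \<in> projectivize A"
        using \<open>x \<in> A\<close> by (auto intro: projectivizeI vec.span_base)
      then show ?thesis unfolding cone_def by blast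
    qed (simp add: cone_def)
  qed
qed

lemma cone_closed_cone:
  assumes "X \<subseteq> projectivize UNIV" shows "cone_closed (cone X)"
proof -
  have "c *s x \<in> l" if "x \<in> l" "l \<in> X" for x l c
  proof -
    have "l \<in> projectivize UNIV" using assms that(2) by blast
    then obtain y where "l = vec.span {y}" by (rule projectivizeE)
    then show ?thesis using that by (simp add: vec.span_scale)
  qed
  then show ?thesis unfolding cone_closed_def cone_def by auto
qed

lemma projectivize_cone:
  assumes "X \<subseteq> projectivize UNIV" shows "projectivize (cone X) = X"
proof
  show "X \<subseteq> projectivize (cone X)"
  proof
    fix l assume l: "l \<in> X"
    then obtain x where x: "l = vec.span {x}" "x \<noteq> 0" using assms by (blast elim: projectivizeE)
    then have "x \<in> cone X" unfolding cone_def using l vec.span_base by blast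
    then show "l \<in> projectivize (cone X)" unfolding x(1) by (rule projectivizeI) (rule x(2))
  qed
  show "projectivize (cone X) \<subseteq> X"
  proof
    fix l assume "l \<in> projectivize (cone X)"
    then obtain x where x: "l = vec.span {x}" "x \<noteq> 0" "x \<in> cone X" by (rule projectivizeE)
    then obtain l' where l': "l' \<in> X" "x \<in> l'" unfolding cone_def by blast
    then obtain y where y: "l' = vec.span {y}" "y \<noteq> 0" using assms by (blast elim: projectivizeE)
    then obtain c where "x = c *s y" using l' by (auto simp: vec.span_singleton)
    then have "vec.span {x} = vec.span {y}" using span_eq_iff[OF x(2) y(2)] x(2) by auto
    then show "l \<in> X" using l' y x by simp
  qed
qed

lemma closed_topspace: "closedin proj_zariski X \<Longrightarrow> X \<subseteq> projectivize UNIV"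
  using closedin_subset topspace_proj_zariski by blast

text \<open>The topology is defined by homogeneous functions, but closedness may be tested with
  arbitrary polynomial functions: on a cone the homogeneous components of a vanishing function
  vanish as well.\<close>

lemma closedin_proj_iff:
  assumes A: "cone_closed A"
  shows "closedin proj_zariski (projectivize A) \<longleftrightarrow>
    (\<forall>y. y \<notin> A \<longrightarrow> (\<exists>f\<in>poly_funs. (\<forall>x\<in>A. f x = 0) \<and> f y \<noteq> 0))" (is "?L \<longleftrightarrow> ?R")
proof
  assume ?L
  then obtain S where S: "S \<subseteq> hom_poly_funs" "projectivize A = projectivize {x. \<forall>f\<in>S. f x = 0}"
    unfolding closedin_proj_zariski by (elim exE conjE)
  show ?R
  proof (intro allI impI)
    fix y assume y: "y \<notin> A"
    then have y0: "y \<noteq> 0" using cone_closed_zero[OF A] by auto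
    have "\<exists>f\<in>S. f y \<noteq> 0"
    proof (rule ccontr)
      assume "\<not> ?thesis"
      then have "y \<in> {x. \<forall>f\<in>S. f x = 0}" by simp
      from projectivizeI[OF this y0] have "vec.span {y} \<in> projectivize A" unfolding S(2) .
      then show False using projectivize_cone_iff[OF A y0] y by simp
    qed
    then obtain f where f: "f \<in> S" "f y \<noteq> 0" by blast
    have fh: "f \<in> hom_poly_funs" using S(1) f(1) by blast
    then obtain d where d: "hom_deg d f" unfolding hom_poly_funs_iff by blast
    consider "d = 0" | "d > 0" by blast
    then show "\<exists>f\<in>poly_funs. (\<forall>x\<in>A. f x = 0) \<and> f y \<noteq> 0"
    proof cases
      case 1
      \<comment> \<open>A form of degree 0 is a constant, here a nonzero one. Then A consists of 0
        alone and a coordinate of y separates.\<close>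
      have const: "f x = f 0" for x using hom_deg_scale[OF d, of 0 x] 1 by simp
      have "x = 0" if "x \<in> A" for x
      proof (rule ccontr)
        assume "x \<noteq> 0"
        from projectivizeI[OF that this] obtain z where "f z = 0" unfolding S(2) using f(1)
          by (elim projectivizeE) auto
        then show False using f(2) const by metis
      qed
      moreover obtain i where "y $ i \<noteq> 0" using y0 by (metis vec_eq_iff zero_index)
      ultimately show ?thesis by (intro bexI[OF _ pf_coord[of i]]) (metis zero_index)
    next
      case 2
      have "f x = 0" if "x \<in> A" for x
      proof (cases "x = 0")
        case True
        then show ?thesis using hom_deg_scale[OF d, of 0 0] 2 by (simp add: power_0_left)
      next
        case False
        from projectivizeI[OF that False] obtain z where z: "vec.span {x} = vec.span {z}" "z \<noteq> 0" "f z = 0"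
          unfolding S(2) using f(1) by (elim projectivizeE) auto
        show ?thesis using hom_poly_funs_span_eq[OF fh z(1) _ False] z(3) by blast
      qed
      then show ?thesis using hom_deg_pf[OF d] f(2) by blast
    qed
  qed
next
  assume R: ?R
  define S where "S = {f \<in> hom_poly_funs. \<forall>x\<in>A. f x = 0}"
  have "A = {x. \<forall>f\<in>S. f x = 0}"
  proof (intro equalityI subsetI)
    fix y assume "y \<in> {x. \<forall>f\<in>S. f x = 0}"
    then show "y \<in> A"
    proof (rule contrapos_pp)
      assume "y \<notin> A"
      then obtain f where f: "f \<in> poly_funs" "\<forall>x\<in>A. f x = 0" "f y \<noteq> 0" using R by blast
      then obtain d g where "hom_deg d g" "\<forall>x\<in>A. g x = 0" "g y \<noteq> 0"
        using homogeneous_component_vanishes[of f A y] cone_closedD[OF A] by blast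
      then have "g \<in> S" "g y \<noteq> 0" unfolding S_def hom_poly_funs_iff by auto
      then show "y \<notin> {x. \<forall>f\<in>S. f x = 0}" by auto
    qed
  qed (simp add: S_def)
  then show ?L unfolding closedin_proj_zariski by (intro exI[of _ S]) (auto simp: S_def)
qed

lemma closed_cone_separate:
  assumes "closedin proj_zariski X" "y \<notin> cone X"
  shows "\<exists>d f. hom_deg d f \<and> (\<forall>x\<in>cone X. f x = 0) \<and> f y \<noteq> 0"
proof -
  note top = closed_topspace[OF assms(1)]
  obtain f where f: "f \<in> poly_funs" "\<forall>x\<in>cone X. f x = 0" "f y \<noteq> 0"
    using closedin_proj_iff[OF cone_closed_cone[OF top]] assms unfolding projectivize_cone[OF top] by blast
  then show ?thesis
    using homogeneous_component_vanishes[of f "cone X" y] cone_closedD[OF cone_closed_cone[OF top]] by blast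
qed

lemma closed_zero_locus:
  assumes "hom_deg d f" "d > 0"
  shows "cone_closed {x. f x = 0}" "closedin proj_zariski (projectivize {x. f x = 0})"
proof -
  have "f 0 = 0" using hom_deg_scale[OF assms(1), of 0 0] assms(2) by (simp add: power_0_left)
  then show c: "cone_closed {x. f x = 0}"
    by (auto simp: cone_closed_def hom_deg_scale[OF assms(1)])
  show "closedin proj_zariski (projectivize {x. f x = 0})"
    unfolding closedin_proj_iff[OF c] using hom_deg_pf[OF assms(1)] by auto
qed

lemma projectivize_Int:
  assumes "cone_closed A" "cone_closed B"
  shows "projectivize (A \<inter> B) = projectivize A \<inter> projectivize B"
proof (intro equalityI subsetI)
  fix l assume l: "l \<in> projectivize A \<inter> projectivize B"
  then obtain x where x: "l = vec.span {x}" "x \<noteq> 0" "x \<in> A" by (blast elim: projectivizeE)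
  then have "x \<in> B" using l projectivize_cone_iff[OF assms(2) x(2)] by simp
  then show "l \<in> projectivize (A \<inter> B)" unfolding x(1) by (intro projectivizeI) (use x in auto)
qed (auto dest: subsetD[OF projectivize_mono, rotated])

lemma projectivize_Un: "projectivize (A \<union> B) = projectivize A \<union> projectivize B"
  unfolding projectivize_def by blast

text \<open>Irreducibility as primality of the homogeneous vanishing ideal; two closed sets that
  fail to contain A give one separating form each.\<close>

lemma irreducible_iff:
  assumes A: "cone_closed A" "A \<noteq> {0}"
  shows "irreducible_in proj_zariski (projectivize A) \<longleftrightarrow>
    (\<forall>d e f g. hom_deg d f \<longrightarrow> hom_deg e g \<longrightarrow> (\<forall>x\<in>A. f x * g x = 0) \<longrightarrow>
      (\<forall>x\<in>A. f x = 0) \<or> (\<forall>x\<in>A. g x = 0))" (is "?L \<longleftrightarrow> ?R")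
proof
  assume L: ?L
  show ?R
  proof (intro allI impI, rule ccontr)
    fix d e f g assume f: "hom_deg d f" and g: "hom_deg e g" and fg: "\<forall>x\<in>A. f x * g x = 0"
      and neg: "\<not> ((\<forall>x\<in>A. f x = 0) \<or> (\<forall>x\<in>A. g x = 0))"
    \<comment> \<open>\<open>closed_zero_locus\<close> is about positive degree. Each of f and g
      vanishes at one of the two points and not at the other, so neither is constant.\<close>
    have pos: "k > 0" if h: "hom_deg k h" and "h y = 0" "h z \<noteq> 0" for k h y z
    proof (rule ccontr)
      assume "\<not> k > 0"
      then have "h x = h 0" for x using hom_deg_scale[OF h, of 0 x] by simp
      then show False using that by metis
    qed
    obtain x y where xy: "x \<in> A" "f x \<noteq> 0" "y \<in> A" "g y \<noteq> 0" using neg by blast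
    have pos: "d > 0" "e > 0" using pos[OF f _ xy(2), of y] pos[OF g _ xy(4), of x] fg xy by auto
    have "projectivize A \<subseteq> projectivize {x. f x = 0} \<union> projectivize {x. g x = 0}"
      unfolding projectivize_Un[symmetric] using fg by (intro projectivize_mono) auto
    with closed_zero_locus(2)[OF f pos(1)] closed_zero_locus(2)[OF g pos(2)]
    have "projectivize A \<subseteq> projectivize {x. f x = 0} \<or> projectivize A \<subseteq> projectivize {x. g x = 0}"
      using L[unfolded irreducible_in_def, THEN conjunct2, THEN conjunct2, rule_format] by metis
    then show False
      unfolding projectivize_subset_iff[OF A(1) closed_zero_locus(1)[OF f pos(1)]]
        projectivize_subset_iff[OF A(1) closed_zero_locus(1)[OF g pos(2)]] using xy by auto
  qed
next
  assume R: ?R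
  show ?L
    unfolding irreducible_in_def topspace_proj_zariski
  proof (intro conjI allI impI)
    show "projectivize A \<subseteq> projectivize UNIV" by (rule projectivize_mono) simp
    obtain x where "x \<in> A" "x \<noteq> 0" using A cone_closed_zero by blast
    then show "projectivize A \<noteq> {}" using projectivizeI by blast
    fix B C :: "(complex ^ 'a) set set"
    assume BC: "closedin proj_zariski B \<and> closedin proj_zariski C \<and> projectivize A \<subseteq> B \<union> C"
    then have top: "B \<subseteq> projectivize UNIV" "C \<subseteq> projectivize UNIV" using closed_topspace by auto
    note pc = projectivize_cone[OF top(1)] projectivize_cone[OF top(2)]
    show "projectivize A \<subseteq> B \<or> projectivize A \<subseteq> C"
    proof (rule ccontr)
      assume "\<not> ?thesis"
      then have "\<not> A \<subseteq> cone B" "\<not> A \<subseteq> cone C"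
        using projectivize_mono[of A "cone B"] projectivize_mono[of A "cone C"] pc by auto
      then obtain y z where yz: "y \<in> A" "y \<notin> cone B" "z \<in> A" "z \<notin> cone C" by blast
      obtain d f where f: "hom_deg d f" "\<forall>x\<in>cone B. f x = 0" "f y \<noteq> 0"
        using closed_cone_separate[of B y] BC yz by blast
      obtain e g where g: "hom_deg e g" "\<forall>x\<in>cone C. g x = 0" "g z \<noteq> 0"
        using closed_cone_separate[of C z] BC yz by blast
      have "f x * g x = 0" if "x \<in> A" for x
      proof (cases "x = 0")
        case True
        then show ?thesis using f(2) by (simp add: cone_def)
      next
        case False
        then have "vec.span {x} \<in> B \<union> C" using BC projectivizeI[OF that] by blast
        then have "x \<in> cone B \<or> x \<in> cone C" unfolding cone_def using vec.span_base[of x "{x}"] by auto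
        then show ?thesis using f g by auto
      qed
      then show False using R f(1,3) g(1,3) yz by blast
    qed
  qed
qed

section \<open>Dimension\<close>

text \<open>In an infinite strictly descending chain V each step provides an f i that vanishes on V
  (i + 1) but not at some point of V i, which contradicts
  \<open>poly_funs_noetherian\<close>.\<close>

lemma exists_minimal_closed:
  fixes X :: "(complex ^ 4) set set"
  assumes "closedin proj_zariski X" "Q X"
  shows "\<exists>W. W \<subseteq> X \<and> closedin proj_zariski W \<and> Q W \<and>
    (\<forall>V. closedin proj_zariski V \<longrightarrow> Q V \<longrightarrow> V \<subseteq> W \<longrightarrow> V = W)"
proof -
  define r where "r = {(V, W :: (complex ^ 4) set set). closedin proj_zariski V \<and> closedin proj_zariski W \<and> V \<subset> W}"
  have wf: "wf r"
    unfolding wf_iff_no_infinite_down_chain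
  proof
    assume "\<exists>f. \<forall>i. (f (Suc i), f i) \<in> r"
    then obtain V where "\<forall>i. (V (Suc i), V i) \<in> r" by blast
    then have V: "\<And>i. closedin proj_zariski (V i)" "\<And>i. V (Suc i) \<subset> V i"
      unfolding r_def by auto
    note top = closed_topspace[OF V(1)]
    have mono: "cone (V j) \<subseteq> cone (V i)" if "i \<le> j" for i j
      using lift_Suc_antimono_le[of V, OF _ that] V(2) unfolding cone_def by blast
    have "\<exists>x f. f \<in> poly_funs \<and> x \<in> cone (V i) \<and> f x \<noteq> 0 \<and> (\<forall>z\<in>cone (V (Suc i)). f z = 0)" for i
    proof -
      have "\<not> cone (V i) \<subseteq> cone (V (Suc i))"
        using V(2)[of i] projectivize_mono[of "cone (V i)" "cone (V (Suc i))"] projectivize_cone[OF top] by auto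
      then obtain x where "x \<in> cone (V i)" "x \<notin> cone (V (Suc i))" by blast
      then show ?thesis using closed_cone_separate[OF V(1)[of "Suc i"]] hom_deg_pf by blast
    qed
    then obtain x f where xf: "\<And>i. f i \<in> poly_funs" "\<And>i. x i \<in> cone (V i)" "\<And>i. f i (x i) \<noteq> 0"
      "\<And>i z. z \<in> cone (V (Suc i)) \<Longrightarrow> f i z = 0" by metis
    obtain n where "\<forall>z. (\<forall>i<n. f i z = 0) \<longrightarrow> f n z = 0" using poly_funs_noetherian[of f] xf(1) by blast
    moreover have "f i (x n) = 0" if "i < n" for i
      using xf(2)[of n] mono[of "Suc i" n] that xf(4)[of "x n" i] by auto
    ultimately show False using xf(3) by blast
  qed
  have "X \<in> {W. W \<subseteq> X \<and> closedin proj_zariski W \<and> Q W}" using assms by simp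
  from wf[unfolded wf_eq_minimal, rule_format, OF this]
  have "\<exists>W\<in>{W. W \<subseteq> X \<and> closedin proj_zariski W \<and> Q W}.
      \<forall>V. (V, W) \<in> r \<longrightarrow> V \<notin> {W. W \<subseteq> X \<and> closedin proj_zariski W \<and> Q W}"
    .
  then obtain W where W: "W \<subseteq> X" "closedin proj_zariski W" "Q W"
    "\<And>V. (V, W) \<in> r \<Longrightarrow> V \<notin> {W. W \<subseteq> X \<and> closedin proj_zariski W \<and> Q W}" by blast
  have "V = W" if "closedin proj_zariski V" "Q V" "V \<subseteq> W" for V
    using W that unfolding r_def by auto
  then show ?thesis using W(1-3) by blast
qed

lemma cone_closed_subspace: "vec.subspace A \<Longrightarrow> cone_closed A"
  by (simp add: cone_closed_def vec.subspace_def)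

lemma projectivize_span_singleton:
  assumes "x \<noteq> 0" shows "projectivize (vec.span {x}) = {vec.span {x}}"
proof (intro equalityI subsetI)
  fix l assume "l \<in> projectivize (vec.span {x})"
  then obtain y where y: "l = vec.span {y}" "y \<noteq> 0" "y \<in> vec.span {x}" by (rule projectivizeE)
  then obtain c where "y = c *s x" by (auto simp: vec.span_singleton)
  then show "l \<in> {vec.span {x}}" using y span_eq_iff[OF y(2) assms] by auto
next
  fix l assume "l \<in> {vec.span {x}}"
  moreover have "vec.span {x} \<in> projectivize (vec.span {x})"
    by (intro projectivizeI assms vec.span_base) simp
  ultimately show "l \<in> projectivize (vec.span {x})" by simp
qed

lemma point_closed:
  assumes "x \<noteq> 0" shows "closedin proj_zariski {vec.span {x}}"
proof -
  have "\<exists>f\<in>poly_funs. (\<forall>z\<in>vec.span {x}. f z = 0) \<and> f y \<noteq> 0" if "y \<notin> vec.span {x}" for y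
  proof -
    obtain i where i: "x $ i \<noteq> 0" using assms by (metis vec_eq_iff zero_index)
    have "\<exists>j. x $ i * y $ j - x $ j * y $ i \<noteq> 0"
    proof (rule ccontr)
      assume "\<not> ?thesis"
      then have "y = (y $ i / x $ i) *s x" using i by (auto simp: vec_eq_iff field_simps)
      then show False using that unfolding vec.span_singleton by blast
    qed
    then obtain j where "x $ i * y $ j - x $ j * y $ i \<noteq> 0" by blast
    then show ?thesis
      by (intro bexI[of _ "\<lambda>z. x $ i * z $ j - x $ j * z $ i"] pf_diff pf_mult pf_const pf_coord)
        (auto simp: vec.span_singleton)
  qed
  then show ?thesis
    using closedin_proj_iff[OF cone_closed_subspace[OF vec.subspace_span[of "{x}"]]]
    by (simp add: projectivize_span_singleton[OF assms])
qed

text \<open>Pull f g back along a polynomial curve from a point where f is nonzero to a point where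
  g is nonzero: univariate polynomials have no zero divisors.\<close>

lemma irreducible_if_curve_connected:
  assumes A: "cone_closed A" "A \<noteq> {0}"
    and conn: "\<And>x y. x \<in> A \<Longrightarrow> y \<in> A \<Longrightarrow>
      \<exists>V. (\<forall>i. \<exists>p. \<forall>\<tau>. V \<tau> $ i = poly p \<tau>) \<and> (\<forall>\<tau>. V \<tau> \<in> A) \<and> V 0 = x \<and> V 1 = y"
  shows "irreducible_in proj_zariski (projectivize A)"
  unfolding irreducible_iff[OF A]
proof (intro allI impI, rule ccontr)
  fix d e f g assume fg: "hom_deg d f" "hom_deg e g" "\<forall>x\<in>A. f x * g x = 0"
    "\<not> ((\<forall>x\<in>A. f x = 0) \<or> (\<forall>x\<in>A. g x = 0))"
  then obtain x y where xy: "x \<in> A" "f x \<noteq> 0" "y \<in> A" "g y \<noteq> 0" by blast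
  from conn[OF xy(1,3)] obtain V where V: "\<forall>i. \<exists>p. \<forall>\<tau>. V \<tau> $ i = poly p \<tau>" "\<forall>\<tau>. V \<tau> \<in> A" "V 0 = x" "V 1 = y"
    by (elim exE conjE)
  have V1: "\<And>i. \<exists>p. \<forall>\<tau>. V \<tau> $ i = poly p \<tau>" using V(1) by blast
  obtain p where p: "\<forall>\<tau>. f (V \<tau>) = poly p \<tau>" using poly_fun_on_curve[OF hom_deg_pf[OF fg(1)] V1] by blast
  obtain q where q: "\<forall>\<tau>. g (V \<tau>) = poly q \<tau>" using poly_fun_on_curve[OF hom_deg_pf[OF fg(2)] V1] by blast
  have "poly (p * q) \<tau> = 0" for \<tau> using fg(3) V(2) p q by (metis poly_mult)
  then have "p * q = 0" using poly_all_0_iff_0 by blast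
  then show False using p q xy V(3,4) by (metis mult_eq_0_iff poly_0)
qed

lemma subspace_irreducible:
  assumes "vec.subspace A" "A \<noteq> {0}" shows "irreducible_in proj_zariski (projectivize A)"
proof (rule irreducible_if_curve_connected)
  fix x y assume "x \<in> A" "y \<in> A"
  then have "x + \<tau> *s (y - x) \<in> A" for \<tau>
    using assms(1) by (intro vec.subspace_add vec.subspace_scale vec.subspace_diff)
  moreover have "\<exists>p. \<forall>\<tau>. (x + \<tau> *s (y - x)) $ i = poly p \<tau>" for i
    by (intro exI[of _ "[:x $ i, y $ i - x $ i:]"]) (simp add: algebra_simps)
  ultimately show "\<exists>V. (\<forall>i. \<exists>p. \<forall>\<tau>. V \<tau> $ i = poly p \<tau>) \<and> (\<forall>\<tau>. V \<tau> \<in> A) \<and> V 0 = x \<and> V 1 = y"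
    by (intro exI[of _ "\<lambda>\<tau>. x + \<tau> *s (y - x)"]) auto
qed (use assms in \<open>auto intro: cone_closed_subspace\<close>)

lemma point_irreducible:
  assumes "x \<noteq> 0" shows "irreducible_in proj_zariski {vec.span {x}}"
proof -
  have "vec.span {x} \<noteq> {0}" using assms vec.span_base[of x "{x}"] by auto
  then show ?thesis
    using subspace_irreducible[OF vec.subspace_span[of "{x}"]] by (simp add: projectivize_span_singleton[OF assms])
qed

lemma krull_dim_ge:
  assumes "\<And>i. i \<le> n \<Longrightarrow> closedin T (Z i) \<and> irreducible_in T (Z i) \<and> Z i \<subseteq> A"
    and "\<And>i. i < n \<Longrightarrow> Z i \<subset> Z (Suc i)"
  shows "enat n \<le> krull_dim T A"
  unfolding krull_dim_def by (intro SUP_upper) (use assms in auto)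

lemma chain_of_three:
  assumes "closedin T U" "irreducible_in T U" "closedin T V" "irreducible_in T V"
    "closedin T W" "irreducible_in T W" "U \<subset> V" "V \<subset> W" "W \<subseteq> A"
  shows "2 \<le> krull_dim T A"
proof -
  have "enat 2 \<le> krull_dim T A"
  proof (rule krull_dim_ge[where Z = "\<lambda>i. if i = 0 then U else if i = 1 then V else W"])
    fix i :: nat assume "i < 2"
    then have "i = 0 \<or> i = 1" by auto
    then show "(if i = 0 then U else if i = 1 then V else W) \<subset>
        (if Suc i = 0 then U else if Suc i = 1 then V else W)" using assms by auto
  qed (use assms in auto)
  then show ?thesis by (simp add: numeral_eq_enat)
qed

text \<open>A minimal infinite closed subset W of Y is irreducible, since of two closed pieces
  covering it one is infinite. A point, W and C would then be a chain of length 2 in a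
  curve.\<close>

lemma curve_proper_closed_finite:
  fixes C :: "(complex ^ 4) set set"
  assumes C: "irreducible_curve C" and Y: "closedin proj_zariski Y" "Y \<subset> C"
  shows "finite Y"
proof (rule ccontr)
  assume "infinite Y"
  then obtain W where W: "W \<subseteq> Y" "closedin proj_zariski W" "infinite W"
    "\<And>V. closedin proj_zariski V \<Longrightarrow> infinite V \<Longrightarrow> V \<subseteq> W \<Longrightarrow> V = W"
    using exists_minimal_closed[of Y infinite] Y(1) by blast
  have irr: "irreducible_in proj_zariski W"
    unfolding irreducible_in_def
  proof (intro conjI allI impI)
    show "W \<subseteq> topspace proj_zariski" using W(2) by (rule closedin_subset)
    show "W \<noteq> {}" using W(3) by auto
    fix A B assume AB: "closedin proj_zariski A \<and> closedin proj_zariski B \<and> W \<subseteq> A \<union> B"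
    then have "W = (W \<inter> A) \<union> (W \<inter> B)" by blast
    then have "infinite (W \<inter> A) \<or> infinite (W \<inter> B)" using W(3) by (metis finite_UnI)
    then show "W \<subseteq> A \<or> W \<subseteq> B"
      using W(4)[of "W \<inter> A"] W(4)[of "W \<inter> B"] AB closedin_Int[OF W(2)] by blast
  qed
  obtain l where l: "l \<in> W" using W(3) by (metis finite.emptyI ex_in_conv)
  then have "l \<in> projectivize UNIV" using closed_topspace[OF W(2)] by blast
  then obtain x where x: "l = vec.span {x}" "x \<noteq> 0" by (rule projectivizeE)
  have "{l} \<subset> W" using l W(3) by auto
  then have "2 \<le> krull_dim proj_zariski C"
    using C W Y irr point_closed[OF x(2)] point_irreducible[OF x(2)]
    by (intro chain_of_three[of proj_zariski "{l}" W C]) (auto simp: x(1) irreducible_curve_def)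
  then show False using C by (simp add: irreducible_curve_def one_enat_def numeral_eq_enat)
qed

section \<open>Upper bounds for the dimension by counting independent forms\<close>

lemma linear_dependence:
  fixes c :: "'i \<Rightarrow> 'j \<Rightarrow> complex"
  assumes "finite J" "finite I" "card J < card I"
  shows "\<exists>l. (\<exists>i\<in>I. l i \<noteq> 0) \<and> (\<forall>k\<in>J. (\<Sum>i\<in>I. l i * c i k) = 0)"
  using assms
proof (induction J arbitrary: I c)
  case empty
  then obtain i where "i \<in> I" by fastforce
  then show ?case by (intro exI[of _ "\<lambda>_. 1"]) auto
next
  case (insert b J)
  show ?case
  proof (cases "\<forall>i\<in>I. c i b = 0")
    case True
    obtain l where "\<exists>i\<in>I. l i \<noteq> 0" "\<forall>k\<in>J. (\<Sum>i\<in>I. l i * c i k) = 0"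
      using insert.IH[of I c] insert.prems insert.hyps by (auto dest: Suc_lessD)
    then show ?thesis using True by (intro exI[of _ l]) auto
  next
    case False
    then obtain p where p: "p \<in> I" "c p b \<noteq> 0" by blast
    define I' where "I' = I - {p}"
    define c' where "c' i k = c i k - c i b / c p b * c p k" for i k
    have "card J < card I'" using insert p unfolding I'_def by simp
    then obtain l where l: "\<exists>i\<in>I'. l i \<noteq> 0" "\<forall>k\<in>J. (\<Sum>i\<in>I'. l i * c' i k) = 0"
      using insert.IH[of I' c'] insert.prems unfolding I'_def by auto
    define m where "m i = (if i = p then - (\<Sum>i\<in>I'. l i * c i b) / c p b else l i)" for i
    have m: "(\<Sum>i\<in>I. m i * c i k) = - (\<Sum>i\<in>I'. l i * c i b) / c p b * c p k + (\<Sum>i\<in>I'. l i * c i k)" for k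
    proof -
      have "(\<Sum>i\<in>I. m i * c i k) = m p * c p k + (\<Sum>i\<in>I'. m i * c i k)"
        unfolding I'_def using p insert.prems by (intro sum.remove) auto
      also have "(\<Sum>i\<in>I'. m i * c i k) = (\<Sum>i\<in>I'. l i * c i k)"
        by (intro sum.cong) (auto simp: m_def I'_def)
      finally show ?thesis by (simp add: m_def)
    qed
    have "(\<Sum>i\<in>I'. l i * c' i k) = (\<Sum>i\<in>I'. l i * c i k) - (\<Sum>i\<in>I'. l i * c i b) / c p b * c p k" for k
      unfolding c'_def sum_divide_distrib sum_distrib_right sum_subtractf[symmetric]
      by (intro sum.cong) (auto simp: algebra_simps)
    then have "\<forall>k\<in>J. (\<Sum>i\<in>I. m i * c i k) = 0" using l(2) unfolding m by simp
    moreover have "(\<Sum>i\<in>I. m i * c i b) = 0" unfolding m using p by simp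
    moreover have "\<exists>i\<in>I. m i \<noteq> 0" using l(1) unfolding m_def I'_def by auto
    ultimately show ?thesis by (intro exI[of _ m]) auto
  qed
qed

definition independent_on :: "'i set \<Rightarrow> ('i \<Rightarrow> 'a \<Rightarrow> complex) \<Rightarrow> 'a set \<Rightarrow> bool" where
  "independent_on J h A \<longleftrightarrow> (\<forall>l. (\<forall>x\<in>A. (\<Sum>i\<in>J. l i * h i x) = 0) \<longrightarrow> (\<forall>i\<in>J. l i = 0))"

lemma irreducible_cancel:
  assumes X: "closedin proj_zariski X" "irreducible_in proj_zariski X"
    and fg: "hom_deg d f" "hom_deg e g" "\<And>x. x \<in> cone X \<Longrightarrow> f x * g x = 0"
    and "y \<in> cone X" "f y \<noteq> 0" "x \<in> cone X"
  shows "g x = 0"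
proof -
  note top = closed_topspace[OF X(1)]
  have "cone X \<noteq> {0}"
  proof
    assume "cone X = {0}"
    then have "projectivize (cone X) = {}" by (auto simp: projectivize_def)
    then show False using X(2) projectivize_cone[OF top] by (simp add: irreducible_in_def)
  qed
  then have "(\<forall>x\<in>cone X. f x = 0) \<or> (\<forall>x\<in>cone X. g x = 0)"
    using irreducible_iff[OF cone_closed_cone[OF top]] X(2) fg unfolding projectivize_cone[OF top] by blast
  then show ?thesis using assms by blast
qed

text \<open>The monomials \<open>f\<^sup>a g\<^bsup>D - a\<^esup>\<close> with coefficients from an independent family on the smaller cone
  stay independent: expand in powers of \<open>f\<close>, which vanishes on the smaller cone.\<close>

lemma independent_on_step:
  assumes X: "closedin proj_zariski X" "irreducible_in proj_zariski X"
    and Y: "closedin proj_zariski Y" "irreducible_in proj_zariski Y" "X \<subseteq> Y"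
    and f: "hom_deg d f" "\<And>x. x \<in> cone X \<Longrightarrow> f x = 0" "y \<in> cone Y" "f y \<noteq> 0"
    and g: "hom_deg d g" "z \<in> cone X" "g z \<noteq> 0"
    and h: "finite J" "\<And>i. i \<in> J \<Longrightarrow> hom_deg e (h i)" "independent_on J h (cone X)"
  shows "independent_on ({..D} \<times> J) (\<lambda>p x. f x ^ fst p * g x ^ (D - fst p) * h (snd p) x) (cone Y)"
  unfolding independent_on_def
proof (intro allI impI)
  fix l assume l: "\<forall>x\<in>cone Y. (\<Sum>p\<in>{..D} \<times> J. l p * (f x ^ fst p * g x ^ (D - fst p) * h (snd p) x)) = 0"
  define H where "H a x = (\<Sum>i\<in>J. l (a, i) * h i x)" for a x
  have H: "hom_deg e (H a)" for a
    unfolding H_def[abs_def] by (intro hom_deg_sum hom_deg_cmult h(2))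
  have sub: "cone X \<subseteq> cone Y" using Y(3) unfolding cone_def by blast
  have tot: "(\<Sum>a\<le>D. f x ^ a * g x ^ (D - a) * H a x) = 0" if "x \<in> cone Y" for x
  proof -
    have "(\<Sum>p\<in>{..D} \<times> J. l p * (f x ^ fst p * g x ^ (D - fst p) * h (snd p) x)) =
        (\<Sum>a\<le>D. \<Sum>i\<in>J. l (a, i) * (f x ^ a * g x ^ (D - a) * h i x))"
      by (simp add: sum.cartesian_product case_prod_unfold)
    also have "\<dots> = (\<Sum>a\<le>D. f x ^ a * g x ^ (D - a) * H a x)"
      unfolding H_def sum_distrib_left by (intro sum.cong refl) (simp add: mult_ac)
    finally show ?thesis using l that by simp
  qed
  have main: "a \<le> D \<Longrightarrow> \<forall>i\<in>J. l (a, i) = 0" for a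
  proof (induction a rule: less_induct)
    case (less a)
    have H0: "H b x = 0" if "b < a" for b x using less that unfolding H_def by simp
    \<comment> \<open>The relation divided by f^a, once the coefficients of lower powers are known
      to vanish. On the smaller cone only the summand b = a survives, because f is zero
      there.\<close>
    define R where "R x = (\<Sum>b\<in>{a..D}. f x ^ (b - a) * g x ^ (D - b) * H b x)" for x
    have R: "hom_deg (d * (D - a) + e) R"
      unfolding R_def[abs_def]
    proof (intro hom_deg_sum)
      fix b assume "b \<in> {a..D}"
      then obtain k m where "b = a + k" "D = a + k + m" by (metis atLeastAtMost_iff le_Suc_ex)
      then show "hom_deg (d * (D - a) + e) (\<lambda>x. f x ^ (b - a) * g x ^ (D - b) * H b x)"
        by (intro hom_deg_mult'[OF hom_deg_mult[OF hom_deg_power[OF f(1)] hom_deg_power[OF g(1)]] H])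
          (simp add: algebra_simps)
    qed
    have fR: "f x ^ a * R x = 0" if "x \<in> cone Y" for x
    proof -
      have "(\<Sum>b\<le>D. f x ^ b * g x ^ (D - b) * H b x) = (\<Sum>b\<in>{a..D}. f x ^ b * g x ^ (D - b) * H b x)"
        using H0 by (intro sum.mono_neutral_right) auto
      also have "\<dots> = f x ^ a * R x"
        unfolding R_def sum_distrib_left
        by (intro sum.cong refl) (auto simp: mult.assoc[symmetric] power_add[symmetric])
      finally show ?thesis using tot[OF that] by simp
    qed
    have R0: "R x = 0" if "x \<in> cone Y" for x
      by (rule irreducible_cancel[OF Y(1,2) hom_deg_power[OF f(1), of a] R fR f(3) _ that]) (use f(4) in auto)
    have gH: "g x ^ (D - a) * H a x = 0" if "x \<in> cone X" for x
    proof -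
      have "R x = (\<Sum>b\<in>{a}. f x ^ (b - a) * g x ^ (D - b) * H b x)"
        unfolding R_def using less.prems f(2)[OF that] by (intro sum.mono_neutral_right) auto
      then show ?thesis using R0 sub that by auto
    qed
    have "H a x = 0" if "x \<in> cone X" for x
      by (rule irreducible_cancel[OF X hom_deg_power[OF g(1), of "D - a"] H gH g(2) _ that]) (use g(3) in auto)
    then show ?case using h(3) unfolding independent_on_def H_def by (elim allE[of _ "\<lambda>i. l (a, i)"]) blast
  qed
  then show "\<forall>i\<in>{..D} \<times> J. l i = 0" by auto
qed

lemma nonempty_closed_point:
  assumes "closedin proj_zariski X" "X \<noteq> {}"
  shows "\<exists>x\<in>cone X. x \<noteq> 0"
proof -
  obtain l where l: "l \<in> X" using assms by blast
  then have "l \<in> projectivize UNIV" using closed_topspace[OF assms(1)] by blast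
  then obtain x where "l = vec.span {x}" "x \<noteq> 0" by (rule projectivizeE)
  then show ?thesis using l unfolding cone_def by (auto intro!: bexI[of _ x] exI[of _ l] vec.span_base)
qed

text \<open>Every step of the chain multiplies the number of independent forms by D + 1 while the
  degree stays linear in D: the Hilbert function of the top member grows at least like D^n.\<close>

lemma chain_independent_family:
  fixes Z :: "nat \<Rightarrow> (complex ^ 'n) set set"
  assumes "\<And>i. i \<le> n \<Longrightarrow> closedin proj_zariski (Z i) \<and> irreducible_in proj_zariski (Z i)"
    and "\<And>i. i < n \<Longrightarrow> Z i \<subset> Z (Suc i)"
  shows "\<exists>e. \<forall>D. \<exists>(J :: nat list set) h. finite J \<and> card J = (D + 1) ^ n \<and>
    (\<forall>i\<in>J. hom_deg (e * D) (h i)) \<and> independent_on J h (cone (Z n))"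
  using assms
proof (induction n)
  case 0
  have "independent_on {[]} (\<lambda>_ _. 1) (cone (Z 0))"
    by (auto simp: independent_on_def cone_def)
  then show ?case
    by (intro exI[of _ 0] allI exI[of _ "{[]}"] exI[of _ "\<lambda>_ _. 1"]) (simp add: hom_deg_const)
next
  case (Suc n)
  have chain: "\<And>i. i \<le> n \<Longrightarrow> closedin proj_zariski (Z i) \<and> irreducible_in proj_zariski (Z i)"
    "\<And>i. i < n \<Longrightarrow> Z i \<subset> Z (Suc i)" using Suc.prems by auto
  obtain e where e: "\<And>D. \<exists>(J :: nat list set) h. finite J \<and> card J = (D + 1) ^ n \<and>
    (\<forall>i\<in>J. hom_deg (e * D) (h i)) \<and> independent_on J h (cone (Z n))"
    using Suc.IH[OF chain] by blast
  have X: "closedin proj_zariski (Z n)" "irreducible_in proj_zariski (Z n)" using chain by auto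
  have Y: "closedin proj_zariski (Z (Suc n))" "irreducible_in proj_zariski (Z (Suc n))" "Z n \<subset> Z (Suc n)"
    using Suc.prems by auto
  have "\<not> cone (Z (Suc n)) \<subseteq> cone (Z n)"
    using Y(3) projectivize_mono[of "cone (Z (Suc n))" "cone (Z n)"]
      projectivize_cone[OF closed_topspace[OF X(1)]] projectivize_cone[OF closed_topspace[OF Y(1)]] by auto
  then obtain y where y: "y \<in> cone (Z (Suc n))" "y \<notin> cone (Z n)" by blast
  obtain d f where f: "hom_deg d f" "\<forall>x\<in>cone (Z n). f x = 0" "f y \<noteq> 0"
    using closed_cone_separate[OF X(1) y(2)] by blast
  obtain z where z: "z \<in> cone (Z n)" "z \<noteq> 0"
    using nonempty_closed_point[OF X(1)] X(2) unfolding irreducible_in_def by blast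
  then obtain k where k: "z $ k \<noteq> 0" by (metis vec_eq_iff zero_index)
  \<comment> \<open>A form that does not vanish identically on \<open>Z n\<close>, of the same
    degree d as f, so that all products f^a g^(D - a) have equal degree.\<close>
  define g where "g x = x $ k ^ d" for x :: "complex ^ 'n"
  have g: "hom_deg d g" "g z \<noteq> 0"
    unfolding g_def[abs_def] using hom_deg_power[OF hom_deg_coord[of k], of d] k by auto
  have "\<exists>(J :: nat list set) h. finite J \<and> card J = (D + 1) ^ Suc n \<and>
    (\<forall>i\<in>J. hom_deg ((e + d) * D) (h i)) \<and> independent_on J h (cone (Z (Suc n)))" for D
  proof -
    obtain J :: "nat list set" and h where J': "finite J \<and> card J = (D + 1) ^ n \<and>
      (\<forall>i\<in>J. hom_deg (e * D) (h i)) \<and> independent_on J h (cone (Z n))" using e[of D] by (elim exE)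
    then have J: "finite J" "card J = (D + 1) ^ n"
      "\<And>i. i \<in> J \<Longrightarrow> hom_deg (e * D) (h i)" "independent_on J h (cone (Z n))" by auto
    \<comment> \<open>Index sets consist of lists so that the exponent of f can be prepended at
      every step without changing the type.\<close>
    define h' where "h' p x = f x ^ hd p * g x ^ (D - hd p) * h (tl p) x" for p x
    define M where "M = (\<lambda>p. fst p # snd p) ` ({..D} \<times> J)"
    have inj: "inj_on (\<lambda>p. fst p # snd p) ({..D} \<times> J)" by (auto simp: inj_on_def)
    have "finite M" "card M = (D + 1) ^ Suc n"
      unfolding M_def by (simp_all add: card_image[OF inj] J(1,2) card_cartesian_product)
    moreover have "hom_deg ((e + d) * D) (h' i)" if i: "i \<in> M" for i
    proof -
      obtain a j where aj: "i = a # j" "a \<le> D" "j \<in> J" using i unfolding M_def by auto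
      then obtain m where "D = a + m" by (metis le_Suc_ex)
      then show ?thesis
        unfolding h'_def[abs_def] aj using J(3)[OF aj(3)]
        by (intro hom_deg_mult'[OF hom_deg_mult[OF hom_deg_power[OF f(1)] hom_deg_power[OF g(1)]]])
          (simp_all add: algebra_simps)
    qed
    moreover have "independent_on M h' (cone (Z (Suc n)))"
      unfolding independent_on_def
    proof (intro allI impI)
      fix l assume l: "\<forall>x\<in>cone (Z (Suc n)). (\<Sum>i\<in>M. l i * h' i x) = 0"
      have "(\<Sum>p\<in>{..D} \<times> J. l (fst p # snd p) * (f x ^ fst p * g x ^ (D - fst p) * h (snd p) x)) = 0"
        if "x \<in> cone (Z (Suc n))" for x
        using l that unfolding M_def by (simp add: sum.reindex[OF inj] h'_def)
      moreover have "independent_on ({..D} \<times> J)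
          (\<lambda>p x. f x ^ fst p * g x ^ (D - fst p) * h (snd p) x) (cone (Z (Suc n)))"
        by (rule independent_on_step[OF X Y(1,2) psubset_imp_subset[OF Y(3)] f(1) _ y(1) f(3) g(1) z(1) g(2) J(1,3,4)])
          (use f(2) in auto)
      ultimately have "\<forall>p\<in>{..D} \<times> J. l (fst p # snd p) = 0"
        unfolding independent_on_def by (elim allE[of _ "\<lambda>p. l (fst p # snd p)"]) simp
      then show "\<forall>i\<in>M. l i = 0" unfolding M_def by auto
    qed
    ultimately show ?thesis by blast
  qed
  then show ?case by (intro exI[of _ "e + d"]) blast
qed

text \<open>A chain of length k + 1 would provide (D + 1)^(k + 1) independent forms of degree e D,
  more than C (e D + 1)^k for suitable D.\<close>

lemma krull_dim_le:
  fixes X :: "(complex ^ 'n) set set"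
  assumes dep: "\<And>N (J :: nat list set) h. finite J \<Longrightarrow> card J > C * (N + 1) ^ k \<Longrightarrow>
    (\<And>i. i \<in> J \<Longrightarrow> hom_deg N (h i)) \<Longrightarrow> \<not> independent_on J h (cone X)"
  shows "krull_dim proj_zariski X \<le> enat k"
  unfolding krull_dim_def
proof (rule SUP_least, rule ccontr)
  fix n assume "n \<in> {n. \<exists>Z. (\<forall>i\<le>n. closedin proj_zariski (Z i) \<and> irreducible_in proj_zariski (Z i) \<and> Z i \<subseteq> X) \<and>
    (\<forall>i<n. Z i \<subset> Z (Suc i))}" and "\<not> enat n \<le> enat k"
  then obtain Z where Z: "\<And>i. i \<le> n \<Longrightarrow> closedin proj_zariski (Z i) \<and> irreducible_in proj_zariski (Z i) \<and> Z i \<subseteq> X"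
    "\<And>i. i < n \<Longrightarrow> Z i \<subset> Z (Suc i)" and n: "k < n" by auto
  have "closedin proj_zariski (Z i) \<and> irreducible_in proj_zariski (Z i)" if "i \<le> Suc k" for i
    using Z(1)[of i] n that by simp
  moreover have "Z i \<subset> Z (Suc i)" if "i < Suc k" for i using Z(2)[of i] n that by simp
  ultimately obtain e where e: "\<forall>D. \<exists>(J :: nat list set) h. finite J \<and> card J = (D + 1) ^ Suc k \<and>
    (\<forall>i\<in>J. hom_deg (e * D) (h i)) \<and> independent_on J h (cone (Z (Suc k)))"
    using chain_independent_family[of "Suc k" Z] by blast
  \<comment> \<open>Since e D + 1 \<le> (e + 1) (D + 1), this choice gives C (e D + 1)^k \<le> D (D
    + 1)^k < (D + 1)^(k + 1).\<close>
  define D where "D = C * (e + 1) ^ k"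
  obtain J :: "nat list set" and h where J': "finite J \<and> card J = (D + 1) ^ Suc k \<and>
    (\<forall>i\<in>J. hom_deg (e * D) (h i)) \<and> independent_on J h (cone (Z (Suc k)))" using e[rule_format, of D] by (elim exE)
  then have J: "finite J" "card J = (D + 1) ^ Suc k"
    "\<And>i. i \<in> J \<Longrightarrow> hom_deg (e * D) (h i)" "independent_on J h (cone (Z (Suc k)))" by auto
  have "C * (e * D + 1) ^ k \<le> C * ((e + 1) * (D + 1)) ^ k"
    by (intro mult_left_mono power_mono) auto
  also have "\<dots> = D * (D + 1) ^ k" by (subst power_mult_distrib) (simp only: D_def mult.assoc)
  also have "\<dots> < (D + 1) ^ Suc k" by simp
  finally have "card J > C * (e * D + 1) ^ k" using J(2) by simp
  then have "\<not> independent_on J h (cone X)" by (rule dep[OF J(1) _ J(3)])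
  moreover have "cone (Z (Suc k)) \<subseteq> cone X" using Z(1)[of "Suc k"] n unfolding cone_def by auto
  ultimately show False using J(4) unfolding independent_on_def by blast
qed

text \<open>Exchange the roles of a and b: f (b + v a) = v^N P (1 / v) is a polynomial in v, which
  bounds the degree of P, and its value at v = 0 is both f b and the coefficient of
  \<tau>^N.\<close>

lemma hom_line_degree:
  assumes f: "hom_deg N f" and P: "\<And>\<tau>. f (a + \<tau> *s b) = poly P \<tau>"
  shows "degree P \<le> N" "coeff P N = f b"
proof -
  obtain S where S: "\<forall>v. f (b + v *s a) = poly S v" using poly_fun_on_line[OF hom_deg_pf[OF f]] by blast
  define R where "R = reflect_poly P"
  define D where "D = degree P"
  have main: "v ^ D * poly S v = v ^ N * poly R v" if "v \<noteq> 0" for v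
  proof -
    have "poly S v = f (v *s (a + (1 / v) *s b))" using S that by (simp add: vector_add_ldistrib vector_smult_assoc add.commute that)
    also have "\<dots> = v ^ N * poly P (1 / v)" unfolding hom_deg_scale[OF f] P ..
    finally show ?thesis
      using that by (simp add: R_def D_def poly_reflect_poly_nz inverse_eq_divide)
  qed
  have eq: "monom 1 D * S = monom 1 N * R"
    by (rule poly_eq_cofinite[of "{0}"]) (use main in \<open>auto simp: poly_monom\<close>)
  have R0: "poly R 0 = lead_coeff P" by (simp add: R_def)
  show *: "degree P \<le> N"
  proof (rule ccontr)
    assume "\<not> ?thesis"
    then have "coeff (monom 1 D * S) N = 0" "P \<noteq> 0" by (auto simp: coeff_monom_mult D_def)
    then have "coeff R 0 = 0" unfolding eq by (simp add: coeff_monom_mult)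
    then show False using R0 \<open>P \<noteq> 0\<close> by (simp add: poly_0_coeff_0)
  qed
  have "coeff (monom 1 D * S) N = coeff R 0" unfolding eq by (simp add: coeff_monom_mult)
  then have cS: "coeff S (N - D) = lead_coeff P" using * R0 by (simp add: coeff_monom_mult D_def poly_0_coeff_0)
  have fb: "f b = coeff S 0" using S[rule_format, of 0] by (simp add: poly_0_coeff_0)
  show "coeff P N = f b"
  proof (cases "D = N")
    case True
    then show ?thesis using cS fb D_def by simp
  next
    case False
    then have "coeff P N = 0" "D < N" using * D_def by (auto intro: coeff_eq_0)
    moreover have "coeff (monom 1 N * R) D = 0" using \<open>D < N\<close> by (simp add: coeff_monom_mult)
    then have "coeff S 0 = 0" unfolding eq[symmetric] by (simp add: coeff_monom_mult)
    ultimately show ?thesis using fb by simp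
  qed
qed

section \<open>Frames\<close>

text \<open>A pair of dual bases. Points of the curve are expanded in b with the coordinates
  \<open>pairing (y i)\<close>, points of the dual surface in y with the coordinates
  \<open>pairing (b i)\<close>.\<close>

definition frame :: "(4 \<Rightarrow> complex ^ 4) \<Rightarrow> (4 \<Rightarrow> complex ^ 4) \<Rightarrow> bool" where
  "frame b y \<longleftrightarrow> (\<forall>i j. pairing (y i) (b j) = (if i = j then 1 else 0))"

lemma frameD: "frame b y \<Longrightarrow> pairing (y i) (b j) = (if i = j then 1 else 0)"
  by (simp add: frame_def)

lemma frame_sym: "frame b y \<Longrightarrow> frame y b"
  by (simp add: frame_def pairing_commute eq_commute)

lemma frame_permute: "frame b y \<Longrightarrow> inj p \<Longrightarrow> frame (b \<circ> p) (y \<circ> p)"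
  by (simp add: frame_def inj_eq)

lemma frame_expand:
  assumes "frame b y" shows "x = (\<Sum>i\<in>UNIV. pairing (y i) x *s b i)"
proof -
  define Y :: "complex ^ 4 ^ 4" where "Y = (\<chi> i. y i)"
  define B :: "complex ^ 4 ^ 4" where "B = (\<chi> k j. b j $ k)"
  have "(Y ** B) $ i $ j = mat 1 $ i $ j" for i j
    using frameD[OF assms, of i j]
    by (simp add: matrix_matrix_mult_def Y_def B_def mat_def pairing_def)
  then have "Y ** B = mat 1" by (simp add: vec_eq_iff)
  then have "B ** Y = mat 1" by (simp add: matrix_left_right_inverse)
  then have "x = B *v (Y *v x)" by (simp add: matrix_vector_mul_assoc)
  also have "\<dots> = (\<Sum>i\<in>UNIV. pairing (y i) x *s b i)"
    by (simp add: vec_eq_iff matrix_vector_mult_def Y_def B_def pairing_def mult.commute)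
  finally show ?thesis .
qed

lemma frame_expand4:
  "frame b y \<Longrightarrow> x = pairing (y 1) x *s b 1 + pairing (y 2) x *s b 2 + pairing (y 3) x *s b 3 + pairing (y 4) x *s b 4"
  using frame_expand[of b y x] by (simp add: sum_4)

lemma frame_eqI:
  assumes "frame b y" "\<And>i. pairing (y i) x = pairing (y i) z" shows "x = z"
  using frame_expand[OF assms(1), of x] frame_expand[OF assms(1), of z] assms(2) by simp

lemma frame_nonzero: "frame b y \<Longrightarrow> b i \<noteq> 0" "frame b y \<Longrightarrow> y i \<noteq> 0"
  using frameD[of b y i i] by auto

text \<open>Extend p, q to a basis; the rows of the inverse of its matrix are the dual
  basis.\<close>

lemma frame_exists:
  assumes "\<And>a c. a *s p + c *s q = 0 \<Longrightarrow> a = 0 \<and> c = 0"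
  shows "\<exists>b y. frame b y \<and> b 1 = p \<and> b 2 = q"
proof -
  have pq: "p \<noteq> q" using assms[of 1 "-1"] by auto
  have ind: "vec.independent {p, q}"
  proof (rule vec.independent_insertI)
    show "p \<notin> vec.span {q}"
    proof
      assume "p \<in> vec.span {q}"
      then obtain k where "p = k *s q" by (auto simp: vec.span_singleton)
      then have "1 *s p + (- k) *s q = 0" by simp
      then show False using assms[of 1 "- k"] by simp
    qed
    have "q \<noteq> 0" using assms[of 0 1] by auto
    then show "vec.independent {q}" by simp
  qed
  define S where "S = vec.extend_basis {p, q}"
  have S: "{p, q} \<subseteq> S" "vec.independent S" "vec.span S = UNIV"
    unfolding S_def using vec.extend_basis_superset[OF ind] vec.independent_extend_basis[OF ind]
      vec.span_extend_basis[OF ind] by auto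
  have "card S = vec.dim (UNIV :: (complex ^ 4) set)"
    using vec.dim_eq_card[of S UNIV] S(2,3) by simp
  then have cS: "card S = 4" unfolding vec_dim_card by simp
  then have "finite S" by (metis card.infinite zero_neq_numeral)
  then have "card (S - {p, q}) = 2" using S(1) cS pq by (simp add: card_Diff_subset)
  then obtain r s where rs: "S - {p, q} = {r, s}" by (meson card_2_iff)
  define b where "b i = (if i = 1 then p else if i = 2 then q else if i = 3 then r else s)" for i :: 4
  have "range b = S" using rs S(1) unfolding b_def UNIV_4 by auto
  then have "\<exists>c. x = (\<Sum>i\<in>UNIV. c i *s b i)" for x
  proof -
    have "vec.span (range b) \<subseteq> {x. \<exists>c. x = (\<Sum>i\<in>UNIV. c i *s b i)}"
    proof (rule vec.span_minimal)
      show "range b \<subseteq> {x. \<exists>c. x = (\<Sum>i\<in>UNIV. c i *s b i)}"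
      proof
        fix x assume "x \<in> range b"
        then obtain j where "x = b j" by blast
        moreover have "b j = (\<Sum>i\<in>UNIV. (if i = j then 1 else 0) *s b i)"
          by (subst sum.remove[of _ j]) auto
        ultimately have "x = (\<Sum>i\<in>UNIV. (if i = j then 1 else 0) *s b i)" by (rule trans)
        then show "x \<in> {x. \<exists>c. x = (\<Sum>i\<in>UNIV. c i *s b i)}" by (intro CollectI exI)
      qed
      show "vec.subspace {x. \<exists>c. x = (\<Sum>i\<in>UNIV. c i *s b i)}"
      proof (rule vec.subspaceI)
        show "0 \<in> {x. \<exists>c. x = (\<Sum>i\<in>UNIV. c i *s b i)}" by (auto intro!: exI[of _ "\<lambda>_. 0"])
      next
        fix x z assume "x \<in> {x. \<exists>c. x = (\<Sum>i\<in>UNIV. c i *s b i)}" "z \<in> {x. \<exists>c. x = (\<Sum>i\<in>UNIV. c i *s b i)}"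
        then obtain c d where "x = (\<Sum>i\<in>UNIV. c i *s b i)" "z = (\<Sum>i\<in>UNIV. d i *s b i)" by blast
        then have "x + z = (\<Sum>i\<in>UNIV. (c i + d i) *s b i)"
          by (simp add: vector_sadd_rdistrib sum.distrib)
        then show "x + z \<in> {x. \<exists>c. x = (\<Sum>i\<in>UNIV. c i *s b i)}"
          by (intro CollectI exI[of _ "\<lambda>i. c i + d i"])
      next
        fix k x assume "x \<in> {x. \<exists>c. x = (\<Sum>i\<in>UNIV. c i *s b i)}"
        then obtain c where "x = (\<Sum>i\<in>UNIV. c i *s b i)" by blast
        then have "k *s x = (\<Sum>i\<in>UNIV. (k * c i) *s b i)" by (simp add: vec.scale_sum_right)
        then show "k *s x \<in> {x. \<exists>c. x = (\<Sum>i\<in>UNIV. c i *s b i)}"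
          by (intro CollectI exI[of _ "\<lambda>i. k * c i"])
      qed
    qed
    then show ?thesis using S(3) \<open>range b = S\<close> by auto
  qed
  then have "\<forall>j. \<exists>c. axis j 1 = (\<Sum>i\<in>UNIV. c i *s b i)" by blast
  from choice[OF this] obtain c where c: "\<And>j. axis j 1 = (\<Sum>i\<in>UNIV. c j i *s b i)" by blast
  define B :: "complex ^ 4 ^ 4" where "B = (\<chi> k i. b i $ k)"
  define A :: "complex ^ 4 ^ 4" where "A = (\<chi> i j. c j i)"
  have "(B ** A) $ k $ j = mat 1 $ k $ j" for k j
    using arg_cong[OF c[of j], of "\<lambda>v. v $ k"]
    by (simp add: matrix_matrix_mult_def A_def B_def mat_def axis_def mult.commute)
  then have "B ** A = mat 1" by (simp add: vec_eq_iff)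
  then have AB: "A ** B = mat 1" by (simp add: matrix_left_right_inverse)
  define y where "y i = A $ i" for i
  have "pairing (y i) (b j) = (if i = j then 1 else 0)" for i j
    using arg_cong[OF AB, of "\<lambda>M. M $ i $ j"]
    by (simp add: matrix_matrix_mult_def y_def B_def mat_def pairing_def)
  then show ?thesis unfolding frame_def by (intro exI[of _ b] exI[of _ y]) (simp add: b_def)
qed

section \<open>Bivariate polynomials\<close>

text \<open>The outer variable of P is z and its coefficients are polynomials in t;
  \<open>zp\<close> specializes t alone.\<close>

definition ev :: "complex poly poly \<Rightarrow> complex \<Rightarrow> complex \<Rightarrow> complex" where
  "ev P t z = poly (poly P [:z:]) t"

definition zp :: "complex poly poly \<Rightarrow> complex \<Rightarrow> complex poly" where
  "zp P t = map_poly (\<lambda>c. poly c t) P"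

lemma ev_simps [simp]:
  "ev 0 t z = 0" "ev (P + Q) t z = ev P t z + ev Q t z" "ev (P * Q) t z = ev P t z * ev Q t z"
  "ev (- P) t z = - ev P t z" "ev (P - Q) t z = ev P t z - ev Q t z"
  "ev (smult c P) t z = poly c t * ev P t z" "ev (pCons c P) t z = poly c t + z * ev P t z"
  by (simp_all add: ev_def)

lemma zp_pCons [simp]: "zp (pCons c P) t = pCons (poly c t) (zp P t)"
  unfolding zp_def by (cases "c = 0 \<and> P = 0") (auto simp: map_poly_pCons)

lemma zp_0 [simp]: "zp 0 t = 0"
  by (simp add: zp_def)

lemma poly_zp [simp]: "poly (zp P t) z = ev P t z"
  by (induction P) simp_all

lemma coeff_zp [simp]: "coeff (zp P t) k = poly (coeff P k) t"
  by (simp add: zp_def coeff_map_poly)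

lemma degree_zp_le: "degree (zp P t) \<le> degree P"
  by (rule degree_le) (simp add: coeff_eq_0)

lemma degree_zp: "poly (lead_coeff P) t \<noteq> 0 \<Longrightarrow> degree (zp P t) = degree P"
  using degree_zp_le[of P t] le_degree[of "zp P t" "degree P"] by simp

lemma zp_pderiv: "zp (pderiv P) t = pderiv (zp P t)"
  by (rule poly_eqI) (simp add: coeff_pderiv)

lemma ev_in_algebra: "(\<lambda>p. ev P (fst p) (snd p)) \<in> generated_algebra {fst, snd}"
proof (induction P)
  case (pCons c P)
  have "(\<lambda>p. poly c (fst p) + snd p * ev P (fst p) (snd p)) \<in> generated_algebra {fst, snd}"
    by (intro ga_add ga_mult ga_poly_comp pCons.IH ga_gen) auto
  then show ?case by simp
qed (simp add: ga_const)

lemma algebra_ev: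
  assumes "F \<in> generated_algebra {fst, snd}"
  shows "\<exists>P. \<forall>t z. F (t, z) = ev P t z"
  using assms
proof induction
  case (gen g)
  then have "g = fst \<or> g = snd" by simp
  then show ?case
  proof
    assume "g = fst"
    then show ?thesis by (intro exI[of _ "[:[:0, 1:]:]"]) simp
  next
    assume "g = snd"
    then show ?thesis by (intro exI[of _ "[:0, 1:]"]) simp
  qed
next
  case (const c)
  show ?case by (intro exI[of _ "[:[:c:]:]"]) simp
next
  case (add f g)
  then obtain P Q where "\<forall>t z. f (t, z) = ev P t z" "\<forall>t z. g (t, z) = ev Q t z" by blast
  then show ?case by (intro exI[of _ "P + Q"]) simp
next
  case (mult f g)
  then obtain P Q where "\<forall>t z. f (t, z) = ev P t z" "\<forall>t z. g (t, z) = ev Q t z" by blast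
  then show ?case by (intro exI[of _ "P * Q"]) simp
qed

lemma homogenize_linear_fractions:
  assumes "F \<in> generated_algebra {fst, snd}"
  shows "\<exists>N. \<forall>M\<ge>N. \<exists>f. hom_deg M f \<and> (\<forall>x. pairing a x \<noteq> 0 \<longrightarrow>
    f x = pairing a x ^ M * F (pairing b x / pairing a x, pairing c x / pairing a x))"
  using assms
proof induction
  case (gen g)
  then have "\<exists>e. \<forall>x. g (pairing b x / pairing a x, pairing c x / pairing a x) = pairing e x / pairing a x" by auto
  then obtain e where e: "\<And>x. g (pairing b x / pairing a x, pairing c x / pairing a x) = pairing e x / pairing a x" by blast
  show ?case
  proof (intro exI[of _ 1] allI impI)
    fix M :: nat assume "1 \<le> M"
    then obtain k where M: "M = Suc k" by (cases M) auto
    have "hom_deg M (\<lambda>x. pairing a x ^ k * pairing e x)"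
      unfolding M by (intro hom_deg_mult'[OF hom_deg_power[OF hom_deg_pairing] hom_deg_pairing]) simp
    then show "\<exists>f. hom_deg M f \<and> (\<forall>x. pairing a x \<noteq> 0 \<longrightarrow>
      f x = pairing a x ^ M * g (pairing b x / pairing a x, pairing c x / pairing a x))"
      unfolding e by (intro exI[of _ "\<lambda>x. pairing a x ^ k * pairing e x"]) (simp add: M)
  qed
next
  case (const k)
  show ?case
    by (intro exI[of _ 0] allI impI exI[of _ "\<lambda>x. pairing a x ^ M * k" for M] conjI
        hom_deg_mult'[OF hom_deg_power[OF hom_deg_pairing] hom_deg_const]) auto
next
  case (add f g)
  then obtain N1 N2 where N: "\<forall>M\<ge>N1. \<exists>h. hom_deg M h \<and> (\<forall>x. pairing a x \<noteq> 0 \<longrightarrow>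
      h x = pairing a x ^ M * f (pairing b x / pairing a x, pairing c x / pairing a x))"
    "\<forall>M\<ge>N2. \<exists>h. hom_deg M h \<and> (\<forall>x. pairing a x \<noteq> 0 \<longrightarrow>
      h x = pairing a x ^ M * g (pairing b x / pairing a x, pairing c x / pairing a x))" by blast
  show ?case
  proof (intro exI[of _ "max N1 N2"] allI impI)
    fix M assume "max N1 N2 \<le> M"
    then have le: "N1 \<le> M" "N2 \<le> M" by auto
    from N(1)[rule_format, OF le(1)] obtain h1 where h1: "hom_deg M h1" "\<And>x. pairing a x \<noteq> 0 \<Longrightarrow>
      h1 x = pairing a x ^ M * f (pairing b x / pairing a x, pairing c x / pairing a x)" by blast
    from N(2)[rule_format, OF le(2)] obtain h2 where h2: "hom_deg M h2" "\<And>x. pairing a x \<noteq> 0 \<Longrightarrow>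
      h2 x = pairing a x ^ M * g (pairing b x / pairing a x, pairing c x / pairing a x)" by blast
    show "\<exists>h. hom_deg M h \<and> (\<forall>x. pairing a x \<noteq> 0 \<longrightarrow>
      h x = pairing a x ^ M * (f (pairing b x / pairing a x, pairing c x / pairing a x) +
        g (pairing b x / pairing a x, pairing c x / pairing a x)))"
      by (intro exI[of _ "\<lambda>x. h1 x + h2 x"] conjI hom_deg_add h1(1) h2(1)) (simp add: h1(2) h2(2) algebra_simps)
  qed
next
  case (mult f g)
  then obtain N1 N2 where N: "\<forall>M\<ge>N1. \<exists>h. hom_deg M h \<and> (\<forall>x. pairing a x \<noteq> 0 \<longrightarrow>
      h x = pairing a x ^ M * f (pairing b x / pairing a x, pairing c x / pairing a x))"
    "\<forall>M\<ge>N2. \<exists>h. hom_deg M h \<and> (\<forall>x. pairing a x \<noteq> 0 \<longrightarrow>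
      h x = pairing a x ^ M * g (pairing b x / pairing a x, pairing c x / pairing a x))" by blast
  show ?case
  proof (intro exI[of _ "N1 + N2"] allI impI)
    fix M assume M: "N1 + N2 \<le> M"
    then have le: "N1 \<le> N1" "N2 \<le> M - N1" by auto
    from N(1)[rule_format, OF le(1)] obtain h1 where h1: "hom_deg N1 h1" "\<And>x. pairing a x \<noteq> 0 \<Longrightarrow>
      h1 x = pairing a x ^ N1 * f (pairing b x / pairing a x, pairing c x / pairing a x)" by blast
    from N(2)[rule_format, OF le(2)] obtain h2 where h2: "hom_deg (M - N1) h2" "\<And>x. pairing a x \<noteq> 0 \<Longrightarrow>
      h2 x = pairing a x ^ (M - N1) * g (pairing b x / pairing a x, pairing c x / pairing a x)" by blast
    have "pairing a x ^ M = pairing a x ^ N1 * pairing a x ^ (M - N1)" for x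
      using M by (simp add: power_add[symmetric])
    then show "\<exists>h. hom_deg M h \<and> (\<forall>x. pairing a x \<noteq> 0 \<longrightarrow>
      h x = pairing a x ^ M * (f (pairing b x / pairing a x, pairing c x / pairing a x) *
        g (pairing b x / pairing a x, pairing c x / pairing a x)))"
      using M by (intro exI[of _ "\<lambda>x. h1 x * h2 x"] conjI hom_deg_mult'[OF h1(1) h2(1)])
        (simp_all add: h1(2) h2(2))
  qed
qed

section \<open>Plane models of a space curve\<close>

locale space_curve =
  fixes C :: "(complex ^ 4) set set"
  assumes curve: "irreducible_curve C"
    and nondegenerate: "h \<noteq> 0 \<Longrightarrow> \<not> C \<subseteq> hyperplane h"
begin

abbreviation "K \<equiv> cone C"

lemma C_closed: "closedin proj_zariski C" and C_irreducible: "irreducible_in proj_zariski C"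
  using curve by (auto simp: irreducible_curve_def)

lemmas C_top = closed_topspace[OF C_closed]

lemma K_cone: "cone_closed K"
  by (rule cone_closed_cone[OF C_top])

lemmas K_scale = cone_closedD[OF K_cone]

lemma K_span: "x \<noteq> 0 \<Longrightarrow> vec.span {x} \<in> C \<longleftrightarrow> x \<in> K"
  using projectivize_cone_iff[OF K_cone, of x] projectivize_cone[OF C_top] by simp

lemmas K_separate = closed_cone_separate[OF C_closed]
lemmas K_cancel = irreducible_cancel[OF C_closed C_irreducible]

lemma K_nondegenerate: "h \<noteq> 0 \<Longrightarrow> \<exists>x\<in>K. pairing h x \<noteq> 0"
proof (rule ccontr)
  assume "h \<noteq> 0" "\<not> (\<exists>x\<in>K. pairing h x \<noteq> 0)"
  then have "projectivize K \<subseteq> hyperplane h" unfolding hyperplane_def by (intro projectivize_mono) auto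
  then show False using nondegenerate \<open>h \<noteq> 0\<close> projectivize_cone[OF C_top] by simp
qed

lemma K_finite_zeros:
  assumes f: "hom_deg d f" and "x0 \<in> K" "f x0 \<noteq> 0"
  shows "finite {vec.span {x} | x. x \<in> K \<and> x \<noteq> 0 \<and> f x = 0}"
proof (cases "d = 0")
  case True
  then have "f x = f 0" for x using hom_deg_scale[OF f, of 0 x] by simp
  then have "f x \<noteq> 0" for x using assms(3) by metis
  then show ?thesis by simp
next
  case False
  then have d: "d > 0" by simp
  note z = closed_zero_locus[OF f d]
  have eq: "{vec.span {x} | x. x \<in> K \<and> x \<noteq> 0 \<and> f x = 0} = C \<inter> projectivize {x. f x = 0}"
  proof -
    have "C \<inter> projectivize {x. f x = 0} = projectivize (K \<inter> {x. f x = 0})"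
      unfolding projectivize_Int[OF K_cone z(1)] projectivize_cone[OF C_top] ..
    then show ?thesis by (auto simp: projectivize_def)
  qed
  have x0: "x0 \<noteq> 0" using assms(3) cone_closed_zero[OF z(1)] by auto
  then have "vec.span {x0} \<in> C" "vec.span {x0} \<notin> projectivize {x. f x = 0}"
    using K_span assms projectivize_cone_iff[OF z(1) x0] by auto
  then have "C \<inter> projectivize {x. f x = 0} \<subset> C" by blast
  then show ?thesis
    unfolding eq using curve_proper_closed_finite[OF curve] closedin_Int[OF C_closed z(2)] by blast
qed

lemma K_finite_hyperplane:
  "h \<noteq> 0 \<Longrightarrow> finite {vec.span {x} | x. x \<in> K \<and> x \<noteq> 0 \<and> pairing h x = 0}"
  using K_nondegenerate K_finite_zeros[OF hom_deg_pairing] by blast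

lemma hyperplane_section: "C \<inter> hyperplane h = {vec.span {x} | x. x \<in> K \<and> x \<noteq> 0 \<and> pairing h x = 0}"
proof -
  have "cone_closed {x. pairing h x = 0}" by (simp add: cone_closed_def pairing_scale)
  then have "C \<inter> hyperplane h = projectivize (K \<inter> {x. pairing h x = 0})"
    unfolding hyperplane_def using projectivize_Int[OF K_cone] projectivize_cone[OF C_top] by simp
  then show ?thesis by (auto simp: projectivize_def)
qed

text \<open>Take one equation of the curve for each point and combine them with a multiplier that
  avoids finitely many ratios. The equations may differ in degree, so the result need not be
  homogeneous.\<close>

lemma separate_finite:
  assumes "finite R" "R \<inter> K = {}"
  shows "\<exists>g\<in>poly_funs. (\<forall>x\<in>K. g x = 0) \<and> (\<forall>x\<in>R. g x \<noteq> 0)"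
  using assms
proof (induction R)
  case empty
  show ?case by (intro bexI[of _ "\<lambda>_. 0"] pf_const) auto
next
  case (insert r R)
  then obtain g where g: "g \<in> poly_funs" "\<forall>x\<in>K. g x = 0" "\<forall>x\<in>R. g x \<noteq> 0" by auto
  obtain f d where f: "hom_deg d f" "\<forall>x\<in>K. f x = 0" "f r \<noteq> 0" using K_separate[of r] insert.prems by blast
  obtain c where c: "c \<notin> (\<lambda>x. - f x / g x) ` R \<union> {- g r / f r} \<union> {0}"
    using complex_avoid_finite[of "(\<lambda>x. - f x / g x) ` R \<union> {- g r / f r} \<union> {0}"] insert.hyps by blast
  show ?case
  proof (cases "g r = 0")
    case True
    have "c * g x + f x \<noteq> 0" if "x \<in> R" for x
    proof
      assume "c * g x + f x = 0"
      then have "c = - f x / g x" using g(3) that by (simp add: field_simps eq_neg_iff_add_eq_0)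
      then show False using c that by blast
    qed
    then show ?thesis
      using g f True hom_deg_pf[OF f(1)]
      by (intro bexI[of _ "\<lambda>x. c * g x + f x"] pf_add pf_mult pf_const) auto
  next
    case False
    then show ?thesis using g by (intro bexI[of _ g]) auto
  qed
qed

text \<open>P is an equation, in the chart a \<noteq> 0, of the plane image of the curve under (a :
  b : c).\<close>

definition relation :: "complex ^ 4 \<Rightarrow> complex ^ 4 \<Rightarrow> complex ^ 4 \<Rightarrow> complex poly poly \<Rightarrow> bool" where
  "relation a b c P \<longleftrightarrow> (\<forall>x\<in>K. pairing a x \<noteq> 0 \<longrightarrow> ev P (pairing b x / pairing a x) (pairing c x / pairing a x) = 0)"

text \<open>Projection from a point outside the curve is closed: on the line through the point and \<open>(t\<^sub>0, z\<^sub>0)\<close>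
  two equations of the curve without common zero stay without common zero for nearby \<open>(t, z)\<close>.\<close>

lemma relation_separate:
  assumes fr: "frame b y" and b4: "b 4 \<notin> K"
    and no: "\<not> (\<exists>x\<in>K. pairing (y 1) x = 1 \<and> pairing (y 2) x = t0 \<and> pairing (y 3) x = z0)"
  shows "\<exists>P. relation (y 1) (y 2) (y 3) P \<and> ev P t0 z0 \<noteq> 0"
proof -
  let ?G = "{fst, snd :: complex \<times> complex \<Rightarrow> complex}"
  \<comment> \<open>The points \<open>A p + w *s b 4\<close> form the line over p in the projection
    from \<open>b 4\<close>; \<open>V i p\<close> is coordinate i on it as a polynomial in
    w.\<close>
  define A where "A p = b 1 + fst p *s b 2 + snd p *s b 3" for p :: "complex \<times> complex"
  define V where "V i p = [:A p $ i, b 4 $ i:]" for i p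
  have V: "polyfam ?G (V i)" for i
    unfolding V_def[abs_def]
  proof (intro polyfam_pCons polyfam_const)
    show "(\<lambda>p. A p $ i) \<in> generated_algebra ?G"
      unfolding A_def by (simp, intro ga_add ga_mult ga_const ga_gen) auto
    show "(\<lambda>p. b 4 $ i) \<in> generated_algebra ?G" by (rule ga_const)
  qed
  have degV: "degree (V i p) \<le> 1" for i p by (simp add: V_def)
  have line: "\<forall>i. (A p + w *s b 4) $ i = poly (V i p) w" for p w by (simp add: V_def)
  \<comment> \<open>Because f is nonzero at \<open>b 4\<close>, it has degree exactly m on every
    such line, so none of its zeros can escape to \<open>b 4\<close> as the line varies.\<close>
  obtain m f where f: "hom_deg m f" "\<forall>x\<in>K. f x = 0" "f (b 4) \<noteq> 0" using K_separate[OF b4] by blast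
  obtain F where F: "polyfam ?G F" "\<And>p w. f (A p + w *s b 4) = poly (F p) w"
    using poly_fun_polyfam[where V = V and G = ?G and D = 1, OF hom_deg_pf[OF f(1)] V degV] line by metis
  have degF: "degree (F p) \<le> m" "coeff (F p) m = f (b 4)" for p
    using hom_line_degree[OF f(1) F(2)] by auto
  have Fm: "degree (F p) = m" "F p \<noteq> 0" for p
    using degF(1)[of p] degF(2)[of p] le_degree[of "F p" m] f(3) by (simp, metis coeff_0)
  define p0 where "p0 = (t0, z0)"
  define R where "R = (\<lambda>w. A p0 + w *s b 4) ` {w. poly (F p0) w = 0}"
  have "finite R" unfolding R_def using poly_roots_finite[OF Fm(2)] by blast
  moreover have "R \<inter> K = {}"
    using no unfolding R_def A_def p0_def
    by (auto simp: pairing_add pairing_scale frameD[OF fr])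
  ultimately obtain g where g: "g \<in> poly_funs" "\<forall>x\<in>K. g x = 0" "\<forall>x\<in>R. g x \<noteq> 0"
    using separate_finite by blast
  obtain H N where H: "polyfam ?G H" "\<And>p. degree (H p) \<le> N" "\<And>p w. g (A p + w *s b 4) = poly (H p) w"
    using poly_fun_polyfam[where V = V and G = ?G and D = 1, OF g(1) V degV] line by metis
  have "poly (H p0) w \<noteq> 0" if "poly (F p0) w = 0" for w
    using g(3) that unfolding R_def H(3)[symmetric] by blast
  \<comment> \<open>The zeros of f on the line over p0 are off the curve, and g is nonzero at all of
    them. The maximum with 1 provides the bound \<open>1 \<le> a\<close> in
    \<open>no_relation_no_common_root\<close>.\<close>
  then have nr: "no_relation (max N 1) m (F p0) (H p0)"
    using no_relation_coprime[OF Fm(2)] Fm(1) by metis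
  obtain G where G: "G \<in> generated_algebra ?G" "G p0 \<noteq> 0"
    "\<And>p. G p \<noteq> 0 \<Longrightarrow> no_relation (max N 1) m (F p) (H p)"
    using no_relation_open[of ?G F H "max N 1" m p0, OF F(1) H(1) nr] by blast
  obtain P where P: "\<And>t z. G (t, z) = ev P t z" using algebra_ev[OF G(1)] by blast
  have "relation (y 1) (y 2) (y 3) P"
    unfolding relation_def
  proof (intro ballI impI, rule ccontr)
    fix x assume x: "x \<in> K" "pairing (y 1) x \<noteq> 0"
      and "ev P (pairing (y 2) x / pairing (y 1) x) (pairing (y 3) x / pairing (y 1) x) \<noteq> 0"
    define p where "p = (pairing (y 2) x / pairing (y 1) x, pairing (y 3) x / pairing (y 1) x)"
    define w where "w = pairing (y 4) x / pairing (y 1) x"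
    have "G p \<noteq> 0" unfolding p_def P by fact
    then have nrp: "no_relation (max N 1) m (F p) (H p)" by (rule G(3))
    have "A p + w *s b 4 = (1 / pairing (y 1) x) *s x"
      by (rule frame_eqI[OF fr], unfold A_def p_def w_def)
        (use x(2) exhaust_4 in \<open>auto simp: pairing_add pairing_scale frameD[OF fr]\<close>)
    then have "A p + w *s b 4 \<in> K" using K_scale[OF x(1)] by simp
    then have "poly (F p) w = 0" "poly (H p) w = 0" using f(2) g(2) F(2) H(3) by metis+
    moreover have "degree (H p) \<le> max N 1" using H(2)[of p] by simp
    ultimately show False using no_relation_no_common_root[OF nrp _ degF(1), of w] by simp
  qed
  moreover have "ev P t0 z0 \<noteq> 0" using G(2) unfolding p0_def P .
  ultimately show ?thesis by blast
qed

lemma relation_combine: "relation a b c P \<Longrightarrow> relation a b c (P * Q)"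
  "relation a b c P \<Longrightarrow> relation a b c (smult k P)"
  "relation a b c P \<Longrightarrow> relation a b c Q \<Longrightarrow> relation a b c (P - Q)"
  by (simp_all add: relation_def)

text \<open>Homogenize both factors and cancel one of them on the irreducible curve. The extra
  factor \<open>pairing a x\<close> makes the product vanish also at the points outside the
  chart.\<close>

lemma relation_prime:
  assumes "relation a b c (P * Q)" shows "relation a b c P \<or> relation a b c Q"
proof (rule disjCI)
  assume "\<not> relation a b c Q"
  then obtain x0 where x0: "x0 \<in> K" "pairing a x0 \<noteq> 0"
    "ev Q (pairing b x0 / pairing a x0) (pairing c x0 / pairing a x0) \<noteq> 0" unfolding relation_def by blast
  obtain M f where f: "hom_deg M f" "\<forall>x. pairing a x \<noteq> 0 \<longrightarrow>
      f x = pairing a x ^ M * ev P (pairing b x / pairing a x) (pairing c x / pairing a x)"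
    using homogenize_linear_fractions[OF ev_in_algebra[of P], of a b c] by auto
  obtain N g where g: "hom_deg N g" "\<forall>x. pairing a x \<noteq> 0 \<longrightarrow>
      g x = pairing a x ^ N * ev Q (pairing b x / pairing a x) (pairing c x / pairing a x)"
    using homogenize_linear_fractions[OF ev_in_algebra[of Q], of a b c] by auto
  have ga: "hom_deg (N + 1) (\<lambda>x. g x * pairing a x)" by (rule hom_deg_mult[OF g(1) hom_deg_pairing])
  have zero: "g x * pairing a x * f x = 0" if "x \<in> K" for x
    using assms that f(2) g(2) unfolding relation_def by (cases "pairing a x = 0") auto
  have nz: "g x0 * pairing a x0 \<noteq> 0" using x0 g(2) by simp
  have "f x = 0" if "x \<in> K" for x
    by (rule K_cancel[OF ga f(1) zero x0(1) nz that])
  then show "relation a b c P" unfolding relation_def using f(2) by (metis mult_eq_0_iff power_not_zero)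
qed

text \<open>An equation in t alone would, by primality, have a factor t - r that is an equation
  itself, and the curve would lie in the plane of \<open>y 2 - r *s y 1\<close>.\<close>

lemma relation_const:
  assumes fr: "frame b y" and "relation (y 1) (y 2) (y 3) [:c:]" shows "c = 0"
  using assms(2)
proof (induction "degree c" arbitrary: c)
  case 0
  then obtain k where k: "c = [:k:]" by (metis degree_0_id)
  obtain x where "x \<in> K" "pairing (y 1) x \<noteq> 0" using K_nondegenerate[OF frame_nonzero(2)[OF fr]] by blast
  then show ?case using 0 k by (auto simp: relation_def)
next
  case (Suc n)
  then have "\<not> constant (poly c)" by (simp add: constant_degree)
  then obtain r where "poly c r = 0" using fundamental_theorem_of_algebra by blast
  then obtain c' where c': "c = [:-r, 1:] * c'" by (auto simp: poly_eq_0_iff_dvd elim!: dvdE)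
  have "[:c:] = [:[:-r, 1:]:] * [:c':]" unfolding c' by simp
  then consider "relation (y 1) (y 2) (y 3) [:[:-r, 1:]:]" | "relation (y 1) (y 2) (y 3) [:c':]"
    using relation_prime Suc.prems by metis
  then show ?case
  proof cases
    case 1
    have zero: "pairing (y 1) x * pairing (y 2 - r *s y 1) x = 0" if "x \<in> K" for x
      using 1 that unfolding relation_def
      by (cases "pairing (y 1) x = 0") (auto simp: pairing_diff_left pairing_scale_left field_simps)
    obtain x0 where x0: "x0 \<in> K" "pairing (y 1) x0 \<noteq> 0" using K_nondegenerate[OF frame_nonzero(2)[OF fr]] by blast
    have "pairing (y 2 - r *s y 1) x = 0" if "x \<in> K" for x
      by (rule K_cancel[OF hom_deg_pairing hom_deg_pairing zero x0 that])
    then have "y 2 - r *s y 1 = 0" using K_nondegenerate by blast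
    then have "pairing (y 2 - r *s y 1) (b 2) = 0" by simp
    then show ?thesis by (simp add: pairing_diff_left pairing_scale_left frameD[OF fr])
  next
    case 2
    show ?thesis
    proof (cases "c' = 0")
      case False
      have "degree c = Suc (degree c')" unfolding c' using False by (subst degree_mult_eq) auto
      then show ?thesis using Suc.hyps(1)[of c'] Suc.hyps(2) 2 c' by auto
    qed (simp add: c')
  qed
qed

text \<open>The plane y 2 = 0 meets the curve finitely often, so some z is not attained over t = 0,
  and the missed point is separated from the image by an equation.\<close>

lemma relation_exists:
  assumes fr: "frame b y" and b4: "b 4 \<notin> K"
  shows "\<exists>P. relation (y 1) (y 2) (y 3) P \<and> P \<noteq> 0"
proof -
  have "\<exists>z0. \<not> (\<exists>x\<in>K. pairing (y 1) x = 1 \<and> pairing (y 2) x = 0 \<and> pairing (y 3) x = z0)"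
  proof (rule ccontr)
    assume "\<not> ?thesis"
    then have "\<forall>z. \<exists>x. x \<in> K \<and> pairing (y 1) x = 1 \<and> pairing (y 2) x = 0 \<and> pairing (y 3) x = z" by blast
    from choice[OF this] obtain x where x: "\<And>z. x z \<in> K" "\<And>z. pairing (y 1) (x z) = 1" "\<And>z. pairing (y 2) (x z) = 0"
      "\<And>z. pairing (y 3) (x z) = z" by blast
    have nz: "x z \<noteq> 0" for z using x(2)[of z] by auto
    have "inj (\<lambda>z. vec.span {x z})"
    proof (rule injI)
      fix z z' assume "vec.span {x z} = vec.span {x z'}"
      then obtain k where k: "x z = k *s x z'" using span_eq_iff[OF nz nz] by blast
      then have "k = 1" using arg_cong[OF k, of "pairing (y 1)"] unfolding pairing_scale x(2) by simp
      then show "z = z'" using k x(4) by (metis vec.scale_one)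
    qed
    then have "infinite (range (\<lambda>z. vec.span {x z}))"
      using finite_imageD infinite_UNIV_char_0 by blast
    moreover have "range (\<lambda>z. vec.span {x z}) \<subseteq> {vec.span {x} | x. x \<in> K \<and> x \<noteq> 0 \<and> pairing (y 2) x = 0}"
      using x nz by blast
    ultimately show False
      using finite_subset K_finite_hyperplane[OF frame_nonzero(2)[OF fr, of 2]] by blast
  qed
  then obtain z0 where "\<not> (\<exists>x\<in>K. pairing (y 1) x = 1 \<and> pairing (y 2) x = 0 \<and> pairing (y 3) x = z0)" ..
  from relation_separate[OF fr b4 this] obtain P where "relation (y 1) (y 2) (y 3) P" "ev P 0 z0 \<noteq> 0" by blast
  then show ?thesis by (intro exI[of _ P]) auto
qed

text \<open>P has least degree in z among the equations and, for that degree, a leading coefficient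
  of least degree. Minimality excludes factors in t alone and makes P and its z-derivative coprime
  up to a polynomial in t; T consists of the zeros of this polynomial and of the leading
  coefficient. Off T every root of P lifts to the curve, since by pseudo-division all equations
  vanish where P does.\<close>

lemma plane_model:
  assumes fr: "frame b y" and b4: "b 4 \<notin> K"
  shows "\<exists>P T. relation (y 1) (y 2) (y 3) P \<and> degree P \<ge> 1 \<and> (\<forall>t. zp P t \<noteq> 0) \<and> finite T \<and>
    (\<forall>t. t \<notin> T \<longrightarrow> degree (zp P t) = degree P \<and> rsquarefree (zp P t) \<and>
      (\<forall>z. ev P t z = 0 \<longrightarrow> (\<exists>x\<in>K. pairing (y 1) x = 1 \<and> pairing (y 2) x = t \<and> pairing (y 3) x = z)))"
proof -
  let ?I = "relation (y 1) (y 2) (y 3)"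
  define n where "n = (LEAST n. \<exists>P. ?I P \<and> P \<noteq> 0 \<and> degree P = n)"
  have n1: "\<exists>P. ?I P \<and> P \<noteq> 0 \<and> degree P = n"
    unfolding n_def by (rule LeastI_ex) (use relation_exists[OF fr b4] in blast)
  have n2: "n \<le> degree P" if "?I P" "P \<noteq> 0" for P
    unfolding n_def by (rule Least_le) (use that in blast)
  obtain P where P: "?I P" "P \<noteq> 0" "degree P = n"
    and Pmin: "\<And>Q. ?I Q \<Longrightarrow> Q \<noteq> 0 \<Longrightarrow> degree Q = n \<Longrightarrow> degree (lead_coeff P) \<le> degree (lead_coeff Q)"
    using exists_least_iff[of "\<lambda>k. \<exists>P. ?I P \<and> P \<noteq> 0 \<and> degree P = n \<and> degree (lead_coeff P) = k"] n1
    by (metis linorder_not_less)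
  define lc where "lc = lead_coeff P"
  have lc: "lc \<noteq> 0" using P(2) by (simp add: lc_def)
  have npos: "n \<ge> 1"
  proof (rule ccontr)
    assume "\<not> n \<ge> 1"
    then have "degree P = 0" using P(3) by simp
    then obtain c where c: "P = [:c:]" by (metis degree_eq_zeroE)
    then show False using relation_const[OF fr, of c] P(1,2) by simp
  qed
  have nonvanish: "zp P t \<noteq> 0" for t
  proof
    assume "zp P t = 0"
    then have "poly (coeff P k) t = 0" for k by (metis coeff_0 coeff_zp)
    then have dv: "[:-t, 1:] dvd coeff P k" for k by (simp add: poly_eq_0_iff_dvd)
    \<comment> \<open>If all coefficients vanish at t, the factor t can be split off, and the
      quotient is an equation whose leading coefficient has smaller degree.\<close>
    define Q where "Q = map_poly (\<lambda>c. c div [:-t, 1:]) P"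
    have "P = smult [:-t, 1:] Q"
      by (rule poly_eqI) (use dv in \<open>simp add: Q_def coeff_map_poly del: mult_pCons_left\<close>)
    then have PQ: "P = [:[:-t, 1:]:] * Q" by simp
    have "\<not> ?I [:[:-t, 1:]:]" using relation_const[OF fr, of "[:-t, 1:]"] by auto
    then have "?I Q" using relation_prime P(1) PQ by metis
    moreover have "Q \<noteq> 0" using PQ P(2) by auto
    moreover have "degree P = degree Q" using PQ \<open>Q \<noteq> 0\<close> by (metis add_0 degree_mult_eq degree_pCons_0 mult_zero_left P(2))
    ultimately have "degree (lead_coeff P) \<le> degree (lead_coeff Q)" using Pmin P(3) by simp
    moreover have "lead_coeff P = [:-t, 1:] * lead_coeff Q" using PQ by (metis lead_coeff_mult lead_coeff_pCons(2))
    then have "degree (lead_coeff P) = 1 + degree (lead_coeff Q)"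
      using \<open>Q \<noteq> 0\<close> by (subst \<open>lead_coeff P = _\<close>, subst degree_mult_eq) auto
    ultimately show False by simp
  qed
  \<comment> \<open>The ideal of P and its z-derivative. An element r of least degree in z divides
    all of it up to factors in t and takes the place of the gcd over the rational functions in
    t.\<close>
  define J where "J Q \<longleftrightarrow> (\<exists>u v. Q = u * P + v * pderiv P)" for Q
  have J_diff: "J (smult k Q - R * S)" if "J Q" "J R" for k Q R S
  proof -
    obtain u v u' v' where uv: "Q = u * P + v * pderiv P" "R = u' * P + v' * pderiv P"
      using \<open>J Q\<close> \<open>J R\<close> unfolding J_def by (elim exE) blast
    then have "smult k Q - R * S = (smult k u - u' * S) * P + (smult k v - v' * S) * pderiv P"
      by (simp add: algebra_simps smult_add_right)
    then show ?thesis unfolding J_def by blast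
  qed
  have JP: "J P" "J (pderiv P)" unfolding J_def
    by (rule exI[of _ 1], rule exI[of _ 0], simp, rule exI[of _ 0], rule exI[of _ 1], simp)
  have P': "pderiv P \<noteq> 0" using npos P(3) by (auto simp: pderiv_eq_0_iff)
  obtain r where r: "J r" "r \<noteq> 0" "\<And>Q. J Q \<Longrightarrow> Q \<noteq> 0 \<Longrightarrow> degree r \<le> degree Q"
    using exists_least_iff[of "\<lambda>k. \<exists>Q. J Q \<and> Q \<noteq> 0 \<and> degree Q = k"] JP(2) P' by (metis linorder_not_less)
  have divides: "\<exists>a q. a \<noteq> 0 \<and> smult a Q = r * q" if Q: "J Q" for Q
  proof -
    obtain a q where aq: "a \<noteq> 0" "smult a Q = r * q + pseudo_mod Q r" using pseudo_mod(1)[OF r(2)] by blast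
    then have "pseudo_mod Q r = smult a Q - r * q" by simp
    then have "J (pseudo_mod Q r)" using J_diff[OF Q r(1)] by simp
    then have "pseudo_mod Q r = 0" using pseudo_mod(2)[OF r(2), of Q] r(3) by fastforce
    then show ?thesis using aq by auto
  qed
  \<comment> \<open>Otherwise a multiple of P by a polynomial in t factors as r q, and by primality
    r or q is an equation; both have smaller degree in z than P.\<close>
  have "degree r = 0"
  proof (rule ccontr)
    assume dr: "degree r \<noteq> 0"
    obtain a q where aq: "a \<noteq> 0" "smult a P = r * q" using divides[OF JP(1)] by blast
    then have qnz: "q \<noteq> 0" using P(2) by auto
    have "degree (smult a P) = degree r + degree q" unfolding aq using r(2) qnz by (rule degree_mult_eq)
    then have dsum: "n = degree r + degree q" using aq(1) P(3) by simp
    have "?I (r * q)" using relation_combine(2)[OF P(1)] aq(2) by metis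
    then consider "?I r" | "?I q" using relation_prime by blast
    then show False
    proof cases
      case 1
      then have "n \<le> degree r" using n2 r(2) by blast
      moreover have "degree r \<le> degree (pderiv P)" using r(3)[OF JP(2) P'] .
      moreover have "degree (pderiv P) < n" using npos P(3) by (simp add: degree_pderiv)
      ultimately show False by simp
    next
      case 2
      then show False using n2[OF 2 qnz] dsum dr by simp
    qed
  qed
  then obtain r0 where r0: "r = [:r0:]" by (metis degree_eq_zeroE)
  obtain u v where uv: "[:r0:] = u * P + v * pderiv P" using r(1) r0 J_def by auto
  \<comment> \<open>Where \<open>r0\<close> is nonzero, the identity above excludes common zeros of
    P and its derivative; where \<open>lc\<close> is nonzero, the degree does not drop.\<close>
  define T where "T = {t. poly (lc * r0) t = 0}"
  have "r0 \<noteq> 0" using r(2) r0 by auto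
  then have "finite T" unfolding T_def using lc by (intro poly_roots_finite) simp
  moreover have "degree (zp P t) = degree P \<and> rsquarefree (zp P t) \<and>
      (\<forall>z. ev P t z = 0 \<longrightarrow> (\<exists>x\<in>K. pairing (y 1) x = 1 \<and> pairing (y 2) x = t \<and> pairing (y 3) x = z))"
    if "t \<notin> T" for t
  proof (intro conjI allI impI)
    have nz: "poly lc t \<noteq> 0" "poly r0 t \<noteq> 0" using that by (auto simp: T_def)
    show "degree (zp P t) = degree P" using degree_zp nz(1) lc_def by blast
    show "rsquarefree (zp P t)"
      unfolding rsquarefree_roots
    proof (intro allI notI)
      fix z assume "poly (zp P t) z = 0 \<and> poly (pderiv (zp P t)) z = 0"
      then have "ev P t z = 0" "ev (pderiv P) t z = 0" unfolding zp_pderiv[symmetric] by simp_all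
      then have "ev [:r0:] t z = 0" unfolding uv by simp
      then show False using nz(2) by simp
    qed
    fix z assume z: "ev P t z = 0"
    show "\<exists>x\<in>K. pairing (y 1) x = 1 \<and> pairing (y 2) x = t \<and> pairing (y 3) x = z"
    proof (rule ccontr)
      assume "\<not> ?thesis"
      from relation_separate[OF fr b4 this] obtain G where G: "?I G" "ev G t z \<noteq> 0" by blast
      obtain q s where qs: "pseudo_divmod G P = (q, s)" by fastforce
      note pd = pseudo_divmod[OF P(2) qs]
      \<comment> \<open>The pseudo-remainder of an equation is an equation of smaller degree than P,
        hence zero.\<close>
      have "s = smult (coeff P (degree P) ^ (Suc (degree G) - degree P)) G - P * q" using pd(1) by simp
      then have "?I s" using relation_combine G(1) P(1) by metis
      then have "s = 0" using pd(2) n2[of s] P(3) by fastforce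
      then have "ev (smult (lc ^ (Suc (degree G) - degree P)) G) t z = 0" using pd(1) z by (simp add: lc_def)
      then show False using nz(1) G(2) by (simp add: poly_power)
    qed
  qed
  ultimately show ?thesis using P npos nonvanish by blast
qed

end

section \<open>The degree of a space curve\<close>

text \<open>Moves the centre of projection from \<open>b 4\<close> to
  \<open>b 4 - \<mu> *s b 3\<close>, which replaces the coordinate y 3 by y 3 + \<mu> y 4.\<close>

lemma frame_shift:
  "frame b y \<Longrightarrow> frame (b(4 := b 4 - \<mu> *s b 3)) (y(3 := y 3 + \<mu> *s y 4))"
  by (auto simp: frame_def pairing_add_left pairing_scale_left pairing_diff pairing_scale)

lemma nonzero_form_on_finite_set:
  assumes "finite F" "\<And>x. x \<in> F \<Longrightarrow> x \<noteq> (0 :: complex ^ 'n)"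
  shows "\<exists>u. \<forall>x\<in>F. pairing u x \<noteq> 0"
  using assms
proof (induction F)
  case (insert r F)
  then obtain u where u: "\<forall>x\<in>F. pairing u x \<noteq> 0" by auto
  obtain v where v: "pairing v r \<noteq> 0"
    using pairing_nondegenerate[of r] insert.prems[of r] by (metis insertI1 pairing_commute)
  obtain c where c: "c \<notin> (\<lambda>x. - pairing v x / pairing u x) ` insert r F"
    using complex_avoid_finite[of "(\<lambda>x. - pairing v x / pairing u x) ` insert r F"] insert.hyps by blast
  show ?case
  proof (cases "pairing u r = 0")
    case True
    have "c * pairing u x + pairing v x \<noteq> 0" if "x \<in> F" for x
    proof
      assume "c * pairing u x + pairing v x = 0"
      then have "c = - pairing v x / pairing u x" using u that by (simp add: field_simps eq_neg_iff_add_eq_0)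
      then show False using c that by blast
    qed
    then show ?thesis
      using True v by (intro exI[of _ "c *s u + v"]) (auto simp: pairing_add_left pairing_scale_left)
  next
    case False
    then show ?thesis using u by (intro exI[of _ u]) auto
  qed
qed simp

text \<open>Serves to pass from n + 1 fixed centres of projection to an arbitrary one in
  \<open>section_bounds\<close>.\<close>

lemma lagrange_interpolation:
  fixes q :: "complex poly"
  assumes "degree q \<le> n" "inj_on \<mu> {..n}"
  shows "(\<Sum>j\<le>n. poly q (\<mu> j) * (\<Prod>i\<in>{..n} - {j}. (m - \<mu> i) / (\<mu> j - \<mu> i))) = poly q m"
proof -
  define L where "L j = (\<Prod>i\<in>{..n} - {j}. [: - \<mu> i / (\<mu> j - \<mu> i), 1 / (\<mu> j - \<mu> i) :])" for j
  have L: "poly (L j) m = (\<Prod>i\<in>{..n} - {j}. (m - \<mu> i) / (\<mu> j - \<mu> i))" for j m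
    unfolding L_def poly_prod by (intro prod.cong) (auto simp: field_simps diff_divide_distrib)
  define R where "R = (\<Sum>j\<le>n. smult (poly q (\<mu> j)) (L j)) - q"
  have "degree (L j) \<le> n" if "j \<le> n" for j
  proof -
    have "degree (L j) \<le> (\<Sum>i\<in>{..n} - {j}. degree [: - \<mu> i / (\<mu> j - \<mu> i), 1 / (\<mu> j - \<mu> i) :])"
      unfolding L_def using degree_prod_sum_le[of "{..n} - {j}"] by (simp add: o_def del: degree_pCons_eq_if)
    also have "\<dots> \<le> (\<Sum>i\<in>{..n} - {j}. 1)" by (intro sum_mono) simp
    also have "\<dots> = n" using that by simp
    finally show ?thesis .
  qed
  then have degR: "degree R \<le> n"
    unfolding R_def by (intro degree_diff_le degree_sum_le assms(1)) (auto intro: order_trans[OF degree_smult_le])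
  have root: "poly R (\<mu> k) = 0" if "k \<le> n" for k
  proof -
    have "poly (L j) (\<mu> k) = (if j = k then 1 else 0)" if "j \<le> n" for j
    proof (cases "j = k")
      case True
      have "\<mu> k - \<mu> i \<noteq> 0" if "i \<in> {..n} - {k}" for i
        using assms(2) that \<open>k \<le> n\<close> by (auto simp: inj_on_def)
      then show ?thesis unfolding L using True by (auto intro!: prod.neutral)
    next
      case False
      then show ?thesis unfolding L using \<open>k \<le> n\<close> by (auto intro!: prod_zero)
    qed
    then have "(\<Sum>j\<le>n. poly q (\<mu> j) * poly (L j) (\<mu> k)) = (\<Sum>j\<le>n. if j = k then poly q (\<mu> k) else 0)"
      by (intro sum.cong) auto
    then show ?thesis unfolding R_def using that by (simp add: poly_sum)
  qed
  have "R = 0"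
  proof (rule ccontr)
    assume nz: "R \<noteq> 0"
    have "Suc n = card (\<mu> ` {..n})" using card_image[OF assms(2)] by simp
    also have "\<dots> \<le> card {x. poly R x = 0}" using root by (intro card_mono poly_roots_finite nz) auto
    also have "\<dots> \<le> degree R" by (rule card_poly_roots_bound[OF nz])
    finally show False using degR by simp
  qed
  then have "poly (\<Sum>j\<le>n. smult (poly q (\<mu> j)) (L j)) m = poly q m" unfolding R_def by simp
  then show ?thesis by (simp add: poly_sum L)
qed

section \<open>Counting points in pencils of planes and comparing plane sections\<close>

context space_curve
begin

text \<open>The points of a plane of the pencil with axis y 1 = y 2 = 0 that lie off the axis,
  scaled to y 1 = 1.\<close>

definition fibre :: "(4 \<Rightarrow> complex ^ 4) \<Rightarrow> complex \<Rightarrow> (complex ^ 4) set" where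
  "fibre y t = {x \<in> K. pairing (y 1) x = 1 \<and> pairing (y 2) x = t}"

lemma fibre_expand:
  assumes "frame b y" "x \<in> fibre y t"
  shows "pairing h x = pairing h (b 1) + t * pairing h (b 2) + pairing (y 3) x * pairing h (b 3) + pairing (y 4) x * pairing h (b 4)"
proof -
  have "x = b 1 + t *s b 2 + pairing (y 3) x *s b 3 + pairing (y 4) x *s b 4"
    using frame_expand4[OF assms(1), of x] assms(2) by (simp add: fibre_def)
  then have "pairing h x = pairing h (b 1 + t *s b 2 + pairing (y 3) x *s b 3 + pairing (y 4) x *s b 4)" by (rule arg_cong)
  then show ?thesis by (simp add: pairing_add pairing_scale)
qed

lemma span_inj_normalized: "inj_on (\<lambda>x. vec.span {x}) {x. pairing u x = 1}"
proof (rule inj_onI)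
  fix x z :: "complex ^ 'a" assume xz: "x \<in> {x. pairing u x = 1}" "z \<in> {x. pairing u x = 1}"
    and eq: "vec.span {x} = vec.span {z}"
  then have nz: "x \<noteq> 0" "z \<noteq> 0" by auto
  then obtain k where k: "x = k *s z" using span_eq_iff eq by blast
  have "k = 1" using arg_cong[OF k, of "pairing u"] xz unfolding pairing_scale by simp
  then show "x = z" using k by simp
qed

lemma finite_if_spans_finite:
  assumes "finite {vec.span {x} | x. x \<in> A}" "\<And>x. x \<in> A \<Longrightarrow> pairing u x = 1"
  shows "finite A"
proof -
  have inj: "inj_on (\<lambda>x. vec.span {x}) A"
    by (rule inj_on_subset[OF span_inj_normalized[of u]]) (use assms(2) in auto)
  have "(\<lambda>x. vec.span {x}) ` A = {vec.span {x} | x. x \<in> A}" by blast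
  then have "finite ((\<lambda>x. vec.span {x}) ` A)" using assms(1) by simp
  then show ?thesis by (rule finite_imageD[OF _ inj])
qed

lemma fibre_finite:
  assumes fr: "frame b y" shows "finite (fibre y t)"
proof (rule finite_if_spans_finite[of _ "y 1"])
  have "pairing (y 2 - t *s y 1) (b 2) = 1" by (simp add: pairing_diff_left pairing_scale_left frameD[OF fr])
  then have "y 2 - t *s y 1 \<noteq> 0" by auto
  from K_finite_hyperplane[OF this]
  show "finite {vec.span {x} | x. x \<in> fibre y t}"
    by (rule rev_finite_subset) (auto simp: fibre_def pairing_diff_left pairing_scale_left)
qed (simp add: fibre_def)

lemma finite_bad_centres:
  assumes fr: "frame b y" shows "finite {\<mu>. b 4 - \<mu> *s b 3 \<in> K}"
proof -
  let ?A = "{b 4 - \<mu> *s b 3 | \<mu>. b 4 - \<mu> *s b 3 \<in> K}"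
  have y4: "pairing (y 4) x = 1" and y1: "pairing (y 1) x = 0" and nz: "x \<noteq> 0" if "x \<in> ?A" for x
  proof -
    show "pairing (y 4) x = 1" "pairing (y 1) x = 0"
      using that by (auto simp: pairing_diff pairing_scale frameD[OF fr])
    then show "x \<noteq> 0" by auto
  qed
  have "finite ?A"
    by (rule finite_if_spans_finite[of _ "y 4", OF rev_finite_subset[OF K_finite_hyperplane[OF frame_nonzero(2)[OF fr, of 1]]] y4])
      (use y1 nz in blast)
  moreover have "(\<lambda>\<mu>. b 4 - \<mu> *s b 3) ` {\<mu>. b 4 - \<mu> *s b 3 \<in> K} = ?A" by blast
  moreover have "inj_on (\<lambda>\<mu>. b 4 - \<mu> *s b 3) {\<mu>. b 4 - \<mu> *s b 3 \<in> K}"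
    by (rule inj_onI) (use frame_nonzero(1)[OF fr, of 3] in simp)
  ultimately show ?thesis using finite_imageD[of "\<lambda>\<mu>. b 4 - \<mu> *s b 3"] by simp
qed

lemma fibre_card_le_degree:
  assumes P: "relation (y 1) (y 2) c P" "zp P t \<noteq> 0"
  shows "finite (pairing c ` fibre y t)" "card (pairing c ` fibre y t) \<le> degree P"
proof -
  have sub: "pairing c ` fibre y t \<subseteq> {z. poly (zp P t) z = 0}"
    using P(1) unfolding relation_def fibre_def by auto
  then show "finite (pairing c ` fibre y t)" using poly_roots_finite[OF P(2)] finite_subset by blast
  have "card (pairing c ` fibre y t) \<le> card {z. poly (zp P t) z = 0}"
    by (rule card_mono[OF poly_roots_finite[OF P(2)] sub])
  also have "\<dots> \<le> degree (zp P t)" by (rule card_poly_roots_bound[OF P(2)])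
  finally show "card (pairing c ` fibre y t) \<le> degree P" using degree_zp_le[of P t] by simp
qed

text \<open>The plane models with centres \<open>b 4\<close> and \<open>b 3\<close> bound the number
  of values of the coordinates y 3 and y 4 separately.\<close>

lemma fibre_card_bounded:
  assumes fr: "frame b y" and b3: "b 3 \<notin> K" and b4: "b 4 \<notin> K"
  shows "\<exists>N. \<forall>t. card (fibre y t) \<le> N"
proof -
  obtain P where P: "relation (y 1) (y 2) (y 3) P" "\<And>t. zp P t \<noteq> 0" using plane_model[OF fr b4] by blast
  define p :: "4 \<Rightarrow> 4" where "p i = (if i = 3 then 4 else if i = 4 then 3 else i)" for i
  have "inj p" by (auto simp: inj_def p_def split: if_splits)
  from frame_permute[OF fr this] have "frame (b \<circ> p) (y \<circ> p)" .
  moreover have "(b \<circ> p) 4 \<notin> K" using b3 by (simp add: p_def)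
  ultimately obtain Q where Q: "relation (y 1) (y 2) (y 4) Q" "\<And>t. zp Q t \<noteq> 0"
    using plane_model[of "b \<circ> p" "y \<circ> p"] by (auto simp: p_def)
  have "card (fibre y t) \<le> degree P * degree Q" for t
  proof -
    let ?f = "\<lambda>x. (pairing (y 3) x, pairing (y 4) x)"
    have "inj_on ?f (fibre y t)"
    proof (rule inj_onI)
      fix x z assume "x \<in> fibre y t" "z \<in> fibre y t" "?f x = ?f z"
      then show "x = z" using frame_expand4[OF fr, of x] frame_expand4[OF fr, of z] by (simp add: fibre_def)
    qed
    then have "card (fibre y t) = card (?f ` fibre y t)" by (simp add: card_image)
    also have "\<dots> \<le> card (pairing (y 3) ` fibre y t \<times> pairing (y 4) ` fibre y t)"
      using fibre_card_le_degree(1)[OF P(1) P(2)] fibre_card_le_degree(1)[OF Q(1) Q(2)] by (intro card_mono) auto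
    also have "\<dots> \<le> degree P * degree Q"
      unfolding card_cartesian_product
      by (intro mult_mono fibre_card_le_degree(2)[OF P(1) P(2)] fibre_card_le_degree(2)[OF Q(1) Q(2)]) auto
    finally show ?thesis .
  qed
  then show ?thesis by blast
qed

text \<open>A projection that separates the points of one fibre of maximal cardinality has a plane model of
  that degree, whose generic fibres are therefore in bijection with those of the curve.\<close>

lemma fibre_model:
  assumes fr: "frame b y" and n: "\<And>t. card (fibre y t) \<le> n" "card (fibre y t2) = n"
    and \<mu>: "b 4 - \<mu> *s b 3 \<notin> K" "inj_on (\<lambda>x. pairing (y 3) x + \<mu> * pairing (y 4) x) (fibre y t2)"
  shows "\<exists>P T. finite T \<and> degree P = n \<and> degree P \<ge> 1 \<and> (\<forall>t. zp P t \<noteq> 0) \<and>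
    (\<forall>t. t \<notin> T \<longrightarrow> poly (lead_coeff P) t \<noteq> 0 \<and> card (fibre y t) = n \<and> rsquarefree (zp P t) \<and> degree (zp P t) = n \<and>
      (\<forall>s. ev P t s = poly (lead_coeff P) t * (\<Prod>x\<in>fibre y t. s - (pairing (y 3) x + \<mu> * pairing (y 4) x))))"
proof -
  define c where "c = y 3 + \<mu> *s y 4"
  have c: "pairing c x = pairing (y 3) x + \<mu> * pairing (y 4) x" for x
    by (simp add: c_def pairing_add_left pairing_scale_left)
  define y' where "y' = y(3 := y 3 + \<mu> *s y 4)"
  have y': "y' 1 = y 1" "y' 2 = y 2" "y' 3 = c" by (simp_all add: y'_def c_def)
  have "(b(4 := b 4 - \<mu> *s b 3)) 4 \<notin> K" using \<mu>(1) by simp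
  from plane_model[OF frame_shift[OF fr, of \<mu>] this, folded y'_def, unfolded y']
  obtain P T where PT: "relation (y 1) (y 2) c P \<and> degree P \<ge> 1 \<and> (\<forall>t. zp P t \<noteq> 0) \<and> finite T \<and>
    (\<forall>t. t \<notin> T \<longrightarrow> degree (zp P t) = degree P \<and> rsquarefree (zp P t) \<and>
      (\<forall>z. ev P t z = 0 \<longrightarrow> (\<exists>x\<in>K. pairing (y 1) x = 1 \<and> pairing (y 2) x = t \<and> pairing c x = z)))"
    by (elim exE)
  then have P: "relation (y 1) (y 2) c P" "degree P \<ge> 1" "\<And>t. zp P t \<noteq> 0" "finite T"
    "\<And>t. t \<notin> T \<Longrightarrow> degree (zp P t) = degree P \<and> rsquarefree (zp P t) \<and>
      (\<forall>z. ev P t z = 0 \<longrightarrow> (\<exists>x\<in>K. pairing (y 1) x = 1 \<and> pairing (y 2) x = t \<and> pairing c x = z))"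
    by auto
  have inj2: "inj_on (pairing c) (fibre y t2)" using \<mu>(2) by (simp add: c[abs_def])
  have "n \<le> degree P" using fibre_card_le_degree(2)[OF P(1) P(3)] card_image[OF inj2] n(2) by metis
  have roots: "{z. poly (zp P t) z = 0} \<subseteq> pairing c ` fibre y t" if t: "t \<notin> T" for t
  proof
    fix z assume "z \<in> {z. poly (zp P t) z = 0}"
    then obtain x where "x \<in> K" "pairing (y 1) x = 1" "pairing (y 2) x = t" "pairing c x = z"
      using P(5)[OF t] by auto
    then show "z \<in> pairing c ` fibre y t" by (auto simp: fibre_def)
  qed
  have cardr: "card {z. poly (zp P t) z = 0} = degree P" if "t \<notin> T" for t
    using rsquarefree_card_roots P(5)[OF that] by metis
  have le: "degree P \<le> card (pairing c ` fibre y t)" if "t \<notin> T" for t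
    using card_mono[OF _ roots[OF that]] fibre_finite[OF fr] cardr[OF that] by simp
  have le2: "card (pairing c ` fibre y t) \<le> card (fibre y t)" for t by (rule card_image_le[OF fibre_finite[OF fr]])
  obtain t0 where "t0 \<notin> T" using complex_avoid_finite[OF P(4)] by blast
  then have degP: "degree P = n" using le[of t0] le2[of t0] n(1)[of t0] \<open>n \<le> degree P\<close> by linarith
  have "poly (lead_coeff P) t \<noteq> 0 \<and> card (fibre y t) = n \<and> rsquarefree (zp P t) \<and> degree (zp P t) = n \<and>
      (\<forall>s. ev P t s = poly (lead_coeff P) t * (\<Prod>x\<in>fibre y t. s - (pairing (y 3) x + \<mu> * pairing (y 4) x)))"
    if t: "t \<notin> T" for t
  proof -
    have cf: "card (fibre y t) = n" "card (pairing c ` fibre y t) = n"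
      using le[OF t] le2[of t] n(1)[of t] degP by linarith+
    then have inj: "inj_on (pairing c) (fibre y t)" using fibre_finite[OF fr] by (simp add: eq_card_imp_inj_on)
    have rt: "{z. poly (zp P t) z = 0} = pairing c ` fibre y t"
      using card_subset_eq[OF _ roots[OF t]] fibre_finite[OF fr] cf cardr[OF t] degP by simp
    have d: "degree (zp P t) = n" using P(5)[OF t] degP by simp
    have lead: "lead_coeff (zp P t) = poly (lead_coeff P) t" using d degP by simp
    have "ev P t s = poly (lead_coeff P) t * (\<Prod>x\<in>fibre y t. s - pairing c x)" for s
    proof -
      have "ev P t s = poly (smult (lead_coeff (zp P t)) (\<Prod>z|poly (zp P t) z = 0. [:-z, 1:])) s"
        using complex_poly_decompose_rsquarefree[of "zp P t"] P(5)[OF t] by simp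
      also have "\<dots> = poly (lead_coeff P) t * (\<Prod>z\<in>pairing c ` fibre y t. s - z)"
        unfolding rt lead by (simp add: poly_prod)
      finally show ?thesis by (simp add: prod.reindex[OF inj])
    qed
    moreover have "poly (lead_coeff P) t \<noteq> 0"
      using lead P(3)[of t] by (metis leading_coeff_0_iff)
    ultimately show ?thesis using cf d P(5)[OF t] by (simp add: c)
  qed
  then show ?thesis using P degP by blast
qed

text \<open>The product of \<open>pairing h x\<close> over the fibre at t has to be recognised as a
  polynomial in t and h. For one centre \<mu> the plane model describes the product of s - (y 3 +
  \<mu> y 4) over the fibre. A plane h asks for this product at \<mu> = h4 / h3, with h3 and h4 the
  values of h at \<open>b 3\<close> and \<open>b 4\<close>; having degree at most n in \<mu>, it is
  interpolated from n + 1 fixed centres. Off T the roots of the resulting \<open>R h\<close> are the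
  parameters of the points of the section, so \<open>card_roots_open\<close> gives the lower bound
  and a uniform degree bound gives N.\<close>

lemma section_bounds:
  assumes fr: "frame b y" and b3: "b 3 \<notin> K" and b4: "b 4 \<notin> K"
  shows "\<exists>N. generically (\<lambda>h. card (fibre y t0) \<le> card (C \<inter> hyperplane h) \<and> card (C \<inter> hyperplane h) \<le> N)"
proof -
  obtain N where N: "\<forall>t. card (fibre y t) \<le> N" using fibre_card_bounded[OF assms] by blast
  obtain t2 where t2: "\<And>t. card (fibre y t) \<le> card (fibre y t2)"
    using ex_has_greatest_nat[of "\<lambda>_. True" t0 "\<lambda>t. card (fibre y t)" "Suc N"] N by (auto simp: less_Suc_eq_le)
  define n where "n = card (fibre y t2)"
  note fin = fibre_finite[OF fr]
  \<comment> \<open>Parameters of centres on the curve, and of centres from which two points of the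
    largest fibre have the same image.\<close>
  define Bad where "Bad = {\<mu>. b 4 - \<mu> *s b 3 \<in> K} \<union>
    (\<lambda>(x, z). (pairing (y 3) x - pairing (y 3) z) / (pairing (y 4) z - pairing (y 4) x)) ` (fibre y t2 \<times> fibre y t2)"
  have "finite Bad" unfolding Bad_def using finite_bad_centres[OF fr] fin by auto
  then have "infinite (- Bad)" by (metis Compl_eq_Diff_UNIV finite_Diff2 infinite_UNIV_char_0)
  then obtain \<mu> :: "nat \<Rightarrow> complex" where \<mu>: "inj \<mu>" "range \<mu> \<subseteq> - Bad"
    using infinite_countable_subset by blast
  define \<Phi> where "\<Phi> j P T \<longleftrightarrow> finite T \<and> degree P = n \<and> degree P \<ge> 1 \<and> (\<forall>t. zp P t \<noteq> 0) \<and>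
    (\<forall>t. t \<notin> T \<longrightarrow> poly (lead_coeff P) t \<noteq> 0 \<and> card (fibre y t) = n \<and> rsquarefree (zp P t) \<and> degree (zp P t) = n \<and>
      (\<forall>s. ev P t s = poly (lead_coeff P) t * (\<Prod>x\<in>fibre y t. s - (pairing (y 3) x + \<mu> j * pairing (y 4) x))))" for j P T
  have model: "\<exists>P T. \<Phi> j P T" for j
    unfolding \<Phi>_def
  proof (rule fibre_model[OF fr])
    show "card (fibre y t) \<le> n" for t using t2 n_def by simp
    show "card (fibre y t2) = n" by (simp add: n_def)
    have nb: "\<mu> j \<notin> Bad" using \<mu>(2) by blast
    then show "b 4 - \<mu> j *s b 3 \<notin> K" by (simp add: Bad_def)
    show "inj_on (\<lambda>x. pairing (y 3) x + \<mu> j * pairing (y 4) x) (fibre y t2)"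
    proof (rule inj_onI, rule ccontr)
      fix x z assume xz: "x \<in> fibre y t2" "z \<in> fibre y t2" "x \<noteq> z"
        and eq: "pairing (y 3) x + \<mu> j * pairing (y 4) x = pairing (y 3) z + \<mu> j * pairing (y 4) z"
      have "pairing (y 4) x \<noteq> pairing (y 4) z"
      proof
        assume "pairing (y 4) x = pairing (y 4) z"
        then have "x = z" using eq xz frame_expand4[OF fr, of x] frame_expand4[OF fr, of z] by (simp add: fibre_def)
        then show False using xz by simp
      qed
      then have "\<mu> j = (pairing (y 3) x - pairing (y 3) z) / (pairing (y 4) z - pairing (y 4) x)"
        using eq by (simp add: field_simps)
      then have "\<mu> j \<in> Bad" unfolding Bad_def using xz by (auto intro!: image_eqI[of _ _ "(x, z)"])
      then show False using nb by simp
    qed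
  qed
  then obtain P where "\<forall>j. \<exists>T. \<Phi> j (P j) T" using choice[of "\<lambda>j P. \<exists>T. \<Phi> j P T"] by blast
  from choice[OF this] obtain T' where \<Phi>: "\<Phi> j (P j) (T' j)" for j by blast
  have PT: "finite (T' j)" "degree (P j) = n" "n \<ge> 1" "zp (P j) t \<noteq> 0"
    "t \<notin> T' j \<Longrightarrow> poly (lead_coeff (P j)) t \<noteq> 0" "t \<notin> T' j \<Longrightarrow> card (fibre y t) = n"
    "t \<notin> T' j \<Longrightarrow> rsquarefree (zp (P j) t) \<and> degree (zp (P j) t) = n"
    "t \<notin> T' j \<Longrightarrow> ev (P j) t s = poly (lead_coeff (P j)) t *
       (\<Prod>x\<in>fibre y t. s - (pairing (y 3) x + \<mu> j * pairing (y 4) x))" for j t s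
    using \<Phi>[of j] unfolding \<Phi>_def by auto
  define T where "T = (\<Union>j\<le>n. T' j)"
  have finT: "finite T" unfolding T_def using PT(1) by simp
  have T: "t \<notin> T' j" if "t \<notin> T" "j \<le> n" for t j using that unfolding T_def by blast
  \<comment> \<open>Multiplication by \<open>Lc j\<close> brings the leading coefficients of all
    models to the common value \<Lambda>, so that the interpolated products differ only in the
    centre.\<close>
  define Lc where "Lc j = (\<Prod>i\<in>{..n} - {j}. lead_coeff (P i))" for j
  define \<Lambda> where "\<Lambda> = (\<Prod>i\<le>n. lead_coeff (P i))"
  have Lc: "poly (Lc j) t * poly (lead_coeff (P j)) t = poly \<Lambda> t" if "j \<le> n" for j t
    unfolding Lc_def \<Lambda>_def poly_prod using that by (subst (2) prod.remove[of _ j]) auto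
  have \<Lambda>: "poly \<Lambda> t \<noteq> 0" if "t \<notin> T" for t
    unfolding \<Lambda>_def poly_prod using PT(5)[OF T[OF that]] by simp
  \<comment> \<open>The Lagrange basis polynomial at h4 / h3 and, in Q, the model j at the value of
    s determined by h, each multiplied by h3^n so that it is polynomial in h.\<close>
  define L where "L j h = (\<Prod>i\<in>{..n} - {j}. (pairing h (b 4) - \<mu> i * pairing h (b 3)) / (\<mu> j - \<mu> i))" for j h
  define Q where "Q j h = (\<Sum>i\<le>n. coeff (P j) i * [:- pairing h (b 1), - pairing h (b 2):] ^ i * [:pairing h (b 3) ^ (n - i):])" for j h
  define R where "R h = (\<Sum>j\<le>n. smult (L j h) (Lc j * Q j h))" for h
  let ?G = "range (\<lambda>i (x :: complex ^ 4). x $ i)"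
  have pg: "(\<lambda>h. pairing h v) \<in> generated_algebra ?G" for v :: "complex ^ 4"
    using pf_pairing[of v] unfolding poly_funs_def pairing_commute[of v, abs_def] by (simp add: eta_contract_eq)
  have Rfam: "polyfam ?G R"
    unfolding R_def[abs_def] L_def Q_def divide_inverse
    by (intro polyfam_sum polyfam_smult polyfam_mult polyfam_const polyfam_power polyfam_pCons
        ga_prod ga_mult ga_diff ga_minus ga_power ga_const pg)
  \<comment> \<open>By interpolation \<open>poly (R h) t\<close> is
    \<open>h3 ^ (2 * n) * poly \<Lambda> t\<close> times the product of
    \<open>- pairing h x / h3\<close> over the fibre.\<close>
  have Rval: "poly (R h) t = 0 \<longleftrightarrow> (\<exists>x\<in>fibre y t. pairing h x = 0)" if h3: "pairing h (b 3) \<noteq> 0" and t: "t \<notin> T" for h t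
  proof -
    define h3 where "h3 = pairing h (b 3)"
    define s where "s = - (pairing h (b 1) + t * pairing h (b 2)) / h3"
    define m where "m = pairing h (b 4) / h3"
    have h3nz: "h3 \<noteq> 0" using h3 h3_def by simp
    define q where "q = (\<Prod>x\<in>fibre y t. [:s - pairing (y 3) x, - pairing (y 4) x:])"
    have qv: "poly q w = (\<Prod>x\<in>fibre y t. s - (pairing (y 3) x + w * pairing (y 4) x))" for w
      unfolding q_def poly_prod by (intro prod.cong) (auto simp: algebra_simps)
    have "degree q \<le> (\<Sum>x\<in>fibre y t. degree [:s - pairing (y 3) x, - pairing (y 4) x:])"
      unfolding q_def using degree_prod_sum_le[OF fin] by (simp add: o_def del: degree_pCons_eq_if)
    also have "\<dots> \<le> (\<Sum>x\<in>fibre y t. 1)" by (intro sum_mono) simp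
    also have "\<dots> = n" using PT(6)[OF T[OF t], of 0] by simp
    finally have dq: "degree q \<le> n" .
    have Qv: "poly (Q j h) t = h3 ^ n * ev (P j) t s" if "j \<le> n" for j
    proof -
      have "h3 ^ n * ev (P j) t s = h3 ^ n * (\<Sum>i\<le>n. poly (coeff (P j) i) t * s ^ i)"
        unfolding poly_zp[symmetric] using PT(7)[OF T[OF t that]] by (simp add: poly_altdef)
      also have "\<dots> = (\<Sum>i\<le>n. poly (coeff (P j) i) t * (h3 * s) ^ i * h3 ^ (n - i))"
        unfolding sum_distrib_left
        by (intro sum.cong) (auto simp: power_mult_distrib power_add[symmetric] mult_ac)
      also have "h3 * s = - pairing h (b 1) - t * pairing h (b 2)" using h3nz by (simp add: s_def)
      finally show ?thesis unfolding Q_def by (simp add: poly_sum poly_power h3_def mult_ac)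
    qed
    have Lv: "L j h = h3 ^ n * (\<Prod>i\<in>{..n} - {j}. (m - \<mu> i) / (\<mu> j - \<mu> i))" if "j \<le> n" for j
    proof -
      have "h3 ^ n = (\<Prod>i\<in>{..n} - {j}. h3)" using that by simp
      then have "h3 ^ n * (\<Prod>i\<in>{..n} - {j}. (m - \<mu> i) / (\<mu> j - \<mu> i)) = (\<Prod>i\<in>{..n} - {j}. h3 * ((m - \<mu> i) / (\<mu> j - \<mu> i)))"
        by (simp only: prod.distrib)
      also have "\<dots> = L j h"
        unfolding L_def by (intro prod.cong refl) (use h3nz in \<open>simp add: m_def h3_def right_diff_distrib mult.commute\<close>)
      finally show ?thesis by simp
    qed
    have "poly (R h) t = (\<Sum>j\<le>n. L j h * (poly (Lc j) t * poly (Q j h) t))" by (simp add: R_def poly_sum)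
    also have "\<dots> = (\<Sum>j\<le>n. (h3 ^ (2 * n) * poly \<Lambda> t) * (poly q (\<mu> j) * (\<Prod>i\<in>{..n} - {j}. (m - \<mu> i) / (\<mu> j - \<mu> i))))"
    proof (rule sum.cong[OF refl])
      fix j assume "j \<in> {..n}"
      then have j: "j \<le> n" by simp
      have e: "ev (P j) t s = poly (lead_coeff (P j)) t * poly q (\<mu> j)" unfolding qv by (rule PT(8)[OF T[OF t j]])
      define A where "A = (\<Prod>i\<in>{..n} - {j}. (m - \<mu> i) / (\<mu> j - \<mu> i))"
      show "L j h * (poly (Lc j) t * poly (Q j h) t) = (h3 ^ (2 * n) * poly \<Lambda> t) * (poly q (\<mu> j) * (\<Prod>i\<in>{..n} - {j}. (m - \<mu> i) / (\<mu> j - \<mu> i)))"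
        unfolding Lv[OF j] Qv[OF j] e Lc[OF j, of t, symmetric] A_def[symmetric] by (simp add: mult_2 power_add)
    qed
    also have "\<dots> = h3 ^ (2 * n) * poly \<Lambda> t * poly q m"
      unfolding sum_distrib_left[symmetric] lagrange_interpolation[OF dq inj_on_subset[OF \<mu>(1) subset_UNIV]] ..
    finally have "poly (R h) t = 0 \<longleftrightarrow> poly q m = 0" using h3nz \<Lambda>[OF t] by simp
    also have "\<dots> \<longleftrightarrow> (\<exists>x\<in>fibre y t. pairing h x = 0)"
    proof -
      have alg: "- (p1 + t * p2) / h3 - (a + p4 / h3 * c) = - (p1 + t * p2 + a * h3 + c * p4) / h3" for p1 p2 p4 a c
      proof -
        have "(- (p1 + t * p2) / h3 - (a + p4 / h3 * c)) * h3 = - (p1 + t * p2 + a * h3 + c * p4)"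
          using h3nz by (simp add: left_diff_distrib distrib_right)
        then show ?thesis using h3nz by (metis nonzero_mult_div_cancel_right)
      qed
      have "s - (pairing (y 3) x + m * pairing (y 4) x) = - pairing h x / h3" if "x \<in> fibre y t" for x
        unfolding fibre_expand[OF fr that, of h] s_def m_def h3_def[symmetric] by (rule alg)
      then have "s - (pairing (y 3) x + m * pairing (y 4) x) = 0 \<longleftrightarrow> pairing h x = 0" if "x \<in> fibre y t" for x
        using that h3nz by simp
      then show ?thesis unfolding qv using fin by auto
    qed
    finally show ?thesis .
  qed
  have secfin: "finite (C \<inter> hyperplane h)" if "h \<noteq> 0" for h
    unfolding hyperplane_section by (rule K_finite_hyperplane[OF that])
  have pick: "card S \<le> card (C \<inter> hyperplane h)"
    if h: "h \<noteq> 0" and S: "finite S" "\<And>t. t \<in> S \<Longrightarrow> \<exists>x\<in>fibre y t. pairing h x = 0" for S h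
  proof -
    obtain x where x: "\<And>t. t \<in> S \<Longrightarrow> x t \<in> fibre y t \<and> pairing h (x t) = 0" using S(2) by metis
    have nz: "x t \<noteq> 0" if "t \<in> S" for t using x[OF that] by (auto simp: fibre_def)
    have "inj_on (\<lambda>t. vec.span {x t}) S"
    proof (rule inj_onI)
      fix t t' assume tt: "t \<in> S" "t' \<in> S" "vec.span {x t} = vec.span {x t'}"
      have f: "x t \<in> fibre y t" "x t' \<in> fibre y t'" using x tt(1,2) by blast+
      then have "x t = x t'"
        by (intro inj_onD[OF span_inj_normalized[of "y 1"] tt(3)]) (simp_all add: fibre_def)
      then show "t = t'" using f by (simp add: fibre_def)
    qed
    then have "card ((\<lambda>t. vec.span {x t}) ` S) = card S" by (rule card_image)
    moreover have "(\<lambda>t. vec.span {x t}) ` S \<subseteq> C \<inter> hyperplane h"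
      unfolding hyperplane_section using x nz by (auto simp: fibre_def)
    ultimately show ?thesis using card_mono[OF secfin[OF h]] by metis
  qed
  have Rnz: "R h \<noteq> 0" if h3: "pairing h (b 3) \<noteq> 0" for h
  proof
    assume R0: "R h = 0"
    have h: "h \<noteq> 0" using h3 by auto
    have "infinite (- T)" using finT by (metis Compl_eq_Diff_UNIV finite_Diff2 infinite_UNIV_char_0)
    then obtain S where S: "S \<subseteq> - T" "finite S" "card S = Suc (card (C \<inter> hyperplane h))"
      using infinite_arbitrarily_large by blast
    have "\<exists>x\<in>fibre y t. pairing h x = 0" if "t \<in> S" for t
      using Rval[OF h3, of t] R0 S(1) that by auto
    from pick[OF h S(2) this] show False using S(3) by simp
  qed
  \<comment> \<open>Vanishes exactly on T. Counting the roots of \<Theta> times \<open>R h\<close>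
    and subtracting \<open>card T\<close> counts roots off T, with no control over
    \<open>R h\<close> on T.\<close>
  define \<Theta> where "\<Theta> = (\<Prod>t\<in>T. [:-t, 1:])"
  have \<Theta>: "poly \<Theta> t = 0 \<longleftrightarrow> t \<in> T" for t unfolding \<Theta>_def poly_prod prod_zero_iff[OF finT] by simp
  obtain t1 where t1: "t1 \<notin> T" using complex_avoid_finite[OF finT] by blast
  have "poly \<Theta> t1 \<noteq> 0" using \<Theta>[of t1] t1 by simp
  then have \<Theta>nz: "\<Theta> \<noteq> 0" by (metis poly_0)
  have "\<exists>h. pairing h (b 3) \<noteq> 0 \<and> n + card T \<le> card {t. poly (\<Theta> * R h) t = 0}"
  proof -
    \<comment> \<open>Planes of the pencil itself have too few parameters t, so the plane over t1 is
      tilted. In model 0, \<open>p \<epsilon>\<close> is the restriction to the line t = t1 +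
      \<epsilon> s; for \<epsilon> = 0 it has the n roots of the fibre over t1.\<close>
    define p where "p \<epsilon> = (\<Sum>i\<le>n. pcompose (coeff (P 0) i) [:t1, \<epsilon>:] * [:0, 1:] ^ i)" for \<epsilon>
    have pfam: "polyfam {\<lambda>x. x} p"
      unfolding p_def[abs_def]
      by (intro polyfam_sum polyfam_mult polyfam_pcompose polyfam_pCons polyfam_const ga_const ga_gen) auto
    have pv: "poly (p \<epsilon>) s = ev (P 0) (t1 + \<epsilon> * s) s" for \<epsilon> s
    proof -
      have "ev (P 0) (t1 + \<epsilon> * s) s = (\<Sum>i\<le>n. poly (coeff (P 0) i) (t1 + \<epsilon> * s) * s ^ i)"
        unfolding ev_def poly_altdef[of "P 0"] PT(2) by (simp add: poly_sum poly_power)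
      then show ?thesis unfolding p_def by (simp add: poly_sum poly_pcompose poly_power mult.commute)
    qed
    have p0: "p 0 = zp (P 0) t1" by (rule poly_ext) (simp add: pv)
    have t10: "t1 \<notin> T' 0" by (rule T[OF t1]) simp
    have "card {s. poly (zp (P 0) t1) s = 0} = degree (zp (P 0) t1)"
      by (rule rsquarefree_card_roots[OF conjunct1[OF PT(7)[OF t10]]])
    also have "\<dots> = n" by (rule conjunct2[OF PT(7)[OF t10]])
    finally have "n \<le> card {s. poly (p 0) s = 0}" unfolding p0 by (rule eq_refl[OF sym])
    moreover have "p 0 \<noteq> 0" unfolding p0 by (rule PT(4))
    ultimately have "\<exists>g\<in>generated_algebra {\<lambda>x. x}. g 0 \<noteq> 0 \<and>
        (\<forall>\<epsilon>. g \<epsilon> \<noteq> 0 \<longrightarrow> p \<epsilon> \<noteq> 0 \<and> n \<le> card {s. poly (p \<epsilon>) s = 0})"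
      by (intro card_roots_open[OF pfam])
    then obtain g where g: "g \<in> generated_algebra {\<lambda>x. x}" "g 0 \<noteq> 0"
      "\<And>\<epsilon>. g \<epsilon> \<noteq> 0 \<Longrightarrow> p \<epsilon> \<noteq> 0 \<and> n \<le> card {s. poly (p \<epsilon>) s = 0}"
      by blast
    then obtain g' where g': "g = poly g'" unfolding ga_univariate by blast
    have "g' \<noteq> 0" using g(2) g' by auto
    \<comment> \<open>Besides 0 and the nongeneric values, excludes those \<epsilon> for which a
      root s gives a parameter t1 + \<epsilon> s in T.\<close>
    define E where "E = {0} \<union> {\<epsilon>. poly g' \<epsilon> = 0} \<union> (\<Union>t\<in>T. (\<lambda>s. (t - t1) / s) ` {s. poly (zp (P 0) t) s = 0})"
    have "finite E" unfolding E_def using finT poly_roots_finite[OF PT(4)] poly_roots_finite[OF \<open>g' \<noteq> 0\<close>] by auto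
    then obtain \<epsilon> where \<epsilon>: "\<epsilon> \<notin> E" using complex_avoid_finite by blast
    then have \<epsilon>0: "\<epsilon> \<noteq> 0" "p \<epsilon> \<noteq> 0" "n \<le> card {s. poly (p \<epsilon>) s = 0}" using g(3) g' by (auto simp: E_def)
    have notT: "t1 + \<epsilon> * s \<notin> T" if s: "poly (p \<epsilon>) s = 0" for s
    proof
      assume tT: "t1 + \<epsilon> * s \<in> T"
      then have "s \<noteq> 0" using t1 by auto
      then have "\<epsilon> = (t1 + \<epsilon> * s - t1) / s" by simp
      moreover have "poly (zp (P 0) (t1 + \<epsilon> * s)) s = 0" using s pv by simp
      ultimately have "\<epsilon> \<in> E" unfolding E_def using tT by blast
      then show False using \<epsilon> by simp
    qed
    \<comment> \<open>The plane over the tilted line through the centre of model 0: on a fibre point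
      with projected coordinate s it takes the value (t - t1) / \<epsilon> - s.\<close>
    define h where "h = (1 / \<epsilon>) *s (y 2 - t1 *s y 1) - (y 3 + \<mu> 0 *s y 4)"
    have hb: "pairing h (b 3) = - 1"
      by (simp add: h_def pairing_diff_left pairing_add_left pairing_scale_left frameD[OF fr])
    have root: "poly (R h) (t1 + \<epsilon> * s) = 0" if s: "poly (p \<epsilon>) s = 0" for s
    proof -
      have "ev (P 0) (t1 + \<epsilon> * s) s = 0" using s pv by simp
      then have "(\<Prod>x\<in>fibre y (t1 + \<epsilon> * s). s - (pairing (y 3) x + \<mu> 0 * pairing (y 4) x)) = 0"
        using PT(8)[OF T[OF notT[OF s]], of 0] PT(5)[OF T[OF notT[OF s]], of 0] by simp
      then obtain x where x: "x \<in> fibre y (t1 + \<epsilon> * s)" "s = pairing (y 3) x + \<mu> 0 * pairing (y 4) x" using fin by auto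
      have "pairing h x = (1 / \<epsilon>) * (t1 + \<epsilon> * s - t1) - s"
        using x(1) unfolding h_def fibre_def by (simp add: pairing_diff_left pairing_add_left pairing_scale_left x(2))
      then have "pairing h x = 0" using \<epsilon>0(1) by simp
      then show ?thesis using Rval[OF _ notT[OF s], of h] hb x(1) by auto
    qed
    have inj: "inj_on (\<lambda>s. t1 + \<epsilon> * s) A" for A using \<epsilon>0(1) by (auto simp: inj_on_def)
    have "n + card T \<le> card ((\<lambda>s. t1 + \<epsilon> * s) ` {s. poly (p \<epsilon>) s = 0}) + card T"
      using \<epsilon>0(3) by (simp add: card_image[OF inj])
    also have "\<dots> = card ((\<lambda>s. t1 + \<epsilon> * s) ` {s. poly (p \<epsilon>) s = 0} \<union> T)"
      using notT finT poly_roots_finite[OF \<epsilon>0(2)] by (intro card_Un_disjoint[symmetric]) auto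
    also have "\<dots> \<le> card {t. poly (\<Theta> * R h) t = 0}"
      using root \<Theta> Rnz[of h] hb \<Theta>nz by (intro card_mono poly_roots_finite) auto
    finally show ?thesis using hb by (intro exI[of _ h]) auto
  qed
  then obtain h0 where h0: "pairing h0 (b 3) \<noteq> 0" "n + card T \<le> card {t. poly (\<Theta> * R h0) t = 0}" by blast
  have fam: "polyfam ?G (\<lambda>h. \<Theta> * R h)" by (intro polyfam_mult polyfam_const Rfam)
  have "\<Theta> * R h0 \<noteq> 0" using \<Theta>nz Rnz[OF h0(1)] by simp
  from card_roots_open[OF fam this h0(2)] obtain g where g: "g \<in> poly_funs" "g h0 \<noteq> 0"
    "\<And>h. g h \<noteq> 0 \<Longrightarrow> \<Theta> * R h \<noteq> 0 \<and> n + card T \<le> card {t. poly (\<Theta> * R h) t = 0}"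
    unfolding poly_funs_def by blast
  \<comment> \<open>Bounds for the degree of \<open>R h\<close> that do not depend on h.\<close>
  define N1 where "N1 = Max ((\<lambda>j. degree (Lc j)) ` {..n})"
  define N2 where "N2 = Max ((\<lambda>(j, i). degree (coeff (P j) i) + n) ` ({..n} \<times> {..n}))"
  define N0 where "N0 = N1 + N2"
  have degQ: "degree (Q j h) \<le> N2" if j: "j \<le> n" for j h
    unfolding Q_def
  proof (intro degree_sum_le)
    fix i assume i: "i \<in> {..n}"
    have "degree ([:- pairing h (b 1), - pairing h (b 2):] ^ i) \<le> degree [:- pairing h (b 1), - pairing h (b 2):] * i"
      by (rule degree_power_le)
    also have "\<dots> \<le> 1 * n" using i by (intro mult_mono) auto
    finally have "degree (coeff (P j) i * [:- pairing h (b 1), - pairing h (b 2):] ^ i * [:pairing h (b 3) ^ (n - i):]) \<le> degree (coeff (P j) i) + n + 0"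
      by (intro order_trans[OF degree_mult_le] add_mono) auto
    also have "degree (coeff (P j) i) + n \<le> N2" unfolding N2_def by (rule Max_ge) (use i j in auto)
    finally show "degree (coeff (P j) i * [:- pairing h (b 1), - pairing h (b 2):] ^ i * [:pairing h (b 3) ^ (n - i):]) \<le> N2"
      by simp
  qed simp
  have degR: "degree (R h) \<le> N0" for h
    unfolding R_def
  proof (intro degree_sum_le)
    fix j assume j: "j \<in> {..n}"
    have "degree (Lc j) \<le> N1" unfolding N1_def by (rule Max_ge) (use j in auto)
    then show "degree (smult (L j h) (Lc j * Q j h)) \<le> N0"
      unfolding N0_def using degQ[of j h] j
      by (intro order_trans[OF degree_smult_le] order_trans[OF degree_mult_le] add_mono) auto
  qed simp
  \<comment> \<open>The points that \<open>R h\<close> does not see: those outside the chart y 1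
    \<noteq> 0 and those over T.\<close>
  define E0 where "E0 = {vec.span {x} | x. x \<in> K \<and> x \<noteq> 0 \<and> pairing (y 1) x = 0} \<union>
    (\<Union>t\<in>T. {vec.span {x} | x. x \<in> K \<and> x \<noteq> 0 \<and> pairing (y 2 - t *s y 1) x = 0})"
  have y2: "y 2 - t *s y 1 \<noteq> 0" for t
  proof
    assume "y 2 - t *s y 1 = 0"
    then have "pairing (y 2 - t *s y 1) (b 2) = 0" by simp
    then show False by (simp add: pairing_diff_left pairing_scale_left frameD[OF fr])
  qed
  have finE0: "finite E0"
    unfolding E0_def using finT K_finite_hyperplane[OF frame_nonzero(2)[OF fr]] K_finite_hyperplane[OF y2] by blast
  have "generically (\<lambda>h. g h \<noteq> 0 \<and> pairing (b 3) h \<noteq> 0)"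
    by (intro generically_conj generically_nonzero[OF g(1,2)] generically_nonzero[OF pf_pairing, of _ h0])
      (use h0 in \<open>simp add: pairing_commute\<close>)
  then have "generically (\<lambda>h. card (fibre y t0) \<le> card (C \<inter> hyperplane h) \<and> card (C \<inter> hyperplane h) \<le> N0 * n + card E0)"
  proof (rule generically_mono)
    fix h assume h: "g h \<noteq> 0 \<and> pairing (b 3) h \<noteq> 0"
    then have h3: "pairing h (b 3) \<noteq> 0" "h \<noteq> 0" by (auto simp: pairing_commute)
    define S where "S = {t. poly (\<Theta> * R h) t = 0} - T"
    have finroots: "finite {t. poly (\<Theta> * R h) t = 0}" using g(3)[of h] h by (intro poly_roots_finite) auto
    have "n \<le> card S" using g(3)[of h] h unfolding S_def
      by (subst card_Diff_subset) (use finT \<Theta> in auto)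
    have "finite S" unfolding S_def using finroots by simp
    have "\<exists>x\<in>fibre y t. pairing h x = 0" if "t \<in> S" for t
      using that Rval[OF h3(1), of t] \<Theta>[of t] unfolding S_def by auto
    from pick[OF h3(2) \<open>finite S\<close> this] have "card (fibre y t0) \<le> card (C \<inter> hyperplane h)"
      using \<open>n \<le> card S\<close> t2[of t0] n_def by linarith
    moreover have "card (C \<inter> hyperplane h) \<le> N0 * n + card E0"
    proof -
      let ?U = "\<Union>t\<in>{t. poly (R h) t = 0}. (\<lambda>x. vec.span {x}) ` fibre y t"
      have finR: "finite {t. poly (R h) t = 0}" by (rule poly_roots_finite[OF Rnz[OF h3(1)]])
      have "C \<inter> hyperplane h \<subseteq> ?U \<union> E0"
      proof
        fix l assume "l \<in> C \<inter> hyperplane h"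
        then obtain x where x: "l = vec.span {x}" "x \<in> K" "x \<noteq> 0" "pairing h x = 0" unfolding hyperplane_section by blast
        show "l \<in> ?U \<union> E0"
        proof (cases "pairing (y 1) x = 0")
          case True
          then show ?thesis unfolding E0_def using x by blast
        next
          case False
          define x' where "x' = (1 / pairing (y 1) x) *s x"
          define t where "t = pairing (y 2) x / pairing (y 1) x"
          have x': "x' \<in> fibre y t" "pairing h x' = 0"
            unfolding fibre_def x'_def t_def using False x K_scale by (auto simp: pairing_scale)
          have "x' \<noteq> 0" using False x(3) by (simp add: x'_def)
          then have l: "l = vec.span {x'}"
            unfolding x(1) span_eq_iff[OF x(3) \<open>x' \<noteq> 0\<close>] using False by (intro exI[of _ "pairing (y 1) x"]) (simp add: x'_def)
          show ?thesis
          proof (cases "t \<in> T")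
            case True
            have "pairing (y 2 - t *s y 1) x = 0" using False by (simp add: t_def pairing_diff_left pairing_scale_left)
            then have "l \<in> {vec.span {x} | x. x \<in> K \<and> x \<noteq> 0 \<and> pairing (y 2 - t *s y 1) x = 0}" using x by blast
            then show ?thesis unfolding E0_def using True by blast
          next
            case tT: False
            then have "poly (R h) t = 0" using Rval[OF h3(1) tT] x' by blast
            then show ?thesis using l x'(1) by blast
          qed
        qed
      qed
      then have "card (C \<inter> hyperplane h) \<le> card (?U \<union> E0)"
        using finR fin finE0 by (intro card_mono) auto
      also have "\<dots> \<le> card ?U + card E0" by (rule card_Un_le)
      also have "card ?U \<le> (\<Sum>t\<in>{t. poly (R h) t = 0}. card ((\<lambda>x. vec.span {x}) ` fibre y t))"
        by (rule card_UN_le[OF finR])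
      also have "\<dots> \<le> (\<Sum>t\<in>{t. poly (R h) t = 0}. n)"
        by (intro sum_mono order_trans[OF card_image_le[OF fin]]) (use t2 n_def in auto)
      also have "\<dots> \<le> N0 * n"
        using card_poly_roots_bound[OF Rnz[OF h3(1)]] degR[of h] by simp
      finally show ?thesis by simp
    qed
    ultimately show "card (fibre y t0) \<le> card (C \<inter> hyperplane h) \<and> card (C \<inter> hyperplane h) \<le> N0 * n + card E0" ..
  qed
  then show ?thesis by blast
qed

text \<open>With h as y 2 and a form u that is nonzero on the whole section as y 1, the given
  section becomes the fibre over t = 0, to which \<open>section_bounds\<close> applies.\<close>

lemma adapted_frame:
  assumes "h \<noteq> 0"
  shows "\<exists>b y. frame b y \<and> b 3 \<notin> K \<and> b 4 \<notin> K \<and> card (C \<inter> hyperplane h) \<le> card (fibre y 0)"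
proof -
  \<comment> \<open>A nonzero vector in the plane of h. Requiring u to be nonzero there keeps u
    independent of h even when the section is empty.\<close>
  define x' :: "complex ^ 4" where "x' = (if h $ 1 = 0 \<and> h $ 2 = 0 then axis 1 1 else (\<chi> i. if i = 1 then h $ 2 else if i = 2 then - h $ 1 else 0))"
  have x': "x' \<noteq> 0" "pairing h x' = 0"
    by (auto simp: x'_def vec_eq_iff pairing_axis forall_4) (simp_all add: pairing_def sum_4)
  define S where "S = {vec.span {x} | x. x \<in> K \<and> x \<noteq> 0 \<and> pairing h x = 0}"
  have "finite S" unfolding S_def by (rule K_finite_hyperplane[OF assms])
  have "\<forall>l\<in>S. \<exists>x. l = vec.span {x} \<and> x \<in> K \<and> x \<noteq> 0 \<and> pairing h x = 0" unfolding S_def by blast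
  from bchoice[OF this] obtain r where r: "\<And>l. l \<in> S \<Longrightarrow> l = vec.span {r l} \<and> r l \<in> K \<and> r l \<noteq> 0 \<and> pairing h (r l) = 0" by blast
  have "x \<noteq> 0" if "x \<in> insert x' (r ` S)" for x using that r x'(1) by auto
  then obtain u where u: "\<forall>x\<in>insert x' (r ` S). pairing u x \<noteq> 0"
    using nonzero_form_on_finite_set[of "insert x' (r ` S)"] \<open>finite S\<close> by blast
  have "a = 0 \<and> c = 0" if "a *s u + c *s h = 0" for a c
  proof -
    have "pairing (a *s u + c *s h) x' = 0" using that by simp
    then have "a = 0" using u x'(2) by (simp add: pairing_add_left pairing_scale_left)
    then show ?thesis using that assms by simp
  qed
  from frame_exists[OF this] obtain y b where "frame y b" and y: "y 1 = u" "y 2 = h" by blast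
  from frame_sym[OF \<open>frame y b\<close>] have fr: "frame b y" .
  have nz: "pairing (y 1) x \<noteq> 0" if x: "x \<in> K" "x \<noteq> 0" "pairing h x = 0" for x
  proof -
    have "vec.span {x} \<in> S" unfolding S_def using x by blast
    from r[OF this] obtain k where "x = k *s r (vec.span {x})" "k \<noteq> 0" using span_eq_iff[OF x(2)] by metis
    then show ?thesis using u \<open>vec.span {x} \<in> S\<close> unfolding y by (metis image_eqI insertCI mult_eq_0_iff pairing_scale)
  qed
  have b34: "b 3 \<notin> K" "b 4 \<notin> K"
    using nz[of "b 3", OF _ frame_nonzero(1)[OF fr]] nz[of "b 4", OF _ frame_nonzero(1)[OF fr]]
      frameD[OF fr, of 1 3] frameD[OF fr, of 2 3] frameD[OF fr, of 1 4] frameD[OF fr, of 2 4] y(2) by auto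
  have "C \<inter> hyperplane h \<subseteq> (\<lambda>x. vec.span {x}) ` fibre y 0"
  proof
    fix l assume "l \<in> C \<inter> hyperplane h"
    then obtain x where x: "l = vec.span {x}" "x \<in> K" "x \<noteq> 0" "pairing h x = 0" unfolding hyperplane_section by blast
    define x2 where "x2 = (1 / pairing (y 1) x) *s x"
    have "x2 \<in> fibre y 0" unfolding fibre_def x2_def using nz[OF x(2-4)] x y K_scale by (auto simp: pairing_scale)
    moreover have "x2 \<noteq> 0" using nz[OF x(2-4)] x(3) by (simp add: x2_def)
    then have "l = vec.span {x2}"
      unfolding x(1) span_eq_iff[OF x(3) \<open>x2 \<noteq> 0\<close>] using nz[OF x(2-4)] by (intro exI[of _ "pairing (y 1) x"]) (simp add: x2_def)
    ultimately show "l \<in> (\<lambda>x. vec.span {x}) ` fibre y 0" by blast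
  qed
  then have "card (C \<inter> hyperplane h) \<le> card ((\<lambda>x. vec.span {x}) ` fibre y 0)"
    using fibre_finite[OF fr] by (intro card_mono) auto
  also have "\<dots> \<le> card (fibre y 0)" by (rule card_image_le[OF fibre_finite[OF fr]])
  finally show ?thesis using fr b34 by blast
qed

text \<open>Every section bounds the generic one from below, and all counts have a common bound
  because two generic conditions can be met together. A section with the largest count therefore has
  the generic count.\<close>

lemma curve_degree_bound:
  assumes "h \<noteq> 0" shows "card (C \<inter> hyperplane h) \<le> curve_degree C"
proof -
  have lower: "\<exists>N. generically (\<lambda>h'. card (C \<inter> hyperplane h) \<le> card (C \<inter> hyperplane h') \<and> card (C \<inter> hyperplane h') \<le> N)"
    if h0: "h \<noteq> 0" for h
  proof -
    obtain b y where by': "frame b y" "b 3 \<notin> K" "b 4 \<notin> K" "card (C \<inter> hyperplane h) \<le> card (fibre y 0)"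
      using adapted_frame[OF h0] by blast
    obtain N where "generically (\<lambda>h'. card (fibre y 0) \<le> card (C \<inter> hyperplane h') \<and> card (C \<inter> hyperplane h') \<le> N)"
      using section_bounds[OF by'(1-3)] by blast
    then show ?thesis using by'(4) by (intro exI[of _ N]) (elim generically_mono, linarith)
  qed
  obtain N where "generically (\<lambda>h'. card (C \<inter> hyperplane h) \<le> card (C \<inter> hyperplane h') \<and> card (C \<inter> hyperplane h') \<le> N)"
    using lower[OF assms] by blast
  then have N: "generically (\<lambda>h'. card (C \<inter> hyperplane h') \<le> N)" by (rule generically_mono) blast
  have bound: "card (C \<inter> hyperplane h) \<le> N" if h0: "h \<noteq> 0" for h
  proof -
    obtain N' where "generically (\<lambda>h'. card (C \<inter> hyperplane h) \<le> card (C \<inter> hyperplane h') \<and> card (C \<inter> hyperplane h') \<le> N')"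
      using lower[OF h0] by blast
    from generically_ex[OF generically_conj[OF N this]] show ?thesis by auto
  qed
  obtain h1 where h1: "h1 \<noteq> 0" "\<And>h. h \<noteq> 0 \<Longrightarrow> card (C \<inter> hyperplane h) \<le> card (C \<inter> hyperplane h1)"
    using ex_has_greatest_nat[of "\<lambda>h. h \<noteq> 0" h "\<lambda>h. card (C \<inter> hyperplane h)" "Suc N"] bound assms
    by (auto simp: less_Suc_eq_le)
  obtain N' where N': "generically (\<lambda>h'. card (C \<inter> hyperplane h1) \<le> card (C \<inter> hyperplane h') \<and> card (C \<inter> hyperplane h') \<le> N')"
    using lower[OF h1(1)] by blast
  have "generically (\<lambda>h :: complex ^ 4. h $ 1 \<noteq> 0)"
    by (rule generically_nonzero[OF pf_coord, where x = "axis 1 1"]) simp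
  from generically_conj[OF N' this]
  have "generically (\<lambda>h. finite (C \<inter> hyperplane h) \<and> card (C \<inter> hyperplane h) = card (C \<inter> hyperplane h1))"
  proof (rule generically_mono)
    fix h assume h: "(card (C \<inter> hyperplane h1) \<le> card (C \<inter> hyperplane h) \<and> card (C \<inter> hyperplane h) \<le> N') \<and> h $ 1 \<noteq> 0"
    then have "h \<noteq> 0" by auto
    then show "finite (C \<inter> hyperplane h) \<and> card (C \<inter> hyperplane h) = card (C \<inter> hyperplane h1)"
      using h h1(2)[of h] K_finite_hyperplane[of h] by (simp add: hyperplane_section)
  qed
  then have "curve_degree C = card (C \<inter> hyperplane h1)" unfolding curve_degree_def by (rule generic_card_eq)
  then show ?thesis using h1(2)[OF assms] by simp
qed

end

section \<open>Binary forms\<close>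

text \<open>Homogenization of f in degree m, with affine parameter t / s. Coefficients beyond m are
  dropped, hence the degree bounds in the lemmas.\<close>

definition bform :: "nat \<Rightarrow> complex poly \<Rightarrow> complex \<Rightarrow> complex \<Rightarrow> complex" where
  "bform m f s t = (\<Sum>i\<le>m. coeff f i * s ^ (m - i) * t ^ i)"

lemma bform_affine:
  assumes "degree f \<le> m" "s \<noteq> 0" shows "bform m f s t = s ^ m * poly f (t / s)"
proof -
  have "poly f (t / s) = (\<Sum>i\<le>m. coeff f i * (t / s) ^ i)"
    unfolding poly_altdef using assms(1) by (intro sum.mono_neutral_left) (auto simp: coeff_eq_0)
  then have "s ^ m * poly f (t / s) = (\<Sum>i\<le>m. s ^ m * (coeff f i * (t / s) ^ i))"
    by (simp add: sum_distrib_left)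
  also have "\<dots> = bform m f s t"
    unfolding bform_def
  proof (rule sum.cong[OF refl])
    fix i assume "i \<in> {..m}"
    then have "s ^ m = s ^ (m - i) * s ^ i" by (simp add: power_add[symmetric])
    then show "s ^ m * (coeff f i * (t / s) ^ i) = coeff f i * s ^ (m - i) * t ^ i"
      using assms(2) by (simp add: power_divide)
  qed
  finally show ?thesis by simp
qed

lemma bform_infinity: "bform m f 0 t = coeff f m * t ^ m"
proof -
  have "bform m f 0 t = (\<Sum>i\<in>{m}. coeff f i * 0 ^ (m - i) * t ^ i)"
    unfolding bform_def by (intro sum.mono_neutral_right) auto
  then show ?thesis by simp
qed

lemma bform_scale: "bform m f (c * s) (c * t) = c ^ m * bform m f s t"
proof -
  have "c ^ m = c ^ (m - i) * c ^ i" if "i \<le> m" for i using that by (simp add: power_add[symmetric])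
  then show ?thesis
    unfolding bform_def sum_distrib_left by (intro sum.cong) (auto simp: power_mult_distrib mult_ac)
qed

lemma bform_in_algebra:
  assumes "f \<in> generated_algebra G" "g \<in> generated_algebra G"
  shows "(\<lambda>x. bform m p (f x) (g x)) \<in> generated_algebra G"
  unfolding bform_def by (intro ga_sum ga_mult ga_const ga_power assms)

lemma bform_add: "bform m (f + g) s t = bform m f s t + bform m g s t"
  by (simp add: bform_def distrib_right sum.distrib)

lemma bform_diff: "bform m (f - g) s t = bform m f s t - bform m g s t"
  by (simp add: bform_def left_diff_distrib sum_subtractf)

lemma bform_smult: "bform m (smult c f) s t = c * bform m f s t"
  by (simp add: bform_def sum_distrib_left mult_ac)

lemma bform_0 [simp]: "bform m 0 s t = 0"
  by (simp add: bform_def)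

lemma bform_sum: "bform m (\<Sum>i\<in>I. f i) s t = (\<Sum>i\<in>I. bform m (f i) s t)"
  by (induction I rule: infinite_finite_induct) (simp_all add: bform_add)

text \<open>Every point \<open>(s, t)\<close> lies on a line that meets the exceptional set finitely often.\<close>

lemma binary_density:
  assumes F: "F \<in> generated_algebra {fst, snd :: complex \<times> complex \<Rightarrow> complex}" and T: "finite T"
    and zero: "\<And>s t. s \<noteq> 0 \<Longrightarrow> t / s \<notin> T \<Longrightarrow> F (s, t) = 0"
  shows "F (s, t) = 0"
proof -
  obtain t1 where t1: "t1 \<notin> T" using complex_avoid_finite[OF T] by blast
  have "(\<lambda>\<tau>. F (s + \<tau>, t + \<tau> * t1)) \<in> generated_algebra {\<lambda>x. x}"
  proof (rule ga_comp[OF F])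
    have "(\<lambda>\<tau>. s + \<tau>) \<in> generated_algebra {\<lambda>x. x}" "(\<lambda>\<tau>. t + \<tau> * t1) \<in> generated_algebra {\<lambda>x. x}"
      by (intro ga_add ga_mult ga_const ga_gen, simp)+
    then show "(\<lambda>\<tau>. g (s + \<tau>, t + \<tau> * t1)) \<in> generated_algebra {\<lambda>x. x}" if "g \<in> {fst, snd}" for g
      using that by auto
  qed
  then obtain p where p: "\<And>\<tau>. F (s + \<tau>, t + \<tau> * t1) = poly p \<tau>"
    unfolding ga_univariate by (auto simp: fun_eq_iff)
  have "finite ({- s} \<union> (\<lambda>r. (r * s - t) / (t1 - r)) ` T)" using T by simp
  moreover have "poly p \<tau> = poly 0 \<tau>" if "\<tau> \<notin> {- s} \<union> (\<lambda>r. (r * s - t) / (t1 - r)) ` T" for \<tau>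
  proof -
    have s\<tau>: "s + \<tau> \<noteq> 0" using that by (auto simp: add_eq_0_iff)
    have "(t + \<tau> * t1) / (s + \<tau>) \<notin> T"
    proof
      assume r: "(t + \<tau> * t1) / (s + \<tau>) \<in> T"
      define r0 where "r0 = (t + \<tau> * t1) / (s + \<tau>)"
      have "r0 * (s + \<tau>) = t + \<tau> * t1" using s\<tau> by (simp add: r0_def)
      then have "\<tau> * (t1 - r0) = r0 * s - t" by (simp add: algebra_simps)
      moreover have "t1 - r0 \<noteq> 0" using r t1 r0_def by auto
      ultimately have "\<tau> = (r0 * s - t) / (t1 - r0)" by (simp add: nonzero_eq_divide_eq)
      moreover have "r0 \<in> T" using r by (simp add: r0_def)
      ultimately have "\<tau> \<in> (\<lambda>r. (r * s - t) / (t1 - r)) ` T" by (rule image_eqI)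
      then show False using that by simp
    qed
    from zero[OF s\<tau> this] show ?thesis by (simp add: p)
  qed
  ultimately have "p = 0" by (rule poly_eq_cofinite)
  then show ?thesis using p[of 0] by simp
qed

text \<open>Finitely many conditions on the coefficients are met one after another, each by avoiding
  finitely many multipliers.\<close>

lemma nonvanishing_combination:
  fixes v :: "'i \<Rightarrow> 'w \<Rightarrow> complex"
  assumes "finite I" "finite W" "\<And>w. w \<in> W \<Longrightarrow> \<exists>i\<in>I. v i w \<noteq> 0"
  shows "\<exists>c. \<forall>w\<in>W. (\<Sum>i\<in>I. c i * v i w) \<noteq> 0"
  using assms(2,3)
proof (induction W)
  case (insert r W)
  then obtain c where c: "\<forall>w\<in>W. (\<Sum>i\<in>I. c i * v i w) \<noteq> 0" by auto
  define S where "S w = (\<Sum>i\<in>I. c i * v i w)" for w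
  show ?case
  proof (cases "S r = 0")
    case True
    obtain j where j: "j \<in> I" "v j r \<noteq> 0" using insert.prems by blast
    obtain k where k: "k \<notin> (\<lambda>w. - v j w / S w) ` W"
      using complex_avoid_finite[of "(\<lambda>w. - v j w / S w) ` W"] insert.hyps by blast
    define d where "d i = k * c i + (if i = j then 1 else 0)" for i
    have d: "(\<Sum>i\<in>I. d i * v i w) = k * S w + v j w" for w
    proof -
      have "(\<Sum>i\<in>I. (if i = j then 1 else 0) * v i w) = v j w"
        using assms(1) j(1) by (subst sum.remove[of _ j]) auto
      then show ?thesis by (simp add: d_def S_def distrib_right sum.distrib sum_distrib_left mult.assoc)
    qed
    have "k * S w + v j w \<noteq> 0" if "w \<in> W" for w
    proof
      assume "k * S w + v j w = 0"
      then have "k * S w = - v j w" by (simp add: eq_neg_iff_add_eq_0)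
      moreover have "k = k * S w / S w" using c that by (simp add: S_def)
      ultimately have "k = - v j w / S w" by simp
      then show False using k that by blast
    qed
    then show ?thesis using True j by (intro exI[of _ d]) (auto simp: d)
  next
    case False
    then show ?thesis using c by (intro exI[of _ c]) (auto simp: S_def)
  qed
qed simp

text \<open>Projection along the projective line is closed. At x0 one form F j with nonzero top
  coefficient and one general combination H of all forms already have no common zero, and this is an
  instance of \<open>no_relation_open\<close>.\<close>

lemma no_common_zero_open:
  assumes I: "finite I" and F: "\<And>i. i \<in> I \<Longrightarrow> polyfam G (F i)" and deg: "\<And>i x. i \<in> I \<Longrightarrow> degree (F i x) \<le> M"
    and none: "\<And>s t. (s, t) \<noteq> (0, 0) \<Longrightarrow> \<exists>i\<in>I. bform M (F i x0) s t \<noteq> 0"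
  shows "\<exists>g\<in>generated_algebra G. g x0 \<noteq> 0 \<and>
    (\<forall>x. g x \<noteq> 0 \<longrightarrow> (\<forall>s t. (s, t) \<noteq> (0, 0) \<longrightarrow> (\<exists>i\<in>I. bform M (F i x) s t \<noteq> 0)))"
proof -
  define a where "a = max M 1"
  have a: "M \<le> a" "1 \<le> a" by (simp_all add: a_def)
  obtain j where j: "j \<in> I" "coeff (F j x0) M \<noteq> 0" using none[of 0 1] by (auto simp: bform_infinity)
  have dj: "degree (F j x0) = M" using deg[OF j(1), of x0] le_degree[OF j(2)] by simp
  have nz: "F j x0 \<noteq> 0" using j by auto
  have fin: "finite {w. poly (F j x0) w = 0}" by (rule poly_roots_finite[OF nz])
  have "\<exists>i\<in>I. poly (F i x0) w \<noteq> 0" for w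
    using none[of 1 w] by (auto simp: bform_affine[OF deg])
  then obtain c where c: "\<forall>w\<in>{w. poly (F j x0) w = 0}. (\<Sum>i\<in>I. c i * poly (F i x0) w) \<noteq> 0"
    using nonvanishing_combination[OF I fin, of "\<lambda>i w. poly (F i x0) w"] by blast
  define H where "H x = (\<Sum>i\<in>I. smult (c i) (F i x))" for x
  have H: "polyfam G H" unfolding H_def[abs_def] by (intro polyfam_sum polyfam_smult ga_const F)
  have dH: "degree (H x) \<le> M" for x
    unfolding H_def by (intro degree_sum_le I order_trans[OF degree_smult_le] deg)
  have "no_relation a M (F j x0) (H x0)"
    using no_relation_coprime[OF nz, of "H x0" "a"] c dj by (simp add: H_def poly_sum)
  then obtain g where g: "g \<in> generated_algebra G" "g x0 \<noteq> 0"
    "\<And>x. g x \<noteq> 0 \<Longrightarrow> no_relation a M (F j x) (H x)"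
    using no_relation_open[OF F[OF j(1)] H] by blast
  have "\<exists>i\<in>I. bform M (F i x) s t \<noteq> 0" if gx: "g x \<noteq> 0" and st: "(s, t) \<noteq> (0, 0)" for x s t
  proof (rule ccontr)
    assume "\<not> ?thesis"
    then have all: "bform M (F i x) s t = 0" if "i \<in> I" for i using that by blast
    then have H0: "bform M (H x) s t = 0" by (simp add: H_def bform_sum bform_smult)
    note nr = g(3)[OF gx]
    show False
    proof (cases "s = 0")
      case True
      then have t: "t \<noteq> 0" using st by simp
      then have c0: "coeff (F j x) M = 0" "coeff (H x) M = 0"
        using all[OF j(1)] H0 True by (auto simp: bform_infinity)
      have "coeff p i = 0" if "coeff p M = 0" "degree p \<le> M" "i \<ge> M" for p :: "complex poly" and i
        using that by (cases "i = M") (auto intro: coeff_eq_0)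
      \<comment> \<open>A common zero at s = 0 means that both top coefficients vanish; then u = H
        and v = - F j are within the bounds and form a relation.\<close>
      then have "F j x = 0" "H x = 0"
        using nr[unfolded no_relation_def, rule_format, of "H x" "- F j x"] c0 deg[OF j(1)] dH a(1) by auto
      moreover have "\<forall>i\<ge>a. coeff (1 :: complex poly) i = 0" using a(2) by (auto simp: coeff_1)
      ultimately show False using nr[unfolded no_relation_def, rule_format, of 1 0] by auto
    next
      case False
      then have "poly (F j x) (t / s) = 0" "poly (H x) (t / s) = 0"
        using all[OF j(1)] H0 by (auto simp: bform_affine[OF deg[OF j(1)]] bform_affine[OF dH])
      then show False
        using no_relation_no_common_root[OF nr _ deg[OF j(1)], of "t / s"] dH[of x] a by simp
    qed
  qed
  then show ?thesis using g by blast
qed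

section \<open>Rational parametrisation\<close>

definition param_vec :: "(4 \<Rightarrow> complex ^ 4) \<Rightarrow> nat \<Rightarrow> (4 \<Rightarrow> complex poly) \<Rightarrow> complex \<Rightarrow> complex \<Rightarrow> complex ^ 4" where
  "param_vec b m \<phi> s t = (\<Sum>i\<in>UNIV. bform m (\<phi> i) s t *s b i)"

lemma param_vec_coord: "frame b y \<Longrightarrow> pairing (y i) (param_vec b m \<phi> s t) = bform m (\<phi> i) s t"
proof -
  assume fr: "frame b y"
  have "pairing (y i) (param_vec b m \<phi> s t) = (\<Sum>j\<in>UNIV. bform m (\<phi> j) s t * (if i = j then 1 else 0))"
    unfolding param_vec_def pairing_sum pairing_scale frameD[OF fr] ..
  also have "\<dots> = bform m (\<phi> i) s t" by (subst sum.remove[of _ i]) (auto intro!: sum.neutral)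
  finally show ?thesis .
qed

locale secant_curve = space_curve +
  fixes \<alpha> \<beta> :: "complex ^ 4"
  assumes independent: "a *s \<alpha> + c *s \<beta> = 0 \<Longrightarrow> a = 0 \<and> c = 0"
    and secant_finite: "finite (C \<inter> projectivize (vec.span {\<alpha>, \<beta>}))"
    and secant_card: "card (C \<inter> projectivize (vec.span {\<alpha>, \<beta>})) + 1 = curve_degree C"
begin

text \<open>Plane models require centres off the curve, whereas \<alpha> and \<beta> lie on it in
  the application. Only finitely many points of the secant line are on the curve, so two others
  serve as auxiliary centres.\<close>

lemma secant_frame:
  "\<exists>b y c1 c2. frame b y \<and> b 3 \<notin> K \<and> b 4 \<notin> K \<and> c1 \<noteq> c2 \<and> b 3 = \<alpha> + c1 *s \<beta> \<and> b 4 = \<alpha> + c2 *s \<beta>"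
proof -
  have nz: "\<alpha> + c *s \<beta> \<noteq> 0" for c using independent[of 1 c] by auto
  have "inj (\<lambda>c. vec.span {\<alpha> + c *s \<beta>})"
  proof (rule injI)
    fix c d assume "vec.span {\<alpha> + c *s \<beta>} = vec.span {\<alpha> + d *s \<beta>}"
    then obtain k where k: "\<alpha> + c *s \<beta> = k *s (\<alpha> + d *s \<beta>)" using span_eq_iff[OF nz nz] by blast
    then have "(1 - k) *s \<alpha> + (c - k * d) *s \<beta> = 0"
      by (simp add: vec_eq_iff algebra_simps)
    then show "c = d" using independent[of "1 - k" "c - k * d"] by auto
  qed
  then have inj: "inj_on (\<lambda>c. vec.span {\<alpha> + c *s \<beta>}) {c. \<alpha> + c *s \<beta> \<in> K}" by (rule inj_on_subset) simp
  have "(\<lambda>c. vec.span {\<alpha> + c *s \<beta>}) ` {c. \<alpha> + c *s \<beta> \<in> K} \<subseteq> C \<inter> projectivize (vec.span {\<alpha>, \<beta>})"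
  proof
    fix l assume "l \<in> (\<lambda>c. vec.span {\<alpha> + c *s \<beta>}) ` {c. \<alpha> + c *s \<beta> \<in> K}"
    then obtain c where c: "l = vec.span {\<alpha> + c *s \<beta>}" "\<alpha> + c *s \<beta> \<in> K" by blast
    have "\<alpha> + c *s \<beta> \<in> vec.span {\<alpha>, \<beta>}"
      by (intro vec.span_add vec.span_scale vec.span_base) auto
    then show "l \<in> C \<inter> projectivize (vec.span {\<alpha>, \<beta>})"
      unfolding c(1) using projectivizeI[OF _ nz, of c] K_span[OF nz, of c] c(2) by simp
  qed
  from finite_imageD[OF finite_subset[OF this secant_finite] inj]
  have fin: "finite {c. \<alpha> + c *s \<beta> \<in> K}" .
  obtain c1 where c1: "c1 \<notin> {c. \<alpha> + c *s \<beta> \<in> K}" using complex_avoid_finite[OF fin] by blast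
  obtain c2 where c2: "c2 \<notin> insert c1 {c. \<alpha> + c *s \<beta> \<in> K}"
    using complex_avoid_finite[of "insert c1 {c. \<alpha> + c *s \<beta> \<in> K}"] fin by blast
  have "a = 0 \<and> c = 0" if "a *s (\<alpha> + c1 *s \<beta>) + c *s (\<alpha> + c2 *s \<beta>) = 0" for a c
  proof -
    have "(a + c) *s \<alpha> + (a * c1 + c * c2) *s \<beta> = 0" using that by (simp add: vec_eq_iff algebra_simps)
    then have eq: "a + c = 0" "a * c1 + c * c2 = 0" using independent by blast+
    then have "a = - c" by (simp add: eq_neg_iff_add_eq_0)
    then have "c * (c2 - c1) = 0" using eq(2) by (simp add: algebra_simps)
    then show ?thesis using c2 \<open>a = - c\<close> by auto
  qed
  from frame_exists[OF this] obtain b y where fr: "frame b y" "b 1 = \<alpha> + c1 *s \<beta>" "b 2 = \<alpha> + c2 *s \<beta>" by blast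
  define p :: "4 \<Rightarrow> 4" where "p i = (if i = 3 then 1 else if i = 4 then 2 else if i = 1 then 3 else 4)" for i
  have "inj p" unfolding inj_def p_def by (simp add: forall_4)
  from frame_permute[OF fr(1) this] have "frame (b \<circ> p) (y \<circ> p)" .
  moreover have bp: "(b \<circ> p) 3 = \<alpha> + c1 *s \<beta>" "(b \<circ> p) 4 = \<alpha> + c2 *s \<beta>" by (simp_all add: p_def fr)
  moreover have "(b \<circ> p) 3 \<notin> K" "(b \<circ> p) 4 \<notin> K" "c1 \<noteq> c2" unfolding bp using c1 c2 by auto
  ultimately show ?thesis by (intro exI conjI)
qed

text \<open>A plane through the secant line contains at most one further point of the curve, so the plane model
  of the projection from the secant is linear in the second coordinate.\<close>

lemma residual_degree:
  assumes fr: "frame b y" and b4: "b 4 \<notin> K" and \<alpha>\<beta>: "\<And>x. x \<in> vec.span {\<alpha>, \<beta>} \<Longrightarrow> pairing (y 1) x = 0 \<and> pairing (y 2) x = 0"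
  shows "\<exists>e0 e1 T. e1 \<noteq> 0 \<and> finite T \<and> relation (y 1) (y 2) (y 3) [:e0, e1:] \<and>
    (\<forall>t. t \<notin> T \<longrightarrow> poly e1 t \<noteq> 0 \<and> (\<exists>x\<in>fibre y t. poly e0 t + pairing (y 3) x * poly e1 t = 0))"
proof -
  from plane_model[OF fr b4] obtain P T where
    PT: "relation (y 1) (y 2) (y 3) P \<and> degree P \<ge> 1 \<and> (\<forall>t. zp P t \<noteq> 0) \<and> finite T \<and>
    (\<forall>t. t \<notin> T \<longrightarrow> degree (zp P t) = degree P \<and> rsquarefree (zp P t) \<and>
      (\<forall>z. ev P t z = 0 \<longrightarrow> (\<exists>x\<in>K. pairing (y 1) x = 1 \<and> pairing (y 2) x = t \<and> pairing (y 3) x = z)))"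
    by (elim exE)
  then have P: "relation (y 1) (y 2) (y 3) P" "degree P \<ge> 1" "finite T"
    and PT2: "\<And>t. t \<notin> T \<Longrightarrow> degree (zp P t) = degree P" "\<And>t. t \<notin> T \<Longrightarrow> rsquarefree (zp P t)"
    and lift: "\<And>t z. t \<notin> T \<Longrightarrow> ev P t z = 0 \<Longrightarrow> \<exists>x\<in>K. pairing (y 1) x = 1 \<and> pairing (y 2) x = t \<and> pairing (y 3) x = z"
    by auto
  obtain t where t: "t \<notin> T" using complex_avoid_finite[OF P(3)] by blast
  \<comment> \<open>The plane of the pencil over t, where the axis of the pencil is the secant
    line.\<close>
  define h where "h = y 2 - t *s y 1"
  have hx: "pairing h x = pairing (y 2) x - t * pairing (y 1) x" for x
    by (simp add: h_def pairing_diff_left pairing_scale_left)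
  have "pairing h (b 2) = 1" by (simp add: hx frameD[OF fr])
  then have h: "h \<noteq> 0" by auto
  define R where "R = {z. poly (zp P t) z = 0}"
  have "\<forall>z\<in>R. \<exists>x. x \<in> K \<and> pairing (y 1) x = 1 \<and> pairing (y 2) x = t \<and> pairing (y 3) x = z"
    using lift[OF t] unfolding R_def by auto
  from bchoice[OF this] obtain x where x: "\<And>z. z \<in> R \<Longrightarrow> x z \<in> K" "\<And>z. z \<in> R \<Longrightarrow> pairing (y 1) (x z) = 1"
    "\<And>z. z \<in> R \<Longrightarrow> pairing (y 2) (x z) = t" "\<And>z. z \<in> R \<Longrightarrow> pairing (y 3) (x z) = z" by blast
  have nz: "x z \<noteq> 0" if "z \<in> R" for z using x(2)[OF that] by auto
  have inj: "inj_on (\<lambda>z. vec.span {x z}) R"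
  proof (rule inj_onI)
    fix z z' assume zz: "z \<in> R" "z' \<in> R" "vec.span {x z} = vec.span {x z'}"
    have "x z = x z'"
      by (rule inj_onD[OF span_inj_normalized[of "y 1"] zz(3)]) (use x(2) zz in simp_all)
    from arg_cong[OF this, of "pairing (y 3)"] show "z = z'" unfolding x(4)[OF zz(1)] x(4)[OF zz(2)] .
  qed
  let ?S = "C \<inter> projectivize (vec.span {\<alpha>, \<beta>})"
  have "vec.span {\<alpha>, \<beta>} \<subseteq> {x. pairing h x = 0}"
  proof
    fix x assume "x \<in> vec.span {\<alpha>, \<beta>}"
    from \<alpha>\<beta>[OF this] show "x \<in> {x. pairing h x = 0}" by (simp add: hx)
  qed
  from projectivize_mono[OF this] have "?S \<subseteq> C \<inter> hyperplane h" unfolding hyperplane_def by blast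
  moreover have "(\<lambda>z. vec.span {x z}) ` R \<subseteq> C \<inter> hyperplane h"
    unfolding hyperplane_section using x nz by (auto simp: hx)
  moreover have fin: "finite (C \<inter> hyperplane h)" unfolding hyperplane_section by (rule K_finite_hyperplane[OF h])
  ultimately have "card (?S \<union> (\<lambda>z. vec.span {x z}) ` R) \<le> card (C \<inter> hyperplane h)" by (intro card_mono) auto
  moreover have "?S \<inter> (\<lambda>z. vec.span {x z}) ` R = {}"
  proof (rule ccontr)
    assume "\<not> ?thesis"
    then obtain z where z: "z \<in> R" "vec.span {x z} \<in> projectivize (vec.span {\<alpha>, \<beta>})" by blast
    then have "x z \<in> vec.span {\<alpha>, \<beta>}"
      using projectivize_cone_iff[OF cone_closed_subspace[OF vec.subspace_span] nz[OF z(1)]] by blast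
    then show False using \<alpha>\<beta> x(2)[OF z(1)] by auto
  qed
  moreover have Rcard: "finite R" "card R = degree P"
    unfolding R_def using poly_roots_finite[of "zp P t"] rsquarefree_card_roots[OF PT2(2)[OF t]] PT2[OF t]
    by (auto simp: rsquarefree_def)
  \<comment> \<open>The plane contains the points on the secant line and, off it, one point for
    every root of the model over t; \<open>curve_degree_bound\<close> limits the total for this
    special plane.\<close>
  ultimately have "card ?S + degree P \<le> curve_degree C"
    using curve_degree_bound[OF h] secant_finite card_image[OF inj] by (simp add: card_Un_disjoint)
  then have deg: "degree P = 1" using secant_card P(2) by linarith
  define e0 where "e0 = coeff P 0"
  define e1 where "e1 = coeff P 1"
  have Pe: "P = [:e0, e1:]"
    by (rule poly_eqI) (use deg in \<open>auto simp: e0_def e1_def coeff_pCons coeff_eq_0 split: nat.split\<close>)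
  have "e1 \<noteq> 0" using deg Pe by auto
  moreover have "poly e1 t \<noteq> 0 \<and> (\<exists>x\<in>fibre y t. poly e0 t + pairing (y 3) x * poly e1 t = 0)" if t: "t \<notin> T" for t
  proof -
    have "degree (zp P t) = 1" using PT2(1)[OF t] deg by simp
    then have e1t: "poly e1 t \<noteq> 0" unfolding Pe by (auto split: if_splits)
    then have "ev P t (- poly e0 t / poly e1 t) = 0" unfolding Pe by simp
    from lift[OF t this] show ?thesis using e1t by (auto simp: fibre_def)
  qed
  ultimately show ?thesis using P unfolding Pe by blast
qed

text \<open>The two linear plane models, for centres \<open>b 4\<close> and \<open>b 3\<close>,
  express the remaining coordinates of the residual point as fractions in t. Only then are the
  auxiliary centres exchanged for \<alpha> and \<beta>, which merely recombines the
  fractions.\<close>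

lemma affine_parametrization:
  "\<exists>b y g p q T. frame b y \<and> b 3 = \<alpha> \<and> b 4 = \<beta> \<and> g \<noteq> 0 \<and> finite T \<and>
    (\<forall>r. \<not> (poly g r = 0 \<and> poly p r = 0 \<and> poly q r = 0)) \<and>
    relation (y 1) (y 2) (y 3) [:- p, g:] \<and> relation (y 1) (y 2) (y 4) [:- q, g:] \<and>
    (\<forall>t. t \<notin> T \<longrightarrow> poly g t \<noteq> 0 \<and> fibre y t \<noteq> {})"
proof -
  obtain b y c1 c2 where fr: "frame b y" and b34: "b 3 \<notin> K" "b 4 \<notin> K" and c12: "c1 \<noteq> c2"
    and b3: "b 3 = \<alpha> + c1 *s \<beta>" and b4: "b 4 = \<alpha> + c2 *s \<beta>" using secant_frame by blast
  define d where "d = c2 - c1"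
  have d: "d \<noteq> 0" using c12 by (simp add: d_def)
  have \<alpha>: "\<alpha> = (c2 / d) *s b 3 - (c1 / d) *s b 4" and \<beta>: "\<beta> = (1 / d) *s b 4 - (1 / d) *s b 3"
  proof -
    have "c2 / d * (a + c1 * e) - c1 / d * (a + c2 * e) = a" for a e
    proof -
      have "c2 / d * (a + c1 * e) - c1 / d * (a + c2 * e) = (c2 * (a + c1 * e) - c1 * (a + c2 * e)) / d"
        by (simp add: diff_divide_distrib)
      also have "c2 * (a + c1 * e) - c1 * (a + c2 * e) = a * d" by (simp add: d_def algebra_simps)
      finally show ?thesis using d by simp
    qed
    then show "\<alpha> = (c2 / d) *s b 3 - (c1 / d) *s b 4"
      unfolding b3 b4 vec_eq_iff vector_minus_component vector_smult_component vector_add_component by (intro allI) (rule sym)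
    have "1 / d * (a + c2 * e) - 1 / d * (a + c1 * e) = e" for a e
    proof -
      have "1 / d * (a + c2 * e) - 1 / d * (a + c1 * e) = ((a + c2 * e) - (a + c1 * e)) / d"
        unfolding diff_divide_distrib by simp
      also have "(a + c2 * e) - (a + c1 * e) = e * d" by (simp add: d_def algebra_simps)
      finally show ?thesis using d by simp
    qed
    then show "\<beta> = (1 / d) *s b 4 - (1 / d) *s b 3"
      unfolding b3 b4 vec_eq_iff vector_minus_component vector_smult_component vector_add_component by (intro allI) (rule sym)
  qed
  have van: "pairing (y 1) x = 0 \<and> pairing (y 2) x = 0" if x: "x \<in> vec.span {\<alpha>, \<beta>}" for x
  proof -
    have "pairing (y 1) \<alpha> = 0" "pairing (y 2) \<alpha> = 0" "pairing (y 1) \<beta> = 0" "pairing (y 2) \<beta> = 0"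
      unfolding \<alpha> \<beta> by (simp_all add: pairing_diff pairing_scale frameD[OF fr])
    then have "{\<alpha>, \<beta>} \<subseteq> {x. pairing (y 1) x = 0 \<and> pairing (y 2) x = 0}" by auto
    then have "vec.span {\<alpha>, \<beta>} \<subseteq> {x. pairing (y 1) x = 0 \<and> pairing (y 2) x = 0}"
      by (rule vec.span_minimal) (auto simp: vec.subspace_def pairing_add pairing_scale)
    then show ?thesis using x by blast
  qed
  obtain e0 e1 T1 where e: "e1 \<noteq> 0" "finite T1" "relation (y 1) (y 2) (y 3) [:e0, e1:]"
    "\<And>t. t \<notin> T1 \<Longrightarrow> poly e1 t \<noteq> 0 \<and> (\<exists>x\<in>fibre y t. poly e0 t + pairing (y 3) x * poly e1 t = 0)"
    using residual_degree[OF fr b34(2) van] by blast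
  define s :: "4 \<Rightarrow> 4" where "s i = (if i = 3 then 4 else if i = 4 then 3 else i)" for i
  have "inj s" unfolding inj_def s_def by (simp add: forall_4)
  note frs = frame_permute[OF fr this]
  have s: "(y \<circ> s) 1 = y 1" "(y \<circ> s) 2 = y 2" "(y \<circ> s) 3 = y 4" "(b \<circ> s) 4 = b 3" by (simp_all add: s_def)
  have fs: "fibre (y \<circ> s) t = fibre y t" for t unfolding fibre_def s ..
  obtain f0 f1 T2 where f: "f1 \<noteq> 0" "finite T2" "relation (y 1) (y 2) (y 4) [:f0, f1:]"
    "\<And>t. t \<notin> T2 \<Longrightarrow> poly f1 t \<noteq> 0 \<and> (\<exists>x\<in>fibre y t. poly f0 t + pairing (y 4) x * poly f1 t = 0)"
    using residual_degree[OF frs] b34(1) van unfolding s fs by blast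
  \<comment> \<open>The new dual vectors are obtained by expressing \<alpha> and \<beta> in the
    auxiliary centres \<alpha> + c1 \<beta> and \<alpha> + c2 \<beta>.\<close>
  define b' where "b' i = (if i = 3 then \<alpha> else if i = 4 then \<beta> else b i)" for i
  define y' where "y' i = (if i = 3 then y 3 + y 4 else if i = 4 then c1 *s y 3 + c2 *s y 4 else y i)" for i
  have fr': "frame b' y'"
    unfolding frame_def b'_def y'_def \<alpha> \<beta> using d
    by (simp add: forall_4 pairing_add_left pairing_scale_left pairing_diff pairing_scale frameD[OF fr] d_def diff_divide_distrib[symmetric])
  \<comment> \<open>The common denominator of both fractions; P and Q are the numerators of the
    coordinates belonging to \<alpha> and \<beta>.\<close>
  define G where "G = e1 * f1"
  define P where "P = - (e0 * f1) - f0 * e1"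
  define Q where "Q = - smult c1 (e0 * f1) - smult c2 (f0 * e1)"
  have G: "G \<noteq> 0" using e(1) f(1) by (simp add: G_def)
  have rels: "poly G t * (pairing (y 3) x / pairing (y 1) x) = - poly (e0 * f1) t"
    "poly G t * (pairing (y 4) x / pairing (y 1) x) = - poly (f0 * e1) t"
    if "x \<in> K" "pairing (y 1) x \<noteq> 0" "t = pairing (y 2) x / pairing (y 1) x" for x t
  proof -
    have "poly e0 t + pairing (y 3) x / pairing (y 1) x * poly e1 t = 0"
      "poly f0 t + pairing (y 4) x / pairing (y 1) x * poly f1 t = 0"
      using e(3) f(3) that unfolding relation_def by auto
    then have "pairing (y 3) x / pairing (y 1) x * poly e1 t = - poly e0 t"
      "pairing (y 4) x / pairing (y 1) x * poly f1 t = - poly f0 t"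
      by (simp_all add: eq_neg_iff_add_eq_0 add.commute)
    then show "poly G t * (pairing (y 3) x / pairing (y 1) x) = - poly (e0 * f1) t"
      "poly G t * (pairing (y 4) x / pairing (y 1) x) = - poly (f0 * e1) t"
      unfolding G_def poly_mult by (metis mult.assoc mult.commute mult_minus_left)+
  qed
  have relP: "relation (y' 1) (y' 2) (y' 3) [:- P, G:]" and relQ: "relation (y' 1) (y' 2) (y' 4) [:- Q, G:]"
    unfolding relation_def
  proof (safe)
    fix x assume x: "x \<in> K" "pairing (y' 1) x \<noteq> 0"
    define t where "t = pairing (y 2) x / pairing (y 1) x"
    have x1: "pairing (y 1) x \<noteq> 0" using x(2) by (simp add: y'_def)
    note r = rels[OF x(1) x1 t_def]
    have "(pairing (y 3) x + pairing (y 4) x) / pairing (y 1) x * poly G t =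
        poly G t * (pairing (y 3) x / pairing (y 1) x) + poly G t * (pairing (y 4) x / pairing (y 1) x)"
      by (simp add: add_divide_distrib distrib_left distrib_right mult.commute)
    then show "ev [:- P, G:] (pairing (y' 2) x / pairing (y' 1) x) (pairing (y' 3) x / pairing (y' 1) x) = 0"
      unfolding r by (simp add: y'_def t_def[symmetric] pairing_add_left P_def)
    have "(c1 * pairing (y 3) x + c2 * pairing (y 4) x) / pairing (y 1) x * poly G t =
        c1 * (poly G t * (pairing (y 3) x / pairing (y 1) x)) + c2 * (poly G t * (pairing (y 4) x / pairing (y 1) x))"
      by (simp add: add_divide_distrib distrib_left distrib_right mult_ac)
    then show "ev [:- Q, G:] (pairing (y' 2) x / pairing (y' 1) x) (pairing (y' 4) x / pairing (y' 1) x) = 0"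
      unfolding r by (simp add: y'_def t_def[symmetric] pairing_add_left pairing_scale_left Q_def)
  qed
  \<comment> \<open>Dividing by D removes affine base points of the parametrization. The quotients
    are still equations of the curve, by primality and \<open>relation_const\<close>.\<close>
  define D where "D = gcd G (gcd P Q)"
  have D: "D \<noteq> 0" using G by (simp add: D_def)
  obtain g where g: "G = D * g" unfolding D_def by (meson dvdE gcd_dvd1)
  obtain p where p: "P = D * p" unfolding D_def by (meson dvdE dvd_trans gcd_dvd1 gcd_dvd2)
  obtain q where q: "Q = D * q" unfolding D_def by (meson dvdE dvd_trans gcd_dvd2)
  have nocommon: "\<not> (poly g r = 0 \<and> poly p r = 0 \<and> poly q r = 0)" for r
  proof
    assume "poly g r = 0 \<and> poly p r = 0 \<and> poly q r = 0"
    then have "[:-r, 1:] dvd g" "[:-r, 1:] dvd p" "[:-r, 1:] dvd q" by (simp_all add: poly_eq_0_iff_dvd)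
    then have "D * [:-r, 1:] dvd G" "D * [:-r, 1:] dvd P" "D * [:-r, 1:] dvd Q"
      unfolding g p q by (simp_all del: mult_pCons_right)
    then have "D * [:-r, 1:] dvd D" unfolding D_def[of] by (metis D_def gcd_greatest)
    then have "degree (D * [:-r, 1:]) \<le> degree D" using D by (rule dvd_imp_degree_le)
    moreover have "degree (D * [:-r, 1:]) = degree D + 1" using D by (subst degree_mult_eq) auto
    ultimately show False by simp
  qed
  have Dnot: "\<not> relation (y' 1) (y' 2) c [:D:]" for c
  proof -
    have "relation (y' 1) (y' 2) c [:D:] \<longleftrightarrow> relation (y' 1) (y' 2) (y' 3) [:D:]" by (simp add: relation_def)
    then show ?thesis using relation_const[OF fr', of D] D by auto
  qed
  have "[:- P, G:] = [:D:] * [:- p, g:]" "[:- Q, G:] = [:D:] * [:- q, g:]" unfolding g p q by simp_all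
  then have rels': "relation (y' 1) (y' 2) (y' 3) [:- p, g:]" "relation (y' 1) (y' 2) (y' 4) [:- q, g:]"
    using relation_prime relP relQ Dnot by metis+
  define T where "T = T1 \<union> T2 \<union> {t. poly G t = 0}"
  have finT: "finite (T1 \<union> T2 \<union> {t. poly G t = 0})" using e(2) f(2) poly_roots_finite[OF G] by simp
  have fibT: "poly g t \<noteq> 0 \<and> fibre y' t \<noteq> {}" if "t \<notin> T" for t
  proof
    have "poly G t \<noteq> 0" using that by (simp add: T_def)
    then show "poly g t \<noteq> 0" unfolding g by auto
    have "fibre y' t = fibre y t" by (simp add: fibre_def y'_def)
    then show "fibre y' t \<noteq> {}" using e(4)[of t] that by (auto simp: T_def)
  qed
  have g0: "g \<noteq> 0" using G g by auto
  have b'34: "b' 3 = \<alpha>" "b' 4 = \<beta>" by (simp_all add: b'_def)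
  show ?thesis
    by (intro exI[of _ b'] exI[of _ y'] exI[of _ g] exI[of _ p] exI[of _ q] exI[of _ T] conjI allI impI
        fr' b'34 g0 finT[folded T_def] nocommon rels' conjunct1[OF fibT] conjunct2[OF fibT])
qed

text \<open>Values of the parametrization lie on the curve for almost all t, because fibres are
  nonempty, and hence for all (s, t). Conversely the cone over the image is closed, by elimination
  of the parameter, and contains the part of the curve where y 1 and g are nonzero; irreducibility
  gives the rest.\<close>

lemma rational_parametrization:
  "\<exists>b y \<phi> m. frame b y \<and> b 3 = \<alpha> \<and> b 4 = \<beta> \<and> \<phi> 1 \<noteq> 0 \<and> \<phi> 2 = pCons 0 (\<phi> 1) \<and> (\<forall>i. degree (\<phi> i) \<le> m) \<and>
    (\<forall>s t. (s, t) \<noteq> (0, 0) \<longrightarrow> param_vec b m \<phi> s t \<noteq> 0) \<and> 1 \<le> m \<and>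
    K = {k *s param_vec b m \<phi> s t | k s t. True}"
proof -
  obtain b y g p q T where
    ap: "frame b y \<and> b 3 = \<alpha> \<and> b 4 = \<beta> \<and> g \<noteq> 0 \<and> finite T \<and>
    (\<forall>r. \<not> (poly g r = 0 \<and> poly p r = 0 \<and> poly q r = 0)) \<and>
    relation (y 1) (y 2) (y 3) [:- p, g:] \<and> relation (y 1) (y 2) (y 4) [:- q, g:] \<and>
    (\<forall>t. t \<notin> T \<longrightarrow> poly g t \<noteq> 0 \<and> fibre y t \<noteq> {})"
    using affine_parametrization by (elim exE)
  then have fr: "frame b y" and b34: "b 3 = \<alpha>" "b 4 = \<beta>" and g: "g \<noteq> 0" and T: "finite T"
    and nc: "\<And>r. \<not> (poly g r = 0 \<and> poly p r = 0 \<and> poly q r = 0)"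
    and rp: "relation (y 1) (y 2) (y 3) [:- p, g:]" and rq: "relation (y 1) (y 2) (y 4) [:- q, g:]"
    and fib: "\<And>t. t \<notin> T \<Longrightarrow> poly g t \<noteq> 0 \<and> fibre y t \<noteq> {}" by auto
  define \<phi> where "\<phi> i = (if i = 1 then g else if i = 2 then pCons 0 g else if i = 3 then p else q)" for i :: 4
  have \<phi>: "\<phi> 1 = g" "\<phi> 2 = pCons 0 g" "\<phi> 3 = p" "\<phi> 4 = q" by (simp_all add: \<phi>_def)
  define m where "m = Max (range (\<lambda>i. degree (\<phi> i)))"
  have deg: "degree (\<phi> i) \<le> m" for i unfolding m_def by (rule Max_ge) auto
  have m1: "1 \<le> m" using deg[of 2] g by (simp add: \<phi>)
  have "m \<in> range (\<lambda>i. degree (\<phi> i))" unfolding m_def by (rule Max_in) auto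
  then obtain i0 where i0: "degree (\<phi> i0) = m" by auto
  then have "\<phi> i0 \<noteq> 0" using m1 by auto
  then have lead: "coeff (\<phi> i0) m \<noteq> 0" using i0 leading_coeff_0_iff by blast
  let ?v = "param_vec b m \<phi>"
  have coord: "pairing (y i) (?v s t) = bform m (\<phi> i) s t" for i s t by (rule param_vec_coord[OF fr])
  have nz: "?v s t \<noteq> 0" if st: "(s, t) \<noteq> (0, 0)" for s t
  proof
    assume "?v s t = 0"
    then have zero: "bform m (\<phi> i) s t = 0" for i using coord[of i s t] by simp
    show False
    proof (cases "s = 0")
      case True
      then show False using zero[of i0] lead st by (simp add: bform_infinity)
    next
      case False
      then have "poly (\<phi> i) (t / s) = 0" for i using zero[of i] by (simp add: bform_affine[OF deg])
      from this[of 1] this[of 3] this[of 4] show False using nc[of "t / s"] by (simp add: \<phi>)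
    qed
  qed
  have line: "(s ^ m * poly g c) *s x = pairing (y 1) x *s ?v s (s * c)"
    if x: "x \<in> K" "pairing (y 1) x \<noteq> 0" "c = pairing (y 2) x / pairing (y 1) x" and s: "s \<noteq> 0" for x c s
  proof (rule frame_eqI[OF fr])
    fix i :: 4
    have v: "bform m (\<phi> j) s (s * c) = s ^ m * poly (\<phi> j) c" for j
      using bform_affine[OF deg s, of j "s * c"] s by simp
    have "- poly p c + pairing (y 3) x / pairing (y 1) x * poly g c = 0"
      "- poly q c + pairing (y 4) x / pairing (y 1) x * poly g c = 0"
      using rp rq x unfolding relation_def by auto
    then have pq: "pairing (y 3) x * poly g c = pairing (y 1) x * poly p c"
      "pairing (y 4) x * poly g c = pairing (y 1) x * poly q c"
      using x(2) by (simp_all add: field_simps)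
    have x2: "pairing (y 2) x = c * pairing (y 1) x" using x(2,3) by simp
    have "i = 1 \<or> i = 2 \<or> i = 3 \<or> i = 4" by (rule exhaust_4)
    then show "pairing (y i) ((s ^ m * poly g c) *s x) = pairing (y i) (pairing (y 1) x *s ?v s (s * c))"
      unfolding pairing_scale coord v
      by (elim disjE) (use pq in \<open>simp_all add: \<phi> x2 mult.assoc mult.left_commute mult.commute\<close>)
  qed
  have inK: "?v s t \<in> K" for s t
  proof (rule ccontr)
    assume "?v s t \<notin> K"
    then obtain d f where f: "hom_deg d f" "\<forall>x\<in>K. f x = 0" "f (?v s t) \<noteq> 0" using K_separate by blast
    have "(\<lambda>z. f (?v (fst z) (snd z))) \<in> generated_algebra {fst, snd}"
    proof (rule poly_funs_comp[OF hom_deg_pf[OF f(1)]])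
      fix i
      have "(\<lambda>z. \<Sum>j\<in>UNIV. bform m (\<phi> j) (fst z) (snd z) * b j $ i) \<in> generated_algebra {fst, snd}"
        by (intro ga_sum ga_mult ga_const bform_in_algebra ga_gen) auto
      then show "(\<lambda>z. ?v (fst z) (snd z) $ i) \<in> generated_algebra {fst, snd}"
        by (simp add: param_vec_def)
    qed
    moreover have "(\<lambda>z. f (?v (fst z) (snd z))) (s, t) = 0" if s: "s \<noteq> 0" and t: "t / s \<notin> T" for s t
    proof -
      obtain x where x: "x \<in> K" "pairing (y 1) x = 1" "pairing (y 2) x = t / s" using fib[OF t] unfolding fibre_def by blast
      have "(s ^ m * poly g (t / s)) *s x = ?v s t" using line[of x "t / s" s] x s by simp
      then have "?v s t \<in> K" using K_scale[OF x(1)] by metis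
      then show ?thesis using f(2) by simp
    qed
    ultimately have "(\<lambda>z. f (?v (fst z) (snd z))) (s, t) = 0" by (rule binary_density[OF _ T])
    then show False using f(3) by simp
  qed
  define W where "W = {k *s ?v s t | k s t. True}"
  have Wcone: "k *s x \<in> W" if x: "x \<in> W" for k x
  proof -
    obtain l s t where "x = l *s ?v s t" using x unfolding W_def by blast
    then have "k *s x = (k * l) *s ?v s t" by simp
    then show ?thesis unfolding W_def by blast
  qed
  have "K \<subseteq> W"
  proof (rule subsetI, rule ccontr)
    fix x0 assume x0: "x0 \<in> K" "x0 \<notin> W"
    have x0nz: "x0 \<noteq> 0"
    proof
      assume "x0 = 0"
      then have "x0 = 0 *s ?v 0 0" by simp
      then show False using x0(2) unfolding W_def by blast
    qed
    \<comment> \<open>The two-by-two minors of x and the parametrized point: x is a multiple of that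
      point iff all of them vanish.\<close>
    define F where "F ij x = smult (pairing (y (fst ij)) x) (\<phi> (snd ij)) - smult (pairing (y (snd ij)) x) (\<phi> (fst ij))" for ij :: "4 \<times> 4" and x
    have bF: "bform m (F ij x) s t = pairing (y (fst ij)) x * bform m (\<phi> (snd ij)) s t - pairing (y (snd ij)) x * bform m (\<phi> (fst ij)) s t"
      for ij x s t unfolding F_def by (simp add: bform_diff bform_smult)
    let ?G = "range (\<lambda>i (x :: complex ^ 4). x $ i)"
    have pg: "pairing u \<in> generated_algebra ?G" for u using pf_pairing[of u] by (simp add: poly_funs_def)
    have Fij: "F ij = (\<lambda>x. smult (pairing (y (fst ij)) x) (\<phi> (snd ij)) + smult ((- 1) * pairing (y (snd ij)) x) (\<phi> (fst ij)))" for ij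
      by (simp add: F_def fun_eq_iff)
    have Ffam: "polyfam ?G (F ij)" for ij
      unfolding Fij by (intro polyfam_add polyfam_smult polyfam_const ga_mult ga_const) (simp_all add: pg)
    have Fdeg: "degree (F ij x) \<le> m" for ij x
      unfolding F_def by (intro degree_diff_le order_trans[OF degree_smult_le] deg)
    have none: "\<exists>ij\<in>UNIV. bform m (F ij x0) s t \<noteq> 0" if st: "(s, t) \<noteq> (0, 0)" for s t
    proof (rule ccontr)
      assume "\<not> ?thesis"
      then have all: "pairing (y i) x0 * bform m (\<phi> j) s t = pairing (y j) x0 * bform m (\<phi> i) s t" for i j
        using bF[of "(i, j)" x0 s t] by simp
      obtain j where j: "bform m (\<phi> j) s t \<noteq> 0"
        using nz[OF st] frame_eqI[OF fr, of "?v s t" 0] coord by auto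
      have "x0 = (pairing (y j) x0 / bform m (\<phi> j) s t) *s ?v s t"
      proof (rule frame_eqI[OF fr])
        fix i
        show "pairing (y i) x0 = pairing (y i) ((pairing (y j) x0 / bform m (\<phi> j) s t) *s ?v s t)"
          unfolding pairing_scale coord using all[of i j] j by (simp add: nonzero_eq_divide_eq)
      qed
      then show False using x0(2) unfolding W_def by blast
    qed
    obtain G0 where G0: "G0 \<in> generated_algebra ?G" "G0 x0 \<noteq> 0"
      "\<And>x s t. G0 x \<noteq> 0 \<Longrightarrow> (s, t) \<noteq> (0, 0) \<Longrightarrow> \<exists>ij\<in>UNIV. bform m (F ij x) s t \<noteq> 0"
      using no_common_zero_open[of UNIV ?G F m x0, OF finite Ffam Fdeg none] by blast
    have "G0 x = 0" if x: "x \<in> W" for x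
    proof (rule ccontr)
      assume G0x: "G0 x \<noteq> 0"
      obtain k s t where kst: "x = k *s ?v s t" using x unfolding W_def by blast
      have "\<exists>s' t'. (s', t') \<noteq> (0, 0) \<and> (\<exists>k'. x = k' *s ?v s' t')"
      proof (cases "(s, t) = (0, 0)")
        case True
        have "?v 0 0 = 0" by (rule frame_eqI[OF fr]) (use m1 in \<open>simp add: coord bform_infinity\<close>)
        then have "x = 0 *s ?v 1 0" using kst True by simp
        then show ?thesis by (intro exI[of _ 1] exI[of _ 0] conjI) auto
      next
        case False
        then show ?thesis using kst by blast
      qed
      then obtain s' t' k' where st': "(s', t') \<noteq> (0, 0)" and k': "x = k' *s ?v s' t'" by blast
      have "bform m (F ij x) s' t' = 0" for ij unfolding bF k' pairing_scale coord by simp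
      then show False using G0(3)[OF G0x st'] by blast
    qed
    then obtain d f where f: "hom_deg d f" "\<forall>x\<in>W. f x = 0" "f x0 \<noteq> 0"
      using homogeneous_component_vanishes[of G0 W x0] G0(1,2) Wcone by (auto simp: poly_funs_def)
    \<comment> \<open>The homogenization H of g as a form on the curve: where H and y 1 are nonzero,
      a point of the curve is a multiple of a value of the parametrization.\<close>
    have "(\<lambda>z. poly g (fst z)) \<in> generated_algebra {fst, snd :: complex \<times> complex \<Rightarrow> complex}"
      by (intro ga_poly_comp ga_gen) simp
    from homogenize_linear_fractions[OF this, of "y 1" "y 2" "y 3"] obtain M H where H: "hom_deg M H"
      "\<forall>x. pairing (y 1) x \<noteq> 0 \<longrightarrow> H x = pairing (y 1) x ^ M * poly g (pairing (y 2) x / pairing (y 1) x)" by auto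
    have H1: "hom_deg (M + 1) (\<lambda>x. H x * pairing (y 1) x)" by (rule hom_deg_mult[OF H(1) hom_deg_pairing])
    have zero: "(H x * pairing (y 1) x) * f x = 0" if x: "x \<in> K" for x
    proof (cases "pairing (y 1) x \<noteq> 0 \<and> poly g (pairing (y 2) x / pairing (y 1) x) \<noteq> 0")
      case True
      define c where "c = pairing (y 2) x / pairing (y 1) x"
      have "poly g c *s x = pairing (y 1) x *s ?v 1 c" using line[OF x _ c_def, of 1] True by simp
      then have "x = (pairing (y 1) x / poly g c) *s ?v 1 c"
        using True c_def by (metis (no_types, lifting) divide_inverse mult.commute vec.scale_left_imp_eq vec.scale_one vec.scale_scale left_inverse)
      then have "x \<in> W" unfolding W_def by blast
      then show ?thesis using f(2) by simp
    next
      case False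
      then show ?thesis using H(2) by auto
    qed
    obtain t where t: "t \<notin> T" using complex_avoid_finite[OF T] by blast
    then obtain x1 where x1: "x1 \<in> K" "pairing (y 1) x1 = 1" "pairing (y 2) x1 = t" using fib unfolding fibre_def by blast
    have nz1: "H x1 * pairing (y 1) x1 \<noteq> 0" using H(2) x1 fib[OF t] by simp
    have "f x0 = 0" by (rule K_cancel[OF H1 f(1) zero x1(1) nz1 x0(1)])
    then show False using f(3) by simp
  qed
  moreover have "W \<subseteq> K" unfolding W_def using inK K_scale by blast
  ultimately have "K = W" by (rule subset_antisym)
  then show ?thesis
    using fr b34 g deg nz m1 \<phi>(1,2) unfolding W_def by (intro exI[of _ b] exI[of _ y] exI[of _ \<phi>] exI[of _ m]) simp
qed

end

section \<open>Tangent spaces\<close>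

text \<open>Stated along arbitrary differentiable curves, so that the formula for
  \<open>differential\<close> and the chain rule both come out of one induction.\<close>

lemma polynomial_gradient:
  assumes "f \<in> (poly_funs :: (complex ^ 'n \<Rightarrow> complex) set)"
  shows "\<exists>D. (\<forall>i. D i \<in> poly_funs) \<and> (\<forall>V V' \<tau>. (\<forall>i. ((\<lambda>\<tau>. V \<tau> $ i) has_field_derivative V' $ i) (at \<tau>)) \<longrightarrow>
    ((\<lambda>\<tau>. f (V \<tau>)) has_field_derivative (\<Sum>i\<in>UNIV. D i (V \<tau>) * V' $ i)) (at \<tau>))"
  using assms unfolding poly_funs_def
proof induction
  case (gen g)
  then obtain j where j: "g = (\<lambda>x. x $ j)" by blast
  have "(\<Sum>i\<in>UNIV. (if i = j then 1 else 0) * v $ i) = v $ j" for v :: "complex ^ 'n"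
    by (subst sum.remove[of _ j]) (auto intro!: sum.neutral)
  then show ?case
    unfolding j by (intro exI[of _ "\<lambda>i x. if i = j then 1 else 0"] conjI allI impI) (auto simp: ga_const)
next
  case (const c)
  show ?case by (intro exI[of _ "\<lambda>i x. 0"] conjI allI impI) (auto simp: ga_const)
next
  case (add f g)
  then obtain D where D: "\<forall>i. D i \<in> generated_algebra (range (\<lambda>i x. x $ i))"
    "\<forall>V V' \<tau>. (\<forall>i. ((\<lambda>\<tau>. V \<tau> $ i) has_field_derivative V' $ i) (at \<tau>)) \<longrightarrow>
    ((\<lambda>\<tau>. f (V \<tau>)) has_field_derivative (\<Sum>i\<in>UNIV. D i (V \<tau>) * V' $ i)) (at \<tau>)" by (elim exE conjE)
  from add obtain E where E: "\<forall>i. E i \<in> generated_algebra (range (\<lambda>i x. x $ i))"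
    "\<forall>V V' \<tau>. (\<forall>i. ((\<lambda>\<tau>. V \<tau> $ i) has_field_derivative V' $ i) (at \<tau>)) \<longrightarrow>
    ((\<lambda>\<tau>. g (V \<tau>)) has_field_derivative (\<Sum>i\<in>UNIV. E i (V \<tau>) * V' $ i)) (at \<tau>)" by (elim exE conjE)
  show ?case
  proof (intro exI[of _ "\<lambda>i x. D i x + E i x"] conjI allI impI)
    show "(\<lambda>x. D i x + E i x) \<in> generated_algebra (range (\<lambda>i x. x $ i))" for i
      using D(1) E(1) by (intro ga_add) auto
    fix V :: "complex \<Rightarrow> complex ^ 'n" and V' \<tau>
    assume V: "\<forall>i. ((\<lambda>\<tau>. V \<tau> $ i) has_field_derivative V' $ i) (at \<tau>)"
    have "((\<lambda>\<tau>. f (V \<tau>)) has_field_derivative (\<Sum>i\<in>UNIV. D i (V \<tau>) * V' $ i)) (at \<tau>)"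
      "((\<lambda>\<tau>. g (V \<tau>)) has_field_derivative (\<Sum>i\<in>UNIV. E i (V \<tau>) * V' $ i)) (at \<tau>)"
      using V by (intro D(2)[rule_format] E(2)[rule_format]; simp)+
    from DERIV_add[OF this]
    show "((\<lambda>\<tau>. f (V \<tau>) + g (V \<tau>)) has_field_derivative (\<Sum>i\<in>UNIV. (D i (V \<tau>) + E i (V \<tau>)) * V' $ i)) (at \<tau>)"
      by (simp add: distrib_right sum.distrib)
  qed
next
  case (mult f g)
  then obtain D where D: "\<forall>i. D i \<in> generated_algebra (range (\<lambda>i x. x $ i))"
    "\<forall>V V' \<tau>. (\<forall>i. ((\<lambda>\<tau>. V \<tau> $ i) has_field_derivative V' $ i) (at \<tau>)) \<longrightarrow>
    ((\<lambda>\<tau>. f (V \<tau>)) has_field_derivative (\<Sum>i\<in>UNIV. D i (V \<tau>) * V' $ i)) (at \<tau>)" by (elim exE conjE)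
  from mult obtain E where E: "\<forall>i. E i \<in> generated_algebra (range (\<lambda>i x. x $ i))"
    "\<forall>V V' \<tau>. (\<forall>i. ((\<lambda>\<tau>. V \<tau> $ i) has_field_derivative V' $ i) (at \<tau>)) \<longrightarrow>
    ((\<lambda>\<tau>. g (V \<tau>)) has_field_derivative (\<Sum>i\<in>UNIV. E i (V \<tau>) * V' $ i)) (at \<tau>)" by (elim exE conjE)
  show ?case
  proof (intro exI[of _ "\<lambda>i x. D i x * g x + E i x * f x"] conjI allI impI)
    show "(\<lambda>x. D i x * g x + E i x * f x) \<in> generated_algebra (range (\<lambda>i x. x $ i))" for i
      using D(1) E(1) mult.hyps by (intro ga_add ga_mult) auto
    fix V :: "complex \<Rightarrow> complex ^ 'n" and V' \<tau>
    assume V: "\<forall>i. ((\<lambda>\<tau>. V \<tau> $ i) has_field_derivative V' $ i) (at \<tau>)"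
    have "(\<Sum>i\<in>UNIV. (D i (V \<tau>) * g (V \<tau>) + E i (V \<tau>) * f (V \<tau>)) * V' $ i) =
        (\<Sum>i\<in>UNIV. D i (V \<tau>) * V' $ i) * g (V \<tau>) + (\<Sum>i\<in>UNIV. E i (V \<tau>) * V' $ i) * f (V \<tau>)"
      unfolding sum_distrib_right sum.distrib[symmetric] by (intro sum.cong) (auto simp: algebra_simps)
    moreover have "((\<lambda>\<tau>. f (V \<tau>)) has_field_derivative (\<Sum>i\<in>UNIV. D i (V \<tau>) * V' $ i)) (at \<tau>)"
      "((\<lambda>\<tau>. g (V \<tau>)) has_field_derivative (\<Sum>i\<in>UNIV. E i (V \<tau>) * V' $ i)) (at \<tau>)"
      using V by (intro D(2)[rule_format] E(2)[rule_format]; simp)+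
    note DERIV_mult[OF this]
    ultimately    show "((\<lambda>\<tau>. f (V \<tau>) * g (V \<tau>)) has_field_derivative (\<Sum>i\<in>UNIV. (D i (V \<tau>) * g (V \<tau>) + E i (V \<tau>) * f (V \<tau>)) * V' $ i)) (at \<tau>)"
      by simp
  qed
qed

lemma differential_properties:
  assumes "f \<in> (poly_funs :: (complex ^ 'n \<Rightarrow> complex) set)"
  shows "\<exists>D. (\<forall>i. D i \<in> poly_funs) \<and> (\<forall>p v. differential f p v = (\<Sum>i\<in>UNIV. D i p * v $ i)) \<and>
    (\<forall>V V' \<tau>. (\<forall>i. ((\<lambda>\<tau>. V \<tau> $ i) has_field_derivative V' $ i) (at \<tau>)) \<longrightarrow>
      ((\<lambda>\<tau>. f (V \<tau>)) has_field_derivative differential f (V \<tau>) V') (at \<tau>))"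
proof -
  obtain D where D: "\<forall>i. D i \<in> poly_funs" "\<forall>V V' \<tau>. (\<forall>i. ((\<lambda>\<tau>. V \<tau> $ i) has_field_derivative V' $ i) (at \<tau>)) \<longrightarrow>
    ((\<lambda>\<tau>. f (V \<tau>)) has_field_derivative (\<Sum>i\<in>UNIV. D i (V \<tau>) * V' $ i)) (at \<tau>)"
    using polynomial_gradient[OF assms] by (elim exE conjE)
  have diff: "differential f p v = (\<Sum>i\<in>UNIV. D i p * v $ i)" for p v
  proof -
    have "((\<lambda>t. (p + t *s v) $ i) has_field_derivative v $ i) (at 0)" for i
      by (auto intro!: derivative_eq_intros)
    from D(2)[rule_format, of "\<lambda>t. p + t *s v" v 0, OF this] show ?thesis
      unfolding differential_def by (simp add: DERIV_imp_deriv)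
  qed
  then show ?thesis using D by (intro exI[of _ D]) simp
qed

lemma differential_add: "f \<in> poly_funs \<Longrightarrow> differential f p (v + w) = differential f p v + differential f p w"
  using differential_properties[of f] by (auto simp: distrib_left sum.distrib)

lemma differential_scale: "f \<in> poly_funs \<Longrightarrow> differential f p (c *s v) = c * differential f p v"
  using differential_properties[of f] by (auto simp: sum_distrib_left mult_ac)

lemma differential_zero: "f \<in> poly_funs \<Longrightarrow> differential f p 0 = 0"
  using differential_scale[of f p 0 0] by simp

lemma differential_chain:
  assumes "f \<in> poly_funs" "\<And>i. ((\<lambda>\<tau>. V \<tau> $ i) has_field_derivative V' $ i) (at \<tau>)"
  shows "((\<lambda>\<tau>. f (V \<tau>)) has_field_derivative differential f (V \<tau>) V') (at \<tau>)"
  using differential_properties[OF assms(1)] assms(2) by blast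

lemma differential_in_algebra:
  assumes "f \<in> poly_funs" "\<And>i. (\<lambda>x. P x $ i) \<in> generated_algebra G" "\<And>i. (\<lambda>x. V x $ i) \<in> generated_algebra G"
  shows "(\<lambda>x. differential f (P x) (V x)) \<in> generated_algebra G"
proof -
  obtain D where D: "\<And>i. D i \<in> poly_funs" "\<And>p v. differential f p v = (\<Sum>i\<in>UNIV. D i p * v $ i)"
    using differential_properties[OF assms(1)] by blast
  show ?thesis unfolding D(2) by (intro ga_sum ga_mult poly_funs_comp[OF D(1)] assms(2,3))
qed

lemma differential_pf: "f \<in> poly_funs \<Longrightarrow> (\<lambda>p. differential f p v) \<in> poly_funs"
  unfolding poly_funs_def
  by (rule differential_in_algebra) (auto simp: poly_funs_def intro: ga_const ga_gen)

lemma differential_pairing: "differential (pairing u) p v = pairing u v"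
  unfolding differential_def pairing_add pairing_scale
  by (rule DERIV_imp_deriv) (auto intro!: derivative_eq_intros)

lemma differential_product:
  assumes "f \<in> poly_funs" "g \<in> poly_funs"
  shows "differential (\<lambda>x. f x * g x) p v = differential f p v * g p + f p * differential g p v"
proof -
  have V: "((\<lambda>t. (p + t *s v) $ i) has_field_derivative v $ i) (at 0)" for i
    by (auto intro!: derivative_eq_intros)
  from DERIV_mult[OF differential_chain[OF assms(1) V] differential_chain[OF assms(2) V]]
  show ?thesis unfolding differential_def[of "\<lambda>x. f x * g x"] by (simp add: DERIV_imp_deriv mult.commute)
qed

lemma tangent_space_subspace: "vec.subspace (tangent_space A p)"
  by (auto simp: vec.subspace_def tangent_space_def differential_add differential_scale differential_zero)

lemma tangent_of_curve:
  assumes "\<And>\<tau>. V \<tau> \<in> A" "\<And>i. ((\<lambda>\<tau>. V \<tau> $ i) has_field_derivative V' $ i) (at \<tau>0)"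
  shows "V' \<in> tangent_space A (V \<tau>0)"
  unfolding tangent_space_def
proof (intro CollectI ballI impI)
  fix f assume f: "f \<in> poly_funs" "\<forall>x\<in>A. f x = 0"
  have "((\<lambda>\<tau>. f (V \<tau>)) has_field_derivative differential f (V \<tau>0) V') (at \<tau>0)"
    by (rule differential_chain[OF f(1) assms(2)])
  moreover have "(\<lambda>\<tau>. f (V \<tau>)) = (\<lambda>\<tau>. 0)" using f(2) assms(1) by auto
  ultimately show "differential f (V \<tau>0) V' = 0" using DERIV_unique[OF _ DERIV_const[of 0]] by metis
qed

lemma tangent_of_line:
  assumes "\<And>\<tau>. p + \<tau> *s v \<in> A" shows "v \<in> tangent_space A p"
proof -
  have "((\<lambda>\<tau>. (p + \<tau> *s v) $ i) has_field_derivative v $ i) (at 0)" for i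
    by (auto intro!: derivative_eq_intros)
  from tangent_of_curve[of "\<lambda>\<tau>. p + \<tau> *s v", OF assms this] show ?thesis by simp
qed

section \<open>Linear subspaces\<close>

definition annihilator :: "(complex ^ 'n) set \<Rightarrow> (complex ^ 'n) set" where
  "annihilator U = {x. \<forall>u\<in>U. pairing u x = 0}"

lemma annihilator_subspace: "vec.subspace (annihilator U)"
  by (auto simp: vec.subspace_def annihilator_def pairing_add pairing_scale)

lemma annihilator_closed: "closedin proj_zariski (projectivize (annihilator U))"
  unfolding closedin_proj_iff[OF cone_closed_subspace[OF annihilator_subspace]]
proof (intro allI impI)
  fix y assume "y \<notin> annihilator U"
  then obtain u where "u \<in> U" "pairing u y \<noteq> 0" by (auto simp: annihilator_def)
  then show "\<exists>f\<in>poly_funs. (\<forall>x\<in>annihilator U. f x = 0) \<and> f y \<noteq> 0"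
    by (intro bexI[OF _ pf_pairing[of u]]) (auto simp: annihilator_def)
qed

lemma cone_annihilator: "cone (projectivize (annihilator U)) = annihilator U"
  by (rule cone_projectivize[OF cone_closed_subspace[OF annihilator_subspace]])

lemma tangent_space_annihilator:
  assumes "p \<in> annihilator U" shows "tangent_space (annihilator U) p = annihilator U"
proof
  show "tangent_space (annihilator U) p \<subseteq> annihilator U"
  proof
    fix v assume v: "v \<in> tangent_space (annihilator U) p"
    have "pairing u v = 0" if u: "u \<in> U" for u
    proof -
      have "\<forall>x\<in>annihilator U. pairing u x = 0" using u by (auto simp: annihilator_def)
      then have "differential (pairing u) p v = 0" using v pf_pairing[of u] unfolding tangent_space_def by blast
      then show ?thesis by (simp add: differential_pairing)
    qed
    then show "v \<in> annihilator U" by (simp add: annihilator_def)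
  qed
  show "annihilator U \<subseteq> tangent_space (annihilator U) p"
  proof
    fix v assume "v \<in> annihilator U"
    then have "p + \<tau> *s v \<in> annihilator U" for \<tau>
      using assms by (simp add: annihilator_def pairing_add pairing_scale)
    then show "v \<in> tangent_space (annihilator U) p" by (rule tangent_of_line)
  qed
qed

text \<open>The restriction has degree at most N and N + 1 roots. The point q at infinity is covered
  as well, since h q is the coefficient of \<tau>^N.\<close>

lemma hom_vanishes_on_line:
  assumes h: "hom_deg N h" and T: "finite T" "card T = N + 1" "\<And>\<tau>. \<tau> \<in> T \<Longrightarrow> h (p + \<tau> *s q) = 0"
  shows "h (x *s p + z *s q) = 0"
proof -
  obtain P where P: "\<And>\<tau>. h (p + \<tau> *s q) = poly P \<tau>" using poly_fun_on_line[OF hom_deg_pf[OF h]] by blast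
  have "P = 0"
  proof (rule ccontr)
    assume nz: "P \<noteq> 0"
    have "N + 1 \<le> card {\<tau>. poly P \<tau> = 0}"
      unfolding T(2)[symmetric] using T(3) P by (intro card_mono poly_roots_finite nz) auto
    also have "\<dots> \<le> degree P" by (rule card_poly_roots_bound[OF nz])
    also have "\<dots> \<le> N" by (rule hom_line_degree(1)[OF h P])
    finally show False by simp
  qed
  then have zero: "h (p + \<tau> *s q) = 0" for \<tau> using P by simp
  show ?thesis
  proof (cases "x = 0")
    case True
    have "h q = coeff P N" using hom_line_degree(2)[OF h P] by simp
    then have "h q = 0" using \<open>P = 0\<close> by simp
    then show ?thesis using True by (simp add: hom_deg_scale[OF h])
  next
    case False
    then have "x *s p + z *s q = x *s (p + (z / x) *s q)" by (simp add: vector_add_ldistrib)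
    then have "h (x *s p + z *s q) = h (x *s (p + (z / x) *s q))" by (rule arg_cong)
    then show ?thesis unfolding hom_deg_scale[OF h] zero by simp
  qed
qed

lemma exists_finite_set: "\<exists>T :: complex set. finite T \<and> card T = n"
  using infinite_arbitrarily_large[OF infinite_UNIV_char_0[where 'a = complex]] by blast

lemma plane_dim:
  fixes p q :: "complex ^ 'n"
  assumes "\<And>x z. x *s p + z *s q = 0 \<Longrightarrow> x = 0 \<and> z = 0" "L = {x *s p + z *s q | x z. True}"
  shows "vec.subspace L" "vec.dim L = 2"
proof -
  show "vec.subspace L"
    unfolding assms(2)
  proof (rule vec.subspaceI)
    show "0 \<in> {x *s p + z *s q | x z. True}" by (intro CollectI exI[of _ 0]) simp
  next
    fix u v assume "u \<in> {x *s p + z *s q | x z. True}" "v \<in> {x *s p + z *s q | x z. True}"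
    then obtain a b c d where "u = a *s p + b *s q" "v = c *s p + d *s q" by blast
    then have "u + v = (a + c) *s p + (b + d) *s q" by (simp add: vec_eq_iff algebra_simps)
    then show "u + v \<in> {x *s p + z *s q | x z. True}" by blast
  next
    fix k u assume "u \<in> {x *s p + z *s q | x z. True}"
    then obtain a b where "u = a *s p + b *s q" by blast
    then have "k *s u = (k * a) *s p + (k * b) *s q" by (simp add: vec_eq_iff algebra_simps)
    then show "k *s u \<in> {x *s p + z *s q | x z. True}" by blast
  qed
  have "p \<noteq> q" using assms(1)[of 1 "-1"] by auto
  have "q \<noteq> 0" using assms(1)[of 0 1] by auto
  have "p \<notin> vec.span {q}"
  proof
    assume "p \<in> vec.span {q}"
    then obtain k where "p = k *s q" by (auto simp: vec.span_singleton)
    then have "1 *s p + (- k) *s q = 0" by simp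
    then show False using assms(1)[of 1 "- k"] by simp
  qed
  then have ind: "vec.independent {p, q}" using \<open>q \<noteq> 0\<close> by (intro vec.independent_insertI) (simp_all add: vec.independent_empty)
  have "vec.span {p, q} = L"
  proof
    show "vec.span {p, q} \<subseteq> L"
    proof (rule vec.span_minimal[OF _ \<open>vec.subspace L\<close>])
      have "p = 1 *s p + 0 *s q" "q = 0 *s p + 1 *s q" by simp_all
      then show "{p, q} \<subseteq> L" unfolding assms(2) by blast
    qed
    show "L \<subseteq> vec.span {p, q}"
      unfolding assms(2) by (auto intro!: vec.span_add[OF vec.span_scale[OF vec.span_base] vec.span_scale[OF vec.span_base]])
  qed
  then have "vec.dim L = card {p, q}" using vec.dim_span_eq_card_independent[OF ind] by simp
  then show "vec.dim L = 2" using \<open>p \<noteq> q\<close> by simp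
qed

text \<open>The dimension is at most 1 because a form of degree N on the line is determined by N + 1
  points; a point in the line gives the lower bound.\<close>

lemma line_irreducible_curve:
  fixes p q :: "complex ^ 'n"
  assumes ind: "\<And>x z. x *s p + z *s q = 0 \<Longrightarrow> x = 0 \<and> z = 0" and L: "annihilator U = {x *s p + z *s q | x z. True}"
  shows "irreducible_curve (projectivize (annihilator U))"
proof -
  let ?L = "projectivize (annihilator U)"
  have p0: "p \<noteq> 0" "q \<noteq> 0" using ind[of 1 0] ind[of 0 1] by auto
  have "p = 1 *s p + 0 *s q" "q = 0 *s p + 1 *s q" by simp_all
  then have pL: "p \<in> annihilator U" "q \<in> annihilator U" unfolding L by blast+
  then have irr: "irreducible_in proj_zariski ?L"
    using p0 by (intro subspace_irreducible[OF annihilator_subspace]) auto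
  have "krull_dim proj_zariski ?L \<le> enat 1"
  proof (rule krull_dim_le[where C = 1])
    fix N and J :: "nat list set" and h :: "nat list \<Rightarrow> complex ^ 'n \<Rightarrow> complex"
    assume J: "finite J" "card J > 1 * (N + 1) ^ 1" and h: "\<And>i. i \<in> J \<Longrightarrow> hom_deg N (h i)"
    obtain T :: "complex set" where T: "finite T" "card T = N + 1" using exists_finite_set by blast
    obtain l where l: "\<exists>i\<in>J. l i \<noteq> 0" "\<forall>\<tau>\<in>T. (\<Sum>i\<in>J. l i * h i (p + \<tau> *s q)) = 0"
      using linear_dependence[OF T(1) J(1), of "\<lambda>i \<tau>. h i (p + \<tau> *s q)"] J(2) T(2) by auto
    have H: "hom_deg N (\<lambda>x. \<Sum>i\<in>J. l i * h i x)" by (intro hom_deg_sum hom_deg_cmult h)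
    have "(\<Sum>i\<in>J. l i * h i x) = 0" if x: "x \<in> cone ?L" for x
    proof -
      obtain a c where "x = a *s p + c *s q" using x unfolding cone_annihilator unfolding L by blast
      then show ?thesis using hom_vanishes_on_line[OF H T, of p q a c] l(2) by blast
    qed
    then show "\<not> independent_on J h (cone ?L)" using l(1) unfolding independent_on_def by blast
  qed
  moreover have "enat 1 \<le> krull_dim proj_zariski ?L"
  proof (rule krull_dim_ge[where Z = "\<lambda>i. if i = 0 then {vec.span {p}} else ?L"])
    have "vec.span {p} \<in> ?L" by (rule projectivizeI[OF pL(1) p0(1)])
    moreover have "vec.span {q} \<in> ?L" by (rule projectivizeI[OF pL(2) p0(2)])
    moreover have "vec.span {q} \<noteq> vec.span {p}"
    proof
      assume "vec.span {q} = vec.span {p}"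
      then obtain c where "q = c *s p" using span_eq_iff[OF p0(2,1)] by blast
      then have "(- c) *s p + 1 *s q = 0" by simp
      then show False using ind[of "- c" 1] by simp
    qed
    ultimately show "(if i = 0 then {vec.span {p}} else ?L) \<subset> (if Suc i = 0 then {vec.span {p}} else ?L)" if "i < 1" for i
      using that by auto
    show "closedin proj_zariski (if i = 0 then {vec.span {p}} else ?L) \<and>
        irreducible_in proj_zariski (if i = 0 then {vec.span {p}} else ?L) \<and>
        (if i = 0 then {vec.span {p}} else ?L) \<subseteq> ?L" for i
      using point_closed[OF p0(1)] point_irreducible[OF p0(1)] annihilator_closed irr \<open>vec.span {p} \<in> ?L\<close> by auto
  qed
  ultimately show ?thesis
    unfolding irreducible_curve_def using irr annihilator_closed by (auto simp: one_enat_def)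
qed

section \<open>A criterion for ML degree one, and lines\<close>

lemma MLD_eq_1:
  assumes "generically (\<lambda>u. \<exists>!x. (x, u) \<in> critical_pairs F X)"
  shows "MLD F X = 1"
proof -
  have dense: "generically (\<lambda>u. u \<in> snd ` critical_pairs F X)"
    by (rule generically_mono[OF assms]) force
  have card: "generically (\<lambda>u. finite {x. (x, u) \<in> critical_pairs F X} \<and> card {x. (x, u) \<in> critical_pairs F X} = 1)"
  proof (rule generically_mono[OF assms])
    fix u assume "\<exists>!x. (x, u) \<in> critical_pairs F X"
    then obtain x where "{x. (x, u) \<in> critical_pairs F X} = {x}" by blast
    then show "finite {x. (x, u) \<in> critical_pairs F X} \<and> card {x. (x, u) \<in> critical_pairs F X} = 1" by simp
  qed
  show ?thesis
    unfolding MLD_def zariski_dense_if_generically[OF dense] generic_card_eq[OF card] by simp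
qed

text \<open>In the basis dual to \<alpha>, \<beta> the function is log a + log c minus a linear
  form, whose only critical point has a and c equal to the reciprocals of the coefficients of that
  form.\<close>

lemma MLD_line:
  fixes p q :: "complex ^ 'n"
  assumes L: "annihilator U = {x *s p + z *s q | x z. True}"
    and pq: "pairing \<alpha> p = 1" "pairing \<beta> p = 0" "pairing \<alpha> q = 0" "pairing \<beta> q = 1"
  shows "MLD (\<lambda>x. pairing \<alpha> x * pairing \<beta> x) (projectivize (annihilator U)) = 1"
proof -
  let ?F = "\<lambda>x. pairing \<alpha> x * pairing \<beta> x" and ?L = "projectivize (annihilator U)"
  have ind: "x = 0 \<and> z = 0" if "x *s p + z *s q = 0" for x z
    using arg_cong[OF that, of "pairing \<alpha>"] arg_cong[OF that, of "pairing \<beta>"] pq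
    by (simp add: pairing_add pairing_scale)
  have "krull_dim proj_zariski ?L = 1" using line_irreducible_curve[OF ind L] by (simp add: irreducible_curve_def)
  then have reg: "cone_reg ?L = annihilator U"
    unfolding cone_reg_def cone_annihilator
    using tangent_space_annihilator[of _ U] plane_dim(2)[OF ind L] by (auto simp: one_enat_def)
  have crit: "(x, u) \<in> critical_pairs ?F ?L \<longleftrightarrow>
      pairing u p \<noteq> 0 \<and> pairing u q \<noteq> 0 \<and> x = (1 / pairing u p) *s p + (1 / pairing u q) *s q" for x u
  proof
    assume "(x, u) \<in> critical_pairs ?F ?L"
    then have x: "x \<in> annihilator U" "?F x \<noteq> 0"
      "\<And>v. v \<in> annihilator U \<Longrightarrow> differential ?F x v / ?F x - pairing u v = 0"
      unfolding critical_pairs_def cone_annihilator using reg tangent_space_annihilator[of x U] by auto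
    obtain a c where ac: "x = a *s p + c *s q" using x(1) L by blast
    have xv: "pairing \<alpha> x = a" "pairing \<beta> x = c" unfolding ac by (simp_all add: pairing_add pairing_scale pq)
    have "p = 1 *s p + 0 *s q" "q = 0 *s p + 1 *s q" by simp_all
    then have pL: "p \<in> annihilator U" "q \<in> annihilator U" unfolding L by blast+
    have "differential ?F x v = pairing \<alpha> v * c + a * pairing \<beta> v" for v
      by (simp add: differential_product[OF pf_pairing pf_pairing] differential_pairing xv)
    then have "c / (a * c) = pairing u p" "a / (a * c) = pairing u q"
      using x(3)[OF pL(1)] x(3)[OF pL(2)] by (simp_all add: xv pq)
    then have "pairing u p = 1 / a" "pairing u q = 1 / c" using x(2) xv by auto
    then show "pairing u p \<noteq> 0 \<and> pairing u q \<noteq> 0 \<and> x = (1 / pairing u p) *s p + (1 / pairing u q) *s q"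
      using x(2) unfolding xv by (simp add: ac)
  next
    assume u: "pairing u p \<noteq> 0 \<and> pairing u q \<noteq> 0 \<and> x = (1 / pairing u p) *s p + (1 / pairing u q) *s q"
    have x: "x \<in> annihilator U" unfolding L using u by blast
    have xv: "pairing \<alpha> x = 1 / pairing u p" "pairing \<beta> x = 1 / pairing u q"
      using u by (simp_all add: pairing_add pairing_scale pq)
    have "differential ?F x v / ?F x - pairing u v = 0" if v: "v \<in> annihilator U" for v
    proof -
      obtain a c where ac: "v = a *s p + c *s q" using v L by blast
      have "differential ?F x v = a * (1 / pairing u q) + (1 / pairing u p) * c"
        by (simp add: differential_product[OF pf_pairing pf_pairing] differential_pairing xv ac pairing_add pairing_scale pq)
      moreover have "pairing u v = a * pairing u p + c * pairing u q" by (simp add: ac pairing_add pairing_scale)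
      moreover have "pairing u p \<noteq> 0" "pairing u q \<noteq> 0" using u by auto
      ultimately show ?thesis unfolding xv by (simp add: distrib_right)
    qed
    then show "(x, u) \<in> critical_pairs ?F ?L"
      unfolding critical_pairs_def cone_annihilator using x reg xv u tangent_space_annihilator[OF x] by simp
  qed
  have p0: "p \<noteq> 0" "q \<noteq> 0" using ind[of 1 0] ind[of 0 1] by auto
  have gen0: "generically (\<lambda>u. pairing u w \<noteq> 0)" if w: "w \<noteq> 0" for w :: "complex ^ 'n"
  proof -
    obtain u where "pairing w u \<noteq> 0" using pairing_nondegenerate w by blast
    from generically_nonzero[OF pf_pairing this] show ?thesis by (simp add: pairing_commute)
  qed
  have gen: "generically (\<lambda>u. pairing u p \<noteq> 0 \<and> pairing u q \<noteq> 0)"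
    by (intro generically_conj gen0 p0)
  show ?thesis by (rule MLD_eq_1, rule generically_mono[OF gen]) (simp add: crit)
qed

lemma hyperplane_dim:
  assumes "q \<noteq> 0" shows "vec.dim {v :: complex ^ 4. pairing q v = 0} = 3"
proof -
  let ?H = "{v. pairing q v = 0}"
  have sub: "vec.subspace ?H" by (auto simp: vec.subspace_def pairing_add pairing_scale)
  obtain w where w: "pairing q w \<noteq> 0" using pairing_nondegenerate assms by blast
  have "v \<in> vec.span (insert w ?H)" for v
  proof -
    have "v = (pairing q v / pairing q w) *s w + (v - (pairing q v / pairing q w) *s w)" by simp
    moreover have "v - (pairing q v / pairing q w) *s w \<in> ?H" using w by (simp add: pairing_diff pairing_scale)
    ultimately show ?thesis by (metis (no_types, lifting) insertCI vec.span_add vec.span_base vec.span_scale)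
  qed
  then have "vec.span (insert w ?H) = UNIV" by blast
  then have "vec.dim (insert w ?H) = vec.dim (UNIV :: (complex ^ 4) set)" by (metis vec.dim_span)
  then have "vec.dim (insert w ?H) = 4" unfolding vec_dim_card by simp
  moreover have "vec.span ?H = ?H" using sub by (simp only: vec.span_eq_iff)
  then have "w \<notin> vec.span ?H" using w by (metis mem_Collect_eq)
  ultimately show ?thesis by (simp add: vec.dim_insert)
qed

lemma proportional_if_same_kernel:
  assumes "q \<noteq> 0" "\<And>v. pairing q v = 0 \<Longrightarrow> pairing l v = 0"
  shows "\<exists>k. l = k *s q"
proof -
  obtain w where w: "pairing q w \<noteq> 0" using pairing_nondegenerate assms(1) by blast
  have "pairing (l - (pairing l w / pairing q w) *s q) v = 0" for v
  proof -
    define v' where "v' = v - (pairing q v / pairing q w) *s w"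
    have "pairing q v' = 0" using w by (simp add: v'_def pairing_diff pairing_scale)
    from assms(2)[OF this] have "pairing l v = pairing q v / pairing q w * pairing l w"
      by (simp add: v'_def pairing_diff pairing_scale)
    then show ?thesis by (simp add: pairing_diff_left pairing_scale_left)
  qed
  then have "l - (pairing l w / pairing q w) *s q = 0" by (rule pairing_nondegenerate)
  then show ?thesis by auto
qed

section \<open>Univariate polynomials\<close>

text \<open>A gcd of a whole family, obtained by splitting off common linear factors; each of them
  lowers the degree of one fixed nonzero member.\<close>

lemma remove_common_roots:
  fixes p :: "'i \<Rightarrow> complex poly"
  assumes "p i0 \<noteq> 0"
  shows "\<exists>G q. G \<noteq> 0 \<and> (\<forall>i. p i = G * q i) \<and> (\<forall>r. \<exists>i. poly (q i) r \<noteq> 0)"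
  using assms
proof (induction "degree (p i0)" arbitrary: p rule: less_induct)
  case less
  show ?case
  proof (cases "\<forall>r. \<exists>i. poly (p i) r \<noteq> 0")
    case True
    then show ?thesis by (intro exI[of _ 1] exI[of _ p]) simp
  next
    case False
    then obtain r where r: "\<And>i. poly (p i) r = 0" by blast
    then have "\<forall>i. \<exists>q. p i = [:-r, 1:] * q" by (simp add: poly_eq_0_iff_dvd dvd_def)
    from choice[OF this] obtain q where q: "\<And>i. p i = [:-r, 1:] * q i" by blast
    have qnz: "q i0 \<noteq> 0" using q[of i0] less.prems by auto
    have "degree (p i0) = Suc (degree (q i0))" unfolding q using qnz by (subst degree_mult_eq) auto
    from less.hyps[of q, OF _ qnz] this obtain G q' where
      G: "G \<noteq> 0" "\<forall>i. q i = G * q' i" "\<forall>r. \<exists>i. poly (q' i) r \<noteq> 0" by auto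
    show ?thesis
    proof (intro exI[of _ "[:-r, 1:] * G"] exI[of _ q'] conjI allI)
      show "p i = [:-r, 1:] * G * q' i" for i using q[of i] G(2) by (metis mult.assoc)
    qed (use G in \<open>simp_all del: mult_pCons_left\<close>)
  qed
qed

text \<open>Subtract from p the multiple of q that creates a root at a point r with q r \<noteq> 0.
  The equation persists, and comparing orders at r shows that the difference is zero, since
  differentiation lowers its order by one.\<close>

lemma proportional_if_wronskian_zero:
  fixes p q :: "complex poly"
  assumes "q \<noteq> 0" "pderiv p * q = p * pderiv q"
  shows "\<exists>k. p = smult k q"
proof -
  have "finite {x. poly q x = 0}" by (rule poly_roots_finite[OF assms(1)])
  then obtain r where r: "poly q r \<noteq> 0" using complex_avoid_finite by blast
  define h where "h = p - smult (poly p r / poly q r) q"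
  have hq: "pderiv h * q = h * pderiv q"
    using assms(2) by (simp add: h_def pderiv_diff pderiv_smult algebra_simps)
  have hr: "poly h r = 0" using r by (simp add: h_def)
  have "h = 0"
  proof (rule ccontr)
    assume h: "h \<noteq> 0"
    have o: "order r h = Suc (order r (pderiv h))" by (rule order_pderiv[OF h hr])
    have "pderiv h \<noteq> 0"
    proof
      assume "pderiv h = 0"
      then obtain c where "h = [:c:]" using pderiv_iszero by blast
      then show False using h hr by simp
    qed
    then have nz: "pderiv h * q \<noteq> 0" using assms(1) by simp
    then have nz': "h * pderiv q \<noteq> 0" using hq by simp
    have "order r (pderiv h) + order r q = order r h + order r (pderiv q)"
      using order_mult[OF nz, of r] order_mult[OF nz', of r] hq by simp
    moreover have "order r q = 0" using r by (simp add: order_0I)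
    ultimately show False using o by simp
  qed
  then show ?thesis unfolding h_def by (intro exI[of _ "poly p r / poly q r"]) simp
qed

lemma poly_zero_if_derivatives_zero:
  fixes q :: "complex poly"
  assumes "\<And>k. poly ((pderiv ^^ k) q) 0 = 0" shows "q = 0"
  using assms
proof (induction "degree q" arbitrary: q rule: less_induct)
  case less
  have q0: "poly q 0 = 0" using less.prems[of 0] by simp
  show ?case
  proof (cases "degree q = 0")
    case True
    then obtain c where "q = [:c:]" by (metis degree_eq_zeroE)
    then show ?thesis using q0 by simp
  next
    case False
    have "poly ((pderiv ^^ k) (pderiv q)) 0 = 0" for k
      using less.prems[of "Suc k"] by (simp add: funpow_swap1)
    then have "pderiv q = 0" using less.hyps[of "pderiv q"] False by (simp add: degree_pderiv)
    then show ?thesis using False by (simp add: pderiv_eq_0_iff)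
  qed
qed

text \<open>If the degree of Q exceeded n, then v^n Q (1 / v) would have a pole at 0.\<close>

lemma degree_le_if_reversed:
  fixes Q S :: "complex poly"
  assumes "\<And>v. v \<noteq> 0 \<Longrightarrow> poly S v = v ^ n * poly Q (1 / v)"
  shows "degree Q \<le> n"
proof (rule ccontr)
  assume "\<not> ?thesis"
  then obtain k where k: "degree Q = n + Suc k" by (metis add_Suc_right less_iff_Suc_add linorder_not_less)
  have "monom 1 (Suc k) * S = reflect_poly Q"
  proof (rule poly_eq_cofinite[of "{0}"])
    fix v :: complex assume "v \<notin> {0}"
    then show "poly (monom 1 (Suc k) * S) v = poly (reflect_poly Q) v"
      using assms[of v] by (simp add: poly_monom poly_reflect_poly_nz k power_add inverse_eq_divide mult_ac)
  qed simp
  then have "poly (reflect_poly Q) 0 = 0" by (metis mult_eq_0_iff poly_monom poly_mult power_0_Suc mult_zero_right)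
  then have "lead_coeff Q = 0" by simp
  then have "Q = 0" by (rule leading_coeff_0_iff[THEN iffD1])
  then show False using k by simp
qed

section \<open>The tangent developable of a rational curve and its dual\<close>

lemma other_two_indices:
  fixes i j :: 4
  assumes "i \<noteq> j" shows "\<exists>k l. k \<noteq> l \<and> k \<noteq> i \<and> k \<noteq> j \<and> l \<noteq> i \<and> l \<noteq> j \<and> UNIV = {i, j, k, l}"
proof -
  have "card (- {i, j}) = 2" unfolding Compl_eq_Diff_UNIV using assms by (simp add: card_Diff_subset)
  then obtain k l where kl: "- {i, j} = {k, l}" "k \<noteq> l" unfolding card_2_iff by (elim exE) simp
  have "k \<in> - {i, j}" "l \<in> - {i, j}" unfolding kl(1) by simp_all
  moreover have "UNIV = {i, j} \<union> - {i, j}" by simp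
  then have "UNIV = {i, j, k, l}" unfolding kl(1) by (simp add: insert_commute)
  ultimately show ?thesis using kl(2) by (intro exI[of _ k] exI[of _ l]) simp
qed

lemma form_identity:
  assumes "F \<in> generated_algebra {fst, snd :: complex \<times> complex \<Rightarrow> complex}" "\<And>s t. s \<noteq> 0 \<Longrightarrow> F (s, t) = 0"
  shows "F (s, t) = 0"
  by (rule binary_density[OF assms(1), of "{}"]) (use assms(2) in auto)

lemma bform_algebra: "(\<lambda>z. bform m p (fst z) (snd z)) \<in> generated_algebra {fst, snd}"
  by (intro bform_in_algebra ga_gen) auto

text \<open>Here \<open>\<phi> \<and> \<phi>' = G \<psi>\<close> with \<open>\<psi>\<close> free of common zeros, so that \<open>\<psi>\<close> extends the family of tangent lines
  to all points of the projective line.\<close>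

locale rational_curve = space_curve +
  fixes b y :: "4 \<Rightarrow> complex ^ 4" and \<phi> :: "4 \<Rightarrow> complex poly" and m :: nat
    and G :: "complex poly" and \<psi> :: "4 \<Rightarrow> 4 \<Rightarrow> complex poly" and M :: nat
  assumes fr: "frame b y" and phi1: "\<phi> 1 \<noteq> 0" and phi2: "\<phi> 2 = pCons 0 (\<phi> 1)"
    and deg: "degree (\<phi> i) \<le> m" and v_nonzero: "(s, t) \<noteq> (0, 0) \<Longrightarrow> param_vec b m \<phi> s t \<noteq> 0"
    and m1: "1 \<le> m" and K_eq: "cone C = {k *s param_vec b m \<phi> s t | k s t. True}"
    and wedge: "\<phi> i * pderiv (\<phi> j) - \<phi> j * pderiv (\<phi> i) = G * \<psi> i j" and G_nonzero: "G \<noteq> 0"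
    and psi_nonzero: "\<exists>i j. poly (\<psi> i j) r \<noteq> 0" and deg_psi: "degree (\<psi> i j) \<le> M"
    and lead_psi: "\<exists>i j. coeff (\<psi> i j) M \<noteq> 0"
begin

abbreviation "v \<equiv> param_vec b m \<phi>"

definition \<Psi> :: "4 \<Rightarrow> 4 \<Rightarrow> complex \<Rightarrow> complex \<Rightarrow> complex" where
  "\<Psi> i j s t = bform M (\<psi> i j) s t"

definition w :: "complex \<Rightarrow> complex ^ 4" where
  "w c = (\<Sum>i\<in>UNIV. poly (\<phi> i) c *s b i)"

definition w' :: "complex \<Rightarrow> complex ^ 4" where
  "w' c = (\<Sum>i\<in>UNIV. poly (pderiv (\<phi> i)) c *s b i)"

text \<open>The parameters of points in the chart y 1 \<noteq> 0, where the curve is the graph of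
  \<phi> i / \<phi> 1 over the parameter.\<close>

definition good :: "complex \<Rightarrow> bool" where
  "good c \<longleftrightarrow> poly (\<phi> 1) c \<noteq> 0"

text \<open>The rows of the skew matrix \<Psi> span the tangent line of the curve, seen as a
  two-dimensional subspace; their annihilator \<Lambda> is the corresponding ruling.\<close>

definition row :: "complex \<Rightarrow> complex \<Rightarrow> 4 \<Rightarrow> complex ^ 4" where
  "row s t i = (\<Sum>j\<in>UNIV. \<Psi> i j s t *s b j)"

definition \<Lambda> :: "complex \<Rightarrow> complex \<Rightarrow> (complex ^ 4) set" where
  "\<Lambda> s t = annihilator (range (row s t))"

lemma v_coord: "pairing (y i) (v s t) = bform m (\<phi> i) s t"
  by (rule param_vec_coord[OF fr])

lemma w_coord: "pairing (y i) (w c) = poly (\<phi> i) c"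
proof -
  have "pairing (y i) (w c) = (\<Sum>j\<in>UNIV. poly (\<phi> j) c * (if i = j then 1 else 0))"
    unfolding w_def pairing_sum pairing_scale frameD[OF fr] ..
  also have "\<dots> = poly (\<phi> i) c" by (subst sum.remove[of _ i]) (auto intro!: sum.neutral)
  finally show ?thesis .
qed

lemma w'_coord: "pairing (y i) (w' c) = poly (pderiv (\<phi> i)) c"
proof -
  have "pairing (y i) (w' c) = (\<Sum>j\<in>UNIV. poly (pderiv (\<phi> j)) c * (if i = j then 1 else 0))"
    unfolding w'_def pairing_sum pairing_scale frameD[OF fr] ..
  also have "\<dots> = poly (pderiv (\<phi> i)) c" by (subst sum.remove[of _ i]) (auto intro!: sum.neutral)
  finally show ?thesis .
qed

lemma v_affine: "s \<noteq> 0 \<Longrightarrow> v s t = s ^ m *s w (t / s)"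
  by (rule frame_eqI[OF fr]) (simp add: v_coord pairing_scale w_coord bform_affine[OF deg])

lemma v_in_K: "v s t \<in> K"
proof -
  have "v s t = 1 *s v s t" by simp
  then show ?thesis unfolding K_eq by blast
qed

lemma w_in_K: "w c \<in> K"
  using v_in_K[of 1 c] v_affine[of 1 c] by simp

lemma v_algebra: "(\<lambda>z. v (fst z) (snd z) $ k) \<in> generated_algebra {fst, snd}"
  unfolding param_vec_def by (simp, intro ga_sum ga_mult ga_const bform_algebra)

lemma psi_algebra: "(\<lambda>z. \<Psi> i j (fst z) (snd z)) \<in> generated_algebra {fst, snd}"
  unfolding \<Psi>_def by (rule bform_algebra)

lemma psi_affine: "s \<noteq> 0 \<Longrightarrow> \<Psi> i j s t = s ^ M * poly (\<psi> i j) (t / s)"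
  unfolding \<Psi>_def by (rule bform_affine[OF deg_psi])

lemma psi_scale: "\<Psi> i j (c * s) (c * t) = c ^ M * \<Psi> i j s t"
  unfolding \<Psi>_def by (rule bform_scale)

lemma psi_form_nonzero:
  assumes "(s, t) \<noteq> (0, 0)" shows "\<exists>i j. \<Psi> i j s t \<noteq> 0"
proof (cases "s = 0")
  case True
  then show ?thesis using lead_psi assms by (simp add: \<Psi>_def bform_infinity)
next
  case False
  then show ?thesis using psi_nonzero[of "t / s"] by (simp add: psi_affine)
qed

lemma psi_skew_poly: "\<psi> i j = - \<psi> j i"
proof -
  have "G * (\<psi> i j + \<psi> j i) = 0" by (simp add: distrib_left wedge[symmetric])
  then show ?thesis using G_nonzero by (simp add: eq_neg_iff_add_eq_0)
qed

text \<open>The relation holds for the decomposable bivector \<phi> \<and> \<phi>', and the factor G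
  squared can be cancelled.\<close>

lemma psi_pluecker_poly: "\<psi> i j * \<psi> k l = \<psi> i k * \<psi> j l - \<psi> i l * \<psi> j k"
proof -
  have "(G * \<psi> i j) * (G * \<psi> k l) = (G * \<psi> i k) * (G * \<psi> j l) - (G * \<psi> i l) * (G * \<psi> j k)"
    unfolding wedge[symmetric] by (simp add: algebra_simps)
  then have "(G * G) * (\<psi> i j * \<psi> k l - (\<psi> i k * \<psi> j l - \<psi> i l * \<psi> j k)) = 0"
    by (simp add: algebra_simps)
  then show ?thesis using G_nonzero by simp
qed

lemma phi_psi_poly: "\<phi> i * \<psi> j k + \<phi> j * \<psi> k i + \<phi> k * \<psi> i j = 0"
proof -
  have "\<phi> i * (G * \<psi> j k) + \<phi> j * (G * \<psi> k i) + \<phi> k * (G * \<psi> i j) = 0"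
    unfolding wedge[symmetric] by (simp add: algebra_simps)
  then have "G * (\<phi> i * \<psi> j k + \<phi> j * \<psi> k i + \<phi> k * \<psi> i j) = 0" by (simp add: algebra_simps)
  then show ?thesis using G_nonzero by simp
qed

lemma psi_skew: "\<Psi> i j s t = - \<Psi> j i s t"
  unfolding \<Psi>_def by (subst psi_skew_poly) (simp add: bform_def sum_negf)

lemma psi_pluecker: "\<Psi> i j s t * \<Psi> k l s t = \<Psi> i k s t * \<Psi> j l s t - \<Psi> i l s t * \<Psi> j k s t"
proof -
  let ?F = "\<lambda>z. \<Psi> i j (fst z) (snd z) * \<Psi> k l (fst z) (snd z) -
    (\<Psi> i k (fst z) (snd z) * \<Psi> j l (fst z) (snd z) - \<Psi> i l (fst z) (snd z) * \<Psi> j k (fst z) (snd z))"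
  have "?F (s, t) = 0"
  proof (rule form_identity)
    show "?F \<in> generated_algebra {fst, snd}" by (intro ga_diff ga_mult psi_algebra)
    fix s t :: complex assume s: "s \<noteq> 0"
    have e: "poly (\<psi> i j) c * poly (\<psi> k l) c = poly (\<psi> i k) c * poly (\<psi> j l) c - poly (\<psi> i l) c * poly (\<psi> j k) c" for c
      using arg_cong[OF psi_pluecker_poly[of i j k l], of "\<lambda>p. poly p c"] by simp
    have "?F (s, t) = s ^ M * s ^ M * (poly (\<psi> i j) (t / s) * poly (\<psi> k l) (t / s) -
        (poly (\<psi> i k) (t / s) * poly (\<psi> j l) (t / s) - poly (\<psi> i l) (t / s) * poly (\<psi> j k) (t / s)))"
      by (simp add: psi_affine[OF s] algebra_simps)
    then show "?F (s, t) = 0" unfolding e by simp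
  qed
  then show ?thesis by simp
qed

lemma row_pairing: "pairing (row s t i) p = (\<Sum>j\<in>UNIV. \<Psi> i j s t * pairing (b j) p)"
  unfolding row_def pairing_commute[of _ p] pairing_sum pairing_scale ..

lemma row_y: "pairing (row s t i) (y j) = \<Psi> i j s t"
proof -
  have "pairing (row s t i) (y j) = (\<Sum>k\<in>UNIV. \<Psi> i k s t * (if j = k then 1 else 0))"
    unfolding row_pairing using frameD[OF fr] by (simp add: pairing_commute)
  also have "\<dots> = \<Psi> i j s t" by (subst sum.remove[of _ j]) (auto intro!: sum.neutral)
  finally show ?thesis .
qed

lemma row_pluecker: "\<Psi> i j s t * pairing (row s t k) p = \<Psi> i k s t * pairing (row s t j) p - pairing (row s t i) p * \<Psi> j k s t"
  unfolding row_pairing sum_distrib_left sum_distrib_right sum_subtractf[symmetric]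
proof (rule sum.cong[OF refl])
  fix l
  have "\<Psi> i j s t * (\<Psi> k l s t * pairing (b l) p) = (\<Psi> i j s t * \<Psi> k l s t) * pairing (b l) p" by simp
  then show "\<Psi> i j s t * (\<Psi> k l s t * pairing (b l) p) =
      \<Psi> i k s t * (\<Psi> j l s t * pairing (b l) p) - \<Psi> i l s t * pairing (b l) p * \<Psi> j k s t"
    unfolding psi_pluecker[of i j s t k l] by (simp add: algebra_simps)
qed

lemma Lambda_iff: "p \<in> \<Lambda> s t \<longleftrightarrow> (\<forall>i. pairing (row s t i) p = 0)"
  by (auto simp: \<Lambda>_def annihilator_def)

text \<open>\<open>\<Psi> i j s t\<close> times the projection onto the ruling along
  \<open>y i\<close> and \<open>y j\<close>. Keeping this factor makes it polynomial in (s, t) and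
  defined for every parameter.\<close>

definition proj :: "4 \<Rightarrow> 4 \<Rightarrow> complex \<Rightarrow> complex \<Rightarrow> complex ^ 4 \<Rightarrow> complex ^ 4" where
  "proj i j s t p = \<Psi> i j s t *s p - pairing (row s t i) p *s y j + pairing (row s t j) p *s y i"

lemma proj_in_Lambda: "proj i j s t p \<in> \<Lambda> s t"
  unfolding Lambda_iff
proof
  fix k
  have "pairing (row s t k) (proj i j s t p) = \<Psi> i j s t * pairing (row s t k) p - pairing (row s t i) p * \<Psi> k j s t + pairing (row s t j) p * \<Psi> k i s t"
    by (simp add: proj_def pairing_add pairing_diff pairing_scale row_y)
  also have "\<dots> = 0"
    unfolding row_pluecker[of i j s t k p] using psi_skew[of i k s t] psi_skew[of j k s t] by (simp add: algebra_simps)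
  finally show "pairing (row s t k) (proj i j s t p) = 0" .
qed

lemma proj_Lambda: "p \<in> \<Lambda> s t \<Longrightarrow> proj i j s t p = \<Psi> i j s t *s p"
  by (simp add: proj_def Lambda_iff)

lemma proj_linear: "proj i j s t (x *s p + z *s q) = x *s proj i j s t p + z *s proj i j s t q"
  by (simp add: proj_def pairing_add pairing_scale vec_eq_iff algebra_simps)

lemma row_algebra: "(\<lambda>z. pairing (row (fst z) (snd z) i) p) \<in> generated_algebra {fst, snd}"
  unfolding row_pairing by (intro ga_sum ga_mult ga_const psi_algebra)

lemma proj_algebra: "(\<lambda>z. proj i j (fst z) (snd z) p $ k) \<in> generated_algebra {fst, snd}"
  unfolding proj_def by (simp, intro ga_add ga_diff ga_mult ga_const row_algebra psi_algebra)

lemma psi_diag: "\<Psi> i i s t = 0"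
  using psi_skew[of i i s t] by (simp add: eq_neg_iff_add_eq_0)

text \<open>For indices with \<open>\<Psi> i j s t \<noteq> 0\<close>, \<open>proj\<close> kills
  \<open>y i\<close> and \<open>y j\<close> and sends the other two dual basis vectors to a basis of
  the ruling.\<close>

lemma Lambda_basis:
  assumes "(s, t) \<noteq> (0, 0)"
  shows "\<exists>p q. (\<forall>x z. x *s p + z *s q = 0 \<longrightarrow> x = 0 \<and> z = 0) \<and> \<Lambda> s t = {x *s p + z *s q | x z. True}"
proof -
  obtain i j where ij: "\<Psi> i j s t \<noteq> 0" using psi_form_nonzero[OF assms] by blast
  then have "i \<noteq> j" using psi_diag by auto
  then obtain k l where kl: "k \<noteq> l" "k \<noteq> i" "k \<noteq> j" "l \<noteq> i" "l \<noteq> j" "UNIV = {i, j, k, l}"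
    using other_two_indices by blast
  let ?R = "proj i j s t"
  have Ri: "?R (y i) = 0" "?R (y j) = 0"
    unfolding proj_def row_y psi_diag using psi_skew[of j i s t] by simp_all
  have c: "pairing (b n) (?R (y k)) = (if n = k then \<Psi> i j s t else 0)" "pairing (b n) (?R (y l)) = (if n = l then \<Psi> i j s t else 0)"
    if "n = k \<or> n = l" for n
    using that kl by (auto simp: proj_def pairing_add pairing_diff pairing_scale frameD[OF frame_sym[OF fr]])
  have ind: "x = 0 \<and> z = 0" if "x *s ?R (y k) + z *s ?R (y l) = 0" for x z
    using arg_cong[OF that, of "pairing (b k)"] arg_cong[OF that, of "pairing (b l)"] kl ij c
    by (auto simp: pairing_add pairing_scale)
  have "\<Lambda> s t = {x *s ?R (y k) + z *s ?R (y l) | x z. True}"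
  proof (intro equalityI subsetI)
    fix p assume p: "p \<in> \<Lambda> s t"
    have "p = (\<Sum>n\<in>UNIV. pairing (b n) p *s y n)" by (rule frame_expand[OF frame_sym[OF fr]])
    also have "\<dots> = pairing (b i) p *s y i + (pairing (b j) p *s y j + (pairing (b k) p *s y k + pairing (b l) p *s y l))"
      unfolding kl(6) using kl(1-5) \<open>i \<noteq> j\<close> by simp
    finally have "?R p = ?R (pairing (b i) p *s y i + 1 *s (pairing (b j) p *s y j + 1 *s (pairing (b k) p *s y k + pairing (b l) p *s y l)))"
      by simp
    also have "\<dots> = pairing (b k) p *s ?R (y k) + pairing (b l) p *s ?R (y l)"
      unfolding proj_linear Ri by simp
    finally have "\<Psi> i j s t *s p = pairing (b k) p *s ?R (y k) + pairing (b l) p *s ?R (y l)"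
      unfolding proj_Lambda[OF p] .
    then have "(1 / \<Psi> i j s t) *s (\<Psi> i j s t *s p) = (1 / \<Psi> i j s t) *s (pairing (b k) p *s ?R (y k) + pairing (b l) p *s ?R (y l))"
      by (rule arg_cong)
    then have "p = (pairing (b k) p / \<Psi> i j s t) *s ?R (y k) + (pairing (b l) p / \<Psi> i j s t) *s ?R (y l)"
      using ij by (simp add: vector_add_ldistrib)
    then show "p \<in> {x *s ?R (y k) + z *s ?R (y l) | x z. True}" by blast
  next
    fix p assume "p \<in> {x *s ?R (y k) + z *s ?R (y l) | x z. True}"
    then obtain x z where "p = ?R (x *s y k + z *s y l)" unfolding proj_linear by blast
    then show "p \<in> \<Lambda> s t" by (simp only: proj_in_Lambda)
  qed
  then show ?thesis using ind by blast
qed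

lemma Lambda_scale: "c \<noteq> 0 \<Longrightarrow> \<Lambda> (c * s) (c * t) = \<Lambda> s t"
  by (auto simp: Lambda_iff row_pairing psi_scale mult.assoc simp flip: sum_distrib_left)

lemma Lambda_affine: "s \<noteq> 0 \<Longrightarrow> \<Lambda> s t = \<Lambda> 1 (t / s)"
  using Lambda_scale[of s 1 "t / s"] by simp

text \<open>Since \<phi> 2 is the parameter times \<phi> 1, the Wronskian of these two coordinates
  is the square of \<phi> 1, and G divides it.\<close>

lemma G_good: "good c \<Longrightarrow> poly G c \<noteq> 0"
proof
  assume c: "good c" and "poly G c = 0"
  then have "poly (\<phi> 1 * pderiv (\<phi> 2) - \<phi> 2 * pderiv (\<phi> 1)) c = 0" unfolding wedge by simp
  then show False using c unfolding phi2 by (simp add: good_def pderiv_pCons algebra_simps)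
qed

lemma psi12: "poly G c * poly (\<psi> 1 2) c = poly (\<phi> 1) c ^ 2"
  using arg_cong[OF wedge[of 1 2], of "\<lambda>p. poly p c"] unfolding phi2
  by (simp add: pderiv_pCons algebra_simps power2_eq_square)

lemma row_affine: "poly G c *s row 1 c i = poly (\<phi> i) c *s w' c - poly (pderiv (\<phi> i)) c *s w c"
proof -
  have e: "poly G c * \<Psi> i j 1 c = poly (\<phi> i) c * poly (pderiv (\<phi> j)) c - poly (pderiv (\<phi> i)) c * poly (\<phi> j) c" for j
    using arg_cong[OF wedge[of i j], of "\<lambda>p. poly p c"] psi_affine[of 1 i j c] by (simp add: mult.commute)
  have "poly G c *s row 1 c i = (\<Sum>j\<in>UNIV. (poly G c * \<Psi> i j 1 c) *s b j)"
    by (simp add: row_def vec.scale_sum_right)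
  also have "\<dots> = poly (\<phi> i) c *s w' c - poly (pderiv (\<phi> i)) c *s w c"
    unfolding e w_def w'_def by (simp add: vec.scale_sum_right vec.scale_left_diff_distrib sum_subtractf)
  finally show ?thesis .
qed

text \<open>Up to the factor G the rows are combinations of \<open>w c\<close> and
  \<open>w' c\<close>. The first two rows recover both vectors, as the determinant of their
  coefficients is the square of \<phi> 1 up to sign.\<close>

lemma Lambda_good:
  assumes "good c"
  shows "p \<in> \<Lambda> 1 c \<longleftrightarrow> pairing (w c) p = 0 \<and> pairing (w' c) p = 0"
proof -
  have e: "poly G c * pairing (row 1 c i) p = poly (\<phi> i) c * pairing (w' c) p - poly (pderiv (\<phi> i)) c * pairing (w c) p" for i
    using arg_cong[OF row_affine[of c i], of "\<lambda>u. pairing u p"] by (simp add: pairing_diff_left pairing_scale_left)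
  have g: "poly (\<phi> 1) c \<noteq> 0" "poly G c \<noteq> 0" using assms G_good by (auto simp: good_def)
  show ?thesis
  proof
    assume "p \<in> \<Lambda> 1 c"
    then have z: "poly (\<phi> i) c * pairing (w' c) p = poly (pderiv (\<phi> i)) c * pairing (w c) p" for i
      using e[of i] by (simp add: Lambda_iff)
    have z1: "poly (\<phi> 1) c * pairing (w' c) p = poly (pderiv (\<phi> 1)) c * pairing (w c) p" by (rule z)
    have "c * (poly (\<phi> 1) c * pairing (w' c) p) = (poly (\<phi> 1) c + c * poly (pderiv (\<phi> 1)) c) * pairing (w c) p"
      using z[of 2] unfolding phi2 by (simp add: pderiv_pCons mult.assoc)
    then have "poly (\<phi> 1) c * pairing (w c) p = 0" unfolding z1 by (simp add: algebra_simps)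
    then have "pairing (w c) p = 0" using g by simp
    then show "pairing (w c) p = 0 \<and> pairing (w' c) p = 0" using z1 g by simp
  next
    assume "pairing (w c) p = 0 \<and> pairing (w' c) p = 0"
    then have "poly G c * pairing (row 1 c i) p = 0" for i using e by simp
    then show "p \<in> \<Lambda> 1 c" using g by (simp add: Lambda_iff)
  qed
qed

lemma finite_bad: "finite {c. \<not> good c}"
  unfolding good_def using poly_roots_finite[OF phi1] by simp

lemma w_deriv: "((\<lambda>\<tau>. w \<tau> $ k) has_field_derivative w' c $ k) (at c)"
  unfolding w_def w'_def by (auto intro!: derivative_eq_intros poly_DERIV DERIV_sum sum.cong)

section \<open>The union of the rulings: closedness and density of the good ones\<close>

definition X' :: "(complex ^ 4) set" where
  "X' = {p. \<exists>s t. (s, t) \<noteq> (0, 0) \<and> p \<in> \<Lambda> s t}"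

lemma Lambda_scaled: "p \<in> \<Lambda> s t \<Longrightarrow> c *s p \<in> \<Lambda> s t"
  by (simp add: Lambda_iff pairing_scale)

lemma X'_cone: "cone_closed X'"
proof -
  note Lambda_scaled
  moreover have "(1 :: complex, 0 :: complex) \<noteq> (0, 0)" "0 \<in> \<Lambda> 1 0" by (simp_all add: Lambda_iff)
  ultimately show ?thesis unfolding cone_closed_def X'_def by blast
qed

text \<open>Membership is a common zero (s, t) of the row forms of p, so eliminating the parameter
  gives equations.\<close>

lemma X'_closed: "closedin proj_zariski (projectivize X')"
  unfolding closedin_proj_iff[OF X'_cone]
proof (intro allI impI)
  fix p0 assume p0: "p0 \<notin> X'"
  let ?G = "range (\<lambda>i (x :: complex ^ 4). x $ i)"
  define F where "F i p = (\<Sum>j\<in>UNIV. smult (pairing (b j) p) (\<psi> i j))" for i p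
  have bF: "bform M (F i p) s t = pairing (row s t i) p" for i p s t
    unfolding F_def row_pairing by (simp add: bform_sum bform_smult \<Psi>_def mult.commute)
  have pg: "pairing u \<in> generated_algebra ?G" for u using pf_pairing[of u] by (simp add: poly_funs_def)
  have fam: "polyfam ?G (F i)" for i
    unfolding F_def[abs_def] by (intro polyfam_sum polyfam_smult polyfam_const) (simp add: pg)
  have dF: "degree (F i p) \<le> M" for i p
    unfolding F_def by (intro degree_sum_le order_trans[OF degree_smult_le] deg_psi) auto
  have none: "\<exists>i\<in>UNIV. bform M (F i p0) s t \<noteq> 0" if "(s, t) \<noteq> (0, 0)" for s t
    using p0 that unfolding bF X'_def Lambda_iff by blast
  obtain g where g: "g \<in> generated_algebra ?G" "g p0 \<noteq> 0"
    "\<And>p s t. g p \<noteq> 0 \<Longrightarrow> (s, t) \<noteq> (0, 0) \<Longrightarrow> \<exists>i\<in>UNIV. bform M (F i p) s t \<noteq> 0"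
    using no_common_zero_open[of UNIV ?G F M p0, OF finite fam dF none] by blast
  have "g p = 0" if "p \<in> X'" for p
    using that g(3)[of p] unfolding bF X'_def Lambda_iff by blast
  then show "\<exists>f\<in>poly_funs. (\<forall>x\<in>X'. f x = 0) \<and> f p0 \<noteq> 0"
    using g(1,2) unfolding poly_funs_def by blast
qed

lemma cone_X': "cone (projectivize X') = X'"
  by (rule cone_projectivize[OF X'_cone])

lemma Lambda_subset: "(s, t) \<noteq> (0, 0) \<Longrightarrow> \<Lambda> s t \<subseteq> X'"
  unfolding X'_def by blast

text \<open>The points \<open>k *s proj i j s t p\<close>, with k the reciprocal of
  \<open>\<Psi> i j\<close> at the ruling of p, form a polynomial family in (s, t) that passes
  through p and stays on the rulings. A function vanishing on all good rulings would vanish along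
  it.\<close>

lemma good_dense:
  assumes f: "f \<in> poly_funs" and p: "p \<in> X'" "f p \<noteq> 0"
  shows "\<exists>c q. good c \<and> q \<in> \<Lambda> 1 c \<and> f q \<noteq> 0"
proof (rule ccontr)
  assume none: "\<not> ?thesis"
  obtain s t where st: "(s, t) \<noteq> (0, 0)" "p \<in> \<Lambda> s t" using p(1) unfolding X'_def by blast
  obtain i j where ij: "\<Psi> i j s t \<noteq> 0" using psi_form_nonzero[OF st(1)] by blast
  define k where "k = 1 / \<Psi> i j s t"
  let ?F = "\<lambda>z. f (k *s proj i j (fst z) (snd z) p)"
  have "?F (s, t) = 0"
  proof (rule binary_density[OF _ finite_bad])
    have "(\<lambda>z. (k *s proj i j (fst z) (snd z) p) $ n) \<in> generated_algebra {fst, snd}" for n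
      by (simp, intro ga_mult ga_const proj_algebra)
    then show "?F \<in> generated_algebra {fst, snd}" by (rule poly_funs_comp[OF f])
    fix s t :: complex assume "s \<noteq> 0" "t / s \<notin> {c. \<not> good c}"
    then show "?F (s, t) = 0" using none Lambda_scaled[OF proj_in_Lambda[of i j s t p], of k] Lambda_affine[of s t] by auto
  qed
  then show False using p(2) ij by (simp add: proj_Lambda[OF st(2)] k_def)
qed

section \<open>Tangent spaces of the curve and its dual variety\<close>

lemma tangent_v: "k \<noteq> 0 \<Longrightarrow> w' c \<in> tangent_space K (k *s w c)" "w c \<in> tangent_space K (k *s w c)"
proof -
  assume k: "k \<noteq> 0"
  have "k *s w' c \<in> tangent_space K (k *s w c)"
  proof (rule tangent_of_curve[of "\<lambda>\<tau>. k *s w \<tau>"])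
    show "k *s w \<tau> \<in> K" for \<tau> by (rule K_scale[OF w_in_K])
    show "((\<lambda>\<tau>. (k *s w \<tau>) $ i) has_field_derivative (k *s w' c) $ i) (at c)" for i
      by (simp, rule DERIV_cmult[OF w_deriv])
  qed
  then have "(1 / k) *s (k *s w' c) \<in> tangent_space K (k *s w c)" by (rule vec.subspace_scale[OF tangent_space_subspace])
  then show "w' c \<in> tangent_space K (k *s w c)" using k by simp
next
  have "k *s w c + \<tau> *s w c \<in> K" for \<tau>
    using K_scale[OF w_in_K, of "k + \<tau>" c] by (simp add: vec.scale_left_distrib)
  then show "w c \<in> tangent_space K (k *s w c)" by (rule tangent_of_line)
qed

text \<open>At good parameters the row is a combination of the tangent vectors \<open>w c\<close>
  and \<open>w' c\<close>. The derivative of an equation along the row is polynomial in (s, t), so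
  it vanishes at the remaining parameters as well, cusps included.\<close>

lemma row_tangent:
  assumes k: "k \<noteq> 0" shows "row s t i \<in> tangent_space K (k *s v s t)"
  unfolding tangent_space_def
proof (intro CollectI ballI impI)
  fix f assume f: "f \<in> poly_funs" "\<forall>x\<in>K. f x = 0"
  let ?F = "\<lambda>z. differential f (k *s v (fst z) (snd z)) (row (fst z) (snd z) i)"
  have "?F (s, t) = 0"
  proof (rule binary_density[OF _ finite_bad])
    show "?F \<in> generated_algebra {fst, snd}"
    proof (rule differential_in_algebra[OF f(1)])
      show "(\<lambda>z. (k *s v (fst z) (snd z)) $ n) \<in> generated_algebra {fst, snd}" for n
        by (simp, intro ga_mult ga_const v_algebra)
      show "(\<lambda>z. row (fst z) (snd z) i $ n) \<in> generated_algebra {fst, snd}" for n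
        unfolding row_def by (simp, intro ga_sum ga_mult ga_const psi_algebra)
    qed
    fix s t :: complex assume s: "s \<noteq> 0" and "t / s \<notin> {c. \<not> good c}"
    then have g: "good (t / s)" by simp
    define c where "c = t / s"
    have vs: "k *s v s t = (k * s ^ m) *s w c" using v_affine[OF s] by (simp add: c_def)
    have ks: "k * s ^ m \<noteq> 0" using k s by simp
    have "row s t i = s ^ M *s row 1 c i"
      unfolding row_def using psi_affine[OF s] psi_affine[of 1] by (simp add: c_def vec.scale_sum_right)
    moreover have "row 1 c i = (1 / poly G c) *s (poly (\<phi> i) c *s w' c - poly (pderiv (\<phi> i)) c *s w c)"
      unfolding row_affine[symmetric] using G_good[OF g] by (simp add: c_def)
    ultimately have "row s t i \<in> tangent_space K (k *s v s t)"
      unfolding vs using tangent_v(1)[OF ks, of c] tangent_v(2)[of c "k * s ^ m"]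
      by (simp only:) (intro vec.subspace_scale[OF tangent_space_subspace] vec.subspace_diff[OF tangent_space_subspace])
    then show "?F (s, t) = 0" using f unfolding tangent_space_def by simp
  qed
  then show "differential f (k *s v s t) (row s t i) = 0" by simp
qed

text \<open>The degree of \<phi> 2 is one more than that of \<phi> 1, so the point with s = 0 lies
  outside the chart y 1 \<noteq> 0.\<close>

lemma phi1_infinity: "bform m (\<phi> 1) 0 t = 0"
proof -
  have "degree (\<phi> 2) = Suc (degree (\<phi> 1))" unfolding phi2 using phi1 by simp
  then have "degree (\<phi> 1) < m" using deg[of 2] by simp
  then show ?thesis by (simp add: bform_infinity coeff_eq_0)
qed

lemma relation_phi: "relation (y 1) (y 2) (y i) [:- \<phi> i, \<phi> 1:]"
  unfolding relation_def
proof (intro ballI impI)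
  fix x assume x: "x \<in> K" "pairing (y 1) x \<noteq> 0"
  then obtain k s t where kst: "x = k *s v s t" unfolding K_eq by blast
  have x1: "pairing (y 1) x = k * bform m (\<phi> 1) s t" by (simp add: kst pairing_scale v_coord)
  have "s \<noteq> 0" using x1 x(2) phi1_infinity by auto
  define c where "c = t / s"
  have xw: "x = (k * s ^ m) *s w c" unfolding kst v_affine[OF \<open>s \<noteq> 0\<close>] c_def by simp
  define l where "l = k * s ^ m"
  have co: "pairing (y j) x = l * poly (\<phi> j) c" for j unfolding xw l_def[symmetric] by (simp add: pairing_scale w_coord)
  have nz: "l \<noteq> 0" "poly (\<phi> 1) c \<noteq> 0" using x(2) co[of 1] by auto
  have "pairing (y 2) x / pairing (y 1) x = c" unfolding co phi2 using nz by simp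
  moreover have "pairing (y i) x / pairing (y 1) x = poly (\<phi> i) c / poly (\<phi> 1) c" unfolding co using nz by simp
  ultimately show "ev [:- \<phi> i, \<phi> 1:] (pairing (y 2) x / pairing (y 1) x) (pairing (y i) x / pairing (y 1) x) = 0"
    using nz by simp
qed

text \<open>Differentiate the homogenized equation of the graph y i / y 1 = \<phi> i / \<phi> 1:
  along a direction with vanishing first two coordinates its derivative is a nonzero multiple of
  coordinate i.\<close>

lemma tangent_good_coord:
  assumes g: "good c" and u: "u \<in> tangent_space K (w c)" and u12: "pairing (y 1) u = 0" "pairing (y 2) u = 0"
  shows "pairing (y i) u = 0"
proof -
  obtain N H where H: "hom_deg N H" "\<And>x. pairing (y 1) x \<noteq> 0 \<Longrightarrow>
      H x = pairing (y 1) x ^ N * ev [:- \<phi> i, \<phi> 1:] (pairing (y 2) x / pairing (y 1) x) (pairing (y i) x / pairing (y 1) x)"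
    using homogenize_linear_fractions[OF ev_in_algebra[of "[:- \<phi> i, \<phi> 1:]"], of "y 1" "y 2" "y i"] by auto
  define f where "f x = pairing (y 1) x * H x" for x
  have f: "f \<in> poly_funs" unfolding f_def[abs_def] by (intro pf_mult pf_pairing hom_deg_pf[OF H(1)])
  have "f x = 0" if "x \<in> K" for x
    using relation_phi[of i] that H(2)[of x] unfolding relation_def f_def by (cases "pairing (y 1) x = 0") auto
  then have zero: "differential f (w c) u = 0" using u f unfolding tangent_space_def by blast
  define a where "a = poly (\<phi> 1) c"
  have a: "a \<noteq> 0" using g by (simp add: a_def good_def)
  have co: "pairing (y j) (w c + \<tau> *s u) = poly (\<phi> j) c + \<tau> * pairing (y j) u" for j \<tau>
    by (simp add: pairing_add pairing_scale w_coord)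
  have "f (w c + \<tau> *s u) = a ^ N * (\<tau> * (a * pairing (y i) u))" for \<tau>
  proof -
    have c1: "pairing (y 1) (w c + \<tau> *s u) = a" "pairing (y 2) (w c + \<tau> *s u) = c * a"
      unfolding co u12 phi2 by (simp_all add: a_def)
    have "f (w c + \<tau> *s u) = a * (a ^ N * (- poly (\<phi> i) c + (poly (\<phi> i) c + \<tau> * pairing (y i) u) / a * a))"
    proof -
      have q: "c * a / a = c" using a by simp
      have "H (w c + \<tau> *s u) = a ^ N * ev [:- \<phi> i, \<phi> 1:] c (pairing (y i) (w c + \<tau> *s u) / a)"
        using H(2)[of "w c + \<tau> *s u"] a unfolding c1 q by blast
      moreover have "f (w c + \<tau> *s u) = a * H (w c + \<tau> *s u)" by (simp only: f_def c1)
      ultimately show ?thesis using a by (simp add: co flip: a_def)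
    qed
    then show ?thesis using a by simp
  qed
  then have "differential f (w c) u = a ^ N * (a * pairing (y i) u)"
    unfolding differential_def by (auto intro!: DERIV_imp_deriv derivative_eq_intros)
  then show ?thesis using zero a by simp
qed

lemma tangent_good:
  assumes g: "good c" shows "tangent_space K (w c) = {x *s w c + z *s w' c | x z. True}"
proof (intro equalityI subsetI)
  fix u assume u: "u \<in> tangent_space K (w c)"
  define a where "a = poly (\<phi> 1) c"
  define a' where "a' = poly (pderiv (\<phi> 1)) c"
  have a: "a \<noteq> 0" using g by (simp add: a_def good_def)
  define z where "z = (pairing (y 2) u - c * pairing (y 1) u) / a"
  define x where "x = (pairing (y 1) u - z * a') / a"
  define u' where "u' = u - (x *s w c + z *s w' c)"
  have T: "u' \<in> tangent_space K (w c)"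
    unfolding u'_def using u tangent_v(1)[of 1 c] tangent_v(2)[of c 1]
    by (intro vec.subspace_diff[OF tangent_space_subspace] vec.subspace_add[OF tangent_space_subspace]
        vec.subspace_scale[OF tangent_space_subspace]) simp_all
  have w2: "poly (\<phi> 2) c = c * a" "poly (pderiv (\<phi> 2)) c = a + c * a'"
    unfolding phi2 by (simp_all add: a_def a'_def pderiv_pCons)
  have xa: "x * a = pairing (y 1) u - z * a'" "z * a = pairing (y 2) u - c * pairing (y 1) u"
    using a by (simp_all add: x_def z_def)
  have 1: "pairing (y 1) u' = 0"
    unfolding u'_def pairing_diff pairing_add pairing_scale w_coord w'_coord a_def[symmetric] a'_def[symmetric] using xa(1) by simp
  have "pairing (y 2) u' = pairing (y 2) u - (c * (x * a) + z * a + c * (z * a'))"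
    unfolding u'_def pairing_diff pairing_add pairing_scale w_coord w'_coord w2 by (simp add: algebra_simps)
  also have "\<dots> = 0" unfolding xa by (simp add: algebra_simps)
  finally have 2: "pairing (y 2) u' = 0" .
  have "u' = 0" by (rule frame_eqI[OF fr]) (simp add: tangent_good_coord[OF g T 1 2])
  then have "u = x *s w c + z *s w' c" by (simp add: u'_def)
  then show "u \<in> {x *s w c + z *s w' c | x z. True}" by blast
next
  fix u assume "u \<in> {x *s w c + z *s w' c | x z. True}"
  then obtain x z where u: "u = x *s w c + z *s w' c" by blast
  show "u \<in> tangent_space K (w c)"
    unfolding u using tangent_v(1)[of 1 c] tangent_v(2)[of c 1]
    by (intro vec.subspace_add[OF tangent_space_subspace] vec.subspace_scale[OF tangent_space_subspace]) simp_all
qed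

lemma w_independent:
  assumes g: "good c" and e: "x *s w c + z *s w' c = 0" shows "x = 0 \<and> z = 0"
proof -
  define a where "a = poly (\<phi> 1) c"
  define a' where "a' = poly (pderiv (\<phi> 1)) c"
  have a: "a \<noteq> 0" using g by (simp add: a_def good_def)
  have w2: "poly (\<phi> 2) c = c * a" "poly (pderiv (\<phi> 2)) c = a + c * a'"
    unfolding phi2 by (simp_all add: a_def a'_def pderiv_pCons)
  have 1: "x * a + z * a' = 0"
    using arg_cong[OF e, of "pairing (y 1)"] by (simp add: pairing_add pairing_scale w_coord w'_coord a_def a'_def)
  have "x * (c * a) + z * (a + c * a') = 0"
    using arg_cong[OF e, of "pairing (y 2)"] by (simp add: pairing_add pairing_scale w_coord w'_coord w2)
  then have "c * (x * a + z * a') + z * a = 0" by (simp add: algebra_simps)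
  then have "z = 0" unfolding 1 using a by simp
  then show ?thesis using 1 a by simp
qed

lemma w_regular:
  assumes g: "good c" shows "w c \<in> cone_reg C"
proof -
  have "vec.dim (tangent_space K (w c)) = 2"
    by (rule plane_dim(2)[OF w_independent[OF g] tangent_good[OF g]])
  moreover have "krull_dim proj_zariski C = 1" using curve by (simp add: irreducible_curve_def)
  ultimately show ?thesis
    unfolding cone_reg_def using w_in_K by (simp add: one_enat_def)
qed

lemma w_nonzero: "good c \<Longrightarrow> w c \<noteq> 0"
  using w_coord[of 1 c] by (auto simp: good_def)

text \<open>A hyperplane tangent at a regular point annihilates the rows there by
  \<open>row_tangent\<close>, so it lies on a ruling. Conversely the good rulings consist of tangent
  hyperplanes and are dense among all rulings.\<close>

lemma dual_variety_eq: "dual_variety C = projectivize X'"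
proof -
  define D where "D = {h. \<exists>x\<in>cone_reg C - {0}. \<forall>u\<in>tangent_space K x. pairing h u = 0}"
  have DX: "D \<subseteq> X'"
  proof
    fix h assume "h \<in> D"
    then obtain x where x: "x \<in> cone_reg C" "x \<noteq> 0" "\<forall>u\<in>tangent_space K x. pairing h u = 0" unfolding D_def by blast
    then obtain k s t where kst: "x = k *s v s t" unfolding cone_reg_def K_eq by blast
    have k: "k \<noteq> 0" "(s, t) \<noteq> (0, 0)"
    proof -
      show "k \<noteq> 0" using kst x(2) by auto
      have "v 0 0 = 0" by (rule frame_eqI[OF fr]) (use m1 in \<open>simp add: v_coord bform_infinity\<close>)
      then show "(s, t) \<noteq> (0, 0)" using kst x(2) by auto
    qed
    have "pairing (row s t i) h = 0" for i
      using x(3) row_tangent[OF k(1), of s t i] unfolding kst by (metis pairing_commute)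
    then show "h \<in> X'" unfolding X'_def Lambda_iff using k(2) by blast
  qed
  have good_D: "\<Lambda> 1 c \<subseteq> D" if g: "good c" for c
  proof
    fix p assume "p \<in> \<Lambda> 1 c"
    then have p: "pairing p (w c) = 0" "pairing p (w' c) = 0" using Lambda_good[OF g] by (auto simp: pairing_commute)
    have "\<forall>u\<in>tangent_space K (w c). pairing p u = 0"
      unfolding tangent_good[OF g] using p by (auto simp: pairing_add pairing_scale)
    then show "p \<in> D" unfolding D_def using w_regular[OF g] w_nonzero[OF g] by blast
  qed
  have dv: "dual_variety C = proj_zariski closure_of projectivize D"
    unfolding dual_variety_def D_def ..
  have "proj_zariski closure_of projectivize D \<subseteq> projectivize X'"
    by (rule closure_of_minimal[OF projectivize_mono[OF DX] X'_closed])
  moreover have "projectivize X' \<subseteq> proj_zariski closure_of projectivize D"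
  proof -
    define Y where "Y = proj_zariski closure_of projectivize D"
    have Y: "closedin proj_zariski Y" unfolding Y_def by (rule closedin_closure_of)
    have sub: "projectivize D \<subseteq> Y"
      unfolding Y_def by (rule closure_of_subset) (simp add: topspace_proj_zariski projectivize_mono)
    have "X' \<subseteq> cone Y"
    proof (rule subsetI, rule ccontr)
      fix p assume p: "p \<in> X'" "p \<notin> cone Y"
      obtain d f where f: "hom_deg d f" "\<forall>x\<in>cone Y. f x = 0" "f p \<noteq> 0" using closed_cone_separate[OF Y p(2)] by blast
      obtain c q where q: "good c" "q \<in> \<Lambda> 1 c" "f q \<noteq> 0" using good_dense[OF hom_deg_pf[OF f(1)] p(1) f(3)] by blast
      have "q \<in> cone Y"
      proof (cases "q = 0")
        case False
        then have "vec.span {q} \<in> Y" using sub good_D[OF q(1)] q(2) projectivizeI[of q D] by blast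
        then show ?thesis unfolding cone_def using vec.span_base[of q "{q}"] by blast
      qed (simp add: cone_def)
      then show False using f(2) q(3) by blast
    qed
    then have "projectivize X' \<subseteq> projectivize (cone Y)" by (rule projectivize_mono)
    then show ?thesis using projectivize_cone[OF closed_topspace[OF Y]] unfolding Y_def by simp
  qed
  ultimately show ?thesis unfolding dv by (rule subset_antisym)
qed

end

lemma ga_no_zero_divisors:
  assumes fg: "f \<in> generated_algebra {\<lambda>x. x}" "g \<in> generated_algebra {\<lambda>x. x}" "\<And>x. f x * g x = 0" and g: "g a \<noteq> 0"
  shows "f x = 0"
proof -
  obtain p q where pq: "f = poly p" "g = poly q" using fg(1,2) unfolding ga_univariate by blast
  have "poly (p * q) x = 0" for x using fg(3)[of x] by (simp add: pq)
  then have "p * q = 0" using poly_all_0_iff_0 by blast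
  moreover have "q \<noteq> 0" using g pq by auto
  ultimately show ?thesis by (simp add: pq)
qed

lemma pairing_in_algebra:
  assumes "\<And>i. (\<lambda>z. P z $ i) \<in> generated_algebra G" shows "(\<lambda>z. pairing u (P z)) \<in> generated_algebra G"
  unfolding pairing_def by (intro ga_sum ga_mult ga_const assms)

section \<open>Irreducibility and dimension of the dual surface\<close>

context rational_curve
begin

lemma psi_comp:
  assumes "S \<in> generated_algebra H" "T \<in> generated_algebra H"
  shows "(\<lambda>z. \<Psi> i j (S z) (T z)) \<in> generated_algebra H"
proof -
  have "(\<lambda>z. (\<lambda>x. \<Psi> i j (fst x) (snd x)) (S z, T z)) \<in> generated_algebra H"
    by (rule ga_comp[OF psi_algebra]) (use assms in auto)
  then show ?thesis by simp
qed

lemma proj_comp: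
  assumes S: "S \<in> generated_algebra H" and T: "T \<in> generated_algebra H"
    and P: "\<And>k. (\<lambda>z. P z $ k) \<in> generated_algebra H"
  shows "(\<lambda>z. proj i j (S z) (T z) (P z) $ k) \<in> generated_algebra H"
  unfolding proj_def row_pairing
  by (simp, intro ga_add ga_diff ga_mult ga_sum ga_const psi_comp[OF S T] P pairing_in_algebra[OF P])

lemma psi12_nonzero:
  assumes "s \<noteq> 0" "good (t / s)" shows "\<Psi> 1 2 s t \<noteq> 0"
  using psi12[of "t / s"] assms unfolding good_def by (auto simp: psi_affine)

text \<open>Where \<open>\<Psi> 1 2\<close> is nonzero, b 3 and b 4, that is \<alpha> and \<beta>,
  are linear coordinates on the ruling.\<close>

lemma Lambda_coord:
  assumes "p \<in> \<Lambda> s t" shows "\<Psi> 1 2 s t *s p = proj 1 2 s t (pairing (b 3) p *s y 3 + pairing (b 4) p *s y 4)"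
proof -
  have R: "proj 1 2 s t (y 1) = 0" "proj 1 2 s t (y 2) = 0"
    unfolding proj_def row_y psi_diag using psi_skew[of 2 1 s t] by simp_all
  have "p = pairing (b 1) p *s y 1 + 1 *s (pairing (b 2) p *s y 2 + 1 *s (pairing (b 3) p *s y 3 + pairing (b 4) p *s y 4))"
    using frame_expand4[OF frame_sym[OF fr], of p] by (simp add: add.assoc)
  then have "proj 1 2 s t p = proj 1 2 s t (pairing (b 1) p *s y 1 + 1 *s (pairing (b 2) p *s y 2 + 1 *s (pairing (b 3) p *s y 3 + pairing (b 4) p *s y 4)))"
    by (rule arg_cong)
  also have "\<dots> = proj 1 2 s t (pairing (b 3) p *s y 3 + pairing (b 4) p *s y 4)"
    unfolding proj_linear[of 1 2 s t _ "y 1"] proj_linear[of 1 2 s t _ "y 2"] R by simp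
  finally show ?thesis unfolding proj_Lambda[OF assms] .
qed

lemma b_y: "pairing (b i) (y j) = (if i = j then 1 else 0)"
  using frameD[OF frame_sym[OF fr]] .

lemma proj_coord:
  "pairing (b 3) (proj 1 2 s t (x3 *s y 3 + x4 *s y 4)) = \<Psi> 1 2 s t * x3"
  "pairing (b 4) (proj 1 2 s t (x3 *s y 3 + x4 *s y 4)) = \<Psi> 1 2 s t * x4"
  by (simp_all add: proj_def pairing_add pairing_diff pairing_scale b_y)

lemma Lambda_eqI:
  assumes "\<Psi> 1 2 s t \<noteq> 0" "p \<in> \<Lambda> s t" "q \<in> \<Lambda> s t" "pairing (b 3) p = pairing (b 3) q" "pairing (b 4) p = pairing (b 4) q"
  shows "p = q"
proof -
  have "\<Psi> 1 2 s t *s p = \<Psi> 1 2 s t *s q" unfolding Lambda_coord[OF assms(2)] Lambda_coord[OF assms(3)] assms(4,5) ..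
  then show ?thesis using assms(1) by simp
qed

text \<open>The point of the ruling with coordinates x3, x4 under b 3, b 4, multiplied by
  \<open>\<Psi> 1 2 1 c\<close> to be polynomial in c.\<close>

definition Pt :: "complex \<Rightarrow> complex \<Rightarrow> complex \<Rightarrow> complex ^ 4" where
  "Pt c x3 x4 = proj 1 2 1 c (x3 *s y 3 + x4 *s y 4)"

lemma Pt_in: "Pt c x3 x4 \<in> \<Lambda> 1 c"
  unfolding Pt_def by (rule proj_in_Lambda)

lemma Pt_X': "Pt c x3 x4 \<in> X'"
  using Lambda_subset[of 1 c] Pt_in by auto

lemma Pt_linear: "Pt c x3 x4 = x3 *s Pt c 1 0 + x4 *s Pt c 0 1"
  unfolding Pt_def by (simp add: proj_linear[symmetric])

lemma good_Pt: "good c \<Longrightarrow> p \<in> \<Lambda> 1 c \<Longrightarrow> \<exists>x3 x4. p = Pt c x3 x4"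
proof -
  assume c: "good c" and p: "p \<in> \<Lambda> 1 c"
  have n: "\<Psi> 1 2 1 c \<noteq> 0" using psi12_nonzero[of 1 c] c by simp
  have "p = Pt c (pairing (b 3) p / \<Psi> 1 2 1 c) (pairing (b 4) p / \<Psi> 1 2 1 c)"
    by (rule Lambda_eqI[OF n p Pt_in]) (use n in \<open>simp_all add: Pt_def proj_coord\<close>)
  then show ?thesis by blast
qed

lemma Pt_comp:
  assumes "S \<in> generated_algebra H" "T \<in> generated_algebra H" "U \<in> generated_algebra H"
  shows "(\<lambda>z. Pt (S z) (T z) (U z) $ k) \<in> generated_algebra H"
  unfolding Pt_def by (intro proj_comp ga_const assms) (simp, intro ga_add ga_mult ga_const assms)

lemma segment_algebra: "(\<lambda>\<tau>. a + \<tau> * d) \<in> generated_algebra {\<lambda>x. x}"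
  by (intro ga_add ga_mult ga_const ga_gen) simp

lemma K_nondegenerate_good:
  assumes "h \<noteq> 0" shows "\<exists>c. good c \<and> pairing h (w c) \<noteq> 0"
proof (rule ccontr)
  assume none: "\<not> ?thesis"
  have "pairing h (v (fst (s, t)) (snd (s, t))) = 0" for s t
  proof (rule binary_density[OF _ finite_bad])
    show "(\<lambda>z. pairing h (v (fst z) (snd z))) \<in> generated_algebra {fst, snd}" by (rule pairing_in_algebra[OF v_algebra])
  qed (use none in \<open>auto simp: v_affine pairing_scale\<close>)
  then have "\<forall>x\<in>K. pairing h x = 0" unfolding K_eq by (auto simp: pairing_scale)
  then show False using K_nondegenerate[OF assms] by blast
qed

lemma good_exists: "\<exists>c. good c"
  using complex_avoid_finite[OF finite_bad] by simp

lemma Pt_nonzero: "good c \<Longrightarrow> Pt c 1 0 \<noteq> 0"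
  using proj_coord(1)[of 1 c 1 0] psi12_nonzero[of 1 c] by (auto simp: Pt_def)

lemma X'_nonzero: "X' \<noteq> {0}"
  using good_exists Pt_nonzero Pt_X' by blast

text \<open>By \<open>good_dense\<close> witnesses can be moved to good rulings, where they are
  values of \<open>Pt\<close>; joining their parameters by a segment pulls f g back to a product of
  univariate polynomials.\<close>

lemma X'_irreducible: "irreducible_in proj_zariski (projectivize X')"
  unfolding irreducible_iff[OF X'_cone X'_nonzero]
proof (intro allI impI, rule ccontr)
  fix d e f g assume f: "hom_deg d f" and g: "hom_deg e g" and fg: "\<forall>x\<in>X'. f x * g x = 0"
    and "\<not> ((\<forall>x\<in>X'. f x = 0) \<or> (\<forall>x\<in>X'. g x = 0))"
  then obtain p q where pq: "p \<in> X'" "f p \<noteq> 0" "q \<in> X'" "g q \<noteq> 0" by blast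
  obtain c0 p' where p': "good c0" "p' \<in> \<Lambda> 1 c0" "f p' \<noteq> 0" using good_dense[OF hom_deg_pf[OF f] pq(1,2)] by blast
  obtain c1 q' where q': "good c1" "q' \<in> \<Lambda> 1 c1" "g q' \<noteq> 0" using good_dense[OF hom_deg_pf[OF g] pq(3,4)] by blast
  obtain x3 x4 where x: "p' = Pt c0 x3 x4" using good_Pt[OF p'(1,2)] by blast
  obtain z3 z4 where z: "q' = Pt c1 z3 z4" using good_Pt[OF q'(1,2)] by blast
  define V where "V \<tau> = Pt (c0 + \<tau> * (c1 - c0)) (x3 + \<tau> * (z3 - x3)) (x4 + \<tau> * (z4 - x4))" for \<tau>
  have V: "(\<lambda>\<tau>. V \<tau> $ k) \<in> generated_algebra {\<lambda>x. x}" for k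
    unfolding V_def by (intro Pt_comp segment_algebra)
  have V01: "V 0 = p'" "V 1 = q'" by (simp_all add: V_def x z)
  have "f (V 0) = 0"
  proof (rule ga_no_zero_divisors[of "\<lambda>\<tau>. f (V \<tau>)" "\<lambda>\<tau>. g (V \<tau>)" 1])
    show "f (V \<tau>) * g (V \<tau>) = 0" for \<tau> using fg Pt_X' by (simp add: V_def)
    show "g (V 1) \<noteq> 0" using q' V01 by simp
  qed (intro poly_funs_comp[OF hom_deg_pf[OF f] V] poly_funs_comp[OF hom_deg_pf[OF g] V])+
  then show False using p' V01 by simp
qed

lemma Lambda_closed: "closedin proj_zariski (projectivize (\<Lambda> s t))"
  unfolding \<Lambda>_def by (rule annihilator_closed)

lemma Lambda_subspace: "vec.subspace (\<Lambda> s t)"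
  unfolding \<Lambda>_def by (rule annihilator_subspace)

lemma Lambda_curve: "(s, t) \<noteq> (0, 0) \<Longrightarrow> irreducible_curve (projectivize (\<Lambda> s t))"
  using Lambda_basis[of s t] line_irreducible_curve unfolding \<Lambda>_def by blast

lemma point_Lambda_chain:
  assumes c: "good c"
  shows "{vec.span {Pt c 1 0}} \<subset> projectivize (\<Lambda> 1 c)"
proof -
  have 1: "vec.span {Pt c 1 0} \<in> projectivize (\<Lambda> 1 c)" by (rule projectivizeI[OF Pt_in Pt_nonzero[OF c]])
  have n: "\<Psi> 1 2 1 c \<noteq> 0" using psi12_nonzero[of 1 c] c by simp
  have z: "Pt c 0 1 \<noteq> 0" using proj_coord(2)[of 1 c 0 1] n by (auto simp: Pt_def)
  have 2: "vec.span {Pt c 0 1} \<in> projectivize (\<Lambda> 1 c)" by (rule projectivizeI[OF Pt_in z])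
  have "vec.span {Pt c 1 0} \<noteq> vec.span {Pt c 0 1}"
  proof
    assume "vec.span {Pt c 1 0} = vec.span {Pt c 0 1}"
    then obtain k where "k \<noteq> 0" "Pt c 1 0 = k *s Pt c 0 1" using span_eq_iff[OF Pt_nonzero[OF c] z] by blast
    then have "pairing (b 3) (Pt c 1 0) = k * pairing (b 3) (Pt c 0 1)" by (simp add: pairing_scale)
    then show False unfolding Pt_def proj_coord using n by simp
  qed
  then show ?thesis using 1 2 by blast
qed

text \<open>Were X' a single ruling, a nonzero point of it would lie on all good rulings and
  annihilate all \<open>w d\<close>, so the curve would be plane.\<close>

lemma Lambda_chain:
  assumes c: "good c"
  shows "projectivize (\<Lambda> 1 c) \<subset> projectivize X'"
proof -
  have "\<Lambda> 1 c \<subseteq> X'" by (rule Lambda_subset) simp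
  moreover have "\<not> X' \<subseteq> \<Lambda> 1 c"
  proof
    assume sub: "X' \<subseteq> \<Lambda> 1 c"
    obtain d where d: "good d" "pairing (Pt c 1 0) (w d) \<noteq> 0" using K_nondegenerate_good[OF Pt_nonzero[OF c]] by blast
    have n: "\<Psi> 1 2 1 c \<noteq> 0" "\<Psi> 1 2 1 d \<noteq> 0" using psi12_nonzero[of 1] c d(1) by simp_all
    have "Pt c 1 0 = Pt d (\<Psi> 1 2 1 c / \<Psi> 1 2 1 d) 0"
      by (rule Lambda_eqI[OF n(1) Pt_in subsetD[OF sub Pt_X']]) (use n in \<open>simp_all only: Pt_def proj_coord, simp_all\<close>)
    then have "pairing (w d) (Pt c 1 0) = 0" using Lambda_good[OF d(1)] Pt_in by metis
    then show False using d(2) by (simp add: pairing_commute)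
  qed
  ultimately show ?thesis
    using projectivize_subset_iff[OF cone_closed_subspace[OF Lambda_subspace] X'_cone, of 1 c]
      projectivize_subset_iff[OF X'_cone cone_closed_subspace[OF Lambda_subspace], of 1 c] by blast
qed

lemma krull_X'_ge: "2 \<le> krull_dim proj_zariski (projectivize X')"
proof -
  obtain c where c: "good c" using good_exists by blast
  have L: "irreducible_in proj_zariski (projectivize (\<Lambda> 1 c))" using Lambda_curve[of 1 c] by (simp add: irreducible_curve_def)
  show ?thesis
    by (rule chain_of_three[OF point_closed[OF Pt_nonzero[OF c]] point_irreducible[OF Pt_nonzero[OF c]] Lambda_closed L
      X'_closed X'_irreducible point_Lambda_chain[OF c] Lambda_chain[OF c] subset_refl])
qed

lemma proj_scale: "proj i j (c * s) (c * t) p = c ^ M *s proj i j s t p"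
  proof -
  have r: "pairing (row (c * s) (c * t) n) p = c ^ M * pairing (row s t n) p" for n
    unfolding row_pairing sum_distrib_left by (simp add: psi_scale mult.assoc)
  show ?thesis unfolding proj_def r psi_scale by (simp add: vec_eq_iff algebra_simps)
qed

text \<open>The point has degree M in the homogeneous parameter, so u^(M N) Q (1 / u) is again a
  polynomial, the value of f at the parameter (u, 1).\<close>

lemma Pt_degree:
  assumes f: "hom_deg N f"
  shows "\<exists>Q. degree Q \<le> M * N \<and> (\<forall>c. f (Pt c x3 x4) = poly Q c)"
proof -
  let ?x = "x3 *s y 3 + x4 *s y 4"
  have V: "(\<lambda>z. proj 1 2 z 1 ?x $ k) \<in> generated_algebra {\<lambda>x. x}" for k
    by (intro proj_comp ga_const ga_gen) simp
  have U: "(\<lambda>z. Pt z x3 x4 $ k) \<in> generated_algebra {\<lambda>x. x}" for k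
    by (intro Pt_comp ga_const ga_gen) simp
  obtain S where S: "(\<lambda>z. f (proj 1 2 z 1 ?x)) = poly S"
    using poly_funs_comp[OF hom_deg_pf[OF f] V] unfolding ga_univariate by blast
  obtain Q where Q: "(\<lambda>z. f (Pt z x3 x4)) = poly Q"
    using poly_funs_comp[OF hom_deg_pf[OF f] U] unfolding ga_univariate by blast
  have "poly S u = u ^ (M * N) * poly Q (1 / u)" if "u \<noteq> 0" for u
  proof -
    have "proj 1 2 u 1 ?x = u ^ M *s Pt (1 / u) x3 x4"
      unfolding Pt_def using proj_scale[of 1 2 u 1 "1 / u" ?x] that by simp
    then show ?thesis
      unfolding fun_cong[OF S, symmetric] fun_cong[OF Q, symmetric] by (simp add: hom_deg_scale[OF f] power_mult)
  qed
  then have "degree Q \<le> M * N" by (rule degree_le_if_reversed)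
  then show ?thesis using fun_cong[OF Q] by blast
qed

text \<open>N + 1 zeros on a ruling kill f on it. At fixed x3, x4 the value is a polynomial in c of
  degree at most M N, so M N + 1 rulings suffice for all good ones, and \<open>good_dense\<close>
  gives the rest.\<close>

lemma vanishes_on_X':
  assumes f: "hom_deg N f" and T: "finite T" "card T = M * N + 1" and U: "finite U" "card U = N + 1"
    and zero: "\<And>c \<tau>. c \<in> T \<Longrightarrow> \<tau> \<in> U \<Longrightarrow> f (Pt c 1 \<tau>) = 0" and p: "p \<in> X'"
  shows "f p = 0"
proof (rule ccontr)
  assume "f p \<noteq> 0"
  then obtain c q where q: "good c" "q \<in> \<Lambda> 1 c" "f q \<noteq> 0" using good_dense[OF hom_deg_pf[OF f] p] by blast
  obtain x3 x4 where x: "q = Pt c x3 x4" using good_Pt[OF q(1,2)] by blast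
  obtain Q where Q: "degree Q \<le> M * N" "\<And>c. f (Pt c x3 x4) = poly Q c" using Pt_degree[OF f] by blast
  have "poly Q d = 0" if "d \<in> T" for d
  proof -
    have "Pt d 1 0 + \<tau> *s Pt d 0 1 = Pt d 1 \<tau>" for \<tau> unfolding Pt_linear[of d 1 \<tau>] by simp
    then have "f (x3 *s Pt d 1 0 + x4 *s Pt d 0 1) = 0"
      by (intro hom_vanishes_on_line[OF f U]) (simp add: zero[OF that])
    then show ?thesis using Q(2)[of d] Pt_linear[of d x3 x4] by simp
  qed
  moreover have "degree Q < card T" using Q(1) T(2) by simp
  ultimately have "Q = 0" using card_poly_roots_bound[of Q] card_mono[OF poly_roots_finite[of Q], of T] by fastforce
  then show False using q(3) Q(2)[of c] x by simp
qed

lemma krull_X'_le: "krull_dim proj_zariski (projectivize X') \<le> enat 2"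
proof (rule krull_dim_le[of "M + 1"])
  fix N and J :: "nat list set" and h :: "nat list \<Rightarrow> complex ^ 4 \<Rightarrow> complex"
  assume J: "finite J" "card J > (M + 1) * (N + 1) ^ 2" and h: "\<And>i. i \<in> J \<Longrightarrow> hom_deg N (h i)"
  obtain T :: "complex set" where T: "finite T" "card T = M * N + 1" using exists_finite_set by blast
  obtain U :: "complex set" where U: "finite U" "card U = N + 1" using exists_finite_set by blast
  \<comment> \<open>The number of conditions is (M N + 1) (N + 1), quadratic in N with the constant
    M + 1.\<close>
  have "M * N + 1 \<le> (M + 1) * (N + 1)" by simp
  then have "card (T \<times> U) \<le> (M + 1) * (N + 1) ^ 2"
    using T U by (simp add: card_cartesian_product power2_eq_square del: mult_Suc mult_Suc_right)
  then obtain l where l: "\<exists>i\<in>J. l i \<noteq> 0" "\<forall>z\<in>T \<times> U. (\<Sum>i\<in>J. l i * h i (Pt (fst z) 1 (snd z))) = 0"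
    using linear_dependence[of "T \<times> U" J "\<lambda>i z. h i (Pt (fst z) 1 (snd z))"] T U J by auto
  have "(\<Sum>i\<in>J. l i * h i x) = 0" if "x \<in> X'" for x
  proof (rule vanishes_on_X'[OF _ T U _ that])
    show "hom_deg N (\<lambda>x. \<Sum>i\<in>J. l i * h i x)" by (intro hom_deg_sum hom_deg_cmult h)
  qed (use l(2) in auto)
  then show "\<not> independent_on J h (cone (projectivize X'))"
    unfolding independent_on_def cone_X' using l(1) by blast
qed

lemma krull_X': "krull_dim proj_zariski (projectivize X') = 2"
  using krull_X'_ge krull_X'_le by (simp add: numeral_eq_enat order_antisym)

text \<open>A full flag is a chain of length 3 in projective space, while X' has dimension
  2.\<close>

lemma X'_proper: "X' \<noteq> UNIV"
proof
  assume full: "X' = UNIV"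
  \<comment> \<open>The flag imposes the last 3 - n of the forms y 1, y 2, y 3, so it rises from the
    line of \<open>b 4\<close> to the whole space.\<close>
  define Z where "Z n = annihilator (set (drop n [y 1, y 2, y 3]))" for n
  have mem: "b i \<in> Z n \<longleftrightarrow> (\<forall>u\<in>set (drop n [y 1, y 2, y 3]). pairing u (b i) = 0)" for i n
    by (simp add: Z_def annihilator_def)
  have "b 4 \<in> Z n" for n unfolding mem using set_drop_subset[of n "[y 1, y 2, y 3]"] by (auto simp: frameD[OF fr])
  then have nz: "Z n \<noteq> {0}" for n using frame_nonzero(1)[OF fr, of 4] by blast
  have strict: "Z n \<subset> Z (Suc n)" if n: "n < 3" for n
  proof -
    have "Z n \<subseteq> Z (Suc n)" unfolding Z_def annihilator_def using set_drop_subset_set_drop[of n "Suc n" "[y 1, y 2, y 3]"] by auto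
    moreover have "\<exists>i. b i \<in> Z (Suc n) \<and> b i \<notin> Z n"
    proof -
      consider "n = 0" | "n = 1" | "n = 2" using n by linarith
      then show ?thesis
      proof cases
        case 1 then show ?thesis unfolding mem by (intro exI[of _ 1]) (simp add: frameD[OF fr])
      next
        case 2 then show ?thesis unfolding mem by (intro exI[of _ 2]) (simp add: frameD[OF fr])
      next
        case 3 then show ?thesis unfolding mem by (intro exI[of _ 3]) (simp add: frameD[OF fr] numeral_2_eq_2)
      qed
    qed
    ultimately show ?thesis by blast
  qed
  have sub: "projectivize (Z n) \<subseteq> projectivize (Z k) \<longleftrightarrow> Z n \<subseteq> Z k" for n k
    unfolding Z_def by (intro projectivize_subset_iff cone_closed_subspace annihilator_subspace)
  have "enat 3 \<le> krull_dim proj_zariski (projectivize X')"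
  proof (rule krull_dim_ge)
    fix n
    show "closedin proj_zariski (projectivize (Z n)) \<and> irreducible_in proj_zariski (projectivize (Z n)) \<and> projectivize (Z n) \<subseteq> projectivize X'"
      unfolding full using subspace_irreducible[OF annihilator_subspace nz[of n, unfolded Z_def]]
      by (simp add: Z_def annihilator_closed projectivize_mono)
  next
    fix n :: nat assume "n < 3"
    from strict[OF this] show "projectivize (Z n) \<subset> projectivize (Z (Suc n))" unfolding less_le_not_le sub .
  qed
  then show False unfolding krull_X' by (simp add: numeral_eq_enat)
qed

text \<open>\<open>Q x3 x4 i\<close> is the polynomial in \<open>c\<close> giving coordinate \<open>i\<close> of \<open>Pt c x3 x4\<close>.\<close>

definition q :: "4 \<Rightarrow> 4 \<Rightarrow> complex poly" where
  "q k i = (if i = 1 then \<psi> 2 k else if i = 2 then \<psi> k 1 else if i = k then \<psi> 1 2 else 0)"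

definition Q :: "complex \<Rightarrow> complex \<Rightarrow> 4 \<Rightarrow> complex poly" where
  "Q x3 x4 i = smult x3 (q 3 i) + smult x4 (q 4 i)"

lemma Pt_coord: "pairing (b i) (Pt c x3 x4) = poly (Q x3 x4 i) c"
proof -
  have e: "\<Psi> i j 1 c = poly (\<psi> i j) c" for i j by (simp add: psi_affine)
  have s: "poly (\<psi> i 1) c = - poly (\<psi> 1 i) c" for i by (subst psi_skew_poly) simp
  have "i = 1 \<or> i = 2 \<or> i = 3 \<or> i = 4" by (rule exhaust_4)
  then show ?thesis
    unfolding Pt_def Q_def q_def proj_def
    by (elim disjE) (simp_all add: pairing_add pairing_diff pairing_scale b_y row_y e s algebra_simps)
qed

lemma Pt_expand: "Pt c x3 x4 = (\<Sum>i\<in>UNIV. poly (Q x3 x4 i) c *s y i)"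
  using frame_expand[OF frame_sym[OF fr], of "Pt c x3 x4"] by (simp add: Pt_coord)

section \<open>Tangent spaces of the dual surface\<close>

lemma phi_deriv_psi: "pderiv (\<phi> i) * \<psi> j k + pderiv (\<phi> j) * \<psi> k i + pderiv (\<phi> k) * \<psi> i j = 0"
proof -
  have "pderiv (\<phi> i) * (G * \<psi> j k) + pderiv (\<phi> j) * (G * \<psi> k i) + pderiv (\<phi> k) * (G * \<psi> i j) = 0"
    unfolding wedge[symmetric] by (simp add: algebra_simps)
  then have "G * (pderiv (\<phi> i) * \<psi> j k + pderiv (\<phi> j) * \<psi> k i + pderiv (\<phi> k) * \<psi> i j) = 0" by (simp add: algebra_simps)
  then show ?thesis using G_nonzero by simp
qed

lemma q_sum:
  assumes "k = 3 \<or> k = 4" shows "(\<Sum>i\<in>UNIV. f i * q k i) = f 1 * \<psi> 2 k + f 2 * \<psi> k 1 + f k * \<psi> 1 2"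
  using assms by (auto simp: sum_4 q_def)

lemma Q_sum: "(\<Sum>i\<in>UNIV. f i * Q x3 x4 i) = smult x3 (\<Sum>i\<in>UNIV. f i * q 3 i) + smult x4 (\<Sum>i\<in>UNIV. f i * q 4 i)"
  unfolding Q_def by (simp add: sum_4 algebra_simps smult_add_right)

lemma phi_Q: "(\<Sum>i\<in>UNIV. \<phi> i * Q x3 x4 i) = 0" "(\<Sum>i\<in>UNIV. pderiv (\<phi> i) * Q x3 x4 i) = 0"
  unfolding Q_sum by (simp_all add: q_sum phi_psi_poly phi_deriv_psi)

text \<open>The pairing of the second derivative of the curve with \<open>Pt\<close>, and by
  \<open>Q_deriv\<close> minus the pairing of \<open>w'\<close> with the derivative of
  \<open>Pt\<close> in c. Where it is nonzero at a good parameter, moving c leads out of the ruling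
  and the parametrization of the cone has full rank.\<close>

definition R :: "complex \<Rightarrow> complex \<Rightarrow> complex poly" where
  "R x3 x4 = (\<Sum>i\<in>UNIV. pderiv (pderiv (\<phi> i)) * Q x3 x4 i)"

lemma Q_deriv:
  "(\<Sum>i\<in>UNIV. \<phi> i * pderiv (Q x3 x4 i)) = 0"
  "(\<Sum>i\<in>UNIV. pderiv (\<phi> i) * pderiv (Q x3 x4 i)) = - R x3 x4"
proof -
  have "pderiv (\<Sum>i\<in>UNIV. f i * Q x3 x4 i) = (\<Sum>i\<in>UNIV. pderiv (f i) * Q x3 x4 i) + (\<Sum>i\<in>UNIV. f i * pderiv (Q x3 x4 i))"
    for f by (simp add: sum_4 pderiv_add pderiv_mult algebra_simps)
  from this[of \<phi>] this[of "\<lambda>i. pderiv (\<phi> i)"]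
  show "(\<Sum>i\<in>UNIV. \<phi> i * pderiv (Q x3 x4 i)) = 0" "(\<Sum>i\<in>UNIV. pderiv (\<phi> i) * pderiv (Q x3 x4 i)) = - R x3 x4"
    unfolding phi_Q R_def by (simp_all add: eq_neg_iff_add_eq_0 add.commute)
qed

lemma frame_pairing: "pairing (\<Sum>i\<in>UNIV. f i *s b i) (\<Sum>i\<in>UNIV. g i *s y i) = (\<Sum>i\<in>UNIV. f i * g i)"
  by (simp add: sum_4 pairing_add pairing_add_left pairing_scale pairing_scale_left b_y)

text \<open>G times R 1 0 is the Wronskian of \<phi> 1, \<phi> 2, \<phi> 3. If it vanishes, two
  applications of \<open>proportional_if_wronskian_zero\<close> make \<phi> 3 a combination of
  \<phi> 1 and \<phi> 2, and the curve lies in the plane of u.\<close>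

lemma R_nonzero: "R 1 0 \<noteq> 0"
proof
  assume R0: "R 1 0 = 0"
  let ?g = "\<phi> 1" and ?h = "\<phi> 3"
  let ?W = "pderiv ?h * ?g - ?h * pderiv ?g"
  define z :: "complex poly" where "z = [:0, 1:]"
  have d2: "pderiv (pderiv (\<phi> 2)) = 2 * pderiv ?g + z * pderiv (pderiv ?g)" "pderiv (\<phi> 2) = ?g + z * pderiv ?g" "\<phi> 2 = z * ?g"
    unfolding phi2 z_def by (simp_all add: pderiv_pCons pderiv_add)
  have "R 1 0 = pderiv (pderiv ?g) * \<psi> 2 3 + pderiv (pderiv (\<phi> 2)) * \<psi> 3 1 + pderiv (pderiv ?h) * \<psi> 1 2"
    unfolding R_def Q_sum by (simp add: q_sum)
  then have "0 = pderiv (pderiv ?g) * (G * \<psi> 2 3) + pderiv (pderiv (\<phi> 2)) * (G * \<psi> 3 1) + pderiv (pderiv ?h) * (G * \<psi> 1 2)"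
    unfolding R0 by (metis (no_types, opaque_lifting) distrib_left mult.left_commute mult_zero_right)
  also have "\<dots> = pderiv ?W * ?g - 2 * pderiv ?g * ?W"
    unfolding wedge[symmetric] d2(1) unfolding d2(2) unfolding d2(3) by (simp add: pderiv_diff pderiv_mult algebra_simps)
  finally have W: "pderiv ?W * ?g = 2 * pderiv ?g * ?W" by simp
  have "pderiv ?W * (?g * ?g) = ?W * pderiv (?g * ?g)"
    using arg_cong[OF W, of "\<lambda>p. p * ?g"] by (simp add: pderiv_mult algebra_simps)
  then obtain k where k: "?W = smult k (?g * ?g)" using proportional_if_wronskian_zero[of "?g * ?g"] phi1 by auto
  let ?e = "?h - smult k (\<phi> 2)"
  have "pderiv ?e * ?g - ?e * pderiv ?g = ?W - smult k (?g * ?g)"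
    unfolding pderiv_diff pderiv_smult d2(2) unfolding d2(3) by (simp add: algebra_simps smult_add_right smult_diff_right)
  then have "pderiv ?e * ?g = ?e * pderiv ?g" unfolding k by simp
  then obtain l where l: "?e = smult l ?g" using proportional_if_wronskian_zero phi1 by blast
  define u where "u = y 3 - k *s y 2 - l *s y 1"
  have "pairing u (w c) = 0" for c
    unfolding u_def pairing_diff_left pairing_scale_left w_coord using arg_cong[OF l, of "\<lambda>p. poly p c"] by simp
  moreover have "pairing u (b 3) = 1"
    unfolding u_def pairing_diff_left pairing_scale_left frameD[OF fr] by simp
  then have "u \<noteq> 0" by auto
  ultimately show False using K_nondegenerate_good by blast
qed

text \<open>The derivative of \<open>Pt\<close> in c is tangent and, as R is nonzero, not killed by
  \<open>w' c\<close>. A multiple of it moves u into the ruling, whose directions are tangent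
  too.\<close>

lemma tangent_generic:
  assumes R: "poly (R x3 x4) c \<noteq> 0" and c: "good c" and u: "pairing (w c) u = 0"
  shows "u \<in> tangent_space X' (Pt c x3 x4)"
proof -
  let ?T = "tangent_space X' (Pt c x3 x4)"
  define d where "d = (\<Sum>i\<in>UNIV. poly (pderiv (Q x3 x4 i)) c *s y i)"
  have "d \<in> ?T"
  proof (rule tangent_of_curve[of "\<lambda>c. Pt c x3 x4"])
    show "Pt \<tau> x3 x4 \<in> X'" for \<tau> by (rule Pt_X')
    show "((\<lambda>\<tau>. Pt \<tau> x3 x4 $ i) has_field_derivative d $ i) (at c)" for i
      unfolding Pt_expand d_def by (auto intro!: derivative_eq_intros poly_DERIV DERIV_sum sum.cong)
  qed
  have wd: "pairing (w c) d = 0"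
    unfolding w_def d_def frame_pairing using arg_cong[OF Q_deriv(1)[of x3 x4], of "\<lambda>p. poly p c"] by (simp add: poly_sum)
  have w'd: "pairing (w' c) d = - poly (R x3 x4) c"
    unfolding w'_def d_def frame_pairing using arg_cong[OF Q_deriv(2)[of x3 x4], of "\<lambda>p. poly p c"] by (simp add: poly_sum)
  define k where "k = pairing (w' c) u / pairing (w' c) d"
  have "pairing (w' c) d \<noteq> 0" using R w'd by simp
  then have "pairing (w' c) (u - k *s d) = 0" by (simp add: pairing_diff pairing_scale k_def)
  moreover have "pairing (w c) (u - k *s d) = 0" using u wd by (simp add: pairing_diff pairing_scale)
  ultimately have "u - k *s d \<in> \<Lambda> 1 c" using Lambda_good[OF c] by blast
  then have "Pt c x3 x4 + \<tau> *s (u - k *s d) \<in> X'" for \<tau>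
    using vec.subspace_add[OF Lambda_subspace Pt_in vec.subspace_scale[OF Lambda_subspace], of "u - k *s d" c x3 x4 \<tau>]
      Lambda_subset[of 1 c] by auto
  then have "u - k *s d \<in> ?T" by (rule tangent_of_line)
  then have "(u - k *s d) + k *s d \<in> ?T"
    using \<open>d \<in> ?T\<close> by (intro vec.subspace_add[OF tangent_space_subspace] vec.subspace_scale[OF tangent_space_subspace])
  then show ?thesis by simp
qed

lemma R_linear: "R x3 x4 = smult x3 (R 1 0) + smult x4 (R 0 1)"
  unfolding R_def Q_sum by simp

text \<open>Where R vanishes, join the parameters of p by a segment to a point with R nonzero; the
  derivative of f along a moving vector vanishes for almost all \<tau> and hence at \<tau> =
  1.\<close>

lemma tangent_good_point:
  assumes c: "good c" and p: "p \<in> \<Lambda> 1 c" and u: "pairing (w c) u = 0"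
  shows "u \<in> tangent_space X' p"
  unfolding tangent_space_def
proof (intro CollectI ballI impI)
  fix f assume f: "f \<in> poly_funs" "\<forall>x\<in>X'. f x = 0"
  obtain x3 x4 where x: "p = Pt c x3 x4" using good_Pt[OF c p] by blast
  have "R 1 0 * \<phi> 1 \<noteq> 0" using R_nonzero phi1 by simp
  then obtain c0 where c0: "poly (R 1 0 * \<phi> 1) c0 \<noteq> 0" using poly_all_0_iff_0 by blast
  obtain a where a: "pairing (w c) a = 1"
  proof -
    obtain a where "pairing (w c) a \<noteq> 0" using pairing_nondegenerate[of "w c"] w_nonzero[OF c] by blast
    then have "pairing (w c) ((1 / pairing (w c) a) *s a) = 1" by (simp add: pairing_scale)
    then show ?thesis by (rule that)
  qed
  define C where "C \<tau> = c0 + \<tau> * (c - c0)" for \<tau>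
  define V where "V \<tau> = Pt (C \<tau>) (1 + \<tau> * (x3 - 1)) (0 + \<tau> * (x4 - 0))" for \<tau>
  \<comment> \<open>Always annihilated by \<open>w (C \<tau>)\<close>, and equal to u at \<tau> = 1
    because there \<open>w c\<close> takes the value 1 at a and 0 at u.\<close>
  define U where "U \<tau> = pairing (w (C \<tau>)) a *s u - pairing (w (C \<tau>)) u *s a" for \<tau>
  have Ca: "C \<in> generated_algebra {\<lambda>x. x}" unfolding C_def[abs_def] by (rule segment_algebra)
  have wa: "(\<lambda>\<tau>. w (C \<tau>) $ i) \<in> generated_algebra {\<lambda>x. x}" for i
    unfolding w_def by (simp, intro ga_sum ga_mult ga_const ga_poly_comp Ca)
  have wp: "(\<lambda>\<tau>. pairing (w (C \<tau>)) z) \<in> generated_algebra {\<lambda>x. x}" for z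
    unfolding pairing_commute[of _ z] by (rule pairing_in_algebra[OF wa])
  have "differential f (V 1) (U 1) = 0"
  proof (rule ga_no_zero_divisors[of "\<lambda>\<tau>. differential f (V \<tau>) (U \<tau>)"
      "\<lambda>\<tau>. ((1 + \<tau> * (x3 - 1)) * poly (R 1 0) (C \<tau>) + (0 + \<tau> * (x4 - 0)) * poly (R 0 1) (C \<tau>)) * poly (\<phi> 1) (C \<tau>)" 0])
    show "(\<lambda>\<tau>. differential f (V \<tau>) (U \<tau>)) \<in> generated_algebra {\<lambda>x. x}"
    proof (rule differential_in_algebra[OF f(1)])
      show "(\<lambda>x. V x $ i) \<in> generated_algebra {\<lambda>x. x}" for i unfolding V_def by (intro Pt_comp Ca segment_algebra)
      show "(\<lambda>x. U x $ i) \<in> generated_algebra {\<lambda>x. x}" for i unfolding U_def by (simp, intro ga_diff ga_mult ga_const wp)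
    qed
    show "(\<lambda>\<tau>. ((1 + \<tau> * (x3 - 1)) * poly (R 1 0) (C \<tau>) + (0 + \<tau> * (x4 - 0)) * poly (R 0 1) (C \<tau>)) * poly (\<phi> 1) (C \<tau>))
        \<in> generated_algebra {\<lambda>x. x}"
      by (intro ga_add ga_mult ga_poly_comp Ca segment_algebra)
    fix \<tau>
    show "differential f (V \<tau>) (U \<tau>) * (((1 + \<tau> * (x3 - 1)) * poly (R 1 0) (C \<tau>) + (0 + \<tau> * (x4 - 0)) * poly (R 0 1) (C \<tau>)) * poly (\<phi> 1) (C \<tau>)) = 0"
      (is "_ * (?r * ?s) = 0")
    proof (cases "?r * ?s = 0")
      case False
      then have g: "good (C \<tau>)" by (simp add: good_def)
      have r: "poly (R (1 + \<tau> * (x3 - 1)) (0 + \<tau> * (x4 - 0))) (C \<tau>) \<noteq> 0"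
        using False by (subst R_linear) simp
      have "pairing (w (C \<tau>)) (U \<tau>) = 0" by (simp add: U_def pairing_diff pairing_scale)
      from tangent_generic[OF r g this] have "differential f (V \<tau>) (U \<tau>) = 0"
        using f unfolding V_def tangent_space_def by blast
      then show ?thesis by simp
    qed simp
  qed (use c0 in \<open>simp add: C_def\<close>)
  then show "differential f p u = 0" using u a by (simp add: U_def V_def C_def x)
qed

text \<open>The same extension once more, now from good rulings to all (s, t), with
  \<open>proj\<close> transporting the point and U the direction.\<close>

lemma tangent_contains:
  assumes st: "(s, t) \<noteq> (0, 0)" and p: "p \<in> \<Lambda> s t" and u: "pairing (v s t) u = 0"
  shows "u \<in> tangent_space X' p"
  unfolding tangent_space_def
proof (intro CollectI ballI impI)
  fix f assume f: "f \<in> poly_funs" "\<forall>x\<in>X'. f x = 0"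
  obtain i j where ij: "\<Psi> i j s t \<noteq> 0" using psi_form_nonzero[OF st] by blast
  define k where "k = 1 / \<Psi> i j s t"
  obtain a where a: "pairing (v s t) a = 1"
  proof -
    obtain a where "pairing (v s t) a \<noteq> 0" using pairing_nondegenerate[of "v s t"] v_nonzero[OF st] by blast
    then have "pairing (v s t) ((1 / pairing (v s t) a) *s a) = 1" by (simp add: pairing_scale)
    then show ?thesis by (rule that)
  qed
  define U where "U s t = pairing (v s t) a *s u - pairing (v s t) u *s a" for s t
  have vU: "pairing (v s t) (U s t) = 0" for s t by (simp add: U_def pairing_diff pairing_scale)
  let ?F = "\<lambda>z. differential f (k *s proj i j (fst z) (snd z) p) (U (fst z) (snd z))"
  have va: "(\<lambda>z. pairing (v (fst z) (snd z)) x) \<in> generated_algebra {fst, snd}" for x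
    unfolding pairing_commute[of _ x] by (rule pairing_in_algebra[OF v_algebra])
  have "?F (s, t) = 0"
  proof (rule binary_density[OF _ finite_bad])
    show "?F \<in> generated_algebra {fst, snd}"
    proof (rule differential_in_algebra[OF f(1)])
      show "(\<lambda>z. (k *s proj i j (fst z) (snd z) p) $ n) \<in> generated_algebra {fst, snd}" for n
        by (simp, intro ga_mult ga_const proj_algebra)
      show "(\<lambda>z. U (fst z) (snd z) $ n) \<in> generated_algebra {fst, snd}" for n
        unfolding U_def by (simp, intro ga_diff ga_mult ga_const va)
    qed
    fix s t :: complex assume s: "s \<noteq> 0" and "t / s \<notin> {c. \<not> good c}"
    then have g: "good (t / s)" by simp
    have "k *s proj i j s t p \<in> \<Lambda> 1 (t / s)" using Lambda_scaled[OF proj_in_Lambda] Lambda_affine[OF s] by blast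
    moreover have "pairing (w (t / s)) (U s t) = 0"
      using vU[of s t] s unfolding v_affine[OF s] by (simp add: pairing_scale_left)
    ultimately have "U s t \<in> tangent_space X' (k *s proj i j s t p)" by (rule tangent_good_point[OF g])
    then show "?F (s, t) = 0" using f unfolding tangent_space_def by simp
  qed
  then show "differential f p u = 0" using ij u a by (simp add: proj_Lambda[OF p] k_def U_def)
qed

text \<open>The tangent space contains a hyperplane, so it is this hyperplane or everything.\<close>

lemma tangent_regular:
  assumes st: "(s, t) \<noteq> (0, 0)" and p: "p \<in> \<Lambda> s t" and T: "tangent_space X' p \<noteq> UNIV"
  shows "tangent_space X' p = {u. pairing (v s t) u = 0}"
proof (rule ccontr)
  assume "\<not> ?thesis"
  then obtain x where x: "x \<in> tangent_space X' p" "pairing (v s t) x \<noteq> 0" using tangent_contains[OF st p] by blast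
  have "z \<in> tangent_space X' p" for z
  proof -
    let ?k = "pairing (v s t) z / pairing (v s t) x"
    have "z - ?k *s x \<in> tangent_space X' p"
      by (rule tangent_contains[OF st p]) (use x(2) in \<open>simp add: pairing_diff pairing_scale\<close>)
    then have "(z - ?k *s x) + ?k *s x \<in> tangent_space X' p"
      using x(1) by (intro vec.subspace_add[OF tangent_space_subspace] vec.subspace_scale[OF tangent_space_subspace])
    then show ?thesis by simp
  qed
  then show False using T by blast
qed

lemma cone_reg_iff: "p \<in> cone_reg (projectivize X') \<longleftrightarrow> p \<in> X' \<and> tangent_space X' p \<noteq> UNIV"
proof -
  have k: "krull_dim proj_zariski (projectivize X') + 1 = enat 3"
    unfolding krull_X' by (simp add: numeral_eq_enat one_enat_def)
  have "vec.dim (tangent_space X' p) = 3 \<longleftrightarrow> tangent_space X' p \<noteq> UNIV" if p: "p \<in> X'"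
  proof
    assume "vec.dim (tangent_space X' p) = 3"
    moreover have "vec.dim (UNIV :: (complex ^ 4) set) = 4" unfolding vec_dim_card by simp
    ultimately show "tangent_space X' p \<noteq> UNIV" by auto
  next
    assume T: "tangent_space X' p \<noteq> UNIV"
    obtain s t where st: "(s, t) \<noteq> (0, 0)" "p \<in> \<Lambda> s t" using p unfolding X'_def by blast
    show "vec.dim (tangent_space X' p) = 3"
      unfolding tangent_regular[OF st T] by (rule hyperplane_dim[OF v_nonzero[OF st(1)]])
  qed
  then show ?thesis unfolding cone_reg_def k cone_X' by auto
qed

lemma tangent_scale:
  assumes k: "k \<noteq> 0" and T: "tangent_space X' p \<noteq> UNIV" shows "tangent_space X' (k *s p) \<noteq> UNIV"
proof
  assume full: "tangent_space X' (k *s p) = UNIV"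
  have "differential f p u = 0" if f: "f \<in> poly_funs" "\<forall>x\<in>X'. f x = 0" for f u
  proof -
    define g where "g x = f ((1 / k) *s x)" for x
    have "(\<lambda>x. ((1 / k) *s x) $ i) \<in> poly_funs" for i by (simp only: vector_smult_component, intro pf_mult pf_const pf_coord)
    then have g: "g \<in> poly_funs" unfolding g_def[abs_def] poly_funs_def by (rule poly_funs_comp[OF f(1)])
    have "\<forall>x\<in>X'. g x = 0" using f(2) cone_closedD[OF X'_cone] by (simp add: g_def)
    then have z: "differential g (k *s p) (k *s u) = 0" using full g unfolding tangent_space_def by blast
    have "(1 / k) *s (k *s p + t *s (k *s u)) = p + t *s u" for t
      using k by (simp add: vec_eq_iff field_simps)
    then have "differential g (k *s p) (k *s u) = differential f p u" unfolding differential_def g_def by simp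
    then show ?thesis using z by simp
  qed
  then show False using T unfolding tangent_space_def by blast
qed

text \<open>If all elements of the ideal of X' had zero derivative in the direction p0 on X', the
  ideal would be closed under this derivative. Then all Taylor coefficients at 0 of f0 along the
  line to p0 would vanish, against \<open>f0 p0 \<noteq> 0\<close>. From there
  \<open>good_dense\<close> and a shift along a ruling reach nonzero x3 and x4, where F does not
  vanish.\<close>

lemma regular_witness:
  "\<exists>f u c x3 x4. f \<in> poly_funs \<and> (\<forall>x\<in>X'. f x = 0) \<and> good c \<and> x3 \<noteq> 0 \<and> x4 \<noteq> 0 \<and> differential f (Pt c x3 x4) u \<noteq> 0"
proof -
  define I where "I = {f \<in> poly_funs. \<forall>x\<in>X'. f x = 0}"
  obtain p0 where "p0 \<notin> X'" using X'_proper by blast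
  then obtain f0 where f0: "f0 \<in> I" "f0 p0 \<noteq> 0"
    using X'_closed unfolding closedin_proj_iff[OF X'_cone] I_def by blast
  have 0: "0 \<in> X'" using X'_cone by (rule cone_closed_zero)
  have "\<exists>f\<in>I. \<exists>p\<in>X'. differential f p p0 \<noteq> 0"
  proof (rule ccontr)
    assume none: "\<not> ?thesis"
    have step: "(\<lambda>x. differential f x p0) \<in> I" if "f \<in> I" for f
      using that none differential_pf unfolding I_def by blast
    have "poly ((pderiv ^^ k) r) 0 = 0" if "f \<in> I" "\<And>\<tau>. f (0 + \<tau> *s p0) = poly r \<tau>" for k f r
      using that
    proof (induction k arbitrary: f r)
      case 0
      then show ?case using \<open>0 \<in> X'\<close> unfolding I_def by (metis (mono_tags, lifting) add.right_neutral funpow_0 mem_Collect_eq vector_smult_lzero)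
    next
      case (Suc k)
      have f: "f \<in> poly_funs" using Suc.prems(1) by (simp add: I_def)
      have "differential f (0 + \<tau> *s p0) p0 = poly (pderiv r) \<tau>" for \<tau>
      proof (rule DERIV_unique)
        show "((\<lambda>\<tau>. f (0 + \<tau> *s p0)) has_field_derivative differential f (0 + \<tau> *s p0) p0) (at \<tau>)"
          by (rule differential_chain[OF f]) (auto intro!: derivative_eq_intros)
        show "((\<lambda>\<tau>. f (0 + \<tau> *s p0)) has_field_derivative poly (pderiv r) \<tau>) (at \<tau>)"
          unfolding Suc.prems(2) by (rule poly_DERIV)
      qed
      then have "poly ((pderiv ^^ k) (pderiv r)) 0 = 0" by (rule Suc.IH[OF step[OF Suc.prems(1)]])
      then show ?case by (simp add: funpow_swap1)
    qed
    moreover obtain r where r: "\<And>\<tau>. f0 (0 + \<tau> *s p0) = poly r \<tau>" using poly_fun_on_line[of f0 0 p0] f0(1) unfolding I_def by auto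
    ultimately have "r = 0" using f0(1) by (intro poly_zero_if_derivatives_zero) blast
    then show False using r[of 1] f0(2) by simp
  qed
  then obtain f p where f: "f \<in> I" "p \<in> X'" "differential f p p0 \<noteq> 0" by blast
  have f': "f \<in> poly_funs" "\<forall>x\<in>X'. f x = 0" using f(1) by (simp_all add: I_def)
  let ?g = "\<lambda>x. differential f x p0"
  have g: "?g \<in> poly_funs" by (rule differential_pf[OF f'(1)])
  obtain c q where q: "good c" "q \<in> \<Lambda> 1 c" "?g q \<noteq> 0" using good_dense[OF g f(2,3)] by blast
  obtain x3 x4 where x: "q = Pt c x3 x4" using good_Pt[OF q(1,2)] by blast
  have V: "(\<lambda>\<tau>. Pt c (x3 + \<tau> * 1) (x4 + \<tau> * 1) $ i) \<in> generated_algebra {\<lambda>x. x}" for i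
    by (intro Pt_comp ga_const segment_algebra)
  obtain P where P: "(\<lambda>\<tau>. ?g (Pt c (x3 + \<tau> * 1) (x4 + \<tau> * 1))) = poly P"
    using poly_funs_comp[OF g V] unfolding ga_univariate by blast
  have "poly P 0 \<noteq> 0" using fun_cong[OF P, of 0] q(3) x by simp
  then have "finite {\<tau>. poly P \<tau> = 0}" by (intro poly_roots_finite) auto
  then obtain \<tau> where "\<tau> \<notin> {\<tau>. poly P \<tau> = 0} \<union> {- x3, - x4}"
    using complex_avoid_finite[of "{\<tau>. poly P \<tau> = 0} \<union> {- x3, - x4}"] by auto
  then have \<tau>: "poly P \<tau> \<noteq> 0" "x3 + \<tau> * 1 \<noteq> 0" "x4 + \<tau> * 1 \<noteq> 0"
    by (auto simp: eq_neg_iff_add_eq_0 add.commute)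
  show ?thesis
    using f' q(1) \<tau> fun_cong[OF P, of \<tau>]
    by (intro exI[of _ f] exI[of _ p0] exI[of _ c] exI[of _ "x3 + \<tau> * 1"] exI[of _ "x4 + \<tau> * 1"]) simp
qed

end

text \<open>The differential of log F at x is \<alpha> / \<alpha>(x) + \<beta> / \<beta>(x).\<close>

lemma critical_pairs_product:
  "(x, u) \<in> critical_pairs (\<lambda>p. pairing \<alpha> p * pairing \<beta> p) X \<longleftrightarrow> x \<in> cone_reg X \<and> pairing \<alpha> x \<noteq> 0 \<and> pairing \<beta> x \<noteq> 0 \<and>
    (\<forall>v\<in>tangent_space (cone X) x. pairing (u - (1 / pairing \<alpha> x) *s \<alpha> - (1 / pairing \<beta> x) *s \<beta>) v = 0)"
proof -
  have diff: "differential (\<lambda>p. pairing \<alpha> p * pairing \<beta> p) x v / (pairing \<alpha> x * pairing \<beta> x) - pairing u v =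
      - pairing (u - (1 / pairing \<alpha> x) *s \<alpha> - (1 / pairing \<beta> x) *s \<beta>) v"
    if "pairing \<alpha> x \<noteq> 0" "pairing \<beta> x \<noteq> 0" for v
    unfolding differential_product[OF pf_pairing pf_pairing] differential_pairing pairing_diff_left pairing_scale_left
    using that by (simp add: add_divide_distrib)
  have eq: "a - b = - c \<Longrightarrow> a = b \<longleftrightarrow> c = 0" for a b c :: complex by auto
  have "differential (\<lambda>p. pairing \<alpha> p * pairing \<beta> p) x v / (pairing \<alpha> x * pairing \<beta> x) = pairing u v \<longleftrightarrow>
      pairing (u - (1 / pairing \<alpha> x) *s \<alpha> - (1 / pairing \<beta> x) *s \<beta>) v = 0"
    if "pairing \<alpha> x \<noteq> 0" "pairing \<beta> x \<noteq> 0" for v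
    by (rule eq[OF diff[OF that]])
  then show ?thesis unfolding critical_pairs_def by auto
qed

section \<open>Critical points on the dual surface\<close>

context rational_curve
begin

abbreviation "F \<equiv> \<lambda>p. pairing (b 3) p * pairing (b 4) p"

text \<open>A critical point \<open>x\<close> on the ruling of \<open>v s t\<close> satisfies \<open>u = b 3 / x3 + b 4 / x4 + k v s t\<close>. The first two
  coordinates of \<open>u\<close> determine the ruling, the other two then determine \<open>x3\<close> and \<open>x4\<close>.\<close>

lemma unique_critical_point:
  assumes u: "\<And>i. pairing (y i) u = U i" and V: "\<And>i. bform m (\<phi> i) (U 1) (U 2) = V i"
    and A: "A = U 3 * V 1 - U 1 * V 3" and B: "B = U 4 * V 1 - U 1 * V 4"
    and nonzero: "U 1 \<noteq> 0" "V 1 \<noteq> 0" "A \<noteq> 0" "B \<noteq> 0"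
    and reg: "tangent_space X' (proj 1 2 (U 1) (U 2) (B *s y 3 + A *s y 4)) \<noteq> UNIV"
  shows "\<exists>!x. (x, u) \<in> critical_pairs F (projectivize X')"
proof -
  define c where "c = U 2 / U 1"
  have "V 1 = U 1 ^ m * poly (\<phi> 1) c" unfolding V[symmetric] bform_affine[OF deg nonzero(1)] c_def ..
  then have g: "good c" using nonzero(2) by (auto simp: good_def)
  have st: "(U 1, U 2) \<noteq> (0, 0)" using nonzero(1) by simp
  have n: "\<Psi> 1 2 (U 1) (U 2) \<noteq> 0" using psi12_nonzero[OF nonzero(1)] g by (simp add: c_def)
  have V2: "U 1 * V 2 = U 2 * V 1"
    unfolding V[symmetric] bform_affine[OF deg nonzero(1)] using nonzero(1) by (simp add: phi2)
  have fr4: "pairing (y i) (b 3) = (if i = 3 then 1 else 0)" "pairing (y i) (b 4) = (if i = 4 then 1 else 0)" for i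
    using frameD[OF fr] by auto
  have four: "i = 1 \<or> i = 2 \<or> i = 3 \<or> i = (4 :: 4)" for i by (rule exhaust_4)
  \<comment> \<open>U 1 / V 1 is the coefficient of the curve point in u. It accounts for the first
    two coordinates, and A / V 1 and B / V 1 are what remains of the other two.\<close>
  have form: "u - (1 / x3) *s b 3 - (1 / x4) *s b 4 = (U 1 / V 1) *s v (U 1) (U 2)"
    if x: "1 / x3 = A / V 1" "1 / x4 = B / V 1" for x3 x4
  proof (rule frame_eqI[OF fr])
    fix i
    have AV: "A / V 1 = U 3 - U 1 / V 1 * V 3" "B / V 1 = U 4 - U 1 / V 1 * V 4"
      unfolding A B diff_divide_distrib using nonzero(2) by simp_all
    have V2': "U 1 / V 1 * V 2 = U 2" using V2 nonzero(2) by simp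
    show "pairing (y i) (u - (1 / x3) *s b 3 - (1 / x4) *s b 4) = pairing (y i) ((U 1 / V 1) *s v (U 1) (U 2))"
      unfolding pairing_diff pairing_scale u fr4 v_coord V x AV
      using four[of i] nonzero(2) V2' by (elim disjE) simp_all
  qed
  let ?X = "proj 1 2 (U 1) (U 2) (B *s y 3 + A *s y 4)"
  \<comment> \<open>Scales the point of the ruling so that its coordinates under b 3 and b 4 are the
    reciprocals of those remainders.\<close>
  define k where "k = V 1 / (A * B * \<Psi> 1 2 (U 1) (U 2))"
  have k: "k \<noteq> 0" using nonzero n by (simp add: k_def)
  have kX: "k *s ?X \<in> \<Lambda> (U 1) (U 2)" by (rule Lambda_scaled[OF proj_in_Lambda])
  have x34: "pairing (b 3) (k *s ?X) = V 1 / A" "pairing (b 4) (k *s ?X) = V 1 / B"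
    unfolding pairing_scale proj_coord k_def using nonzero n by simp_all
  show ?thesis
  proof (rule ex1I)
    have T: "tangent_space X' (k *s ?X) \<noteq> UNIV" by (rule tangent_scale[OF k reg])
    have "u - (1 / pairing (b 3) (k *s ?X)) *s b 3 - (1 / pairing (b 4) (k *s ?X)) *s b 4 = (U 1 / V 1) *s v (U 1) (U 2)"
      by (rule form) (simp_all add: x34)
    then have "\<forall>z\<in>tangent_space X' (k *s ?X).
        pairing (u - (1 / pairing (b 3) (k *s ?X)) *s b 3 - (1 / pairing (b 4) (k *s ?X)) *s b 4) z = 0"
      unfolding tangent_regular[OF st kX T] by (simp add: pairing_scale_left)
    moreover have "k *s ?X \<in> X'" using Lambda_subset[OF st] kX by blast
    moreover have "pairing (b 3) (k *s ?X) \<noteq> 0" "pairing (b 4) (k *s ?X) \<noteq> 0" unfolding x34 using nonzero by simp_all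
    ultimately show "(k *s ?X, u) \<in> critical_pairs F (projectivize X')"
      unfolding critical_pairs_product cone_X' cone_reg_iff using T by blast
  next
    fix x assume "(x, u) \<in> critical_pairs F (projectivize X')"
    then have x: "x \<in> X'" "tangent_space X' x \<noteq> UNIV" "pairing (b 3) x \<noteq> 0" "pairing (b 4) x \<noteq> 0"
      and crit: "\<And>z. z \<in> tangent_space X' x \<Longrightarrow> pairing (u - (1 / pairing (b 3) x) *s b 3 - (1 / pairing (b 4) x) *s b 4) z = 0"
      unfolding critical_pairs_product cone_X' cone_reg_iff by auto
    obtain s t where st': "(s, t) \<noteq> (0, 0)" "x \<in> \<Lambda> s t" using x(1) unfolding X'_def by blast
    obtain l where "u - (1 / pairing (b 3) x) *s b 3 - (1 / pairing (b 4) x) *s b 4 = l *s v s t"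
      using proportional_if_same_kernel[OF v_nonzero[OF st'(1)] crit] tangent_regular[OF st' x(2)] by blast
    then have e: "U i - 1 / pairing (b 3) x * (if i = 3 then 1 else 0) - 1 / pairing (b 4) x * (if i = 4 then 1 else 0) =
        l * bform m (\<phi> i) s t" for i
      using arg_cong[of _ _ "pairing (y i)"] unfolding u[symmetric] fr4[symmetric] v_coord[symmetric] pairing_scale[symmetric] pairing_diff[symmetric]
      by blast
    have e1: "U 1 = l * bform m (\<phi> 1) s t" and e2: "U 2 = l * bform m (\<phi> 2) s t" using e[of 1] e[of 2] by simp_all
    have s: "s \<noteq> 0"
    proof
      assume "s = 0"
      then show False using e1 nonzero(1) phi1_infinity by simp
    qed
    have "U 2 = (t / s) * U 1" unfolding e1 e2 bform_affine[OF deg s] by (simp add: phi2)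
    then have c: "t / s = c" using nonzero(1) by (simp add: c_def)
    have ls: "U 1 = l * s ^ m * poly (\<phi> 1) c" unfolding e1 bform_affine[OF deg s] c by simp
    have e': "l * bform m (\<phi> i) s t = U 1 / V 1 * V i" for i
    proof -
      have "U 1 / V 1 = (l * s ^ m) / U 1 ^ m"
        unfolding V[symmetric] bform_affine[OF deg nonzero(1)] c_def[symmetric] using ls nonzero(1) g by (simp add: good_def)
      then have "U 1 / V 1 * V i = (l * s ^ m) / U 1 ^ m * (U 1 ^ m * poly (\<phi> i) c)"
        unfolding V[symmetric] bform_affine[OF deg nonzero(1)] c_def by simp
      also have "\<dots> = l * s ^ m * poly (\<phi> i) c" using nonzero(1) by simp
      finally show ?thesis unfolding bform_affine[OF deg s] c by simp
    qed
    have "1 / pairing (b 3) x = U 3 - U 1 / V 1 * V 3" "1 / pairing (b 4) x = U 4 - U 1 / V 1 * V 4"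
      using e[of 3] e[of 4] unfolding e' by (simp_all add: algebra_simps)
    then have "1 / pairing (b 3) x = A / V 1" "1 / pairing (b 4) x = B / V 1"
      unfolding A B diff_divide_distrib using nonzero(2) by simp_all
    then have "1 / (1 / pairing (b 3) x) = 1 / (A / V 1)" "1 / (1 / pairing (b 4) x) = 1 / (B / V 1)" by simp_all
    then have xx: "pairing (b 3) x = V 1 / A" "pairing (b 4) x = V 1 / B" by simp_all
    have "x \<in> \<Lambda> (U 1) (U 2)" using st'(2) Lambda_affine[OF s] Lambda_affine[OF nonzero(1)] c by (simp add: c_def)
    then show "x = k *s ?X" by (rule Lambda_eqI[OF n _ kX]) (simp_all only: x34 xx)
  qed
qed

text \<open>All conditions of \<open>unique_critical_point\<close> are collected in one polynomial
  in u. That it is not identically zero is shown by working backwards from a regular point to a u of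
  which it is the critical point.\<close>

lemma MLD_X': "MLD F (projectivize X') = 1"
proof (rule MLD_eq_1)
  define U where "U i u = pairing (y i) u" for i and u :: "complex ^ 4"
  define V where "V i u = bform m (\<phi> i) (U 1 u) (U 2 u)" for i u
  define A where "A u = U 3 u * V 1 u - U 1 u * V 3 u" for u
  define B where "B u = U 4 u * V 1 u - U 1 u * V 4 u" for u
  define X where "X u = proj 1 2 (U 1 u) (U 2 u) (B u *s y 3 + A u *s y 4)" for u
  obtain f e c x3 x4 where f: "f \<in> poly_funs" "\<forall>x\<in>X'. f x = 0" and c: "good c" and x: "x3 \<noteq> 0" "x4 \<noteq> 0"
    and nz: "differential f (Pt c x3 x4) e \<noteq> 0" using regular_witness by (elim exE) auto
  \<comment> \<open>The last factor certifies regularity: a nonzero derivative of an equation at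
    \<open>X u\<close> excludes a full tangent space.\<close>
  define H where "H u = U 1 u * V 1 u * A u * B u * differential f (X u) e" for u
  have U: "U i \<in> poly_funs" for i unfolding U_def[abs_def] by (rule pf_pairing)
  have V: "V i \<in> poly_funs" for i
    unfolding V_def[abs_def] poly_funs_def by (intro bform_in_algebra) (rule U[unfolded poly_funs_def])+
  have A: "A \<in> poly_funs" unfolding A_def[abs_def] by (intro pf_diff pf_mult U V)
  have B: "B \<in> poly_funs" unfolding B_def[abs_def] by (intro pf_diff pf_mult U V)
  have BA: "(\<lambda>u. (B u *s y 3 + A u *s y 4) $ k) \<in> poly_funs" for k
    by (simp, intro pf_add pf_mult pf_const A B)
  have X: "(\<lambda>u. X u $ k) \<in> poly_funs" for k
    unfolding X_def poly_funs_def
    by (intro proj_comp) (rule U[unfolded poly_funs_def] BA[unfolded poly_funs_def])+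
  have D: "(\<lambda>u. differential f (X u) e) \<in> poly_funs"
    unfolding poly_funs_def by (rule differential_in_algebra[OF f(1)]) (rule X[unfolded poly_funs_def] ga_const)+
  have H: "H \<in> poly_funs" unfolding H_def[abs_def] by (intro pf_mult U V A B D)
  have "\<exists>u. H u \<noteq> 0"
  proof -
    define a where "a = poly (\<phi> 1) c"
    define r where "r = \<Psi> 1 2 1 c"
    have a: "a \<noteq> 0" using c by (simp add: a_def good_def)
    have r: "r \<noteq> 0" using psi12_nonzero[of 1 c] c by (simp add: r_def)
    define p3 where "p3 = r * x3"
    define p4 where "p4 = r * x4"
    have p: "p3 \<noteq> 0" "p4 \<noteq> 0" using r x by (simp_all add: p3_def p4_def)
    \<comment> \<open>Scaling the parameter (1, c) by \<sigma> scales \<open>X u\<close> by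
      \<sigma>^M through \<open>proj\<close> and by \<sigma>^m through A and B; this root makes
      \<open>X u\<close> exactly the chosen point and not only a multiple.\<close>
    obtain \<sigma> where \<sigma>: "p3 * p4 / (a * r) = \<sigma> ^ (M + m)" using exists_complex_root[of "M + m"] m1 by auto
    have s: "\<sigma> \<noteq> 0"
    proof
      assume "\<sigma> = 0"
      then have "p3 * p4 / (a * r) = 0" unfolding \<sigma> using m1 by simp
      then show False using p a r by simp
    qed
    \<comment> \<open>The form that the critical equation prescribes, with the coefficient \<sigma>
      / a chosen so that U 1 = \<sigma> and U 2 = \<sigma> c.\<close>
    define u where "u = (1 / p3) *s b 3 + (1 / p4) *s b 4 + (\<sigma> / a) *s w c"
    have Uu: "U 1 u = \<sigma> * 1" "U 2 u = \<sigma> * c" "U 3 u = 1 / p3 + \<sigma> / a * poly (\<phi> 3) c" "U 4 u = 1 / p4 + \<sigma> / a * poly (\<phi> 4) c"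
      unfolding U_def u_def pairing_add pairing_scale w_coord frameD[OF fr] phi2 using a by (simp_all add: a_def)
    have Vu: "V i u = \<sigma> ^ m * poly (\<phi> i) c" for i
      unfolding V_def Uu bform_scale using bform_affine[OF deg[of i], of 1 c] by simp
    have Au: "A u = \<sigma> ^ m * a / p3" "B u = \<sigma> ^ m * a / p4"
      unfolding A_def B_def Uu Vu a_def[symmetric] using a by (simp_all add: distrib_right)
    define K where "K = \<sigma> ^ m * a * r / (p3 * p4)"
    have K34: "B u = K * x3" "A u = K * x4"
      unfolding Au K_def p3_def p4_def using r x by simp_all
    have "X u = \<sigma> ^ M *s Pt c (K * x3) (K * x4)" unfolding X_def Uu(1,2) proj_scale Pt_def K34 ..
    also have "Pt c (K * x3) (K * x4) = K *s Pt c x3 x4"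
      unfolding Pt_linear[of c "K * x3"] Pt_linear[of c x3] by (simp add: vector_add_ldistrib)
    also have "\<sigma> ^ M *s (K *s Pt c x3 x4) = (\<sigma> ^ (M + m) * (a * r / (p3 * p4))) *s Pt c x3 x4"
      by (simp add: K_def power_add mult.assoc)
    also have "\<sigma> ^ (M + m) * (a * r / (p3 * p4)) = 1" unfolding \<sigma>[symmetric] using a r p by simp
    finally have "X u = Pt c x3 x4" by simp
    then have "H u \<noteq> 0" unfolding H_def Uu(1) Vu Au using nz s a p by (simp add: a_def)
    then show ?thesis by blast
  qed
  then obtain u0 where "H u0 \<noteq> 0" by blast
  from generically_nonzero[OF H this]
  show "generically (\<lambda>u. \<exists>!x. (x, u) \<in> critical_pairs F (projectivize X'))"
  proof (rule generically_mono)
    fix u assume h: "H u \<noteq> 0"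
    show "\<exists>!x. (x, u) \<in> critical_pairs F (projectivize X')"
    proof (rule unique_critical_point[where U = "\<lambda>i. U i u" and V = "\<lambda>i. V i u" and A = "A u" and B = "B u"])
      show "tangent_space X' (proj 1 2 (U 1 u) (U 2 u) (B u *s y 3 + A u *s y 4)) \<noteq> UNIV"
      proof
        assume "tangent_space X' (proj 1 2 (U 1 u) (U 2 u) (B u *s y 3 + A u *s y 4)) = UNIV"
        then have "e \<in> tangent_space X' (X u)" by (simp add: X_def)
        then have "differential f (X u) e = 0" using f unfolding tangent_space_def by blast
        then show False using h by (simp add: H_def)
      qed
    qed (use h in \<open>simp_all add: U_def V_def A_def B_def H_def\<close>)
  qed
qed

section \<open>The family of rulings\<close>

definition B :: "(complex ^ 4) set set" where
  "B = projectivize (annihilator {axis 3 1, axis 4 1})"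

text \<open>The base B is the parameter line embedded in projective 3-space: the first two
  coordinates of a carry (s : t).\<close>

definition Z :: "((complex ^ 4) set \<times> (complex ^ 4) set) set" where
  "Z = {(vec.span {a}, vec.span {x}) | a x. a \<noteq> 0 \<and> x \<noteq> 0 \<and> a $ 3 = 0 \<and> a $ 4 = 0 \<and> x \<in> \<Lambda> (a $ 1) (a $ 2)}"

lemma pairing_axis_left: "pairing (axis i 1) x = x $ i"
  unfolding pairing_commute[of "axis i 1"] by (rule pairing_axis)

lemma B_iff: "l \<in> B \<longleftrightarrow> (\<exists>a. l = vec.span {a} \<and> a \<noteq> 0 \<and> a $ 3 = 0 \<and> a $ 4 = 0)"
  unfolding B_def projectivize_def annihilator_def by (auto simp: pairing_axis_left)

lemma parameter_nonzero: "a \<noteq> 0 \<Longrightarrow> a $ 3 = 0 \<Longrightarrow> a $ 4 = 0 \<Longrightarrow> (a $ 1, a $ 2) \<noteq> (0, 0)" for a :: "complex ^ 4"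
  by (auto simp: vec_eq_iff forall_4)

lemma axes_expand: "a $ 3 = 0 \<Longrightarrow> a $ 4 = 0 \<Longrightarrow> a = a $ 1 *s axis 1 1 + a $ 2 *s axis 2 1" for a :: "complex ^ 4"
proof -
  assume a: "a $ 3 = 0" "a $ 4 = 0"
  have "a $ i = (a $ 1 *s axis 1 1 + a $ 2 *s axis 2 1) $ i" for i
    using exhaust_4[of i] a by (elim disjE) (simp_all add: axis_def)
  then show ?thesis unfolding vec_eq_iff by (rule allI)
qed

lemma B_curve: "irreducible_curve B"
  unfolding B_def
proof (rule line_irreducible_curve)
  fix x z :: complex assume e: "x *s axis 1 1 + z *s axis 2 1 = (0 :: complex ^ 4)"
  show "x = 0 \<and> z = 0" using arg_cong[OF e, of "\<lambda>v. v $ 1"] arg_cong[OF e, of "\<lambda>v. v $ 2"] by (simp add: axis_def)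
next
  show "annihilator {axis 3 1, axis 4 1 :: complex ^ 4} = {x *s axis 1 1 + z *s axis 2 1 | x z. True}"
  proof (intro equalityI subsetI)
    fix a :: "complex ^ 4" assume "a \<in> annihilator {axis 3 1, axis 4 1}"
    then have "a $ 3 = 0" "a $ 4 = 0" unfolding annihilator_def by (simp_all add: pairing_axis_left)
    from axes_expand[OF this] show "a \<in> {x *s axis 1 1 + z *s axis 2 1 | x z. True}" by blast
  next
    fix a :: "complex ^ 4" assume "a \<in> {x *s axis 1 1 + z *s axis 2 1 | x z. True}"
    then show "a \<in> annihilator {axis 3 1, axis 4 1}"
      unfolding annihilator_def by (auto simp: pairing_axis_left) (simp_all add: axis_def)
  qed
qed

lemma Z_fibre:
  assumes a: "a \<noteq> 0" "a $ 3 = 0" "a $ 4 = 0"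
  shows "Z `` {vec.span {a}} = projectivize (\<Lambda> (a $ 1) (a $ 2))"
proof (intro equalityI subsetI)
  fix l assume "l \<in> Z `` {vec.span {a}}"
  then obtain a' x where x: "vec.span {a} = vec.span {a'}" "l = vec.span {x}" "a' \<noteq> 0" "x \<noteq> 0" "x \<in> \<Lambda> (a' $ 1) (a' $ 2)"
    unfolding Z_def by blast
  obtain k where k: "k \<noteq> 0" "a = k *s a'" using x(1) span_eq_iff[OF a(1) x(3)] by blast
  have "x \<in> \<Lambda> (a $ 1) (a $ 2)" unfolding k(2) using x(5) Lambda_scale[OF k(1)] by simp
  then show "l \<in> projectivize (\<Lambda> (a $ 1) (a $ 2))" unfolding x(2) using x(4) by (rule projectivizeI)
next
  fix l assume "l \<in> projectivize (\<Lambda> (a $ 1) (a $ 2))"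
  then obtain x where "l = vec.span {x}" "x \<noteq> 0" "x \<in> \<Lambda> (a $ 1) (a $ 2)" by (rule projectivizeE)
  then show "l \<in> Z `` {vec.span {a}}" unfolding Z_def using a by blast
qed

lemma Z_closed: "proj_prod_closed Z"
proof -
  let ?G = "range (\<lambda>i (z :: (complex ^ 4) \<times> (complex ^ 4)). fst z $ i) \<union> range (\<lambda>j z. snd z $ j)"
  define c where "c i z = fst z $ i" for i and z :: "(complex ^ 4) \<times> (complex ^ 4)"
  define r where "r i z = pairing (row (fst z $ 1) (fst z $ 2) i) (snd z)" for i and z :: "(complex ^ 4) \<times> (complex ^ 4)"
  have fst: "(\<lambda>z. fst z $ i) \<in> generated_algebra ?G" for i by (rule ga_gen) blast
  have snd: "(\<lambda>z. snd z $ i) \<in> generated_algebra ?G" for i by (rule ga_gen) blast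
  have "c i \<in> bihom_poly_funs" for i
  proof -
    have "c i (k *s a, l *s x) = k ^ 1 * l ^ 0 * c i (a, x)" for k l a x by (simp add: c_def)
    moreover have "c i \<in> generated_algebra ?G" unfolding c_def[abs_def] by (rule fst)
    ultimately show ?thesis unfolding bihom_poly_funs_def by blast
  qed
  moreover have "r i \<in> bihom_poly_funs" for i
  proof -
    have "r i \<in> generated_algebra ?G"
      unfolding r_def[abs_def] row_pairing by (intro ga_sum ga_mult psi_comp fst pairing_in_algebra snd)
    moreover have "r i (k *s a, l *s x) = k ^ M * l ^ 1 * r i (a, x)" for k l a x
      unfolding r_def row_pairing by (simp add: psi_scale pairing_scale sum_distrib_left mult.assoc mult.left_commute)
    ultimately show ?thesis unfolding bihom_poly_funs_def by blast
  qed
  ultimately have "{c 3, c 4} \<union> range r \<subseteq> bihom_poly_funs" by blast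
  moreover have "(\<forall>f\<in>{c 3, c 4} \<union> range r. f (a, x) = 0) \<longleftrightarrow> a $ 3 = 0 \<and> a $ 4 = 0 \<and> x \<in> \<Lambda> (a $ 1) (a $ 2)" for a x
    unfolding Lambda_iff by (auto simp: c_def r_def)
  then have "Z = {(vec.span {a}, vec.span {x}) | a x. a \<noteq> 0 \<and> x \<noteq> 0 \<and> (\<forall>f\<in>{c 3, c 4} \<union> range r. f (a, x) = 0)}"
    unfolding Z_def by (simp only:)
  ultimately show ?thesis unfolding proj_prod_closed_def by blast
qed

lemma fibre_curve: "l \<in> B \<Longrightarrow> irreducible_curve (Z `` {l})"
  unfolding B_iff using Z_fibre Lambda_curve[OF parameter_nonzero] by auto

lemma ruled_X': "ruled_by_curves (projectivize X') B Z"
  unfolding ruled_by_curves_def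
proof (intro conjI ballI)
  show "Z \<subseteq> B \<times> projectivize X'"
  proof
    fix z assume "z \<in> Z"
    then obtain a x where z: "z = (vec.span {a}, vec.span {x})" and a: "a \<noteq> 0" "a $ 3 = 0" "a $ 4 = 0" and x: "x \<noteq> 0" "x \<in> \<Lambda> (a $ 1) (a $ 2)"
      unfolding Z_def by blast
    have "x \<in> X'" using Lambda_subset[OF parameter_nonzero[OF a]] x(2) by blast
    then have "vec.span {x} \<in> projectivize X'" using x(1) by (rule projectivizeI)
    moreover have "vec.span {a} \<in> B" unfolding B_iff using a by blast
    ultimately show "z \<in> B \<times> projectivize X'" by (simp add: z)
  qed
  then have "Z `` B \<subseteq> projectivize X'" by blast
  moreover have "projectivize X' \<subseteq> Z `` B"
  proof
    fix l assume "l \<in> projectivize X'"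
    then obtain x where x: "l = vec.span {x}" "x \<noteq> 0" "x \<in> X'" by (rule projectivizeE)
    then obtain s t where st: "(s, t) \<noteq> (0, 0)" "x \<in> \<Lambda> s t" unfolding X'_def by blast
    define a :: "complex ^ 4" where "a = s *s axis 1 1 + t *s axis 2 1"
    have c: "a $ 1 = s" "a $ 2 = t" "a $ 3 = 0" "a $ 4 = 0" by (simp_all add: a_def axis_def)
    have "a \<noteq> 0" using c(1,2) st(1) by auto
    have "vec.span {a} \<in> B" unfolding B_iff using \<open>a \<noteq> 0\<close> c(3,4) by blast
    moreover have "l \<in> Z `` {vec.span {a}}"
      unfolding Z_fibre[OF \<open>a \<noteq> 0\<close> c(3,4)] c(1,2) x(1) by (rule projectivizeI[OF st(2) x(2)])
    ultimately show "l \<in> Z `` B" by blast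
  qed
  ultimately show "Z `` B = projectivize X'" by (rule subset_antisym)
  show "krull_dim proj_zariski (Z `` {l}) = 1" if "l \<in> B" for l
    using fibre_curve[OF that] by (simp add: irreducible_curve_def)
  have "{l \<in> B. \<not> irreducible_curve (Z `` {l})} = {}" using fibre_curve by blast
  then show "finite {l \<in> B. \<not> irreducible_curve (Z `` {l})}" by (simp only: finite.emptyI)
qed (rule B_curve Z_closed)+

lemma MLD_ruling:
  assumes c: "good c" shows "MLD F (projectivize (\<Lambda> 1 c)) = 1"
  unfolding \<Lambda>_def
proof (rule MLD_line)
  have n: "\<Psi> 1 2 1 c \<noteq> 0" using psi12_nonzero[of 1 c] c by simp
  \<comment> \<open>Normalizes the two points of the ruling to a basis dual to b 3, b 4, as
    \<open>MLD_line\<close> requires.\<close>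
  define r where "r = 1 / \<Psi> 1 2 1 c"
  have r: "r \<noteq> 0" using n by (simp add: r_def)
  show "annihilator (range (row 1 c)) = {x *s (r *s Pt c 1 0) + z *s (r *s Pt c 0 1) | x z. True}"
    unfolding \<Lambda>_def[symmetric]
  proof (intro equalityI subsetI)
    fix p assume "p \<in> \<Lambda> 1 c"
    then obtain x3 x4 where "p = x3 *s Pt c 1 0 + x4 *s Pt c 0 1" using good_Pt[OF c] Pt_linear by blast
    then have "p = (x3 / r) *s (r *s Pt c 1 0) + (x4 / r) *s (r *s Pt c 0 1)" using r by simp
    then show "p \<in> {x *s (r *s Pt c 1 0) + z *s (r *s Pt c 0 1) | x z. True}" by blast
  next
    fix p assume "p \<in> {x *s (r *s Pt c 1 0) + z *s (r *s Pt c 0 1) | x z. True}"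
    then obtain x z where "p = x *s (r *s Pt c 1 0) + z *s (r *s Pt c 0 1)" by blast
    then show "p \<in> \<Lambda> 1 c"
      using Lambda_subspace Pt_in by (simp only:) (intro vec.subspace_add vec.subspace_scale)
  qed
  show "pairing (b 3) (r *s Pt c 1 0) = 1" "pairing (b 4) (r *s Pt c 1 0) = 0"
    "pairing (b 3) (r *s Pt c 0 1) = 0" "pairing (b 4) (r *s Pt c 0 1) = 1"
    unfolding pairing_scale Pt_def proj_coord using n by (simp_all add: r_def)
qed

text \<open>Exceptions can only be the ruling at infinity, s = 0, and those over the finitely many
  parameters that are not good.\<close>

lemma MLD_rulings: "finite {l \<in> B. MLD F (Z `` {l}) \<noteq> 1}"
proof (rule finite_subset)
  show "{l \<in> B. MLD F (Z `` {l}) \<noteq> 1} \<subseteq>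
      insert (vec.span {axis 2 1}) ((\<lambda>c. vec.span {axis 1 1 + c *s axis 2 1}) ` {c. \<not> good c})"
  proof
    fix l assume "l \<in> {l \<in> B. MLD F (Z `` {l}) \<noteq> 1}"
    then have l: "l \<in> B" "MLD F (Z `` {l}) \<noteq> 1" by simp_all
    then obtain a where a: "l = vec.span {a}" "a \<noteq> 0" "a $ 3 = 0" "a $ 4 = 0" unfolding B_iff by blast
    note e = axes_expand[OF a(3,4)]
    show "l \<in> insert (vec.span {axis 2 1}) ((\<lambda>c. vec.span {axis 1 1 + c *s axis 2 1}) ` {c. \<not> good c})"
    proof (cases "a $ 1 = 0")
      case True
      then have e2: "a = a $ 2 *s axis 2 1" using e by simp
      then have "a $ 2 \<noteq> 0" using a(2) by (metis vector_smult_lzero)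
      moreover have "axis 2 1 \<noteq> (0 :: complex ^ 4)" by (simp add: axis_eq_0_iff)
      ultimately have "l = vec.span {axis 2 1}" unfolding a(1) using span_eq_iff[OF a(2)] e2 by blast
      then show ?thesis by simp
    next
      case False
      define c where "c = a $ 2 / a $ 1"
      define d :: "complex ^ 4" where "d = axis 1 1 + c *s axis 2 1"
      have "a $ 1 *s d = a" using False by (subst (2) e) (simp add: d_def c_def vector_add_ldistrib)
      moreover from this have "d \<noteq> 0" using a(2) by auto
      ultimately have "l = vec.span {d}" unfolding a(1) using span_eq_iff[OF a(2)] False by metis
      moreover have "\<not> good c"
      proof
        assume "good c"
        then have "MLD F (projectivize (\<Lambda> (a $ 1) (a $ 2))) = 1"
          unfolding Lambda_affine[OF False] c_def[symmetric] by (rule MLD_ruling)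
        then show False using l(2) unfolding a(1) Z_fibre[OF a(2-4)] by simp
      qed
      ultimately show ?thesis unfolding d_def by blast
    qed
  qed
  show "finite (insert (vec.span {axis 2 1 :: complex ^ 4}) ((\<lambda>c. vec.span {axis 1 1 + c *s axis 2 1}) ` {c. \<not> good c}))"
    using finite_bad by simp
qed

end

theorem theorem5p3:
  fixes X Xdual :: "(complex ^ 4) set set"
    and \<alpha> \<beta> :: "complex ^ 4"
    and F :: "complex ^ 4 \<Rightarrow> complex"
  assumes curve: "irreducible_curve Xdual"
    and not_plane: "\<not> (\<exists>h. h \<noteq> 0 \<and> Xdual \<subseteq> hyperplane h)"
    and X: "X = dual_variety Xdual"
    and smooth: "vec.span {\<alpha>} \<in> smooth_points Xdual" "vec.span {\<beta>} \<in> smooth_points Xdual"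
    and distinct: "vec.span {\<alpha>} \<noteq> vec.span {\<beta>}"
    and secant: "finite (Xdual \<inter> projectivize (vec.span {\<alpha>, \<beta>}))"
      "card (Xdual \<inter> projectivize (vec.span {\<alpha>, \<beta>})) + 1 = curve_degree Xdual"
    and F: "F = (\<lambda>p. pairing \<alpha> p * pairing \<beta> p)"
  shows "MLD F X = 1 \<and>
    (\<exists>(B :: (complex ^ 4) set set) Z. ruled_by_curves X B Z \<and>
       finite {b \<in> B. MLD F (Z `` {b}) \<noteq> 1})"
proof -
  \<comment> \<open>A smooth point is a point of projective space, hence the span of some nonzero
    vector.\<close>
  have nonzero: "z \<noteq> 0" if z: "vec.span {z} \<in> smooth_points Xdual" for z :: "complex ^ 4"
  proof
    assume "z = 0"
    obtain x where x: "vec.span {z} = vec.span {x}" "x \<noteq> 0"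
      using z unfolding smooth_points_def by (rule projectivizeE)
    then have "x \<in> vec.span {z}" by (simp add: vec.span_base)
    then show False using x(2) \<open>z = 0\<close> by simp
  qed
  have ind: "a = 0 \<and> c = 0" if e: "a *s \<alpha> + c *s \<beta> = 0" for a c
  proof -
    have "a = 0"
    proof (rule ccontr)
      assume a: "a \<noteq> 0"
      have "a *s \<alpha> = - (c *s \<beta>)" using e by (simp add: eq_neg_iff_add_eq_0)
      then have "(1 / a) *s (a *s \<alpha>) = (1 / a) *s (- (c *s \<beta>))" by simp
      then have \<alpha>: "\<alpha> = (- c / a) *s \<beta>" using a by (simp add: vec_eq_iff)
      then have "- c / a \<noteq> 0" using nonzero[OF smooth(1)] by (metis vector_smult_lzero)
      then show False using \<alpha> distinct span_eq_iff[OF nonzero[OF smooth(1)] nonzero[OF smooth(2)]] by blast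
    qed
    then show ?thesis using e nonzero[OF smooth(2)] by simp
  qed
  interpret secant_curve Xdual \<alpha> \<beta>
    by unfold_locales (use curve not_plane ind secant in blast)+
  obtain b y \<phi> m where fr: "frame b y" and b: "b 3 = \<alpha>" "b 4 = \<beta>" and phi: "\<phi> 1 \<noteq> 0" "\<phi> 2 = pCons 0 (\<phi> 1)"
      "\<And>i. degree (\<phi> i) \<le> m" and v: "\<And>s t. (s, t) \<noteq> (0, 0) \<Longrightarrow> param_vec b m \<phi> s t \<noteq> 0" and m: "1 \<le> m"
    and K: "cone Xdual = {k *s param_vec b m \<phi> s t | k s t. True}"
    using rational_parametrization by (elim exE) auto
  \<comment> \<open>The bivector \<phi> \<and> \<phi>', indexed by pairs. Its entry (1, 2) is the
    square of \<phi> 1, which gives \<open>remove_common_roots\<close> a nonzero member to start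
    from.\<close>
  define W where "W z = \<phi> (fst z) * pderiv (\<phi> (snd z)) - \<phi> (snd z) * pderiv (\<phi> (fst z))" for z :: "4 \<times> 4"
  have "W (1, 2) = \<phi> 1 * \<phi> 1" unfolding W_def fst_conv snd_conv phi(2) by (simp add: pderiv_pCons algebra_simps)
  then have "W (1, 2) \<noteq> 0" using phi(1) by simp
  from remove_common_roots[of W, OF this] obtain G \<psi> where G: "G \<noteq> 0" "\<And>z. W z = G * \<psi> z" "\<And>r. \<exists>z. poly (\<psi> z) r \<noteq> 0"
    by (elim exE) auto
  define M where "M = Max (range (\<lambda>z. degree (\<psi> z)))"
  have M: "degree (\<psi> z) \<le> M" for z unfolding M_def by (rule Max_ge) auto
  have lead: "\<exists>z. coeff (\<psi> z) M \<noteq> 0"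
  proof -
    have "M \<in> range (\<lambda>z. degree (\<psi> z))" unfolding M_def by (rule Max_in) auto
    then obtain z where z: "M = degree (\<psi> z)" by blast
    obtain z' where z': "poly (\<psi> z') 0 \<noteq> 0" using G(3) by blast
    show ?thesis
    proof (cases "\<psi> z = 0")
      \<comment> \<open>The largest degree M is then 0, and the coefficient sought is the nonzero
        constant term of another entry.\<close>
      case True
      then have "coeff (\<psi> z') M \<noteq> 0" using z z' by (simp add: poly_0_coeff_0)
      then show ?thesis by blast
    next
      case False
      then have "coeff (\<psi> z) M \<noteq> 0" by (simp add: z)
      then show ?thesis by blast
    qed
  qed
  interpret rational_curve Xdual b y \<phi> m G "\<lambda>i j. \<psi> (i, j)" M
  proof unfold_locales
    show "\<phi> i * pderiv (\<phi> j) - \<phi> j * pderiv (\<phi> i) = G * \<psi> (i, j)" for i j using G(2)[of "(i, j)"] by (simp add: W_def)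
    show "\<exists>i j. poly (\<psi> (i, j)) r \<noteq> 0" for r using G(3)[of r] by auto
    show "\<exists>i j. coeff (\<psi> (i, j)) M \<noteq> 0" using lead by auto
  qed (fact fr phi v m K G(1) M)+
  show ?thesis
    unfolding X F dual_variety_eq b[symmetric] using MLD_X' ruled_X' MLD_rulings by blast
qed

end
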